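(* Let $\Bbbk$ be a unital commutative ring. The triple $(\mathrm{Lie}^{\diamond}_{3},d,\Delta)$, consisting of the dg $\mathbb{S}$-module $(\mathrm{Lie}^{\diamond}_{3},d)$ and the decomposition map $\Delta\colon \mathrm{Lie}^{\diamond}_{3}\to\mathrm{Lie}^{\diamond}_{3}\circ\mathrm{Lie}^{\diamond}_{3}$ defined explicitly in the context, is a dg cooperad.
   Context: Conventions. Chain complexes are $\mathbb{Z}$-graded complexes of $\Bbbk$-modules with differential of degree $-1$; the Koszul sign rule is used. A dg $\mathbb{S}$-module $M$ is a family of dg right $\Bbbk[\mathbb{S}_n]$-modules $M(n)$, $n\ge 0$. Permutations are written in cycle notation ($(123)$ means $1\mapsto2\mapsto3\mapsto1$) and are composed as functions; $x^\sigma$ denotes the right action, so $(x^\sigma)^\tau=x^{\sigma\tau}$, with the normalization that for multilinear operations $\mu^\sigma(v_1,\dots,v_n)=\pm\mu(v_{\sigma^{-1}(1)},\dots,v_{\sigma^{-1}(n)})$ ($\pm$ the Koszul sign). The composite product is $(M\circ N)(n)=\bigoplus_m\bigoplus_{n=n_1+\dots+n_m}M(m)\otimes_{\mathbb{S}_m}\mathrm{Ind}_{\mathbb{S}_{n_1}\times\dots\times\mathbb{S}_{n_m}}^{\mathbb{S}_n}(N(n_1)\otimes\dots\otimes N(n_m))$, with differential $d^M\circ 1+1\circ' d^N$ (apply $d^M$ to the $M$-factor, resp. $d^N$ to each $N$-factor in turn, with Koszul signs). The unit is $\mathrm{I}=(0,\Bbbk,0,0,\dots)$. $\mu\circ(\nu_1,\dots,\nu_m)$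 denotes an elementary element and $\mu\circ(\nu_1,\dots,\nu_m)^\sigma$ its image under the right action of $\sigma$. A dg cooperad is a comonoid in the monoidal category (dg $\mathbb{S}$-modules, $\circ$, $\mathrm{I}$): $\Delta$ commutes with differentials, is coassociative, $(\Delta\circ\mathrm{id})\Delta=(\mathrm{id}\circ\Delta)\Delta$, and counital; here the counit is the projection onto arity 1. The dg $\mathbb{S}$-module $\mathrm{Lie}^{\diamond}_3$. $\mathrm{Lie}^{\diamond}_3(0)=0$, $\mathrm{Lie}^{\diamond}_3(1)=\Bbbk$ in degree $0$ spanned by $1=:l_1$, $\mathrm{Lie}^{\diamond}_3(n)=0$ for $n\ge6$. In arities $2\le n\le5$ it is the free graded $\Bbbk[\mathbb{S}_n]$-module on: arity 2: $l_2$ (degree 1), $l_{2;1}$ (degree 2), $l_{2;1,1}$ (degree 3), $l_{2;1,1,1}$ (degree 4); arity 3: $l_3$ (degree 2), $l_{3;1},l_{3;2}$ (degree 3), $l_{3;1,1},l_{3;1,2},l_{3;2,2}$ (degree 4); arity 4: $l_4$ (degree 3), $l_{4;1},l_{4;2},l_{4;3}$ (degree 4); arity 5: $l_5$ (degree 4). The equivariant differential is: $d l_n=0$; $d l_{2;1}=-l_2-l_2^{(12)}$; $d l_{2;1,1}=-l_{2;1}+l_{2;1}^{(12)}$; $d l_{2;1,1,1}=-l_{2;1,1}-l_{2;1,1}^{(12)}$; $d l_{3;1}=-l_3-l_3^{(12)}$; $d l_{3;2}=-l_3-l_3^{(23)}$; $d l_{3;1,1}=-l_{3;1}+l_{3;1}^{(12)}$;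 $d l_{3;1,2}=l_{3;1}+l_{3;1}^{(23)}+l_{3;1}^{(132)}-l_{3;2}-l_{3;2}^{(12)}-l_{3;2}^{(123)}$; $d l_{3;2,2}=-l_{3;2}+l_{3;2}^{(23)}$; $d l_{4;1}=-l_4-l_4^{(12)}$; $d l_{4;2}=-l_4-l_4^{(23)}$; $d l_{4;3}=-l_4-l_4^{(34)}$. The decomposition map. $\Delta$ is $\mathbb{S}$-equivariant, $\Delta(1)=1\circ(1)$, and $\Delta(\mu)=1\circ(\mu)+\bar\Delta(\mu)+\mu\circ(1,\dots,1)$ for $\mu$ of arity $\ge2$. For $2\le n\le 5$: $$\Delta(l_n)=\sum_{1\le j\le n,\ i_1+\dots+i_j=n,\ i_p\geq 1}(-1)^{(j-1)(n-j)}(-1)^{\sum_{p=1}^{j}(p-1)(i_p-1)}\sum_{\sigma\in\overline{\mathrm{Sh}}^{-1}(i_1,\dots,i_j)}(-1)^{|\sigma|}\,l_j\circ(l_{i_1},\dots,l_{i_j})^\sigma,$$ where $\overline{\mathrm{Sh}}^{-1}(i_1,\dots,i_j)$ is the set of inverses of reduced shuffles; a shuffle $\tau\in\mathbb{S}_n$ is increasing on each of the consecutive blocks of sizes $i_1,\dots,i_j$, and it is reduced if $\tau(i_1)<\tau(i_1+i_2)<\dots<\tau(i_1+\dots+i_j)$. (E.g. $\bar\Delta(l_3)=-l_2\circ(l_2,1)+l_2\circ(1,l_2)-l_2\circ(1,l_2)^{(12)}$.) On the other generators: $\bar\Delta(l_{2;1})=\bar\Delta(l_{2;1,1})=\bar\Delta(l_{2;1,1,1})=0$;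 $\bar\Delta(l_{3;1})=l_2\circ(l_{2;1},1)$; $\bar\Delta(l_{3;2})=-l_{2;1}\circ(l_2,1)-l_2\circ(1,l_{2;1})-l_{2;1}\circ(1,l_2)^{(12)}$; $\bar\Delta(l_{3;1,1})=-l_2\circ(l_{2;1,1},1)$; $\bar\Delta(l_{3;1,2})=-l_{2;1}\circ(l_{2;1},1)-l_{2;1}\circ(1,l_{2;1})-l_{2;1}\circ(1,l_{2;1})^{(12)}+l_{2;1,1}\circ(1,l_2)^{(132)}$; $\bar\Delta(l_{3;2,2})=-l_{2;1,1}\circ(l_2,1)+l_2\circ(1,l_{2;1,1})-l_{2;1,1}\circ(1,l_2)^{(12)}$; $\bar\Delta(l_{4;1})=-l_2\circ(l_{3;1},1)-l_2\circ(1,l_{3;1})^{(123)}+l_2\circ(l_{2;1},l_2)+l_3\circ(l_{2;1},1,1)+l_{3;1}\circ(1,1,l_2)$; $\bar\Delta(l_{4;2})=-l_2\circ(l_{3;2},1)-l_2\circ(1,l_{3;1})+l_2\circ(l_{2;1},l_2)^{(132)}+l_{3;1}\circ(l_2,1,1)+l_{3;1}\circ(1,l_2,1)^{(12)}-l_3\circ(1,l_{2;1},1)+l_{3;1}\circ(1,1,l_2)^{(132)}$; $\bar\Delta(l_{4;3})=l_{2;1}\circ(1,l_3)^{(123)}-l_2\circ(1,l_{3;2})+l_2\circ(1,l_{3;2})^{(12)}+l_{2;1}\circ(l_3,1)-l_2\circ(l_2,l_{2;1})-l_{2;1}\circ(l_2,l_2)^{(132)}+l_{2;1}\circ(l_2,l_2)^{(23)}+l_{3;2}\circ(l_2,1,1)-l_{3;2}\circ(1,1,l_2)^{(23)}+l_{3;2}\circ(1,1,l_2)^{(132)}+l_3\circ(1,1,l_{2;1})-l_{3;2}\circ(1,l_2,1)+l_{3;2}\circ(1,l_2,1)^{(12)}$.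 *)

theory Defs
  imports "HOL-Combinatorics.Cycles" "HOL-Algebra.AbelCoset" "HOL-Algebra.Module"
begin

section \<open>Modules over a commutative ring\<close>

text \<open>
  Modules are those of \<^theory>\<open>HOL-Algebra.Module\<close>. Their record type extends that of rings; the
  fields \<open>mult\<close> and \<open>one\<close> play no role in the theory of modules and are left unspecified below.
\<close>

definition module_hom ::
    "('r, 'm) ring_scheme \<Rightarrow> ('r, 'a) module \<Rightarrow> ('r, 'b) module \<Rightarrow> ('a \<Rightarrow> 'b) set" where
  "module_hom R A B = {f \<in> carrier A \<rightarrow> carrier B.
     (\<forall>x\<in>carrier A. \<forall>y\<in>carrier A. f (x \<oplus>\<^bsub>A\<^esub> y) = f x \<oplus>\<^bsub>B\<^esub> f y) \<and>
     (\<forall>a\<in>carrier R. \<forall>x\<in>carrier A. f (a \<odot>\<^bsub>A\<^esub> x) = a \<odot>\<^bsub>B\<^esub> f x)}"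

definition list_sum :: "('r, 'a) module \<Rightarrow> 'a list \<Rightarrow> 'a" where
  "list_sum A xs = foldr (\<lambda>x y. x \<oplus>\<^bsub>A\<^esub> y) xs \<zero>\<^bsub>A\<^esub>"

definition free_module :: "('r, 'm) ring_scheme \<Rightarrow> 's set \<Rightarrow> ('r, 's \<Rightarrow> 'r) module" where
  "free_module R S =
     \<lparr>carrier = {f. (\<forall>s. f s \<in> carrier R) \<and> finite {s. f s \<noteq> \<zero>\<^bsub>R\<^esub>} \<and> (\<forall>s. s \<notin> S \<longrightarrow> f s = \<zero>\<^bsub>R\<^esub>)},
      mult = undefined, one = undefined,
      zero = (\<lambda>s. \<zero>\<^bsub>R\<^esub>), add = (\<lambda>f g s. f s \<oplus>\<^bsub>R\<^esub> g s),
      smult = (\<lambda>a f s. a \<otimes>\<^bsub>R\<^esub> f s)\<rparr>"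

definition basis :: "('r, 'm) ring_scheme \<Rightarrow> 's \<Rightarrow> 's \<Rightarrow> 'r" where
  "basis R s = (\<lambda>t. if t = s then \<one>\<^bsub>R\<^esub> else \<zero>\<^bsub>R\<^esub>)"

text \<open>The linear extension to a free module of a map \<open>\<phi>\<close> given on the basis.\<close>

definition free_lift ::
    "('r, 'm) ring_scheme \<Rightarrow> ('r, 'a) module \<Rightarrow> ('s \<Rightarrow> 'a) \<Rightarrow> ('s \<Rightarrow> 'r) \<Rightarrow> 'a" where
  "free_lift R A \<phi> f = (\<Oplus>\<^bsub>A\<^esub>s\<in>{s. f s \<noteq> \<zero>\<^bsub>R\<^esub>}. f s \<odot>\<^bsub>A\<^esub> \<phi> s)"

definition quotient_module ::
    "('r, 'a) module \<Rightarrow> 'a set \<Rightarrow> ('r, 'a set) module" where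
  "quotient_module A H =
     \<lparr>carrier = a_rcosets\<^bsub>A\<^esub> H, mult = undefined, one = undefined,
      zero = H, add = set_add A,
      smult = (\<lambda>a X. \<Union>x\<in>X. H +>\<^bsub>A\<^esub> (a \<odot>\<^bsub>A\<^esub> x))\<rparr>"

text \<open>
  The map induced on a quotient of a free module by a map \<open>\<phi>\<close> given on the basis: the linear extension
  of \<open>\<phi>\<close> is evaluated on an arbitrary representative. It is only used for \<open>\<phi>\<close> that respect the
  relations, so that the value does not depend on the representative.
\<close>

definition quotient_lift ::
    "('r, 'm) ring_scheme \<Rightarrow> ('r, 'a) module \<Rightarrow> ('s \<Rightarrow> 'a) \<Rightarrow> ('s \<Rightarrow> 'r) set \<Rightarrow> 'a" where
  "quotient_lift R A \<phi> X = free_lift R A \<phi> (SOME f. f \<in> X)"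


section \<open>Permutations and signs\<close>

text \<open>
  An element of the symmetric group on \<open>n\<close> letters is a function \<open>\<sigma>\<close> with \<open>\<sigma> permutes {1..n}\<close>;
  the product is composition of functions. Lists are indexed from \<open>0\<close>, so the entry of \<open>xs\<close> in
  position \<open>i \<in> {1..n}\<close> is \<open>xs ! (i - 1)\<close>.
\<close>

type_synonym perm = "nat \<Rightarrow> nat"

definition minus_one_pow :: "int \<Rightarrow> int" where
  "minus_one_pow k = (if even k then 1 else -1)"

text \<open>\<open>(x\<^sub>1, \<dots>, x\<^sub>m)\<close> is sent to the list of the \<open>x\<close> with indices \<open>\<tau>\<inverse>(1), \<dots>, \<tau>\<inverse>(m)\<close>.\<close>

definition permuted :: "perm \<Rightarrow> 'x list \<Rightarrow> 'x list" where
  "permuted \<tau> xs = map (\<lambda>i. xs ! (inv_into UNIV \<tau> i - 1)) [1..<length xs + 1]"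

text \<open>The Koszul sign of the rearrangement \<open>permuted \<tau>\<close> of factors of degrees \<open>qs\<close>.\<close>

definition koszul_sign :: "perm \<Rightarrow> int list \<Rightarrow> int" where
  "koszul_sign \<tau> qs =
     (\<Prod>(i, j)\<in>{(i, j). i \<in> {1..length qs} \<and> j \<in> {1..length qs} \<and> i < j \<and> \<tau> i > \<tau> j}.
        minus_one_pow (qs ! (i - 1) * qs ! (j - 1)))"

text \<open>
  Sizes \<open>ns = [n\<^sub>1, \<dots>, n\<^sub>m]\<close> cut \<open>{1..n\<^sub>1+\<dots>+n\<^sub>m}\<close> into consecutive blocks; the block with (0-based)
  index \<open>i\<close> is \<open>{block_end ns i<..block_end ns (i+1)}\<close>.
\<close>

definition block_end :: "nat list \<Rightarrow> nat \<Rightarrow> nat" where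
  "block_end ns i = sum_list (take i ns)"

definition block_of :: "nat list \<Rightarrow> nat \<Rightarrow> nat" where
  "block_of ns x = (LEAST i. x \<le> block_end ns (Suc i))"

text \<open>The image of \<open>(\<tau>\<^sub>1, \<dots>, \<tau>\<^sub>m)\<close> under the inclusion of the product of symmetric groups.\<close>

definition sum_perm :: "nat list \<Rightarrow> perm list \<Rightarrow> perm" where
  "sum_perm ns \<tau>s x =
     (if x \<in> {1..sum_list ns}
      then let i = block_of ns x in block_end ns i + (\<tau>s ! i) (x - block_end ns i)
      else x)"

text \<open>
  The permutation moving the whole block number \<open>i\<close> to place \<open>\<tau> i\<close>, preserving the order inside
  the blocks: with \<open>\<rho> = block_perm \<tau> ns\<close>, the list \<open>permuted \<rho> (concat Vs)\<close> is
  \<open>concat (permuted \<tau> Vs)\<close> whenever \<open>Vs\<close> is a list of lists with lengths \<open>ns\<close>.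
\<close>

definition block_perm :: "perm \<Rightarrow> nat list \<Rightarrow> perm" where
  "block_perm \<tau> ns x =
     (if x \<in> {1..sum_list ns}
      then let i = block_of ns x
           in (\<Sum>j | j < length ns \<and> \<tau> (Suc j) < \<tau> (Suc i). ns ! j) + (x - block_end ns i)
      else x)"

primrec chunks :: "nat list \<Rightarrow> 'x list \<Rightarrow> 'x list list" where
  "chunks [] xs = []"
| "chunks (n # ns) xs = take n xs # chunks ns (drop n xs)"


section \<open>Differential graded symmetric modules\<close>

text \<open>
  \<open>piece M n p\<close> is the component of arity \<open>n\<close> and homological degree \<open>p\<close>; a graded module is
  given by its homogeneous components. The differential and the right action of \<open>\<sigma>\<close> are
  \<open>dif M n p\<close>, from degree \<open>p\<close> to degree \<open>p - 1\<close>, and \<open>\<lambda>x. act M n p x \<sigma>\<close>.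
\<close>

record ('r, 'a) smodule =
  piece :: "nat \<Rightarrow> int \<Rightarrow> ('r, 'a) module"
  act :: "nat \<Rightarrow> int \<Rightarrow> 'a \<Rightarrow> perm \<Rightarrow> 'a"
  dif :: "nat \<Rightarrow> int \<Rightarrow> 'a \<Rightarrow> 'a"

locale dg_smodule = R?: cring R for R (structure) +
  fixes M :: "('a, 'b) smodule"
  assumes piece_module: "module R (piece M n p)"
    and dif_hom: "dif M n p \<in> module_hom R (piece M n p) (piece M n (p - 1))"
    and dif_dif: "x \<in> carrier (piece M n p) \<Longrightarrow>
          dif M n (p - 1) (dif M n p x) = \<zero>\<^bsub>piece M n (p - 1 - 1)\<^esub>"
    and act_hom: "\<sigma> permutes {1..n} \<Longrightarrow>
          (\<lambda>x. act M n p x \<sigma>) \<in> module_hom R (piece M n p) (piece M n p)"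
    and act_id: "x \<in> carrier (piece M n p) \<Longrightarrow> act M n p x id = x"
    and act_act: "\<sigma> permutes {1..n} \<Longrightarrow> \<tau> permutes {1..n} \<Longrightarrow> x \<in> carrier (piece M n p) \<Longrightarrow>
          act M n p (act M n p x \<sigma>) \<tau> = act M n p x (\<sigma> \<circ> \<tau>)"
    and dif_act: "\<sigma> permutes {1..n} \<Longrightarrow> x \<in> carrier (piece M n p) \<Longrightarrow>
          dif M n p (act M n p x \<sigma>) = act M n (p - 1) (dif M n p x) \<sigma>"

text \<open>Morphisms (of degree \<open>0\<close>).\<close>

definition dg_smodule_hom ::
    "('r, 'm) ring_scheme \<Rightarrow> ('r, 'a) smodule \<Rightarrow> ('r, 'b) smodule \<Rightarrow> (nat \<Rightarrow> int \<Rightarrow> 'a \<Rightarrow> 'b) set"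
  where
  "dg_smodule_hom R M N = {f. \<forall>n p.
     f n p \<in> module_hom R (piece M n p) (piece N n p) \<and>
     (\<forall>x\<in>carrier (piece M n p).
        f n (p - 1) (dif M n p x) = dif N n p (f n p x) \<and>
        (\<forall>\<sigma>. \<sigma> permutes {1..n} \<longrightarrow> f n p (act M n p x \<sigma>) = act N n p (f n p x) \<sigma>))}"

text \<open>
  A homogeneous element \<open>(n, p, x)\<close> carries its arity \<open>n\<close> and degree \<open>p\<close>, which cannot be
  recovered from \<open>x\<close> alone (for instance if \<open>x\<close> is zero).
\<close>

type_synonym 'a homog = "nat \<times> int \<times> 'a"

definition arity :: "'a homog \<Rightarrow> nat" where "arity = fst"
definition degr :: "'a homog \<Rightarrow> int" where "degr = fst \<circ> snd"
definition elt :: "'a homog \<Rightarrow> 'a" where "elt = snd \<circ> snd"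

definition homogs :: "('r, 'a) smodule \<Rightarrow> 'a homog set" where
  "homogs M = {(n, p, x). x \<in> carrier (piece M n p)}"

definition hact :: "('r, 'a) smodule \<Rightarrow> 'a homog \<Rightarrow> perm \<Rightarrow> 'a homog" where
  "hact M = (\<lambda>(n, p, x) \<sigma>. (n, p, act M n p x \<sigma>))"

definition hdif :: "('r, 'a) smodule \<Rightarrow> 'a homog \<Rightarrow> 'a homog" where
  "hdif M = (\<lambda>(n, p, x). (n, p - 1, dif M n p x))"

definition hmap :: "(nat \<Rightarrow> int \<Rightarrow> 'a \<Rightarrow> 'b) \<Rightarrow> 'a homog \<Rightarrow> 'b homog" where
  "hmap f = (\<lambda>(n, p, x). (n, p, f n p x))"


section \<open>The composite product\<close>

text \<open>
  The component of arity \<open>n\<close> and degree \<open>p\<close> of the composite product is presented by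
  generators and relations. The generator \<open>(\<mu>, [\<nu>\<^sub>1, \<dots>, \<nu>\<^sub>m], \<sigma>)\<close> stands for the element
  \<open>\<mu> \<otimes> ((\<nu>\<^sub>1 \<otimes> \<dots> \<otimes> \<nu>\<^sub>m) \<otimes> \<sigma>)\<close> of the direct sum over \<open>m\<close> and \<open>n = n\<^sub>1 + \<dots> + n\<^sub>m\<close>, where
  \<open>(\<nu>\<^sub>1 \<otimes> \<dots> \<otimes> \<nu>\<^sub>m) \<otimes> \<sigma>\<close> lies in the induced module, i.e. in
  \<open>(N(n\<^sub>1) \<otimes> \<dots> \<otimes> N(n\<^sub>m)) \<otimes> k[S\<^sub>n]\<close> with the last tensor product taken over the group ring of
  the product of the symmetric groups on \<open>n\<^sub>1, \<dots>, n\<^sub>m\<close> letters.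
\<close>

type_synonym ('a, 'b) gen = "'a homog \<times> 'b homog list \<times> perm"

definition gen_arity :: "('a, 'b) gen \<Rightarrow> nat" where
  "gen_arity = (\<lambda>(\<mu>, \<nu>s, \<sigma>). sum_list (map arity \<nu>s))"

definition gen_degr :: "('a, 'b) gen \<Rightarrow> int" where
  "gen_degr = (\<lambda>(\<mu>, \<nu>s, \<sigma>). degr \<mu> + sum_list (map degr \<nu>s))"

definition gens :: "('r, 'a) smodule \<Rightarrow> ('r, 'b) smodule \<Rightarrow> nat \<Rightarrow> int \<Rightarrow> ('a, 'b) gen set" where
  "gens M N n p = {(\<mu>, \<nu>s, \<sigma>). \<mu> \<in> homogs M \<and> set \<nu>s \<subseteq> homogs N \<and> arity \<mu> = length \<nu>s \<and>
     gen_arity (\<mu>, \<nu>s, \<sigma>) = n \<and> gen_degr (\<mu>, \<nu>s, \<sigma>) = p \<and> \<sigma> permutes {1..n}}"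

text \<open>
  The relations: linearity in \<open>\<mu>\<close> and in each \<open>\<nu>\<^sub>i\<close>; balancedness over the group rings of
  the product of the symmetric groups on \<open>n\<^sub>1, \<dots>, n\<^sub>m\<close> letters and of the symmetric group on \<open>m\<close> letters.
  The last relation corresponds to the normalization
  \<open>\<mu>\<^sup>\<tau>(v\<^sub>1, \<dots>, v\<^sub>m) = \<plusminus>\<mu>(v\<^bsub>\<tau>\<inverse>(1)\<^esub>, \<dots>, v\<^bsub>\<tau>\<inverse>(m)\<^esub>)\<close> of the right action, the left action
  of \<open>\<tau>\<close> on the sum of induced modules being \<open>permuted \<tau>\<close> on the \<open>\<nu>\<^sub>i\<close>, with its Koszul sign.
\<close>

definition rels ::
    "('r, 'm) ring_scheme \<Rightarrow> ('r, 'a) smodule \<Rightarrow> ('r, 'b) smodule \<Rightarrow> nat \<Rightarrow> int \<Rightarrow>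
     (('a, 'b) gen \<Rightarrow> 'r) set" where
  "rels R M N n p = (let F = free_module R (gens M N n p); e = basis R in
     {e ((m, q, x \<oplus>\<^bsub>piece M m q\<^esub> y), \<nu>s, \<sigma>) \<ominus>\<^bsub>F\<^esub> (e ((m, q, x), \<nu>s, \<sigma>) \<oplus>\<^bsub>F\<^esub> e ((m, q, y), \<nu>s, \<sigma>))
       | m q x y \<nu>s \<sigma>. ((m, q, x), \<nu>s, \<sigma>) \<in> gens M N n p \<and> y \<in> carrier (piece M m q)} \<union>
     {e ((m, q, a \<odot>\<^bsub>piece M m q\<^esub> x), \<nu>s, \<sigma>) \<ominus>\<^bsub>F\<^esub> (a \<odot>\<^bsub>F\<^esub> e ((m, q, x), \<nu>s, \<sigma>))
       | m q a x \<nu>s \<sigma>. ((m, q, x), \<nu>s, \<sigma>) \<in> gens M N n p \<and> a \<in> carrier R} \<union>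
     {e (\<mu>, \<nu>s @ (k, q, x \<oplus>\<^bsub>piece N k q\<^esub> y) # \<nu>s', \<sigma>) \<ominus>\<^bsub>F\<^esub>
        (e (\<mu>, \<nu>s @ (k, q, x) # \<nu>s', \<sigma>) \<oplus>\<^bsub>F\<^esub> e (\<mu>, \<nu>s @ (k, q, y) # \<nu>s', \<sigma>))
       | \<mu> \<nu>s k q x y \<nu>s' \<sigma>.
         (\<mu>, \<nu>s @ (k, q, x) # \<nu>s', \<sigma>) \<in> gens M N n p \<and> y \<in> carrier (piece N k q)} \<union>
     {e (\<mu>, \<nu>s @ (k, q, a \<odot>\<^bsub>piece N k q\<^esub> x) # \<nu>s', \<sigma>) \<ominus>\<^bsub>F\<^esub>
        (a \<odot>\<^bsub>F\<^esub> e (\<mu>, \<nu>s @ (k, q, x) # \<nu>s', \<sigma>))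
       | \<mu> \<nu>s k q a x \<nu>s' \<sigma>. (\<mu>, \<nu>s @ (k, q, x) # \<nu>s', \<sigma>) \<in> gens M N n p \<and> a \<in> carrier R} \<union>
     {e (\<mu>, map2 (hact N) \<nu>s \<tau>s, \<sigma>) \<ominus>\<^bsub>F\<^esub> e (\<mu>, \<nu>s, sum_perm (map arity \<nu>s) \<tau>s \<circ> \<sigma>)
       | \<mu> \<nu>s \<tau>s \<sigma>. (\<mu>, \<nu>s, \<sigma>) \<in> gens M N n p \<and>
         list_all2 (\<lambda>\<nu> \<tau>. \<tau> permutes {1..arity \<nu>}) \<nu>s \<tau>s} \<union>
     {e (hact M \<mu> \<tau>, \<nu>s, \<sigma>) \<ominus>\<^bsub>F\<^esub>
        ([koszul_sign \<tau> (map degr \<nu>s)] \<cdot>\<^bsub>F\<^esub>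
          e (\<mu>, permuted \<tau> \<nu>s, block_perm \<tau> (map arity \<nu>s) \<circ> \<sigma>))
       | \<mu> \<nu>s \<tau> \<sigma>. (\<mu>, \<nu>s, \<sigma>) \<in> gens M N n p \<and> \<tau> permutes {1..arity \<mu>}})"

definition rel_submodule ::
    "('r, 'm) ring_scheme \<Rightarrow> ('r, 'a) smodule \<Rightarrow> ('r, 'b) smodule \<Rightarrow> nat \<Rightarrow> int \<Rightarrow>
     (('a, 'b) gen \<Rightarrow> 'r) set" where
  "rel_submodule R M N n p =
     \<Inter>{H. submodule H R (free_module R (gens M N n p)) \<and> rels R M N n p \<subseteq> H}"

definition composite_piece ::
    "('r, 'm) ring_scheme \<Rightarrow> ('r, 'a) smodule \<Rightarrow> ('r, 'b) smodule \<Rightarrow> nat \<Rightarrow> int \<Rightarrow>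
     ('r, (('a, 'b) gen \<Rightarrow> 'r) set) module" where
  "composite_piece R M N n p =
     quotient_module (free_module R (gens M N n p)) (rel_submodule R M N n p)"

text \<open>\<open>elementary R M N (\<mu>, [\<nu>\<^sub>1, \<dots>, \<nu>\<^sub>m], \<sigma>)\<close> is the element \<open>\<mu> \<circ> (\<nu>\<^sub>1, \<dots>, \<nu>\<^sub>m)\<^sup>\<sigma>\<close>.\<close>

definition elementary ::
    "('r, 'm) ring_scheme \<Rightarrow> ('r, 'a) smodule \<Rightarrow> ('r, 'b) smodule \<Rightarrow> ('a, 'b) gen \<Rightarrow>
     (('a, 'b) gen \<Rightarrow> 'r) set" where
  "elementary R M N s = (let n = gen_arity s; p = gen_degr s in
     rel_submodule R M N n p +>\<^bsub>free_module R (gens M N n p)\<^esub> basis R s)"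

definition elementary_dif ::
    "('r, 'm) ring_scheme \<Rightarrow> ('r, 'a) smodule \<Rightarrow> ('r, 'b) smodule \<Rightarrow> ('a, 'b) gen \<Rightarrow>
     (('a, 'b) gen \<Rightarrow> 'r) set" where
  "elementary_dif R M N = (\<lambda>(\<mu>, \<nu>s, \<sigma>).
     let Q = composite_piece R M N (gen_arity (\<mu>, \<nu>s, \<sigma>)) (gen_degr (\<mu>, \<nu>s, \<sigma>) - 1) in
     elementary R M N (hdif M \<mu>, \<nu>s, \<sigma>) \<oplus>\<^bsub>Q\<^esub>
     (\<Oplus>\<^bsub>Q\<^esub>i\<in>{..<length \<nu>s}.
        [minus_one_pow (degr \<mu> + sum_list (map degr (take i \<nu>s)))] \<cdot>\<^bsub>Q\<^esub>
          elementary R M N (\<mu>, \<nu>s[i := hdif N (\<nu>s ! i)], \<sigma>)))"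

definition composite ::
    "('r, 'm) ring_scheme \<Rightarrow> ('r, 'a) smodule \<Rightarrow> ('r, 'b) smodule \<Rightarrow>
     ('r, (('a, 'b) gen \<Rightarrow> 'r) set) smodule" where
  "composite R M N =
     \<lparr>piece = composite_piece R M N,
      act = (\<lambda>n p X \<tau>. quotient_lift R (composite_piece R M N n p)
               (\<lambda>(\<mu>, \<nu>s, \<sigma>). elementary R M N (\<mu>, \<nu>s, \<sigma> \<circ> \<tau>)) X),
      dif = (\<lambda>n p X. quotient_lift R (composite_piece R M N n (p - 1)) (elementary_dif R M N) X)\<rparr>"

text \<open>The morphism \<open>f \<circ> g\<close> induced by morphisms \<open>f\<close> to \<open>M'\<close> and \<open>g\<close> to \<open>N'\<close>.\<close>

definition composite_map ::
    "('r, 'm) ring_scheme \<Rightarrow> ('r, 'a2) smodule \<Rightarrow> ('r, 'b2) smodule \<Rightarrow>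
     (nat \<Rightarrow> int \<Rightarrow> 'a \<Rightarrow> 'a2) \<Rightarrow> (nat \<Rightarrow> int \<Rightarrow> 'b \<Rightarrow> 'b2) \<Rightarrow>
     nat \<Rightarrow> int \<Rightarrow> (('a, 'b) gen \<Rightarrow> 'r) set \<Rightarrow> (('a2, 'b2) gen \<Rightarrow> 'r) set" where
  "composite_map R M' N' f g n p = quotient_lift R (composite_piece R M' N' n p)
     (\<lambda>(\<mu>, \<nu>s, \<sigma>). elementary R M' N' (hmap f \<mu>, map (hmap g) \<nu>s, \<sigma>))"

text \<open>
  The associator \<open>(M \<circ> N) \<circ> P \<rightarrow> M \<circ> (N \<circ> P)\<close>. Balancedness first brings
  \<open>(\<mu> \<circ> (\<nu>\<^sub>1, \<dots>, \<nu>\<^sub>m)\<^sup>\<tau>) \<circ> (\<pi>\<^sub>1, \<dots>)\<^sup>\<sigma>\<close> to the form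
  \<open>\<plusminus>(\<mu> \<circ> (\<nu>\<^sub>1, \<dots>, \<nu>\<^sub>m)) \<circ> (\<pi>\<^bsub>\<tau>\<inverse>(1)\<^esub>, \<dots>)\<close> with \<open>block_perm \<tau>\<close> acting; the factors
  \<open>\<pi>\<close> are then distributed in order over the \<open>\<nu>\<^sub>j\<close>. The sign \<open>distrib_sign\<close> comes from
  moving each \<open>\<nu>\<^sub>j\<close> to the right past the factors \<open>\<pi>\<close> given to \<open>\<nu>\<^sub>1, \<dots>, \<nu>\<^bsub>j-1\<^esub>\<close>.
\<close>

definition distrib_sign :: "int list \<Rightarrow> int list list \<Rightarrow> int" where
  "distrib_sign qs rss =
     minus_one_pow (\<Sum>j<length qs. qs ! j * sum_list (map sum_list (take j rss)))"

definition associator_gen ::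
    "('r, 'm) ring_scheme \<Rightarrow> ('r, 'a) smodule \<Rightarrow> ('r, 'b) smodule \<Rightarrow> ('r, 'c) smodule \<Rightarrow>
     nat \<Rightarrow> int \<Rightarrow> ('a, 'b) gen \<Rightarrow> 'c homog list \<Rightarrow> perm \<Rightarrow>
     (('a, (('b, 'c) gen \<Rightarrow> 'r) set) gen \<Rightarrow> 'r) set" where
  "associator_gen R M N P n p = (\<lambda>(\<mu>, \<nu>s, \<tau>) \<pi>s \<sigma>.
     let \<pi>ss = chunks (map arity \<nu>s) (permuted \<tau> \<pi>s);
         inner = (\<lambda>\<nu> \<pi>s'. (gen_arity (\<nu>, \<pi>s', id), gen_degr (\<nu>, \<pi>s', id),
                           elementary R N P (\<nu>, \<pi>s', id)))
     in [(koszul_sign \<tau> (map degr \<pi>s) * distrib_sign (map degr \<nu>s) (map (map degr) \<pi>ss))]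
          \<cdot>\<^bsub>composite_piece R M (composite R N P) n p\<^esub>
        elementary R M (composite R N P)
          (\<mu>, map2 inner \<nu>s \<pi>ss, block_perm \<tau> (map arity \<pi>s) \<circ> \<sigma>))"

definition associator ::
    "('r, 'm) ring_scheme \<Rightarrow> ('r, 'a) smodule \<Rightarrow> ('r, 'b) smodule \<Rightarrow> ('r, 'c) smodule \<Rightarrow>
     nat \<Rightarrow> int \<Rightarrow> (((('a, 'b) gen \<Rightarrow> 'r) set, 'c) gen \<Rightarrow> 'r) set \<Rightarrow>
     (('a, (('b, 'c) gen \<Rightarrow> 'r) set) gen \<Rightarrow> 'r) set" where
  "associator R M N P n p =
     (let Q = composite_piece R M (composite R N P) n p in
      quotient_lift R Q
        (\<lambda>(X, \<pi>s, \<sigma>). quotient_lift R Q (\<lambda>s. associator_gen R M N P n p s \<pi>s \<sigma>) (elt X)))"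

definition unit_smodule :: "('r, 'm) ring_scheme \<Rightarrow> ('r, 'r) smodule" where
  "unit_smodule R =
     \<lparr>piece = (\<lambda>n p. \<lparr>carrier = (if n = 1 \<and> p = 0 then carrier R else {\<zero>\<^bsub>R\<^esub>}),
        mult = undefined, one = undefined,
        zero = \<zero>\<^bsub>R\<^esub>, add = add R, smult = monoid.mult R\<rparr>),
      act = (\<lambda>n p x \<sigma>. x),
      dif = (\<lambda>n p x. \<zero>\<^bsub>R\<^esub>)\<rparr>"

text \<open>The unitors \<open>I \<circ> M \<rightarrow> M\<close> and \<open>M \<circ> I \<rightarrow> M\<close>.\<close>

definition left_unitor ::
    "('r, 'm) ring_scheme \<Rightarrow> ('r, 'a) smodule \<Rightarrow> nat \<Rightarrow> int \<Rightarrow> (('r, 'a) gen \<Rightarrow> 'r) set \<Rightarrow> 'a" where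
  "left_unitor R M n p = quotient_lift R (piece M n p)
     (\<lambda>((m, q, a), \<nu>s, \<sigma>). if m = 1 \<and> q = 0
        then a \<odot>\<^bsub>piece M n p\<^esub> act M n p (elt (hd \<nu>s)) \<sigma>
        else \<zero>\<^bsub>piece M n p\<^esub>)"

definition right_unitor ::
    "('r, 'm) ring_scheme \<Rightarrow> ('r, 'a) smodule \<Rightarrow> nat \<Rightarrow> int \<Rightarrow> (('a, 'r) gen \<Rightarrow> 'r) set \<Rightarrow> 'a" where
  "right_unitor R M n p = quotient_lift R (piece M n p)
     (\<lambda>(\<mu>, as, \<sigma>). if list_all (\<lambda>a. arity a = 1 \<and> degr a = 0) as
        then foldr (\<lambda>a b. a \<otimes>\<^bsub>R\<^esub> b) (map elt as) \<one>\<^bsub>R\<^esub> \<odot>\<^bsub>piece M n p\<^esub> act M n p (elt \<mu>) \<sigma>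
        else \<zero>\<^bsub>piece M n p\<^esub>)"


section \<open>Differential graded cooperads\<close>

locale dg_cooperad = dg_smodule R C for R (structure) and C +
  fixes \<Delta> :: "nat \<Rightarrow> int \<Rightarrow> 'b \<Rightarrow> (('b, 'b) gen \<Rightarrow> 'a) set"
    and \<epsilon> :: "nat \<Rightarrow> int \<Rightarrow> 'b \<Rightarrow> 'a"
  assumes decomposition_hom: "\<Delta> \<in> dg_smodule_hom R C (composite R C C)"
    and counit_hom: "\<epsilon> \<in> dg_smodule_hom R C (unit_smodule R)"
    and coassociative: "x \<in> carrier (piece C n p) \<Longrightarrow>
          associator R C C C n p
            (composite_map R (composite R C C) C \<Delta> (\<lambda>_ _ y. y) n p (\<Delta> n p x)) =
          composite_map R C (composite R C C) (\<lambda>_ _ y. y) \<Delta> n p (\<Delta> n p x)"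
    and left_counital: "x \<in> carrier (piece C n p) \<Longrightarrow>
          left_unitor R C n p
            (composite_map R (unit_smodule R) C \<epsilon> (\<lambda>_ _ y. y) n p (\<Delta> n p x)) = x"
    and right_counital: "x \<in> carrier (piece C n p) \<Longrightarrow>
          right_unitor R C n p
            (composite_map R C (unit_smodule R) (\<lambda>_ _ y. y) \<epsilon> n p (\<Delta> n p x)) = x"


section \<open>The triple \<open>Lie\<^sub>3\<close>\<close>

text \<open>
  The generator \<open>l\<^bsub>3;1,2\<^esub>\<close> is \<open>L3_12\<close>, and similarly for the others. The component of arity 1 is
  free on \<open>L1\<close>, the symmetric group being trivial there.
\<close>

datatype lgen =
    L1
  | L2 | L2_1 | L2_11 | L2_111
  | L3 | L3_1 | L3_2 | L3_11 | L3_12 | L3_22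
  | L4 | L4_1 | L4_2 | L4_3
  | L5

fun lgen_arity :: "lgen \<Rightarrow> nat" where
  "lgen_arity L1 = 1"
| "lgen_arity L2 = 2" | "lgen_arity L2_1 = 2" | "lgen_arity L2_11 = 2" | "lgen_arity L2_111 = 2"
| "lgen_arity L3 = 3" | "lgen_arity L3_1 = 3" | "lgen_arity L3_2 = 3"
| "lgen_arity L3_11 = 3" | "lgen_arity L3_12 = 3" | "lgen_arity L3_22 = 3"
| "lgen_arity L4 = 4" | "lgen_arity L4_1 = 4" | "lgen_arity L4_2 = 4" | "lgen_arity L4_3 = 4"
| "lgen_arity L5 = 5"

fun lgen_degr :: "lgen \<Rightarrow> int" where
  "lgen_degr L1 = 0"
| "lgen_degr L2 = 1" | "lgen_degr L2_1 = 2" | "lgen_degr L2_11 = 3" | "lgen_degr L2_111 = 4"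
| "lgen_degr L3 = 2" | "lgen_degr L3_1 = 3" | "lgen_degr L3_2 = 3"
| "lgen_degr L3_11 = 4" | "lgen_degr L3_12 = 4" | "lgen_degr L3_22 = 4"
| "lgen_degr L4 = 3" | "lgen_degr L4_1 = 4" | "lgen_degr L4_2 = 4" | "lgen_degr L4_3 = 4"
| "lgen_degr L5 = 4"

text \<open>\<open>cyc [1, 2, 3]\<close> is the cycle \<open>1 \<mapsto> 2 \<mapsto> 3 \<mapsto> 1\<close>.\<close>

abbreviation cyc :: "nat list \<Rightarrow> perm" where
  "cyc \<equiv> cycle_of_list"

text \<open>The entry \<open>(c, h, \<sigma>)\<close> stands for the term \<open>c h\<^sup>\<sigma>\<close>.\<close>

fun lgen_dif :: "lgen \<Rightarrow> (int \<times> lgen \<times> perm) list" where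
  "lgen_dif L1 = []"
| "lgen_dif L2 = []"
| "lgen_dif L2_1 = [(-1, L2, id), (-1, L2, cyc [1,2])]"
| "lgen_dif L2_11 = [(-1, L2_1, id), (1, L2_1, cyc [1,2])]"
| "lgen_dif L2_111 = [(-1, L2_11, id), (-1, L2_11, cyc [1,2])]"
| "lgen_dif L3 = []"
| "lgen_dif L3_1 = [(-1, L3, id), (-1, L3, cyc [1,2])]"
| "lgen_dif L3_2 = [(-1, L3, id), (-1, L3, cyc [2,3])]"
| "lgen_dif L3_11 = [(-1, L3_1, id), (1, L3_1, cyc [1,2])]"
| "lgen_dif L3_12 =
     [(1, L3_1, id), (1, L3_1, cyc [2,3]), (1, L3_1, cyc [1,3,2]),
      (-1, L3_2, id), (-1, L3_2, cyc [1,2]), (-1, L3_2, cyc [1,2,3])]"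
| "lgen_dif L3_22 = [(-1, L3_2, id), (1, L3_2, cyc [2,3])]"
| "lgen_dif L4 = []"
| "lgen_dif L4_1 = [(-1, L4, id), (-1, L4, cyc [1,2])]"
| "lgen_dif L4_2 = [(-1, L4, id), (-1, L4, cyc [2,3])]"
| "lgen_dif L4_3 = [(-1, L4, id), (-1, L4, cyc [3,4])]"
| "lgen_dif L5 = []"

definition Lie3_piece ::
    "('r, 'm) ring_scheme \<Rightarrow> nat \<Rightarrow> int \<Rightarrow> ('r, lgen \<times> perm \<Rightarrow> 'r) module" where
  "Lie3_piece R n p =
     free_module R {(g, \<sigma>). lgen_arity g = n \<and> lgen_degr g = p \<and> \<sigma> permutes {1..n}}"

text \<open>The basis element \<open>(g, \<sigma>)\<close> is \<open>g\<^sup>\<sigma>\<close>.\<close>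

definition Lie3 :: "('r, 'm) ring_scheme \<Rightarrow> ('r, lgen \<times> perm \<Rightarrow> 'r) smodule" where
  "Lie3 R =
     \<lparr>piece = Lie3_piece R,
      act = (\<lambda>n p x \<tau>. free_lift R (Lie3_piece R n p) (\<lambda>(g, \<sigma>). basis R (g, \<sigma> \<circ> \<tau>)) x),
      dif = (\<lambda>n p x. free_lift R (Lie3_piece R n (p - 1))
               (\<lambda>(g, \<sigma>). list_sum (Lie3_piece R n (p - 1))
                  (map (\<lambda>(c, h, \<tau>). [c] \<cdot>\<^bsub>Lie3_piece R n (p - 1)\<^esub> basis R (h, \<tau> \<circ> \<sigma>))
                     (lgen_dif g))) x)\<rparr>"

definition lgen_homog :: "('r, 'm) ring_scheme \<Rightarrow> lgen \<Rightarrow> (lgen \<times> perm \<Rightarrow> 'r) homog" where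
  "lgen_homog R g = (lgen_arity g, lgen_degr g, basis R (g, id))"

text \<open>\<open>lcomp R h [g\<^sub>1, \<dots>, g\<^sub>m] \<sigma>\<close> is \<open>h \<circ> (g\<^sub>1, \<dots>, g\<^sub>m)\<^sup>\<sigma>\<close>.\<close>

definition lcomp ::
    "('r, 'm) ring_scheme \<Rightarrow> lgen \<Rightarrow> lgen list \<Rightarrow> perm \<Rightarrow>
     ((lgen \<times> perm \<Rightarrow> 'r, lgen \<times> perm \<Rightarrow> 'r) gen \<Rightarrow> 'r) set" where
  "lcomp R h gs \<sigma> = elementary R (Lie3 R) (Lie3 R) (lgen_homog R h, map (lgen_homog R) gs, \<sigma>)"

definition compositions :: "nat \<Rightarrow> nat list set" where
  "compositions n = {ks. sum_list ks = n \<and> (\<forall>k\<in>set ks. k \<ge> 1)}"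

definition shuffles_of :: "nat list \<Rightarrow> perm set" where
  "shuffles_of ks = {\<tau>. \<tau> permutes {1..sum_list ks} \<and>
     (\<forall>i<length ks. strict_mono_on {block_end ks i<..block_end ks (Suc i)} \<tau>)}"

definition reduced_shuffles :: "nat list \<Rightarrow> perm set" where
  "reduced_shuffles ks = {\<tau> \<in> shuffles_of ks.
     strict_mono_on {1..length ks} (\<lambda>i. \<tau> (block_end ks i))}"

text \<open>\<open>lgen_l n\<close> is the generator \<open>l\<^sub>n\<close>, for \<open>n \<in> {1..5}\<close>.\<close>

definition lgen_l :: "nat \<Rightarrow> lgen" where
  "lgen_l n = [L1, L2, L3, L4, L5] ! (n - 1)"

definition decomp_l ::
    "('r, 'm) ring_scheme \<Rightarrow> nat \<Rightarrow> ((lgen \<times> perm \<Rightarrow> 'r, lgen \<times> perm \<Rightarrow> 'r) gen \<Rightarrow> 'r) set" where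
  "decomp_l R n = (let Q = composite_piece R (Lie3 R) (Lie3 R) n (lgen_degr (lgen_l n)) in
     \<Oplus>\<^bsub>Q\<^esub>ks\<in>compositions n.
       [((-1) ^ ((length ks - 1) * (n - length ks)) *
         (-1) ^ (\<Sum>i=1..length ks. (i - 1) * (ks ! (i - 1) - 1)) :: int)] \<cdot>\<^bsub>Q\<^esub>
       (\<Oplus>\<^bsub>Q\<^esub>\<sigma>\<in>inv_into UNIV ` reduced_shuffles ks.
          [sign \<sigma>] \<cdot>\<^bsub>Q\<^esub> lcomp R (lgen_l (length ks)) (map lgen_l ks) \<sigma>))"

text \<open>
  The reduced decomposition map on the generators other than the \<open>l\<^sub>n\<close>; the entry
  \<open>(c, h, gs, \<sigma>)\<close> stands for the term \<open>c h \<circ> (gs)\<^sup>\<sigma>\<close>. On the \<open>l\<^sub>n\<close> it is not used.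
\<close>

fun lgen_reduced_decomp :: "lgen \<Rightarrow> (int \<times> lgen \<times> lgen list \<times> perm) list" where
  "lgen_reduced_decomp L2_1 = []"
| "lgen_reduced_decomp L2_11 = []"
| "lgen_reduced_decomp L2_111 = []"
| "lgen_reduced_decomp L3_1 = [(1, L2, [L2_1, L1], id)]"
| "lgen_reduced_decomp L3_2 =
     [(-1, L2_1, [L2, L1], id),
      (-1, L2, [L1, L2_1], id),
      (-1, L2_1, [L1, L2], cyc [1,2])]"
| "lgen_reduced_decomp L3_11 = [(-1, L2, [L2_11, L1], id)]"
| "lgen_reduced_decomp L3_12 =
     [(-1, L2_1, [L2_1, L1], id),
      (-1, L2_1, [L1, L2_1], id),
      (-1, L2_1, [L1, L2_1], cyc [1,2]),
      (1, L2_11, [L1, L2], cyc [1,3,2])]"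
| "lgen_reduced_decomp L3_22 =
     [(-1, L2_11, [L2, L1], id),
      (1, L2, [L1, L2_11], id),
      (-1, L2_11, [L1, L2], cyc [1,2])]"
| "lgen_reduced_decomp L4_1 =
     [(-1, L2, [L3_1, L1], id),
      (-1, L2, [L1, L3_1], cyc [1,2,3]),
      (1, L2, [L2_1, L2], id),
      (1, L3, [L2_1, L1, L1], id),
      (1, L3_1, [L1, L1, L2], id)]"
| "lgen_reduced_decomp L4_2 =
     [(-1, L2, [L3_2, L1], id),
      (-1, L2, [L1, L3_1], id),
      (1, L2, [L2_1, L2], cyc [1,3,2]),
      (1, L3_1, [L2, L1, L1], id),
      (1, L3_1, [L1, L2, L1], cyc [1,2]),
      (-1, L3, [L1, L2_1, L1], id),
      (1, L3_1, [L1, L1, L2], cyc [1,3,2])]"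
| "lgen_reduced_decomp L4_3 =
     [(1, L2_1, [L1, L3], cyc [1,2,3]),
      (-1, L2, [L1, L3_2], id),
      (1, L2, [L1, L3_2], cyc [1,2]),
      (1, L2_1, [L3, L1], id),
      (-1, L2, [L2, L2_1], id),
      (-1, L2_1, [L2, L2], cyc [1,3,2]),
      (1, L2_1, [L2, L2], cyc [2,3]),
      (1, L3_2, [L2, L1, L1], id),
      (-1, L3_2, [L1, L1, L2], cyc [2,3]),
      (1, L3_2, [L1, L1, L2], cyc [1,3,2]),
      (1, L3, [L1, L1, L2_1], id),
      (-1, L3_2, [L1, L2, L1], id),
      (1, L3_2, [L1, L2, L1], cyc [1,2])]"
| "lgen_reduced_decomp _ = undefined"

definition lgen_decomp ::
    "('r, 'm) ring_scheme \<Rightarrow> lgen \<Rightarrow> ((lgen \<times> perm \<Rightarrow> 'r, lgen \<times> perm \<Rightarrow> 'r) gen \<Rightarrow> 'r) set" where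
  "lgen_decomp R g =
     (if g = L1 then lcomp R L1 [L1] id
      else if g \<in> {L2, L3, L4, L5} then decomp_l R (lgen_arity g)
      else let Q = composite_piece R (Lie3 R) (Lie3 R) (lgen_arity g) (lgen_degr g) in
        lcomp R L1 [g] id \<oplus>\<^bsub>Q\<^esub>
        list_sum Q (map (\<lambda>(c, h, gs, \<sigma>). [c] \<cdot>\<^bsub>Q\<^esub> lcomp R h gs \<sigma>) (lgen_reduced_decomp g)) \<oplus>\<^bsub>Q\<^esub>
        lcomp R g (replicate (lgen_arity g) L1) id)"

definition Lie3_decomp ::
    "('r, 'm) ring_scheme \<Rightarrow> nat \<Rightarrow> int \<Rightarrow> (lgen \<times> perm \<Rightarrow> 'r) \<Rightarrow>
     ((lgen \<times> perm \<Rightarrow> 'r, lgen \<times> perm \<Rightarrow> 'r) gen \<Rightarrow> 'r) set" where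
  "Lie3_decomp R n p = free_lift R (composite_piece R (Lie3 R) (Lie3 R) n p)
     (\<lambda>(g, \<sigma>). act (composite R (Lie3 R) (Lie3 R)) n p (lgen_decomp R g) \<sigma>)"

text \<open>The projection onto arity 1.\<close>

definition Lie3_counit ::
    "('r, 'm) ring_scheme \<Rightarrow> nat \<Rightarrow> int \<Rightarrow> (lgen \<times> perm \<Rightarrow> 'r) \<Rightarrow> 'r" where
  "Lie3_counit R n p x = (if n = 1 \<and> p = 0 then x (L1, id) else \<zero>\<^bsub>R\<^esub>)"

end

theory Submission
  imports "HOL-Combinatorics.Multiset_Permutations" Defs
begin

text \<open>
  Every piece of the composite product is a quotient of a free module, so a map out of it is well
  defined as soon as it respects the defining relations. An identity between morphisms out of the
  triple is then an identity between integral combinations of elementary elements for each of the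
  sixteen generators. With permutations in one-line notation, where the balancing relations
  are only used in the form that the structure maps produce, both sides become explicit finite formal
  sums; equality of normal forms is then decided by evaluation inside the logic.
\<close>

section \<open>Homomorphisms, free modules and quotients\<close>

text \<open>Why comparing normal forms can succeed: every component of the triple is free over its
  group ring, so in the composite product all permutations attached to outer or inner generators can
  be pushed into the last one, and the elements \<open>h \<circ> (g1, ..., gm)^s\<close> with
  untwisted generators form a basis. What the argument uses is that equal formal sums have equal
  values; as signs and coefficients are integers, one computation serves every ring
  \<open>R\<close>.

  The main obstacle is the associator. That it is well defined rests on compatibilities between
  block permutations and block sums, and on matching identities between Koszul signs and
  distribution signs. The former hold because a permutation is determined by its effect on lists,
  where moving blocks becomes an operation on lists of lists; the latter are obtained modulo 2 by
  comparing the contributions of each pair of factors. Evaluating the decomposition formula also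
  requires the sign of a permutation as a count of inversions, that is, as a Koszul sign with all
  degrees equal to 1.\<close>

lemma module_homI:
  assumes "\<And>x. x \<in> carrier A \<Longrightarrow> f x \<in> carrier B"
    and "\<And>x y. x \<in> carrier A \<Longrightarrow> y \<in> carrier A \<Longrightarrow> f (x \<oplus>\<^bsub>A\<^esub> y) = f x \<oplus>\<^bsub>B\<^esub> f y"
    and "\<And>a x. a \<in> carrier R \<Longrightarrow> x \<in> carrier A \<Longrightarrow> f (a \<odot>\<^bsub>A\<^esub> x) = a \<odot>\<^bsub>B\<^esub> f x"
  shows "f \<in> module_hom R A B"
  using assms by (auto simp: module_hom_def)

lemma
  assumes "f \<in> module_hom R A B"
  shows module_hom_closed: "x \<in> carrier A \<Longrightarrow> f x \<in> carrier B"
    and module_hom_add: "x \<in> carrier A \<Longrightarrow> y \<in> carrier A \<Longrightarrow> f (x \<oplus>\<^bsub>A\<^esub> y) = f x \<oplus>\<^bsub>B\<^esub> f y"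
    and module_hom_smult: "a \<in> carrier R \<Longrightarrow> x \<in> carrier A \<Longrightarrow> f (a \<odot>\<^bsub>A\<^esub> x) = a \<odot>\<^bsub>B\<^esub> f x"
  using assms by (auto simp: module_hom_def)

lemma module_hom_comp:
  assumes "f \<in> module_hom R A B" "g \<in> module_hom R B C"
  shows "(\<lambda>x. g (f x)) \<in> module_hom R A C"
  using assms by (auto simp: module_hom_def Pi_iff)

text \<open>The two functions may differ off the carrier, where total functions take arbitrary
  values; closure of the carrier under the operations lets the agreement be applied to sums and
  multiples.\<close>

lemma module_hom_cong:
  assumes "f \<in> module_hom R A B" "\<And>x. x \<in> carrier A \<Longrightarrow> f x = g x" "module R A"
  shows "g \<in> module_hom R A B"
proof -
  interpret A: module R A by fact
  show ?thesis
    using assms(1,2) by (auto simp: module_hom_def Pi_iff)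
qed

lemma module_hom_id: "(\<lambda>x. x) \<in> module_hom R A A"
  by (rule module_homI) auto

text \<open>Keys and their evaluation \<open>ev\<close> are kept apart: the list can be rewritten by
  computation on the keys alone and then be evaluated in any module. Integer coefficients have a
  meaning over every ring.\<close>

definition lsum :: "('r, 'a) module \<Rightarrow> ('t \<Rightarrow> 'a) \<Rightarrow> (int \<times> 't) list \<Rightarrow> 'a" where
  "lsum A ev xs = list_sum A (map (\<lambda>(c, t). [c] \<cdot>\<^bsub>A\<^esub> ev t) xs)"

lemma list_sum_simps [simp]:
  "list_sum A [] = \<zero>\<^bsub>A\<^esub>" "list_sum A (x # xs) = x \<oplus>\<^bsub>A\<^esub> list_sum A xs"
  by (simp_all add: list_sum_def)

lemma lsum_simps [simp]:
  "lsum A ev [] = \<zero>\<^bsub>A\<^esub>" "lsum A ev ((c, t) # xs) = [c] \<cdot>\<^bsub>A\<^esub> ev t \<oplus>\<^bsub>A\<^esub> lsum A ev xs"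
  by (simp_all add: lsum_def)

section \<open>Integer multiples, finite sums and linear maps in a module\<close>

locale rmodule = module R M for R :: "('a, 'b) ring_scheme" (structure) and M :: "('a, 'c) module" (structure)

context rmodule
begin

lemma zsmult_closed [simp, intro]: "x \<in> carrier M \<Longrightarrow> [(c::int)] \<cdot>\<^bsub>M\<^esub> x \<in> carrier M"
  using M.add.int_pow_closed by (simp add: add_pow_def)

lemma zsmult_0 [simp]: "[(0::int)] \<cdot>\<^bsub>M\<^esub> x = \<zero>\<^bsub>M\<^esub>"
  by (simp add: add_pow_def)

lemma zsmult_1 [simp]: "x \<in> carrier M \<Longrightarrow> [(1::int)] \<cdot>\<^bsub>M\<^esub> x = x"
  using M.add.int_pow_1 by (simp add: add_pow_def)

lemma zsmult_zero [simp]: "[(c::int)] \<cdot>\<^bsub>M\<^esub> \<zero>\<^bsub>M\<^esub> = \<zero>\<^bsub>M\<^esub>"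
  using M.add.int_pow_one by (simp add: add_pow_def)

lemma zsmult_zsmult: "x \<in> carrier M \<Longrightarrow> [(b::int)] \<cdot>\<^bsub>M\<^esub> ([(c::int)] \<cdot>\<^bsub>M\<^esub> x) = [(b * c)] \<cdot>\<^bsub>M\<^esub> x"
  using M.add.int_pow_pow[of x b c] by (simp add: add_pow_def mult.commute)

lemma zsmult_add_left: "x \<in> carrier M \<Longrightarrow> [(b + c :: int)] \<cdot>\<^bsub>M\<^esub> x = [b] \<cdot>\<^bsub>M\<^esub> x \<oplus>\<^bsub>M\<^esub> [c] \<cdot>\<^bsub>M\<^esub> x"
  using M.add.int_pow_mult[of x b c] by (simp add: add_pow_def)

lemma zsmult_add_right:
  "x \<in> carrier M \<Longrightarrow> y \<in> carrier M \<Longrightarrow> [(c::int)] \<cdot>\<^bsub>M\<^esub> (x \<oplus>\<^bsub>M\<^esub> y) = [c] \<cdot>\<^bsub>M\<^esub> x \<oplus>\<^bsub>M\<^esub> [c] \<cdot>\<^bsub>M\<^esub> y"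
  using M.add.int_pow_distrib[of x y c] by (simp add: add_pow_def)

text \<open>Reduces integer multiples to scalars from the image of the integers in \<open>R\<close>;
  hence linear maps commute with them, and signs can be treated as integers throughout.\<close>

lemma zsmult_smult:
  assumes "x \<in> carrier M"
  shows "[(c::int)] \<cdot>\<^bsub>M\<^esub> x = ([c] \<cdot>\<^bsub>R\<^esub> \<one>) \<odot>\<^bsub>M\<^esub> x"
proof -
  have nat: "[k] \<cdot>\<^bsub>M\<^esub> x = ([k] \<cdot>\<^bsub>R\<^esub> \<one>) \<odot>\<^bsub>M\<^esub> x" for k :: nat
    by (induction k) (use assms in \<open>simp_all add: smult_l_distr\<close>)
  show ?thesis
  proof (cases "c \<ge> 0")
    case True
    then show ?thesis
      using nat by (simp add: add_pow_int_ge)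
  next
    case False
    then show ?thesis
      using nat[of "nat (- c)"] assms by (simp add: add_pow_int_lt smult_l_minus)
  qed
qed

lemma list_sum_closed [intro]: "set xs \<subseteq> carrier M \<Longrightarrow> list_sum M xs \<in> carrier M"
  by (induction xs) auto

lemma finsum_set_eq_list_sum:
  "distinct xs \<Longrightarrow> f \<in> set xs \<rightarrow> carrier M \<Longrightarrow> finsum M f (set xs) = list_sum M (map f xs)"
  by (induction xs) (auto simp: Pi_iff)

lemma lsum_closed [intro]: "ev ` snd ` set xs \<subseteq> carrier M \<Longrightarrow> lsum M ev xs \<in> carrier M"
  by (induction xs) auto

lemma lsum_append:
  assumes "ev ` snd ` set xs \<subseteq> carrier M" "ev ` snd ` set ys \<subseteq> carrier M"
  shows "lsum M ev (xs @ ys) = lsum M ev xs \<oplus>\<^bsub>M\<^esub> lsum M ev ys"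
  using assms by (induction xs) (auto simp: M.a_assoc lsum_closed)

lemma zsmult_lsum:
  assumes "ev ` snd ` set xs \<subseteq> carrier M"
  shows "[b] \<cdot>\<^bsub>M\<^esub> lsum M ev xs = lsum M ev (map (\<lambda>(c, t). (b * c, t)) xs)"
  using assms by (induction xs) (auto simp: zsmult_add_right zsmult_zsmult lsum_closed)

lemma lsum_concat:
  assumes "\<And>xs. xs \<in> set xss \<Longrightarrow> ev ` snd ` set xs \<subseteq> carrier M"
  shows "lsum M ev (concat xss) = list_sum M (map (lsum M ev) xss)"
  using assms
proof (induction xss)
  case (Cons xs xss)
  have "lsum M ev (xs @ concat xss) = lsum M ev xs \<oplus>\<^bsub>M\<^esub> lsum M ev (concat xss)"
  proof (rule lsum_append)
    show "ev ` snd ` set (concat xss) \<subseteq> carrier M"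
      using Cons.prems by fastforce
  qed (use Cons.prems in simp)
  then show ?case using Cons by simp
qed simp

text \<open>The relation submodule is an intersection of submodules. A linear map that kills the
  relations kills all of it, because its kernel is one of the submodules intersected.\<close>

lemma kernel_submodule:
  assumes "module R A" "f \<in> module_hom R M A"
  shows "submodule {x \<in> carrier M. f x = \<zero>\<^bsub>A\<^esub>} R M"
proof -
  interpret A: rmodule R A by (rule rmodule.intro) fact
  note hom = module_hom_closed[OF assms(2)] module_hom_add[OF assms(2)] module_hom_smult[OF assms(2)]
  have zero: "f \<zero>\<^bsub>M\<^esub> = \<zero>\<^bsub>A\<^esub>"
    using hom(3)[of \<zero> "\<zero>\<^bsub>M\<^esub>"] hom(1)[of "\<zero>\<^bsub>M\<^esub>"] by simp
  show ?thesis
  proof (rule submoduleI)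
    fix x assume "x \<in> {x \<in> carrier M. f x = \<zero>\<^bsub>A\<^esub>}"
    then show "\<ominus>\<^bsub>M\<^esub> x \<in> {x \<in> carrier M. f x = \<zero>\<^bsub>A\<^esub>}"
      using hom(3)[of "\<ominus> \<one>" x] by (auto simp: smult_l_minus)
  qed (use zero in \<open>auto simp: hom\<close>)
qed

lemma
  assumes "module R A" "f \<in> module_hom R M A"
  shows module_hom_zero: "f \<zero>\<^bsub>M\<^esub> = \<zero>\<^bsub>A\<^esub>"
    and module_hom_minus: "x \<in> carrier M \<Longrightarrow> f (\<ominus>\<^bsub>M\<^esub> x) = \<ominus>\<^bsub>A\<^esub> f x"
    and module_hom_diff:
      "x \<in> carrier M \<Longrightarrow> y \<in> carrier M \<Longrightarrow> f (x \<ominus>\<^bsub>M\<^esub> y) = f x \<ominus>\<^bsub>A\<^esub> f y"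
    and module_hom_zsmult: "x \<in> carrier M \<Longrightarrow> f ([(c::int)] \<cdot>\<^bsub>M\<^esub> x) = [c] \<cdot>\<^bsub>A\<^esub> f x"
proof -
  interpret A: rmodule R A by (rule rmodule.intro) fact
  note hom = module_hom_closed[OF assms(2)] module_hom_add[OF assms(2)] module_hom_smult[OF assms(2)]
  show "f \<zero>\<^bsub>M\<^esub> = \<zero>\<^bsub>A\<^esub>"
    using hom(3)[of \<zero> "\<zero>\<^bsub>M\<^esub>"] hom(1)[of "\<zero>\<^bsub>M\<^esub>"] by simp
  show minus: "f (\<ominus>\<^bsub>M\<^esub> x) = \<ominus>\<^bsub>A\<^esub> f x" if "x \<in> carrier M" for x
    using hom(3)[of "\<ominus> \<one>" x] that hom(1) by (auto simp: smult_l_minus A.smult_l_minus)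
  show "f (x \<ominus>\<^bsub>M\<^esub> y) = f x \<ominus>\<^bsub>A\<^esub> f y" if "x \<in> carrier M" "y \<in> carrier M" for x y
    using that by (simp add: a_minus_def minus hom)
  show "f ([(c::int)] \<cdot>\<^bsub>M\<^esub> x) = [c] \<cdot>\<^bsub>A\<^esub> f x" if "x \<in> carrier M" for x
    using that by (simp add: zsmult_smult A.zsmult_smult hom)
qed

lemma module_hom_finsum:
  assumes "module R A" "f \<in> module_hom R M A" "g \<in> I \<rightarrow> carrier M" "finite I"
  shows "f (finsum M g I) = finsum A (\<lambda>i. f (g i)) I"
proof -
  interpret A: rmodule R A by (rule rmodule.intro) fact
  note hom = module_hom_closed[OF assms(2)] module_hom_add[OF assms(2)]
  show ?thesis
    using assms(4,3)
  proof (induction I rule: finite_induct)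
    case (insert i I)
    then have "g \<in> I \<rightarrow> carrier M" "g i \<in> carrier M" by auto
    then show ?case
      using insert by (simp add: hom Pi_iff)
  qed (simp add: module_hom_zero[OF assms(1,2)])
qed

lemma module_hom_lsum:
  assumes "module R A" "f \<in> module_hom R M A" "ev ` snd ` set xs \<subseteq> carrier M"
  shows "f (lsum M ev xs) = lsum A (\<lambda>t. f (ev t)) xs"
  using assms(3)
  by (induction xs)
    (auto simp: module_hom_zero[OF assms(1,2)] module_hom_add[OF assms(2)] lsum_closed
      module_hom_zsmult[OF assms(1,2)])

lemma module_hom_compose_add:
  assumes "module R A" "f \<in> module_hom R A M" "g \<in> module_hom R A M"
  shows "(\<lambda>x. f x \<oplus>\<^bsub>M\<^esub> g x) \<in> module_hom R A M"
proof (rule module_homI)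
  interpret A: rmodule R A by (rule rmodule.intro) fact
  note hom = module_hom_closed[OF assms(2)] module_hom_closed[OF assms(3)]
  fix x y assume xy: "x \<in> carrier A" "y \<in> carrier A"
  show "f (x \<oplus>\<^bsub>A\<^esub> y) \<oplus>\<^bsub>M\<^esub> g (x \<oplus>\<^bsub>A\<^esub> y) = f x \<oplus>\<^bsub>M\<^esub> g x \<oplus>\<^bsub>M\<^esub> (f y \<oplus>\<^bsub>M\<^esub> g y)"
    using xy by (simp add: hom module_hom_add[OF assms(2)] module_hom_add[OF assms(3)] M.a_ac)
next
  fix a x assume "a \<in> carrier R" "x \<in> carrier A"
  then show "f (a \<odot>\<^bsub>A\<^esub> x) \<oplus>\<^bsub>M\<^esub> g (a \<odot>\<^bsub>A\<^esub> x) = a \<odot>\<^bsub>M\<^esub> (f x \<oplus>\<^bsub>M\<^esub> g x)"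
    using module_hom_closed[OF assms(2)] module_hom_closed[OF assms(3)]
    by (simp add: module_hom_smult[OF assms(2)] module_hom_smult[OF assms(3)] smult_r_distr)
qed (use module_hom_closed[OF assms(2)] module_hom_closed[OF assms(3)] in auto)

lemma module_hom_zsmult_fun:
  assumes "f \<in> module_hom R A M"
  shows "(\<lambda>x. [(c::int)] \<cdot>\<^bsub>M\<^esub> f x) \<in> module_hom R A M"
proof -
  have "[c] \<cdot>\<^bsub>R\<^esub> \<one> \<in> carrier R"
    using R.add.int_pow_closed[of \<one> c] by (simp add: add_pow_def)
  note closed = this module_hom_closed[OF assms]
  show ?thesis
    using closed
    by (intro module_homI) (simp_all add: module_hom_add[OF assms] zsmult_add_right
      module_hom_smult[OF assms] zsmult_smult smult_r_distr R.m_comm flip: smult_assoc1)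
qed

end

section \<open>Free modules, their bases and linear extension\<close>

lemma free_module_simps:
  "zero (free_module R S) = (\<lambda>s. \<zero>\<^bsub>R\<^esub>)"
  "add (free_module R S) = (\<lambda>f g s. f s \<oplus>\<^bsub>R\<^esub> g s)"
  "smult (free_module R S) = (\<lambda>a f s. a \<otimes>\<^bsub>R\<^esub> f s)"
  by (simp_all add: free_module_def)

lemma in_free_module:
  "f \<in> carrier (free_module R S) \<longleftrightarrow>
    (\<forall>s. f s \<in> carrier R) \<and> finite {s. f s \<noteq> \<zero>\<^bsub>R\<^esub>} \<and> (\<forall>s. s \<notin> S \<longrightarrow> f s = \<zero>\<^bsub>R\<^esub>)"
  by (simp add: free_module_def)

context cring
begin

lemma free_module_is_module: "module R (free_module R S)"
proof (rule moduleI)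
  show "abelian_group (free_module R S)"
  proof (rule abelian_groupI)
    fix f g assume *: "f \<in> carrier (free_module R S)" "g \<in> carrier (free_module R S)"
    then have "finite {s. f s \<oplus> g s \<noteq> \<zero>}"
      by - (rule finite_subset[of _ "{s. f s \<noteq> \<zero>} \<union> {s. g s \<noteq> \<zero>}"], auto simp: in_free_module)
    with * show "f \<oplus>\<^bsub>free_module R S\<^esub> g \<in> carrier (free_module R S)"
      by (auto simp: in_free_module free_module_simps)
  next
    fix f assume *: "f \<in> carrier (free_module R S)"
    then have "finite {s. \<ominus> f s \<noteq> \<zero>}"
      by - (rule finite_subset[of _ "{s. f s \<noteq> \<zero>}"], auto simp: in_free_module)
    with * have "(\<lambda>s. \<ominus> f s) \<in> carrier (free_module R S)"
      by (simp add: in_free_module)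
    with * show "\<exists>g\<in>carrier (free_module R S). g \<oplus>\<^bsub>free_module R S\<^esub> f = \<zero>\<^bsub>free_module R S\<^esub>"
      by (intro bexI[of _ "\<lambda>s. \<ominus> f s"]) (auto simp: in_free_module free_module_simps l_neg)
  qed (simp_all add: in_free_module free_module_simps fun_eq_iff a_ac)
next
  fix a f assume *: "a \<in> carrier R" "f \<in> carrier (free_module R S)"
  then have "finite {s. a \<otimes> f s \<noteq> \<zero>}"
    by - (rule finite_subset[of _ "{s. f s \<noteq> \<zero>}"], auto simp: in_free_module)
  with * show "a \<odot>\<^bsub>free_module R S\<^esub> f \<in> carrier (free_module R S)"
    by (auto simp: in_free_module free_module_simps)
qed (simp_all add: in_free_module free_module_simps fun_eq_iff l_distr r_distr m_assoc is_cring)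

lemma basis_in_free_module: "s \<in> S \<Longrightarrow> basis R s \<in> carrier (free_module R S)"
  by (auto simp: in_free_module basis_def intro: finite_subset[of _ "{s}"])

text \<open>Induction on the size of the support: setting one nonzero value to zero removes exactly
  that point, and what was removed is a multiple of a basis element.\<close>

lemma free_module_induct [consumes 1, case_names zero step]:
  assumes "f \<in> carrier (free_module R S)"
    and "P (\<lambda>s. \<zero>)"
    and step: "\<And>f a s. f \<in> carrier (free_module R S) \<Longrightarrow> P f \<Longrightarrow> s \<in> S \<Longrightarrow> a \<in> carrier R \<Longrightarrow>
      P (f \<oplus>\<^bsub>free_module R S\<^esub> a \<odot>\<^bsub>free_module R S\<^esub> basis R s)"
  shows "P f"
  using assms(1)
proof (induction "card {s. f s \<noteq> \<zero>}" arbitrary: f)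
  case 0
  then have "f = (\<lambda>s. \<zero>)" by (auto simp: in_free_module)
  with assms(2) show ?case by simp
next
  case (Suc n f)
  have "{s. f s \<noteq> \<zero>} \<noteq> {}"
    using Suc.hyps(2) by (intro notI) simp
  then obtain s where s: "f s \<noteq> \<zero>" by auto
  define g where "g = f(s := \<zero>)"
  have eq: "{s. g s \<noteq> \<zero>} = {s. f s \<noteq> \<zero>} - {s}" by (auto simp: g_def)
  have fin: "finite {s. f s \<noteq> \<zero>}" using Suc.prems by (simp add: in_free_module)
  have g: "g \<in> carrier (free_module R S)"
    using Suc.prems fin by (auto simp: in_free_module eq) (auto simp: g_def)
  have "n = card {s. g s \<noteq> \<zero>}" unfolding eq using s fin Suc.hyps(2) by simp
  from Suc.hyps(1)[OF this g] have "P g" .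
  have "s \<in> S" "f s \<in> carrier R" using s Suc.prems by (auto simp: in_free_module)
  have "f = g \<oplus>\<^bsub>free_module R S\<^esub> f s \<odot>\<^bsub>free_module R S\<^esub> basis R s"
    using Suc.prems by (auto simp: free_module_simps basis_def g_def in_free_module)
  with step[OF g \<open>P g\<close> \<open>s \<in> S\<close> \<open>f s \<in> carrier R\<close>] show ?case by simp
qed

lemma free_module_hom_eqI:
  assumes "module R A" "f \<in> module_hom R (free_module R S) A" "g \<in> module_hom R (free_module R S) A"
    and "\<And>s. s \<in> S \<Longrightarrow> f (basis R s) = g (basis R s)"
    and "x \<in> carrier (free_module R S)"
  shows "f x = g x"
proof -
  interpret F: rmodule R "free_module R S" by (intro rmodule.intro free_module_is_module)
  show ?thesis
    using assms(5)
  proof (induction rule: free_module_induct)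
    case zero
    show ?case
      using F.module_hom_zero[OF assms(1,2)] F.module_hom_zero[OF assms(1,3)]
      by (simp add: free_module_simps)
  next
    case (step x a s)
    then show ?case
      by (simp add: module_hom_add[OF assms(2)] module_hom_add[OF assms(3)] assms(4)
          module_hom_smult[OF assms(2)] module_hom_smult[OF assms(3)] basis_in_free_module)
  qed
qed

context
  fixes A :: "('a, 'c) module" and \<phi> :: "'s \<Rightarrow> 'c" and S :: "'s set"
  assumes A: "module R A" and \<phi>: "\<And>s. s \<in> S \<Longrightarrow> \<phi> s \<in> carrier A"
begin

interpretation A: rmodule R A by (intro rmodule.intro A)

text \<open>The defining sum runs over the exact support, which changes under addition and scaling.
  Enlarging the index set by points with zero coefficient lets both sides be summed over a common
  finite set.\<close>

lemma free_lift_eq_finsum: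
  assumes f: "f \<in> carrier (free_module R S)" and T: "finite T" "{s. f s \<noteq> \<zero>} \<subseteq> T" "T \<subseteq> S"
  shows "free_lift R A \<phi> f = (\<Oplus>\<^bsub>A\<^esub>s\<in>T. f s \<odot>\<^bsub>A\<^esub> \<phi> s)"
  unfolding free_lift_def
proof (rule A.add.finprod_mono_neutral_cong_left)
  show "(\<lambda>s. f s \<odot>\<^bsub>A\<^esub> \<phi> s) \<in> T \<rightarrow> carrier A"
    using f T \<phi> by (auto simp: in_free_module)
  show "f i \<odot>\<^bsub>A\<^esub> \<phi> i = \<zero>\<^bsub>A\<^esub>" if "i \<in> T - {s. f s \<noteq> \<zero>}" for i
    using that T \<phi> by auto
qed (use T in auto)

lemma free_lift_hom: "free_lift R A \<phi> \<in> module_hom R (free_module R S) A"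
proof (rule module_homI)
  interpret F: rmodule R "free_module R S" by (intro rmodule.intro free_module_is_module)
  let ?T = "\<lambda>f. {s. f s \<noteq> \<zero>}"
  have T: "finite (?T f)" "?T f \<subseteq> S" "\<And>s. f s \<in> carrier R" if "f \<in> carrier (free_module R S)" for f
    using that by (auto simp: in_free_module)
  show "free_lift R A \<phi> f \<in> carrier A" if "f \<in> carrier (free_module R S)" for f
    unfolding free_lift_def using T[OF that] \<phi> by (intro A.finsum_closed) auto
  fix f g assume f: "f \<in> carrier (free_module R S)" and g: "g \<in> carrier (free_module R S)"
  let ?U = "?T f \<union> ?T g"
  have U: "finite ?U" "?U \<subseteq> S" using T[OF f] T[OF g] by auto
  have sub: "?T (f \<oplus>\<^bsub>free_module R S\<^esub> g) \<subseteq> ?U"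
    using f g by (auto simp: free_module_simps)
  have "free_lift R A \<phi> (f \<oplus>\<^bsub>free_module R S\<^esub> g) =
      (\<Oplus>\<^bsub>A\<^esub>s\<in>?U. f s \<odot>\<^bsub>A\<^esub> \<phi> s \<oplus>\<^bsub>A\<^esub> g s \<odot>\<^bsub>A\<^esub> \<phi> s)"
    using U \<phi> T(3)[OF f] T(3)[OF g]
    by (subst free_lift_eq_finsum[OF F.add.m_closed[OF f g] U(1) sub U(2)])
      (intro A.finsum_cong', auto simp: free_module_simps A.smult_l_distr subset_iff)
  also have "\<dots> = (\<Oplus>\<^bsub>A\<^esub>s\<in>?U. f s \<odot>\<^bsub>A\<^esub> \<phi> s) \<oplus>\<^bsub>A\<^esub> (\<Oplus>\<^bsub>A\<^esub>s\<in>?U. g s \<odot>\<^bsub>A\<^esub> \<phi> s)"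
    using U \<phi> T(3)[OF f] T(3)[OF g] by (intro A.finsum_addf) (auto simp: subset_iff)
  also have "\<dots> = free_lift R A \<phi> f \<oplus>\<^bsub>A\<^esub> free_lift R A \<phi> g"
    using free_lift_eq_finsum[OF f U(1) _ U(2)] free_lift_eq_finsum[OF g U(1) _ U(2)] by auto
  finally show "free_lift R A \<phi> (f \<oplus>\<^bsub>free_module R S\<^esub> g) = \<dots>" .
next
  interpret F: rmodule R "free_module R S" by (intro rmodule.intro free_module_is_module)
  fix a f assume a: "a \<in> carrier R" and f: "f \<in> carrier (free_module R S)"
  let ?U = "{s. f s \<noteq> \<zero>}"
  have U: "finite ?U" "?U \<subseteq> S" "\<And>s. f s \<in> carrier R" using f by (auto simp: in_free_module)
  have sub: "{s. (a \<odot>\<^bsub>free_module R S\<^esub> f) s \<noteq> \<zero>} \<subseteq> ?U"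
    using a f by (auto simp: free_module_simps)
  have "free_lift R A \<phi> (a \<odot>\<^bsub>free_module R S\<^esub> f) = (\<Oplus>\<^bsub>A\<^esub>s\<in>?U. a \<odot>\<^bsub>A\<^esub> (f s \<odot>\<^bsub>A\<^esub> \<phi> s))"
    using U a \<phi> by (subst free_lift_eq_finsum[OF F.smult_closed[OF a f] U(1) sub U(2)])
      (intro A.finsum_cong', auto simp: free_module_simps A.smult_assoc1 subset_iff)
  also have "\<dots> = a \<odot>\<^bsub>A\<^esub> free_lift R A \<phi> f"
    unfolding free_lift_def using U \<phi> a by (intro A.finsum_smult_ldistr[symmetric]) auto
  finally show "free_lift R A \<phi> (a \<odot>\<^bsub>free_module R S\<^esub> f) = \<dots>" .
qed

lemma free_lift_basis:
  assumes "s \<in> S"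
  shows "free_lift R A \<phi> (basis R s) = \<phi> s"
proof -
  have "free_lift R A \<phi> (basis R s) = (\<Oplus>\<^bsub>A\<^esub>t\<in>{s}. basis R s t \<odot>\<^bsub>A\<^esub> \<phi> t)"
    by (rule free_lift_eq_finsum[OF basis_in_free_module]) (use assms in \<open>auto simp: basis_def\<close>)
  also have "\<dots> = \<phi> s"
    using \<phi>[OF assms] by (simp add: basis_def)
  finally show ?thesis .
qed

end

end

section \<open>Quotient modules and maps out of them\<close>

locale module_quotient = rmodule R M for R (structure) and M (structure) +
  fixes H
  assumes sub: "submodule H R M"
begin

sublocale Q: abelian_subgroup H M
  by (intro abelian_subgroupI3 additive_subgroupI submodule.axioms(1)[OF sub] M.abelian_group_axioms)

abbreviation "Q \<equiv> quotient_module M H"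

text \<open>The scalar multiple of a coset is a union over all representatives. These differ by
  elements of \<open>H\<close>, which is closed under scalars, so all sets in the union
  coincide.\<close>

lemma smult_coset:
  assumes "a \<in> carrier R" "x \<in> carrier M"
  shows "a \<odot>\<^bsub>Q\<^esub> (H +>\<^bsub>M\<^esub> x) = H +>\<^bsub>M\<^esub> (a \<odot>\<^bsub>M\<^esub> x)"
proof -
  have *: "H +>\<^bsub>M\<^esub> (a \<odot>\<^bsub>M\<^esub> y) = H +>\<^bsub>M\<^esub> (a \<odot>\<^bsub>M\<^esub> x)" if y: "y \<in> H +>\<^bsub>M\<^esub> x" for y
  proof -
    have yc: "y \<in> carrier M"
      using y assms(2) Q.a_elemrcos_carrier by blast
    have "y \<ominus>\<^bsub>M\<^esub> x \<in> H"
      using Q.a_rcos_module_imp[OF assms(2) y] by (simp add: a_minus_def)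
    then have "a \<odot>\<^bsub>M\<^esub> (y \<ominus>\<^bsub>M\<^esub> x) \<in> H"
      using submodule.smult_closed[OF sub assms(1)] by simp
    moreover have "a \<odot>\<^bsub>M\<^esub> (y \<ominus>\<^bsub>M\<^esub> x) = a \<odot>\<^bsub>M\<^esub> y \<oplus>\<^bsub>M\<^esub> \<ominus>\<^bsub>M\<^esub> (a \<odot>\<^bsub>M\<^esub> x)"
      using assms yc by (simp add: a_minus_def smult_r_distr smult_r_minus)
    ultimately have "a \<odot>\<^bsub>M\<^esub> y \<in> H +>\<^bsub>M\<^esub> (a \<odot>\<^bsub>M\<^esub> x)"
      using assms yc by (intro Q.a_rcos_module_rev) auto
    then show ?thesis
      using Q.a_repr_independence'[of "a \<odot>\<^bsub>M\<^esub> y" "a \<odot>\<^bsub>M\<^esub> x"] assms by simp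
  qed
  have "x \<in> H +>\<^bsub>M\<^esub> x" using Q.a_rcos_self assms by simp
  then have "(\<Union>y\<in>H +>\<^bsub>M\<^esub> x. H +>\<^bsub>M\<^esub> (a \<odot>\<^bsub>M\<^esub> y)) = H +>\<^bsub>M\<^esub> (a \<odot>\<^bsub>M\<^esub> x)"
    using * by (intro SUP_eq_const) blast+
  then show ?thesis by (simp add: quotient_module_def)
qed

lemma coset_eq_iff:
  assumes "x \<in> carrier M" "y \<in> carrier M"
  shows "H +>\<^bsub>M\<^esub> x = H +>\<^bsub>M\<^esub> y \<longleftrightarrow> x \<ominus>\<^bsub>M\<^esub> y \<in> H"
proof
  assume "H +>\<^bsub>M\<^esub> x = H +>\<^bsub>M\<^esub> y"
  then have "x \<in> H +>\<^bsub>M\<^esub> y" using Q.a_rcos_self[of x] assms by simp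
  then show "x \<ominus>\<^bsub>M\<^esub> y \<in> H" using Q.a_rcos_module_imp[of y x] assms by (simp add: a_minus_def)
next
  assume "x \<ominus>\<^bsub>M\<^esub> y \<in> H"
  then have "x \<in> H +>\<^bsub>M\<^esub> y" using Q.a_rcos_module_rev[of y x] assms by (simp add: a_minus_def)
  then show "H +>\<^bsub>M\<^esub> x = H +>\<^bsub>M\<^esub> y" using Q.a_repr_independence'[of x y] assms by simp
qed

lemma add_coset:
  assumes "x \<in> carrier M" "y \<in> carrier M"
  shows "(H +>\<^bsub>M\<^esub> x) \<oplus>\<^bsub>Q\<^esub> (H +>\<^bsub>M\<^esub> y) = H +>\<^bsub>M\<^esub> (x \<oplus>\<^bsub>M\<^esub> y)"
  using assms Q.a_rcos_sum by (simp add: quotient_module_def)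

lemma carrier_quotient: "carrier Q = (\<lambda>x. H +>\<^bsub>M\<^esub> x) ` carrier M"
  by (auto simp: quotient_module_def A_RCOSETS_def')

lemma coset_in_carrier [simp, intro]: "x \<in> carrier M \<Longrightarrow> H +>\<^bsub>M\<^esub> x \<in> carrier Q"
  by (auto simp: carrier_quotient)

lemma zero_quotient: "\<zero>\<^bsub>Q\<^esub> = H +>\<^bsub>M\<^esub> \<zero>\<^bsub>M\<^esub>"
  using M.a_coset_add_zero[OF Q.a_subset] by (simp add: quotient_module_def)

lemma quotient_is_module: "module R Q"
proof (rule moduleI)
  show "abelian_group Q"
  proof (rule abelian_groupI)
    fix X assume "X \<in> carrier Q"
    then obtain x where x: "x \<in> carrier M" "X = H +>\<^bsub>M\<^esub> x" by (auto simp: carrier_quotient)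
    then show "\<exists>Y\<in>carrier Q. Y \<oplus>\<^bsub>Q\<^esub> X = \<zero>\<^bsub>Q\<^esub>"
      by (intro bexI[of _ "H +>\<^bsub>M\<^esub> \<ominus>\<^bsub>M\<^esub> x"]) (simp_all add: add_coset zero_quotient M.l_neg)
  qed (auto simp: carrier_quotient add_coset zero_quotient M.a_ac)
qed (auto simp: carrier_quotient add_coset smult_coset smult_l_distr smult_r_distr smult_assoc1
    R.is_cring)

lemma coset_hom: "(\<lambda>x. H +>\<^bsub>M\<^esub> x) \<in> module_hom R M Q"
  by (rule module_homI) (auto simp: add_coset smult_coset)

end

text \<open>The arbitrary representative is harmless: any two members of a coset differ by an
  element of \<open>H\<close>, on which the linear extension is assumed to vanish.\<close>

lemma quotient_lift:
  assumes "cring R" "module R A" and H: "submodule H R (free_module R S)"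
    and \<phi>: "\<And>s. s \<in> S \<Longrightarrow> \<phi> s \<in> carrier A"
    and vanish: "\<And>h. h \<in> H \<Longrightarrow> free_lift R A \<phi> h = \<zero>\<^bsub>A\<^esub>"
  shows quotient_lift_hom:
      "quotient_lift R A \<phi> \<in> module_hom R (quotient_module (free_module R S) H) A"
    and quotient_lift_coset: "f \<in> carrier (free_module R S) \<Longrightarrow>
      quotient_lift R A \<phi> (H +>\<^bsub>free_module R S\<^esub> f) = free_lift R A \<phi> f"
proof -
  interpret R: cring R by fact
  interpret A: rmodule R A by (rule rmodule.intro) fact
  interpret module_quotient R "free_module R S" H
    by (intro module_quotient.intro rmodule.intro R.free_module_is_module module_quotient_axioms.intro H)
  note hom = R.free_lift_hom[OF assms(2), of S \<phi>, OF \<phi>, simplified]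
  show coset: "quotient_lift R A \<phi> (H +>\<^bsub>free_module R S\<^esub> f) = free_lift R A \<phi> f"
    if f: "f \<in> carrier (free_module R S)" for f
  proof -
    define g where "g = (SOME g. g \<in> H +>\<^bsub>free_module R S\<^esub> f)"
    have g: "g \<in> H +>\<^bsub>free_module R S\<^esub> f"
      unfolding g_def using Q.a_rcos_self[OF f] by (metis someI)
    then have gc: "g \<in> carrier (free_module R S)"
      using f Q.a_elemrcos_carrier by blast
    have "g \<ominus>\<^bsub>free_module R S\<^esub> f \<in> H"
      using g f Q.a_rcos_module_imp by (simp add: a_minus_def)
    then have "free_lift R A \<phi> (g \<ominus>\<^bsub>free_module R S\<^esub> f) = \<zero>\<^bsub>A\<^esub>"
      by (rule vanish)
    then have "free_lift R A \<phi> g \<ominus>\<^bsub>A\<^esub> free_lift R A \<phi> f = \<zero>\<^bsub>A\<^esub>"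
      using module_hom_diff[OF assms(2) hom gc f] by simp
    then have "free_lift R A \<phi> g = free_lift R A \<phi> f"
      using module_hom_closed[OF hom gc] module_hom_closed[OF hom f]
      by (metis A.M.a_inv_closed A.M.minus_equality A.M.minus_minus a_minus_def)
    then show ?thesis by (simp add: quotient_lift_def g_def)
  qed
  show "quotient_lift R A \<phi> \<in> module_hom R Q A"
  proof (rule module_homI)
    fix X Y assume "X \<in> carrier Q" "Y \<in> carrier Q"
    then obtain x y where "x \<in> carrier (free_module R S)" "y \<in> carrier (free_module R S)"
      "X = H +>\<^bsub>free_module R S\<^esub> x" "Y = H +>\<^bsub>free_module R S\<^esub> y"
      by (auto simp: carrier_quotient)
    then show "quotient_lift R A \<phi> (X \<oplus>\<^bsub>Q\<^esub> Y) = quotient_lift R A \<phi> X \<oplus>\<^bsub>A\<^esub> quotient_lift R A \<phi> Y"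
      by (simp add: add_coset coset module_hom_add[OF hom])
  qed (auto simp: carrier_quotient smult_coset coset module_hom_closed[OF hom]
      module_hom_smult[OF hom])
qed

section \<open>Permutations of lists and of blocks\<close>

declare upt_Suc [simp del]

definition oneline :: "nat \<Rightarrow> perm \<Rightarrow> nat list" where
  "oneline n \<sigma> = map \<sigma> [1..<n + 1]"

lemma length_oneline [simp]: "length (oneline n \<sigma>) = n"
  by (simp add: oneline_def)

lemma nth_oneline: "i < n \<Longrightarrow> oneline n \<sigma> ! i = \<sigma> (Suc i)"
  by (simp add: oneline_def)

lemma length_permuted [simp]: "length (permuted \<tau> xs) = length xs"
  by (simp add: permuted_def)

lemma permutes_range: "\<tau> permutes {1..n} \<Longrightarrow> i \<in> {1..n} \<Longrightarrow> \<tau> i \<in> {1..n}"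
  by (simp only: permutes_in_image)

lemma permutes_range_Suc: "\<tau> permutes {1..n} \<Longrightarrow> i < n \<Longrightarrow> \<tau> (Suc i) \<in> {1..n}"
  by (rule permutes_range) auto

text \<open>\<open>permuted\<close> is defined through the inverse permutation; this form avoids the
  inverse. The shifts by one pass between letters, counted from 1, and list positions, counted from
  0.\<close>

lemma nth_permuted:
  assumes "\<tau> permutes {1..length xs}" "i < length xs"
  shows "permuted \<tau> xs ! (\<tau> (Suc i) - 1) = xs ! i"
proof -
  have "\<tau> (Suc i) \<in> {1..length xs}"
    using permutes_range_Suc[OF assms] by simp
  moreover have "inv_into UNIV \<tau> (\<tau> (Suc i)) = Suc i"
    by (rule permutes_inverses(2)[OF assms(1)])
  ultimately show ?thesis
    by (auto simp: permuted_def nth_map_upt)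
qed

lemma permutes_index_bij:
  assumes "\<tau> permutes {1..n}"
  shows "bij_betw (\<lambda>i. \<tau> (Suc i) - 1) {..<n} {..<n}"
proof -
  have "bij_betw Suc {..<n} {1..n}"
    by (intro bij_betwI[of _ _ _ "\<lambda>i. i - 1"]) auto
  moreover have "bij_betw \<tau> {1..n} {1..n}"
    using assms by (rule permutes_imp_bij)
  moreover have "bij_betw (\<lambda>i. i - 1) {1..n} {..<n}"
    by (intro bij_betwI[of _ _ _ Suc]) auto
  ultimately have "bij_betw ((\<lambda>i. i - 1) \<circ> (\<tau> \<circ> Suc)) {..<n} {..<n}"
    by (metis bij_betw_trans)
  then show ?thesis by (simp add: o_def)
qed

text \<open>The positions \<open>\<tau> (Suc i) - 1\<close> exhaust the list because the shifted
  permutation is a bijection of the positions, so it suffices to compare there.\<close>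

lemma permuted_eqI:
  assumes "\<tau> permutes {1..n}" "length xs = n" "length ys = n"
    and "\<And>i. i < n \<Longrightarrow> ys ! (\<tau> (Suc i) - 1) = xs ! i"
  shows "permuted \<tau> xs = ys"
proof (rule nth_equalityI)
  fix k assume "k < length (permuted \<tau> xs)"
  then have "k \<in> (\<lambda>i. \<tau> (Suc i) - 1) ` {..<n}"
    using assms bij_betw_imp_surj_on[OF permutes_index_bij[OF assms(1)]] by simp
  then obtain i where "i < n" "k = \<tau> (Suc i) - 1" by auto
  then show "permuted \<tau> xs ! k = ys ! k"
    using assms nth_permuted[of \<tau> xs i] by simp
qed (use assms in simp)

lemma permuted_id [simp]: "permuted id xs = xs"
  by (rule permuted_eqI[of _ "length xs"]) (auto simp: permutes_id)

lemma permuted_comp: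
  assumes "\<sigma> permutes {1..length xs}" "\<tau> permutes {1..length xs}"
  shows "permuted (\<sigma> \<circ> \<tau>) xs = permuted \<sigma> (permuted \<tau> xs)"
proof (rule permuted_eqI[OF permutes_compose])
  fix i assume i: "i < length xs"
  have r: "\<tau> (Suc i) \<in> {1..length xs}" by (rule permutes_range_Suc[OF assms(2) i])
  then have "permuted \<sigma> (permuted \<tau> xs) ! (\<sigma> (Suc (\<tau> (Suc i) - 1)) - 1) = permuted \<tau> xs ! (\<tau> (Suc i) - 1)"
    using assms by (intro nth_permuted) auto
  with r show "permuted \<sigma> (permuted \<tau> xs) ! ((\<sigma> \<circ> \<tau>) (Suc i) - 1) = xs ! i"
    using nth_permuted[OF assms(2) i] by auto
qed (use assms in auto)

lemma permuted_map:
  assumes "\<tau> permutes {1..length xs}"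
  shows "permuted \<tau> (map f xs) = map f (permuted \<tau> xs)"
proof (rule permuted_eqI[OF assms])
  fix i assume i: "i < length xs"
  then have "\<tau> (Suc i) \<in> {1..length xs}" using permutes_range_Suc[OF assms(1)] by blast
  then show "map f (permuted \<tau> xs) ! (\<tau> (Suc i) - 1) = map f xs ! i"
    using nth_permuted[OF assms i] i by auto
qed auto

lemma permuted_map2:
  assumes "\<tau> permutes {1..length xs}" "length ys = length xs"
  shows "permuted \<tau> (map2 f xs ys) = map2 f (permuted \<tau> xs) (permuted \<tau> ys)"
proof (rule permuted_eqI[OF assms(1)])
  fix i assume i: "i < length xs"
  then have "\<tau> (Suc i) \<in> {1..length xs}" using permutes_range_Suc[OF assms(1)] by blast
  then show "map2 f (permuted \<tau> xs) (permuted \<tau> ys) ! (\<tau> (Suc i) - 1) = map2 f xs ys ! i"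
    using nth_permuted[OF assms(1) i] nth_permuted[of \<tau> ys i] assms i by auto
qed (use assms in auto)

lemma set_permuted:
  assumes "\<tau> permutes {1..length xs}"
  shows "set (permuted \<tau> xs) = set xs"
proof -
  have "set (permuted \<tau> xs) = (\<lambda>k. permuted \<tau> xs ! k) ` {..<length xs}"
    by (auto simp: set_conv_nth)
  also have "\<dots> = (\<lambda>k. permuted \<tau> xs ! k) ` (\<lambda>i. \<tau> (Suc i) - 1) ` {..<length xs}"
    using permutes_index_bij[OF assms] by (simp add: bij_betw_def)
  also have "\<dots> = (\<lambda>i. xs ! i) ` {..<length xs}"
    unfolding image_image using nth_permuted[OF assms] by (intro image_cong) auto
  also have "\<dots> = set xs" by (auto simp: set_conv_nth)
  finally show ?thesis .
qed

lemma sum_nth_permuted: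
  fixes f :: "'x \<Rightarrow> 'y :: comm_monoid_add"
  assumes "\<tau> permutes {1..length xs}"
  shows "(\<Sum>k<length xs. f (permuted \<tau> xs ! k)) = (\<Sum>k<length xs. f (xs ! k))"
proof -
  have "(\<Sum>k<length xs. f (permuted \<tau> xs ! k)) = (\<Sum>i<length xs. f (permuted \<tau> xs ! (\<tau> (Suc i) - 1)))"
    by (rule sum.reindex_bij_betw[OF permutes_index_bij[OF assms], symmetric])
  also have "\<dots> = (\<Sum>k<length xs. f (xs ! k))"
    using nth_permuted[OF assms] by (intro sum.cong) auto
  finally show ?thesis .
qed

lemma sum_list_permuted:
  assumes "\<tau> permutes {1..length xs}"
  shows "sum_list (permuted \<tau> xs) = (sum_list xs :: 'x :: comm_monoid_add)"
  using sum_nth_permuted[OF assms, of "\<lambda>x. x"] by (simp add: sum_list_sum_nth atLeast0LessThan)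

text \<open>The action on lists is faithful: applied to the list of letters it writes down the
  inverse permutation. Identities between block permutations are thereby reduced to identities
  between rearranged lists, where cutting and concatenating are available.\<close>

lemma permutes_eqI_permuted:
  assumes "\<sigma> permutes {1..n}" "\<tau> permutes {1..n}"
    and "\<And>xs :: nat list. length xs = n \<Longrightarrow> permuted \<sigma> xs = permuted \<tau> xs"
  shows "\<sigma> = \<tau>"
proof -
  have "inv_into UNIV \<sigma> k = inv_into UNIV \<tau> k" for k
  proof (cases "k \<in> {1..n}")
    case True
    have nth: "permuted \<rho> [1..<n + 1] ! (k - 1) = inv_into UNIV \<rho> k" if "\<rho> permutes {1..n}" for \<rho>
    proof -
      have "inv_into UNIV \<rho> k \<in> {1..n}"
        using True by (rule permutes_range[OF permutes_inv[OF that]])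
      then show ?thesis using True by (auto simp: permuted_def nth_map_upt)
    qed
    then show ?thesis
      using nth[OF assms(1)] nth[OF assms(2)] assms(3)[of "[1..<n + 1]"] by simp
  next
    case False
    then show ?thesis
      using permutes_inv[OF assms(1)] permutes_inv[OF assms(2)] by (metis permutes_not_in)
  qed
  then have "inv_into UNIV \<sigma> = inv_into UNIV \<tau>" by blast
  then show ?thesis
    by (metis assms(1,2) permutes_inv_inv)
qed

section \<open>Cutting lists and intervals into consecutive blocks\<close>

lemma length_chunks [simp]: "length (chunks ns xs) = length ns"
  by (induction ns arbitrary: xs) auto

lemma map_length_chunks: "length xs = sum_list ns \<Longrightarrow> map length (chunks ns xs) = ns"
  by (induction ns arbitrary: xs) auto

lemma concat_chunks: "length xs = sum_list ns \<Longrightarrow> concat (chunks ns xs) = xs"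
  by (induction ns arbitrary: xs) auto

lemma chunks_concat: "map length xss = ns \<Longrightarrow> chunks ns (concat xss) = xss"
  by (induction ns arbitrary: xss) auto

lemma chunks_map: "chunks ns (map f xs) = map (map f) (chunks ns xs)"
  by (induction ns arbitrary: xs) (auto simp: take_map drop_map)

lemma concat_concat: "concat (concat xsss) = concat (map concat xsss)"
  by (induction xsss) auto

lemma obtain_blocks:
  assumes "length xs = sum_list ns"
  obtains xss where "xs = concat xss" "map length xss = ns"
  using assms concat_chunks map_length_chunks by metis

lemma obtain_block_blocks:
  assumes "length xs = sum_list (concat nss)"
  obtains xsss where "xs = concat (concat xsss)" "map (map length) xsss = nss"
proof -
  obtain xss where xss: "xs = concat xss" "map length xss = concat nss"
    using assms by (rule obtain_blocks)
  have "length xss = sum_list (map length nss)"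
    using arg_cong[OF xss(2), of length] by (simp add: length_concat)
  then obtain xsss where xsss: "xss = concat xsss" "map length xsss = map length nss"
    by (rule obtain_blocks)
  have "concat (map (map length) xsss) = concat nss"
    using xss(2) xsss(1) by (simp add: map_concat)
  then have "chunks (map length nss) (concat (map (map length) xsss)) = chunks (map length nss) (concat nss)"
    by simp
  then have "map (map length) xsss = nss"
    using xsss(2) by (simp add: chunks_concat comp_def)
  with xss xsss that show ?thesis by blast
qed

lemma block_end_simps [simp]:
  "block_end ns 0 = 0" "block_end (n # ns) (Suc i) = n + block_end ns i"
  by (simp_all add: block_end_def)

lemma block_of_Cons:
  assumes "x \<le> n + sum_list ns"
  shows "block_of (n # ns) x = (if x \<le> n then 0 else Suc (block_of ns (x - n)))"
proof (cases "x \<le> n")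
  case False
  \<comment> \<open>A witness that the least index exists: past the last block, \<open>take\<close>
    returns the whole list, so the end is the total size.\<close>
  have "x \<le> block_end (n # ns) (Suc (Suc (length ns)))"
    using assms by (simp add: block_end_def)
  then have "block_of (n # ns) x = Suc (LEAST i. x \<le> block_end (n # ns) (Suc (Suc i)))"
    unfolding block_of_def by (rule Least_Suc) (use False in simp)
  also have "(\<lambda>i. x \<le> block_end (n # ns) (Suc (Suc i))) = (\<lambda>i. x - n \<le> block_end ns (Suc i))"
    using False by (auto simp: fun_eq_iff)
  finally show ?thesis using False by (simp add: block_of_def)
qed (simp add: block_of_def)

lemma block_end_add_le:
  "i < length ns \<Longrightarrow> r \<le> ns ! i \<Longrightarrow> block_end ns i + r \<le> sum_list ns"
proof (induction ns arbitrary: i)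
  case (Cons n ns)
  show ?case
  proof (cases i)
    case (Suc j)
    then have "block_end ns j + r \<le> sum_list ns" using Cons by simp
    with Suc show ?thesis by simp
  qed (use Cons.prems in simp)
qed simp

lemma block_of_add:
  "i < length ns \<Longrightarrow> r \<in> {1..ns ! i} \<Longrightarrow> block_of ns (block_end ns i + r) = i"
proof (induction ns arbitrary: i)
  case (Cons n ns)
  show ?case
  proof (cases i)
    case 0
    then show ?thesis using Cons.prems by (subst block_of_Cons) auto
  next
    case (Suc j)
    then have "block_end ns j + r \<le> sum_list ns"
      using Cons.prems block_end_add_le[of j ns r] by auto
    then show ?thesis
      using Cons Suc by (subst block_of_Cons) auto
  qed
qed simp

lemma obtain_block_position:
  assumes "x \<in> {1..sum_list ns}"
  obtains i r where "i < length ns" "r \<in> {1..ns ! i}" "x = block_end ns i + r"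
  using assms
proof (induction ns arbitrary: x thesis)
  case (Cons n ns)
  show ?case
  proof (cases "x \<le> n")
    case True
    then show ?thesis using Cons.prems by (intro Cons.prems(1)[of 0 x]) auto
  next
    case False
    then have "x - n \<in> {1..sum_list ns}" using Cons.prems(2) by auto
    then obtain i r where "i < length ns" "r \<in> {1..ns ! i}" "x - n = block_end ns i + r"
      using Cons.IH by metis
    then show ?thesis using False by (intro Cons.prems(1)[of "Suc i" r]) auto
  qed
qed simp

lemma nth_concat_block:
  "i < length xss \<Longrightarrow> r < length (xss ! i) \<Longrightarrow>
   concat xss ! (block_end (map length xss) i + r) = xss ! i ! r"
proof (induction xss arbitrary: i)
  case (Cons xs xss)
  then show ?case by (cases i) (auto simp: nth_append)
qed simp

text \<open>Lists the letters block by block, so that the one-line word of a block permutation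
  splits into one increasing run per block.\<close>

lemma upt_eq_concat_blocks:
  "[1..<sum_list ns + 1] =
   concat (map (\<lambda>i. map (\<lambda>r. block_end ns i + r) [1..<ns ! i + 1]) [0..<length ns])"
proof (rule nth_equalityI)
  have "length (concat (map (\<lambda>i. map (\<lambda>r. block_end ns i + r) [1..<ns ! i + 1]) [0..<length ns]))
      = sum_list (map ((!) ns) [0..<length ns])"
    by (simp add: length_concat comp_def)
  then show len: "length [1..<sum_list ns + 1] =
      length (concat (map (\<lambda>i. map (\<lambda>r. block_end ns i + r) [1..<ns ! i + 1]) [0..<length ns]))"
    by (simp only: map_nth) simp
  fix k assume "k < length [1..<sum_list ns + 1]"
  then have "Suc k \<in> {1..sum_list ns}" by simp
  then obtain i r where ir: "i < length ns" "r \<in> {1..ns ! i}" "Suc k = block_end ns i + r"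
    by (rule obtain_block_position)
  let ?f = "\<lambda>i. map (\<lambda>r. block_end ns i + r) [1..<ns ! i + 1]"
  have "concat (map ?f [0..<length ns]) ! (block_end (map length (map ?f [0..<length ns])) i + (r - 1)) =
      map ?f [0..<length ns] ! i ! (r - 1)"
    using ir by (intro nth_concat_block) (auto)
  moreover have "map length (map ?f [0..<length ns]) = ns"
    by (simp add: comp_def map_nth)
  ultimately have "concat (map ?f [0..<length ns]) ! (block_end ns i + (r - 1)) = block_end ns i + r"
    using ir by (auto)
  moreover have "k = block_end ns i + (r - 1)" using ir by auto
  ultimately show "[1..<sum_list ns + 1] ! k = concat (map ?f [0..<length ns]) ! k"
    using ir \<open>k < _\<close> by simp
qed

subsection \<open>Block sums of permutations\<close>

text \<open>The two-block case of \<open>sum_perm\<close>, which turns statements about many blocks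
  into inductions on the list of blocks.\<close>

definition perm_sum :: "nat \<Rightarrow> perm \<Rightarrow> perm \<Rightarrow> perm" where
  "perm_sum n \<sigma> \<tau> x = (if x \<le> n then \<sigma> x else n + \<tau> (x - n))"

lemma sum_perm_Nil [simp]: "sum_perm [] \<tau>s = id"
  by (auto simp: sum_perm_def)

lemma perm_sum_permutes:
  assumes "\<sigma> permutes {1..n}" "\<tau> permutes {1..m}"
  shows "perm_sum n \<sigma> \<tau> permutes {1..n + m}"
proof (rule bij_imp_permutes)
  have "inj_on (perm_sum n \<sigma> \<tau>) {1..n + m}"
  proof (rule inj_onI)
    fix x y assume xy: "x \<in> {1..n + m}" "y \<in> {1..n + m}" "perm_sum n \<sigma> \<tau> x = perm_sum n \<sigma> \<tau> y"
    have 1: "\<sigma> z \<in> {1..n}" if "z \<in> {1..n}" for z using permutes_range[OF assms(1) that] .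
    have 2: "\<tau> (z - n) \<ge> 1" if "z \<in> {1..n + m}" "\<not> z \<le> n" for z
      using permutes_range[OF assms(2), of "z - n"] that by force
    show "x = y"
      using xy 1[of x] 1[of y] 2[of x] 2[of y] permutes_inj[OF assms(1)] permutes_inj[OF assms(2)]
      by (auto simp: perm_sum_def inj_eq split: if_splits)
  qed
  moreover have "perm_sum n \<sigma> \<tau> ` {1..n + m} \<subseteq> {1..n + m}"
  proof
    fix y assume "y \<in> perm_sum n \<sigma> \<tau> ` {1..n + m}"
    then obtain x where "x \<in> {1..n + m}" "y = perm_sum n \<sigma> \<tau> x" by blast
    then show "y \<in> {1..n + m}"
      using permutes_range[OF assms(1), of x] permutes_range[OF assms(2), of "x - n"]
      by (force simp: perm_sum_def)
  qed
  ultimately show "bij_betw (perm_sum n \<sigma> \<tau>) {1..n + m} {1..n + m}"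
    by (simp add: bij_betw_def endo_inj_surj)
  show "perm_sum n \<sigma> \<tau> x = x" if "x \<notin> {1..n + m}" for x
  proof -
    have "x - n \<notin> {1..m}" using that by auto
    from permutes_not_in[OF assms(2) this] show ?thesis
      using that permutes_not_in[OF assms(1), of x] by (cases "x \<le> n") (auto simp: perm_sum_def)
  qed
qed

abbreviation perms_of :: "nat list \<Rightarrow> perm list \<Rightarrow> bool" where
  "perms_of \<equiv> list_all2 (\<lambda>n \<tau>. \<tau> permutes {1..n})"

lemma sum_perm_permutes_and_Cons:
  assumes "perms_of ns \<tau>s"
  shows "sum_perm ns \<tau>s permutes {1..sum_list ns}"
    and "\<tau> permutes {1..n} \<Longrightarrow> sum_perm (n # ns) (\<tau> # \<tau>s) = perm_sum n \<tau> (sum_perm ns \<tau>s)"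
proof -
  have Cons_eq: "sum_perm (n # ns) (\<tau> # \<tau>s) = perm_sum n \<tau> (sum_perm ns \<tau>s)"
    if "\<tau> permutes {1..n}" for n ns \<tau> \<tau>s
  proof
    fix x
    \<comment> \<open>The value 0 lies outside every \<open>{1..n}\<close> but falls into the branch
      \<open>x \<le> n\<close> of \<open>perm_sum\<close>, so it is treated on its own.\<close>
    consider "x = 0" | "x \<in> {1..n}" | "n < x" "x - n \<in> {1..sum_list ns}" | "x > n + sum_list ns"
      by fastforce
    then show "sum_perm (n # ns) (\<tau> # \<tau>s) x = perm_sum n \<tau> (sum_perm ns \<tau>s) x"
    proof cases
      case 1
      then show ?thesis using permutes_not_in[OF that, of 0] by (auto simp: sum_perm_def perm_sum_def)
    next
      case 3
      then have "x \<in> {1..sum_list (n # ns)}" by auto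
      with 3 show ?thesis
        by (simp add: sum_perm_def perm_sum_def Let_def block_of_Cons)
    qed (auto simp: sum_perm_def perm_sum_def Let_def block_of_Cons)
  qed
  show "sum_perm ns \<tau>s permutes {1..sum_list ns}"
    using assms
  proof (induction rule: list_all2_induct)
    case (Cons n ns \<tau> \<tau>s)
    then show ?case using perm_sum_permutes by (simp only: Cons_eq sum_list.Cons)
  qed (simp add: fun_eq_iff)
  show "\<tau> permutes {1..n} \<Longrightarrow> sum_perm (n # ns) (\<tau> # \<tau>s) = perm_sum n \<tau> (sum_perm ns \<tau>s)"
    by (rule Cons_eq)
qed

lemmas sum_perm_permutes = sum_perm_permutes_and_Cons(1)
lemmas sum_perm_Cons = sum_perm_permutes_and_Cons(2)

lemma permuted_perm_sum:
  assumes "\<sigma> permutes {1..length xs}" "\<tau> permutes {1..length ys}"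
  shows "permuted (perm_sum (length xs) \<sigma> \<tau>) (xs @ ys) = permuted \<sigma> xs @ permuted \<tau> ys"
proof (rule permuted_eqI[OF perm_sum_permutes[OF assms]])
  fix i assume i: "i < length xs + length ys"
  show "(permuted \<sigma> xs @ permuted \<tau> ys) ! (perm_sum (length xs) \<sigma> \<tau> (Suc i) - 1) = (xs @ ys) ! i"
  proof (cases "i < length xs")
    case True
    then show ?thesis
      using permutes_range[OF assms(1), of "Suc i"] nth_permuted[OF assms(1), of i]
      by (auto simp: perm_sum_def nth_append)
  next
    case False
    let ?j = "i - length xs"
    have j: "?j < length ys" using i False by auto
    have "Suc i - length xs = Suc ?j" using False by auto
    moreover have "\<tau> (Suc ?j) \<ge> 1" using permutes_range[OF assms(2), of "Suc ?j"] j by auto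
    ultimately show ?thesis
      using False nth_permuted[OF assms(2) j]
      by (auto simp: perm_sum_def nth_append)
  qed
qed auto

lemma permuted_sum_perm:
  assumes "perms_of (map length xss) \<tau>s"
  shows "permuted (sum_perm (map length xss) \<tau>s) (concat xss) = concat (map2 permuted \<tau>s xss)"
  using assms
proof (induction xss arbitrary: \<tau>s)
  case (Cons xs xss)
  then obtain \<tau> \<tau>s' where \<tau>: "\<tau>s = \<tau> # \<tau>s'" "\<tau> permutes {1..length xs}" "perms_of (map length xss) \<tau>s'"
    by (auto simp: list_all2_Cons1)
  have "sum_perm (map length xss) \<tau>s' permutes {1..length (concat xss)}"
    using sum_perm_permutes[OF \<tau>(3)] by (simp add: length_concat)
  from permuted_perm_sum[OF \<tau>(2) this] show ?case
    using \<tau> Cons.IH[OF \<tau>(3)] by (simp add: sum_perm_Cons)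
qed simp

subsection \<open>Block permutations\<close>

text \<open>The offset of block \<open>i\<close> after the move: the total size of the blocks that
  land before it. It is the sum occurring in \<open>block_perm\<close>.\<close>

definition block_start :: "perm \<Rightarrow> nat list \<Rightarrow> nat \<Rightarrow> nat" where
  "block_start \<tau> ns i = (\<Sum>j | j < length ns \<and> \<tau> (Suc j) < \<tau> (Suc i). ns ! j)"

text \<open>Both sides add the sizes of the blocks placed before block \<open>i\<close>, indexed
  once by old and once by new places; the sums match by reindexing along
  \<open>\<tau>\<close>.\<close>

lemma block_start_eq:
  assumes "\<tau> permutes {1..length ns}" "i < length ns"
  shows "block_start \<tau> ns i = block_end (permuted \<tau> ns) (\<tau> (Suc i) - 1)"
proof -
  have r: "\<tau> (Suc j) \<in> {1..length ns}" if "j < length ns" for j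
    using permutes_range[OF assms(1), of "Suc j"] that by auto
  let ?t = "\<lambda>j. \<tau> (Suc j) - 1"
  have "block_end (permuted \<tau> ns) (?t i) = (\<Sum>k<?t i. permuted \<tau> ns ! k)"
    unfolding block_end_def using r[OF assms(2)]
    by (auto simp: sum_list_sum_nth atLeast0LessThan min_def intro!: sum.cong)
  also have "\<dots> = (\<Sum>k<length ns. if k < ?t i then permuted \<tau> ns ! k else 0)"
  proof -
    have "{..<?t i} = {k \<in> {..<length ns}. k < ?t i}" using r[OF assms(2)] by auto
    then show ?thesis by (simp only:) (rule sum.inter_filter, simp)
  qed
  also have "\<dots> = (\<Sum>j<length ns. if ?t j < ?t i then permuted \<tau> ns ! ?t j else 0)"
    by (rule sum.reindex_bij_betw[OF permutes_index_bij[OF assms(1)], symmetric])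
  also have "\<dots> = (\<Sum>j<length ns. if \<tau> (Suc j) < \<tau> (Suc i) then ns ! j else 0)"
  proof (rule sum.cong[OF refl])
    fix j assume "j \<in> {..<length ns}"
    then have j: "j < length ns" by simp
    show "(if ?t j < ?t i then permuted \<tau> ns ! ?t j else 0) =
        (if \<tau> (Suc j) < \<tau> (Suc i) then ns ! j else 0)"
      using r[OF j] r[OF assms(2)] nth_permuted[OF assms(1) j] by auto
  qed
  also have "\<dots> = (\<Sum>j\<in>{j \<in> {..<length ns}. \<tau> (Suc j) < \<tau> (Suc i)}. ns ! j)"
    by (rule sum.inter_filter[symmetric]) simp
  also have "\<dots> = block_start \<tau> ns i"
    unfolding block_start_def by (rule sum.cong) auto
  finally show ?thesis by simp
qed

lemma block_perm_block:
  assumes "i < length ns" "r \<in> {1..ns ! i}"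
  shows "block_perm \<tau> ns (block_end ns i + r) = block_start \<tau> ns i + r"
  using block_end_add_le[of i ns r] assms
  by (auto simp: block_perm_def block_of_add block_start_def Let_def)

text \<open>An entry at offset \<open>r\<close> of block \<open>i\<close> keeps its offset while the
  block moves to place \<open>\<tau> (Suc i)\<close>.\<close>

lemma nth_concat_permuted:
  assumes \<tau>: "\<tau> permutes {1..length xss}" and k: "k < length (concat xss)"
  shows "block_perm \<tau> (map length xss) (Suc k) \<in> {1..length (concat xss)}"
    and "concat (permuted \<tau> xss) ! (block_perm \<tau> (map length xss) (Suc k) - 1) = concat xss ! k"
proof -
  let ?ns = "map length xss"
  have "Suc k \<in> {1..sum_list ?ns}" using k by (simp add: length_concat)
  then obtain i r where ir: "i < length ?ns" "r \<in> {1..?ns ! i}" "Suc k = block_end ?ns i + r"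
    by (rule obtain_block_position)
  have i: "i < length xss" using ir by simp
  have \<tau>i: "\<tau> (Suc i) \<in> {1..length xss}" using permutes_range[OF \<tau>, of "Suc i"] ir by auto
  have pm: "permuted \<tau> ?ns = map length (permuted \<tau> xss)"
    by (rule permuted_map[OF \<tau>])
  have bp: "block_perm \<tau> ?ns (Suc k) = block_end (map length (permuted \<tau> xss)) (\<tau> (Suc i) - 1) + r"
    using block_perm_block[OF ir(1,2)] ir(3) block_start_eq[of \<tau> ?ns i] \<tau> ir(1) pm by simp
  have nth: "permuted \<tau> xss ! (\<tau> (Suc i) - 1) = xss ! i"
    by (rule nth_permuted[OF \<tau> i])
  have "block_end (map length (permuted \<tau> xss)) (\<tau> (Suc i) - 1) + r \<le> sum_list (map length (permuted \<tau> xss))"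
    using ir \<tau>i nth by (intro block_end_add_le) auto
  then show "block_perm \<tau> ?ns (Suc k) \<in> {1..length (concat xss)}"
    using bp sum_list_permuted[of \<tau> ?ns] \<tau> pm ir(2) by (auto simp: length_concat)
  have "concat (permuted \<tau> xss) ! (block_end (map length (permuted \<tau> xss)) (\<tau> (Suc i) - 1) + (r - 1)) = xss ! i ! (r - 1)"
    using ir \<tau>i nth by (subst nth_concat_block) auto
  moreover have "block_perm \<tau> ?ns (Suc k) - 1 = block_end (map length (permuted \<tau> xss)) (\<tau> (Suc i) - 1) + (r - 1)"
    using bp ir(2) by auto
  moreover have "concat xss ! (block_end ?ns i + (r - 1)) = xss ! i ! (r - 1)"
    using ir by (intro nth_concat_block) auto
  moreover have "k = block_end ?ns i + (r - 1)" using ir by auto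
  ultimately show "concat (permuted \<tau> xss) ! (block_perm \<tau> ?ns (Suc k) - 1) = concat xss ! k"
    by metis
qed

lemma block_perm_permutes:
  assumes "\<tau> permutes {1..length ns}"
  shows "block_perm \<tau> ns permutes {1..sum_list ns}"
proof (rule bij_imp_permutes)
  \<comment> \<open>The positions themselves are cut into blocks and moved: reading the result at
    the image of \<open>Suc k\<close> gives back \<open>k\<close>, which yields injectivity.\<close>
  define xss where "xss = chunks ns [0..<sum_list ns]"
  have ns: "map length xss = ns" and cc: "concat xss = [0..<sum_list ns]"
    unfolding xss_def by (simp_all add: map_length_chunks concat_chunks)
  have len: "length xss = length ns" by (simp add: xss_def)
  let ?\<rho> = "block_perm \<tau> ns"
  have 1: "?\<rho> (Suc k) \<in> {1..sum_list ns}" "concat (permuted \<tau> xss) ! (?\<rho> (Suc k) - 1) = k"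
    if "k < sum_list ns" for k
    using nth_concat_permuted[of \<tau> xss k] assms that by (simp_all add: ns cc len)
  have sub: "?\<rho> ` {1..sum_list ns} \<subseteq> {1..sum_list ns}"
  proof
    fix y assume "y \<in> ?\<rho> ` {1..sum_list ns}"
    then obtain x where "x \<in> {1..sum_list ns}" "y = ?\<rho> x" by blast
    then show "y \<in> {1..sum_list ns}" using 1(1)[of "x - 1"] by auto
  qed
  have "inj_on ?\<rho> {1..sum_list ns}"
  proof (rule inj_onI)
    fix x y assume "x \<in> {1..sum_list ns}" "y \<in> {1..sum_list ns}" "?\<rho> x = ?\<rho> y"
    then have "x - 1 = y - 1" "x \<ge> 1" "y \<ge> 1" using 1(2)[of "x - 1"] 1(2)[of "y - 1"] by auto
    then show "x = y" by linarith
  qed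
  with sub show "bij_betw ?\<rho> {1..sum_list ns} {1..sum_list ns}"
    by (simp add: bij_betw_def endo_inj_surj)
  show "?\<rho> x = x" if "x \<notin> {1..sum_list ns}" for x
    using that unfolding block_perm_def by (rule if_not_P)
qed

lemma permuted_block_perm:
  assumes "\<tau> permutes {1..length xss}"
  shows "permuted (block_perm \<tau> (map length xss)) (concat xss) = concat (permuted \<tau> xss)"
proof (rule permuted_eqI)
  show "block_perm \<tau> (map length xss) permutes {1..length (concat xss)}"
    using block_perm_permutes[of \<tau> "map length xss"] assms by (simp add: length_concat)
  show "length (concat (permuted \<tau> xss)) = length (concat xss)"
    using sum_list_permuted[of \<tau> "map length xss"] assms permuted_map[OF assms, of length]
    by (simp add: length_concat)
qed (use nth_concat_permuted[OF assms] in auto)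

subsection \<open>Compatibilities between block sums and block permutations\<close>

lemma perms_of_permuted:
  assumes "\<rho> permutes {1..length ns}" "perms_of ns \<tau>s"
  shows "perms_of (permuted \<rho> ns) (permuted \<rho> \<tau>s)"
proof -
  have len: "length \<tau>s = length ns" using assms(2) by (simp add: list_all2_lengthD)
  have "\<forall>z \<in> set (zip (permuted \<rho> ns) (permuted \<rho> \<tau>s)). snd z permutes {1..fst z}"
    using set_permuted[of \<rho> "zip ns \<tau>s"] permuted_map2[of \<rho> ns \<tau>s Pair] assms len
    by (auto simp: list_all2_iff)
  then show ?thesis using len by (auto simp: list_all2_iff)
qed

text \<open>When \<open>\<sigma>\<close> acts, the blocks already stand in the order given by
  \<open>\<tau>\<close>; hence the rearranged sizes in the left factor of the composition.\<close>

lemma block_perm_comp: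
  assumes "\<sigma> permutes {1..length ns}" "\<tau> permutes {1..length ns}"
  shows "block_perm (\<sigma> \<circ> \<tau>) ns = block_perm \<sigma> (permuted \<tau> ns) \<circ> block_perm \<tau> ns"
proof (rule permutes_eqI_permuted)
  have s: "block_perm \<sigma> (permuted \<tau> ns) permutes {1..sum_list ns}"
    using block_perm_permutes[of \<sigma> "permuted \<tau> ns"] assms by (simp add: sum_list_permuted)
  show "block_perm (\<sigma> \<circ> \<tau>) ns permutes {1..sum_list ns}"
    by (intro block_perm_permutes permutes_compose assms)
  show "block_perm \<sigma> (permuted \<tau> ns) \<circ> block_perm \<tau> ns permutes {1..sum_list ns}"
    by (intro permutes_compose block_perm_permutes assms s)
  fix xs :: "nat list" assume "length xs = sum_list ns"
  then obtain xss where xss: "xs = concat xss" "map length xss = ns" by (rule obtain_blocks)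
  then have [simp]: "length xss = length ns" by auto
  have len: "length (concat xss) = sum_list ns" using xss by (simp add: length_concat)
  have "permuted (block_perm (\<sigma> \<circ> \<tau>) ns) xs = concat (permuted \<sigma> (permuted \<tau> xss))"
    using permuted_block_perm[of "\<sigma> \<circ> \<tau>" xss] assms xss
    by (simp add: permutes_compose permuted_comp)
  also have "\<dots> = permuted (block_perm \<sigma> (permuted \<tau> ns)) (concat (permuted \<tau> xss))"
    using permuted_block_perm[of \<sigma> "permuted \<tau> xss"] assms xss permuted_map[of \<tau> xss length] by simp
  also have "concat (permuted \<tau> xss) = permuted (block_perm \<tau> ns) xs"
    using permuted_block_perm[of \<tau> xss] assms xss by simp
  also have "permuted (block_perm \<sigma> (permuted \<tau> ns)) (permuted (block_perm \<tau> ns) xs) =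
      permuted (block_perm \<sigma> (permuted \<tau> ns) \<circ> block_perm \<tau> ns) xs"
    using block_perm_permutes[OF assms(2)] s xss len by (subst permuted_comp) simp_all
  finally show "permuted (block_perm (\<sigma> \<circ> \<tau>) ns) xs =
      permuted (block_perm \<sigma> (permuted \<tau> ns) \<circ> block_perm \<tau> ns) xs" .
qed

lemma perms_of_block_perm:
  assumes "perms_of (map length nss) \<tau>s"
  shows "perms_of (map sum_list nss) (map2 block_perm \<tau>s nss)"
  using assms
  by (induction nss arbitrary: \<tau>s) (auto simp: list_all2_Cons1 simp del: One_nat_def intro: block_perm_permutes)

lemma map2_permuted_block_perm:
  assumes "map (map length) xsss = nss" "perms_of (map length nss) \<tau>s"
  shows "map2 permuted (map2 block_perm \<tau>s nss) (map concat xsss) = map concat (map2 permuted \<tau>s xsss)"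
  using assms
  by (induction xsss arbitrary: nss \<tau>s)
    (auto simp: list_all2_Cons1 permuted_block_perm simp del: One_nat_def)

text \<open>Blocks within blocks: permuting small blocks separately inside each large block acts on
  letters as a block sum of block permutations. This serves the action on the middle factors of the
  associator.\<close>

lemma block_perm_sum_perm:
  assumes "perms_of (map length nss) \<tau>s"
  shows "block_perm (sum_perm (map length nss) \<tau>s) (concat nss) =
    sum_perm (map sum_list nss) (map2 block_perm \<tau>s nss)"
proof (rule permutes_eqI_permuted)
  have p: "sum_perm (map length nss) \<tau>s permutes {1..length (concat nss)}"
    using sum_perm_permutes[OF assms] by (simp add: length_concat)
  have sum: "sum_list (map sum_list nss) = sum_list (concat nss)"
    by (induction nss) auto
  show "block_perm (sum_perm (map length nss) \<tau>s) (concat nss) permutes {1..sum_list (concat nss)}"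
    by (rule block_perm_permutes[OF p])
  show "sum_perm (map sum_list nss) (map2 block_perm \<tau>s nss) permutes {1..sum_list (concat nss)}"
    using sum_perm_permutes[OF perms_of_block_perm[OF assms]] by (simp only: sum)
  fix xs :: "nat list" assume "length xs = sum_list (concat nss)"
  then obtain xsss where xsss: "xs = concat (concat xsss)" "map (map length) xsss = nss"
    by (rule obtain_block_blocks)
  have lens: "map length (concat xsss) = concat nss" "map length nss = map length xsss"
    "map sum_list nss = map length (map concat xsss)"
    using xsss(2) by (auto simp: map_concat length_concat)
  have "permuted (block_perm (sum_perm (map length nss) \<tau>s) (concat nss)) xs =
      concat (permuted (sum_perm (map length xsss) \<tau>s) (concat xsss))"
    using permuted_block_perm[of "sum_perm (map length nss) \<tau>s" "concat xsss"] p lens xsss(1)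
    by (metis length_map)
  also have "\<dots> = concat (concat (map2 permuted \<tau>s xsss))"
    using assms by (simp add: permuted_sum_perm lens(2))
  also have "\<dots> = concat (map concat (map2 permuted \<tau>s xsss))"
    by (rule concat_concat)
  also have "\<dots> = concat (map2 permuted (map2 block_perm \<tau>s nss) (map concat xsss))"
    by (simp only: map2_permuted_block_perm[OF xsss(2) assms])
  also have "\<dots> = permuted (sum_perm (map sum_list nss) (map2 block_perm \<tau>s nss)) (concat (map concat xsss))"
    using permuted_sum_perm[of "map concat xsss" "map2 block_perm \<tau>s nss"]
      perms_of_block_perm[OF assms] unfolding lens(3) by simp
  also have "concat (map concat xsss) = xs"
    by (simp add: xsss(1) concat_concat)
  finally show "permuted (block_perm (sum_perm (map length nss) \<tau>s) (concat nss)) xs =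
      permuted (sum_perm (map sum_list nss) (map2 block_perm \<tau>s nss)) xs" .
qed

text \<open>Moving large blocks of small blocks moves the letters in blocks of the summed sizes.
  This serves the action on the outermost factor of the associator.\<close>

lemma block_perm_block_perm:
  assumes "\<rho> permutes {1..length nss}"
  shows "block_perm (block_perm \<rho> (map length nss)) (concat nss) = block_perm \<rho> (map sum_list nss)"
proof (rule permutes_eqI_permuted)
  have p: "block_perm \<rho> (map length nss) permutes {1..length (concat nss)}"
    using block_perm_permutes[of \<rho> "map length nss"] assms by (simp add: length_concat)
  have sum: "sum_list (map sum_list nss) = sum_list (concat nss)"
    by (induction nss) auto
  show "block_perm (block_perm \<rho> (map length nss)) (concat nss) permutes {1..sum_list (concat nss)}"
    by (rule block_perm_permutes[OF p])
  show "block_perm \<rho> (map sum_list nss) permutes {1..sum_list (concat nss)}"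
    using block_perm_permutes[of \<rho> "map sum_list nss"] assms by (simp add: sum)
  fix xs :: "nat list" assume "length xs = sum_list (concat nss)"
  then obtain xsss where xsss: "xs = concat (concat xsss)" "map (map length) xsss = nss"
    by (rule obtain_block_blocks)
  have lens: "map length (concat xsss) = concat nss" "map length nss = map length xsss"
    "map sum_list nss = map length (map concat xsss)" "length xsss = length nss"
    using xsss(2) by (auto simp: map_concat length_concat)
  have "permuted (block_perm (block_perm \<rho> (map length nss)) (concat nss)) xs =
      concat (permuted (block_perm \<rho> (map length xsss)) (concat xsss))"
    using permuted_block_perm[of "block_perm \<rho> (map length nss)" "concat xsss"] p lens xsss(1)
    by (metis length_map)
  also have "\<dots> = concat (concat (permuted \<rho> xsss))"
    using assms lens(4) by (simp add: permuted_block_perm)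
  also have "\<dots> = concat (map concat (permuted \<rho> xsss))"
    by (rule concat_concat)
  also have "\<dots> = concat (permuted \<rho> (map concat xsss))"
    using assms lens(4) by (simp add: permuted_map)
  also have "\<dots> = permuted (block_perm \<rho> (map sum_list nss)) (concat (map concat xsss))"
    using permuted_block_perm[of \<rho> "map concat xsss"] assms lens(4) unfolding lens(3) by simp
  also have "concat (map concat xsss) = xs"
    by (simp add: xsss(1) concat_concat)
  finally show "permuted (block_perm (block_perm \<rho> (map length nss)) (concat nss)) xs =
      permuted (block_perm \<rho> (map sum_list nss)) xs" .
qed

lemma perms_of_sum_perm:
  assumes "list_all2 perms_of nss \<tau>ss"
  shows "perms_of (map sum_list nss) (map2 sum_perm nss \<tau>ss)"
  using assms
  by (induction rule: list_all2_induct) (auto intro: sum_perm_permutes simp del: One_nat_def)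

lemma perms_of_concat:
  assumes "list_all2 perms_of nss \<tau>ss"
  shows "perms_of (concat nss) (concat \<tau>ss)"
  using assms by (induction rule: list_all2_induct) (auto intro: list_all2_appendI)

lemma map2_permuted_sum_perm:
  assumes "map (map length) xsss = nss" "list_all2 perms_of nss \<tau>ss"
  shows "concat (map2 permuted (map2 sum_perm nss \<tau>ss) (map concat xsss)) =
    concat (map2 permuted (concat \<tau>ss) (concat xsss))"
  using assms
proof (induction xsss arbitrary: nss \<tau>ss)
  case (Cons xss xsss)
  then obtain \<tau>s \<tau>ss' where \<tau>: "\<tau>ss = \<tau>s # \<tau>ss'" "perms_of (map length xss) \<tau>s"
    "list_all2 perms_of (map (map length) xsss) \<tau>ss'"
    by (auto simp: list_all2_Cons1 simp del: One_nat_def)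
  have "length \<tau>s = length xss" using list_all2_lengthD[OF \<tau>(2)] by simp
  with \<tau> Cons show ?case
    by (auto simp: permuted_sum_perm zip_append simp del: One_nat_def)
qed simp

text \<open>Associativity of block sums, used when permutations act on the innermost factors, which
  are grouped under the middle ones.\<close>

lemma sum_perm_sum_perm:
  assumes "list_all2 perms_of nss \<tau>ss"
  shows "sum_perm (map sum_list nss) (map2 sum_perm nss \<tau>ss) = sum_perm (concat nss) (concat \<tau>ss)"
proof (rule permutes_eqI_permuted)
  have sum: "sum_list (map sum_list nss) = sum_list (concat nss)"
    by (induction nss) auto
  show "sum_perm (map sum_list nss) (map2 sum_perm nss \<tau>ss) permutes {1..sum_list (concat nss)}"
    using sum_perm_permutes[OF perms_of_sum_perm[OF assms]] by (simp only: sum)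
  show "sum_perm (concat nss) (concat \<tau>ss) permutes {1..sum_list (concat nss)}"
    by (rule sum_perm_permutes[OF perms_of_concat[OF assms]])
  fix xs :: "nat list" assume "length xs = sum_list (concat nss)"
  then obtain xsss where xsss: "xs = concat (concat xsss)" "map (map length) xsss = nss"
    by (rule obtain_block_blocks)
  have lens: "map length (concat xsss) = concat nss" "map sum_list nss = map length (map concat xsss)"
    using xsss(2) by (auto simp: map_concat length_concat)
  have "permuted (sum_perm (map sum_list nss) (map2 sum_perm nss \<tau>ss)) (concat (map concat xsss)) =
      concat (map2 permuted (map2 sum_perm nss \<tau>ss) (map concat xsss))"
    using perms_of_sum_perm[OF assms] unfolding lens(2) by (rule permuted_sum_perm)
  also have "\<dots> = permuted (sum_perm (concat nss) (concat \<tau>ss)) (concat (concat xsss))"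
    using permuted_sum_perm[of "concat xsss" "concat \<tau>ss"] perms_of_concat[OF assms]
    by (simp add: map2_permuted_sum_perm[OF xsss(2) assms] lens)
  finally show "permuted (sum_perm (map sum_list nss) (map2 sum_perm nss \<tau>ss)) xs =
      permuted (sum_perm (concat nss) (concat \<tau>ss)) xs"
    by (simp add: xsss(1) concat_concat)
qed

text \<open>Permuting inside blocks and moving blocks commute once the inner permutations travel
  with their blocks; on lists this is the compatibility of \<open>permuted\<close> with
  \<open>map2\<close>.\<close>

lemma sum_perm_block_perm:
  assumes "\<rho> permutes {1..length ns}" "perms_of ns \<tau>s"
  shows "sum_perm (permuted \<rho> ns) (permuted \<rho> \<tau>s) \<circ> block_perm \<rho> ns = block_perm \<rho> ns \<circ> sum_perm ns \<tau>s"
proof (rule permutes_eqI_permuted)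
  have len\<tau>: "length \<tau>s = length ns" using assms(2) by (simp add: list_all2_lengthD)
  note perms = perms_of_permuted[OF assms]
  have s: "sum_perm (permuted \<rho> ns) (permuted \<rho> \<tau>s) permutes {1..sum_list ns}"
    using sum_perm_permutes[OF perms] assms(1) by (simp add: sum_list_permuted)
  note b = block_perm_permutes[OF assms(1)] and t = sum_perm_permutes[OF assms(2)]
  show "sum_perm (permuted \<rho> ns) (permuted \<rho> \<tau>s) \<circ> block_perm \<rho> ns permutes {1..sum_list ns}"
    by (rule permutes_compose[OF b s])
  show "block_perm \<rho> ns \<circ> sum_perm ns \<tau>s permutes {1..sum_list ns}"
    by (rule permutes_compose[OF t b])
  fix xs :: "nat list" assume xs: "length xs = sum_list ns"
  then obtain xss where xss: "xs = concat xss" "map length xss = ns" by (rule obtain_blocks)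
  then have len: "length xss = length ns" by auto
  have \<rho>ns: "map length (permuted \<rho> xss) = permuted \<rho> ns"
    using assms len xss(2) permuted_map[of \<rho> xss length] by simp
  have "length (fst z) = length (snd z)" if "z \<in> set (zip (map2 permuted \<tau>s xss) xss)" for z
    using that len by (auto simp: set_zip)
  then have t_ns: "map length (map2 permuted \<tau>s xss) = ns"
    using len len\<tau> xss(2) by (auto intro!: nth_equalityI simp: list_eq_iff_nth_eq)
  have "permuted (sum_perm (permuted \<rho> ns) (permuted \<rho> \<tau>s) \<circ> block_perm \<rho> ns) xs =
      permuted (sum_perm (permuted \<rho> ns) (permuted \<rho> \<tau>s)) (permuted (block_perm \<rho> ns) xs)"
    using xs s b by (simp add: permuted_comp)
  also have "permuted (block_perm \<rho> ns) xs = concat (permuted \<rho> xss)"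
    using permuted_block_perm[of \<rho> xss] assms xss len by simp
  also have "permuted (sum_perm (permuted \<rho> ns) (permuted \<rho> \<tau>s)) (concat (permuted \<rho> xss)) =
      concat (map2 permuted (permuted \<rho> \<tau>s) (permuted \<rho> xss))"
    using permuted_sum_perm[of "permuted \<rho> xss" "permuted \<rho> \<tau>s"] perms by (simp add: \<rho>ns)
  also have "\<dots> = concat (permuted \<rho> (map2 permuted \<tau>s xss))"
    using assms len len\<tau> by (simp add: permuted_map2)
  also have "\<dots> = permuted (block_perm \<rho> ns) (concat (map2 permuted \<tau>s xss))"
    using permuted_block_perm[of \<rho> "map2 permuted \<tau>s xss"] assms len len\<tau> unfolding t_ns by simp
  also have "concat (map2 permuted \<tau>s xss) = permuted (sum_perm ns \<tau>s) xs"
    using permuted_sum_perm[of xss \<tau>s] assms xss by simp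
  also have "permuted (block_perm \<rho> ns) (permuted (sum_perm ns \<tau>s) xs) =
      permuted (block_perm \<rho> ns \<circ> sum_perm ns \<tau>s) xs"
    using xs t b by (simp add: permuted_comp)
  finally show "permuted (sum_perm (permuted \<rho> ns) (permuted \<rho> \<tau>s) \<circ> block_perm \<rho> ns) xs =
      permuted (block_perm \<rho> ns \<circ> sum_perm ns \<tau>s) xs" .
qed

section \<open>Koszul signs\<close>

lemma minus_one_pow_add: "minus_one_pow (a + b) = minus_one_pow a * minus_one_pow b"
  by (auto simp: minus_one_pow_def)

lemma minus_one_pow_cong: "even (a - b) \<Longrightarrow> minus_one_pow a = minus_one_pow b"
  by (auto simp: minus_one_pow_def)

lemma minus_one_pow_sum: "finite A \<Longrightarrow> minus_one_pow (sum f A) = (\<Prod>x\<in>A. minus_one_pow (f x))"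
  by (induction rule: finite_induct) (auto simp: minus_one_pow_add, simp add: minus_one_pow_def)

lemma minus_one_pow_0 [simp]: "minus_one_pow 0 = 1"
  by (simp add: minus_one_pow_def)

lemma minus_one_pow_square [simp]: "minus_one_pow a * minus_one_pow a = 1"
  by (simp add: minus_one_pow_def)

text \<open>
  All identities between signs are congruences modulo 2 between sums over pairs of indices, which
  hold after adding up the terms for \<open>(i, j)\<close> and \<open>(j, i)\<close>.
\<close>

lemma even_double_sum:
  fixes g :: "nat \<Rightarrow> nat \<Rightarrow> int"
  assumes "\<And>i j. i < n \<Longrightarrow> j < i \<Longrightarrow> even (g i j + g j i)" and "\<And>i. i < n \<Longrightarrow> even (g i i)"
  shows "even (\<Sum>i<n. \<Sum>j<n. g i j)"
  using assms
proof (induction n)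
  case (Suc n)
  have eq: "(\<Sum>i<Suc n. \<Sum>j<Suc n. g i j) =
      (\<Sum>i<n. \<Sum>j<n. g i j) + (\<Sum>i<n. g n i + g i n) + g n n"
    by (simp add: sum.distrib)
  have "even (\<Sum>i<n. g n i + g i n)"
    by (intro dvd_sum Suc.prems) auto
  moreover have "even (\<Sum>i<n. \<Sum>j<n. g i j)"
  proof (rule Suc.IH)
    show "even (g i j + g j i)" if "i < n" "j < i" for i j
      using Suc.prems(1)[of i j] that by simp
    show "even (g i i)" if "i < n" for i
      using Suc.prems(2)[of i] that by simp
  qed
  ultimately show ?case
    unfolding eq using Suc.prems(2)[of n] by (intro dvd_add) simp_all
qed simp

text \<open>Two labellings instead of one permutation: each pair on which the orders by
  \<open>a\<close> and by \<open>b\<close> disagree is weighted by the product of its degrees.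
  Comparing arbitrary orders makes the composition rule a transitivity statement.\<close>

definition inversion_sum :: "nat \<Rightarrow> (nat \<Rightarrow> nat) \<Rightarrow> (nat \<Rightarrow> nat) \<Rightarrow> (nat \<Rightarrow> int) \<Rightarrow> int" where
  "inversion_sum n a b q = (\<Sum>i<n. \<Sum>j<n. if a i < a j \<and> b j < b i then q i * q j else 0)"

lemma koszul_sign_eq:
  "koszul_sign \<tau> qs =
    minus_one_pow (inversion_sum (length qs) (\<lambda>i. i) (\<lambda>i. \<tau> (Suc i)) ((!) qs))"
proof -
  let ?n = "length qs"
  let ?S = "{(i, j). i \<in> {1..?n} \<and> j \<in> {1..?n} \<and> i < j \<and> \<tau> i > \<tau> j}"
  let ?T = "{(i, j). i < ?n \<and> j < ?n \<and> i < j \<and> \<tau> (Suc i) > \<tau> (Suc j)}"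
  have fin: "finite ?T" by (rule finite_subset[of _ "{..<?n} \<times> {..<?n}"]) auto
  have "inversion_sum ?n (\<lambda>i. i) (\<lambda>i. \<tau> (Suc i)) ((!) qs) =
      (\<Sum>(i, j)\<in>{..<?n} \<times> {..<?n}. if i < j \<and> \<tau> (Suc j) < \<tau> (Suc i) then qs ! i * qs ! j else 0)"
    unfolding inversion_sum_def by (simp add: sum.cartesian_product)
  also have "\<dots> = (\<Sum>(i, j)\<in>?T. qs ! i * qs ! j)"
    by (rule sum.mono_neutral_cong_right) (auto split: if_splits)
  finally have "minus_one_pow (inversion_sum ?n (\<lambda>i. i) (\<lambda>i. \<tau> (Suc i)) ((!) qs)) =
      (\<Prod>(i, j)\<in>?T. minus_one_pow (qs ! i * qs ! j))"
    using fin by (simp add: minus_one_pow_sum case_prod_unfold)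
  also have "\<dots> = (\<Prod>(i, j)\<in>?S. minus_one_pow (qs ! (i - 1) * qs ! (j - 1)))"
  proof (rule prod.reindex_bij_witness[of _ "\<lambda>(i, j). (i - 1, j - 1)" "\<lambda>(i, j). (Suc i, Suc j)"])
  qed (auto simp: Suc_diff_le)
  finally show ?thesis by (simp add: koszul_sign_def)
qed

text \<open>On each pair of indices, the orders by \<open>a\<close> and \<open>c\<close> disagree
  exactly when an odd number of the two steps from \<open>a\<close> to \<open>b\<close> and from
  \<open>b\<close> to \<open>c\<close> reverse it.\<close>

lemma inversion_sum_trans:
  assumes "inj_on a {..<n}" "inj_on b {..<n}" "inj_on c {..<n}"
  shows "even (inversion_sum n a b q + inversion_sum n b c q - inversion_sum n a c q)"
proof -
  have "inversion_sum n a b q + inversion_sum n b c q - inversion_sum n a c q =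
     (\<Sum>i<n. \<Sum>j<n. (if a i < a j \<and> b j < b i then q i * q j else 0) +
        (if b i < b j \<and> c j < c i then q i * q j else 0) -
        (if a i < a j \<and> c j < c i then q i * q j else 0))" (is "_ = (\<Sum>i<n. \<Sum>j<n. ?g i j)")
    by (simp add: inversion_sum_def sum.distrib sum_subtractf)
  moreover have "even (\<Sum>i<n. \<Sum>j<n. ?g i j)"
  proof (rule even_double_sum)
    fix i j assume "i < n" "j < i"
    then have "a i \<noteq> a j" "b i \<noteq> b j" "c i \<noteq> c j"
      using assms by (auto dest!: inj_onD)
    then show "even (?g i j + ?g j i)"
      by (auto simp: mult.commute not_less dest: antisym)
  qed simp
  ultimately show ?thesis by simp
qed

lemma permutes_inj_on_Suc: "\<tau> permutes {1..n} \<Longrightarrow> inj_on (\<lambda>i. \<tau> (Suc i)) A"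
  by (intro inj_onI) (metis permutes_inj injD Suc_inject)

lemma double_sum_reindex:
  assumes "\<tau> permutes {1..n}"
  shows "(\<Sum>i<n. \<Sum>j<n. g i j) = (\<Sum>i<n. \<Sum>j<n. g (\<tau> (Suc i) - 1) (\<tau> (Suc j) - 1) :: int)"
proof -
  note re = sum.reindex_bij_betw[OF permutes_index_bij[OF assms]]
  have "(\<Sum>i<n. \<Sum>j<n. g i j) = (\<Sum>i<n. \<Sum>j<n. g (\<tau> (Suc i) - 1) j)"
    by (rule re[symmetric])
  also have "\<dots> = (\<Sum>i<n. \<Sum>j<n. g (\<tau> (Suc i) - 1) (\<tau> (Suc j) - 1))"
    by (rule sum.cong[OF refl], rule re[symmetric])
  finally show ?thesis .
qed

lemma inversion_sum_permuted:
  assumes "\<tau> permutes {1..length qs}"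
  shows "inversion_sum (length qs) (\<lambda>i. i) (\<lambda>i. \<sigma> (Suc i)) ((!) (permuted \<tau> qs)) =
    inversion_sum (length qs) (\<lambda>i. \<tau> (Suc i)) (\<lambda>i. \<sigma> (\<tau> (Suc i))) ((!) qs)"
proof -
  let ?t = "\<lambda>i. \<tau> (Suc i) - 1"
  have r: "\<tau> (Suc i) \<ge> 1" if "i < length qs" for i
    using permutes_range_Suc[OF assms that] by simp
  show ?thesis
    unfolding inversion_sum_def double_sum_reindex[OF assms, of "\<lambda>i j. if i < j \<and> _ i j then _ i j else 0"]
  proof (intro sum.cong refl)
    fix i j assume "i \<in> {..<length qs}" "j \<in> {..<length qs}"
    then have ij: "i < length qs" "j < length qs" by auto
    have "\<tau> (Suc i) - 1 < \<tau> (Suc j) - 1 \<longleftrightarrow> \<tau> (Suc i) < \<tau> (Suc j)"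
      using r[OF ij(1)] r[OF ij(2)] by auto
    then show "(if ?t i < ?t j \<and> \<sigma> (Suc (?t j)) < \<sigma> (Suc (?t i)) then permuted \<tau> qs ! ?t i * permuted \<tau> qs ! ?t j else 0) =
        (if \<tau> (Suc i) < \<tau> (Suc j) \<and> \<sigma> (\<tau> (Suc j)) < \<sigma> (\<tau> (Suc i)) then qs ! i * qs ! j else 0)"
      using r[OF ij(1)] r[OF ij(2)] nth_permuted[OF assms ij(1)] nth_permuted[OF assms ij(2)] by auto
  qed
qed

text \<open>Transitivity for three orders: the original one, the one after \<open>\<tau>\<close> and
  the one after \<open>\<sigma> \<circ> \<tau>\<close>.\<close>

lemma koszul_sign_comp:
  assumes "\<sigma> permutes {1..length qs}" "\<tau> permutes {1..length qs}"
  shows "koszul_sign (\<sigma> \<circ> \<tau>) qs = koszul_sign \<tau> qs * koszul_sign \<sigma> (permuted \<tau> qs)"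
proof -
  let ?n = "length qs"
  have "even (inversion_sum ?n (\<lambda>i. i) (\<lambda>i. \<tau> (Suc i)) ((!) qs) +
      inversion_sum ?n (\<lambda>i. \<tau> (Suc i)) (\<lambda>i. \<sigma> (\<tau> (Suc i))) ((!) qs) -
      inversion_sum ?n (\<lambda>i. i) (\<lambda>i. \<sigma> (\<tau> (Suc i))) ((!) qs))"
    using permutes_inj_on_Suc[OF assms(2)] permutes_inj_on_Suc[OF permutes_compose[OF assms(2,1)]]
    by (intro inversion_sum_trans) (auto simp: o_def)
  then show ?thesis
    by (simp add: koszul_sign_eq inversion_sum_permuted[OF assms(2)] flip: minus_one_pow_add)
      (auto intro!: minus_one_pow_cong)
qed

lemma koszul_sign_id [simp]: "koszul_sign id qs = 1"
proof -
  have "inversion_sum n (\<lambda>i. i) (\<lambda>i. id (Suc i)) q = 0" for n q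
    unfolding inversion_sum_def by (intro sum.neutral ballI) auto
  then show ?thesis by (simp add: koszul_sign_eq)
qed

text \<open>The exponent is rewritten as a sum over pairs of indices, so that it can be compared
  pair by pair with inversion sums.\<close>

lemma distrib_sign_eq:
  assumes "length rss = length qs"
  shows "distrib_sign qs rss =
    minus_one_pow (\<Sum>i<length qs. \<Sum>j<length qs. if i < j then sum_list (rss ! i) * qs ! j else 0)"
proof -
  have take: "sum_list (map sum_list (take j rss)) = (\<Sum>i<length qs. if i < j then sum_list (rss ! i) else 0)"
    if "j < length qs" for j
  proof -
    have "sum_list (map sum_list (take j rss)) = (\<Sum>i<j. sum_list (rss ! i))"
      using that assms by (simp add: sum_list_sum_nth atLeast0LessThan min_def)
    also have "{..<j} = {i \<in> {..<length qs}. i < j}" using that by auto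
    also have "(\<Sum>i\<in>{i \<in> {..<length qs}. i < j}. sum_list (rss ! i)) =
        (\<Sum>i<length qs. if i < j then sum_list (rss ! i) else 0)"
      by (rule sum.inter_filter) simp
    finally show ?thesis .
  qed
  have "(\<Sum>j<length qs. qs ! j * sum_list (map sum_list (take j rss))) =
      (\<Sum>j<length qs. \<Sum>i<length qs. if i < j then sum_list (rss ! i) * qs ! j else 0)"
    by (intro sum.cong refl) (auto simp: take sum_distrib_left if_distrib intro!: sum.cong)
  also have "\<dots> = (\<Sum>i<length qs. \<Sum>j<length qs. if i < j then sum_list (rss ! i) * qs ! j else 0)"
    by (rule sum.swap)
  finally show ?thesis by (simp add: distrib_sign_def)
qed

text \<open>Both sides agree on pairs \<open>i < j\<close> kept in order by \<open>\<rho>\<close>.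
  On a reversed pair the product of total degrees expands into \<open>q_i q_j\<close>,
  \<open>r_i r_j\<close> and two mixed terms; modulo 2 the mixed terms account for replacing
  \<open>r_i q_j\<close> by \<open>r_j q_i\<close> in the distribution exponent. This is the sign
  identity behind the outer action in the associator.\<close>

lemma distrib_sign_permuted:
  assumes "\<rho> permutes {1..length qs}" and len: "length rss = length qs"
  shows "koszul_sign \<rho> qs * distrib_sign (permuted \<rho> qs) (permuted \<rho> rss) * koszul_sign \<rho> (map sum_list rss) =
    koszul_sign \<rho> (map2 (+) qs (map sum_list rss)) * distrib_sign qs rss"
proof -
  let ?n = "length qs"
  let ?r = "\<lambda>i. sum_list (rss ! i)" and ?p = "\<lambda>i. \<rho> (Suc i)" and ?t = "\<lambda>i. \<rho> (Suc i) - 1"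
  have r: "\<rho> (Suc i) \<ge> 1" if "i < ?n" for i
    using permutes_range_Suc[OF assms(1) that] by simp
  have D: "(\<Sum>i<?n. \<Sum>j<?n. if i < j then sum_list (permuted \<rho> rss ! i) * permuted \<rho> qs ! j else 0) =
      (\<Sum>i<?n. \<Sum>j<?n. if ?p i < ?p j then ?r i * qs ! j else 0)"
    unfolding double_sum_reindex[OF assms(1), of "\<lambda>i j. if i < j then _ i j else 0"]
  proof (intro sum.cong refl)
    fix i j assume "i \<in> {..<?n}" "j \<in> {..<?n}"
    then have ij: "i < ?n" "j < ?n" by auto
    have "?t i < ?t j \<longleftrightarrow> ?p i < ?p j"
      using r[OF ij(1)] r[OF ij(2)] by auto
    then show "(if ?t i < ?t j then sum_list (permuted \<rho> rss ! ?t i) * permuted \<rho> qs ! ?t j else 0) =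
        (if ?p i < ?p j then ?r i * qs ! j else 0)"
      using nth_permuted[of \<rho> rss i] nth_permuted[OF assms(1) ij(2)] assms ij by auto
  qed
  have inv: "inversion_sum ?n (\<lambda>i. i) ?p ((!) (map sum_list rss)) = inversion_sum ?n (\<lambda>i. i) ?p ?r"
    "inversion_sum ?n (\<lambda>i. i) ?p ((!) (map2 (+) qs (map sum_list rss))) =
      inversion_sum ?n (\<lambda>i. i) ?p (\<lambda>i. qs ! i + ?r i)"
    unfolding inversion_sum_def using len by (auto intro!: sum.cong)
  have "even (inversion_sum ?n (\<lambda>i. i) ?p ((!) qs) +
      (\<Sum>i<?n. \<Sum>j<?n. if ?p i < ?p j then ?r i * qs ! j else 0) +
      inversion_sum ?n (\<lambda>i. i) ?p ?r -
      (inversion_sum ?n (\<lambda>i. i) ?p (\<lambda>i. qs ! i + ?r i) +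
       (\<Sum>i<?n. \<Sum>j<?n. if i < j then ?r i * qs ! j else 0)))"
  proof -
    let ?g = "\<lambda>i j. (if i < j \<and> ?p j < ?p i then qs ! i * qs ! j else 0) +
      (if ?p i < ?p j then ?r i * qs ! j else 0) + (if i < j \<and> ?p j < ?p i then ?r i * ?r j else 0) -
      ((if i < j \<and> ?p j < ?p i then (qs ! i + ?r i) * (qs ! j + ?r j) else 0) +
       (if i < j then ?r i * qs ! j else 0))"
    have "even (\<Sum>i<?n. \<Sum>j<?n. ?g i j)"
    proof (rule even_double_sum)
      fix i j assume "i < ?n" "j < i"
      then have "?p i \<noteq> ?p j"
        using permutes_inj_on_Suc[OF assms(1), of UNIV] by (auto dest!: inj_onD)
      with \<open>j < i\<close> show "even (?g i j + ?g j i)"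
        by (cases "?p i < ?p j") (auto simp: algebra_simps)
    qed simp
    then show ?thesis
      by (simp add: inversion_sum_def sum.distrib sum_subtractf)
  qed
  then show ?thesis
    using len by (simp add: koszul_sign_eq distrib_sign_eq D inv flip: minus_one_pow_add)
      (rule minus_one_pow_cong, simp)
qed

text \<open>Lowering the degree of factor \<open>i\<close> by one removes from the exponent the
  degrees of all factors whose order with it is reversed. Those are exactly the factors that stand
  in front of it on one side of the rearrangement and not on the other. This makes the signs of the
  differential compatible with permuting the factors.\<close>

lemma koszul_sign_update:
  assumes "\<tau> permutes {1..length qs}" "i < length qs"
  shows "koszul_sign \<tau> (qs[i := qs ! i - 1]) * minus_one_pow (sum_list (take i qs)) =
    koszul_sign \<tau> qs * minus_one_pow (sum_list (take (\<tau> (Suc i) - 1) (permuted \<tau> qs)))"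
proof -
  let ?n = "length qs" and ?p = "\<lambda>i. \<tau> (Suc i)"
  have r: "\<tau> (Suc i) \<in> {1..length qs}" if "i < ?n" for i
    by (rule permutes_range_Suc[OF assms(1) that])
  have take: "sum_list (take k xs) = (\<Sum>j<?n. if j < k then xs ! j else 0)"
    if "k \<le> ?n" "length xs = ?n" for k and xs :: "int list"
  proof -
    have "sum_list (take k xs) = (\<Sum>i<k. xs ! i)"
      using that by (simp add: sum_list_sum_nth atLeast0LessThan min_def)
    also have "{..<k} = {i \<in> {..<?n}. i < k}" using that by auto
    also have "(\<Sum>j\<in>{i \<in> {..<?n}. i < k}. xs ! j) = (\<Sum>j<?n. if j < k then xs ! j else 0)"
      by (rule sum.inter_filter) simp
    finally show ?thesis .
  qed
  have T1: "sum_list (take i qs) = (\<Sum>k<?n. if k < i then qs ! k else 0)"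
    using assms(2) by (intro take) auto
  have "sum_list (take (?p i - 1) (permuted \<tau> qs)) = (\<Sum>k<?n. if k < ?p i - 1 then permuted \<tau> qs ! k else 0)"
    using r[OF assms(2)] by (intro take) auto
  also have "\<dots> = (\<Sum>k<?n. if ?p k < ?p i then qs ! k else 0)"
    unfolding sum.reindex_bij_betw[OF permutes_index_bij[OF assms(1)], symmetric,
      of "\<lambda>k. if k < ?p i - 1 then permuted \<tau> qs ! k else 0"]
  proof (rule sum.cong[OF refl])
    fix k assume "k \<in> {..<?n}"
    then have k: "k < ?n" by simp
    have "?p k - 1 < ?p i - 1 \<longleftrightarrow> ?p k < ?p i"
      using r[OF k] r[OF assms(2)] by auto
    then show "(if ?p k - 1 < ?p i - 1 then permuted \<tau> qs ! (?p k - 1) else 0) = (if ?p k < ?p i then qs ! k else 0)"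
      using nth_permuted[OF assms(1) k] by auto
  qed
  finally have T2: "sum_list (take (?p i - 1) (permuted \<tau> qs)) = (\<Sum>k<?n. if ?p k < ?p i then qs ! k else 0)" .
  let ?q = "(!) qs" and ?d = "\<lambda>k. if k = i then 1 else 0 :: int"
  let ?I = "\<lambda>a b. a < b \<and> ?p b < ?p a"
  have upd: "inversion_sum ?n (\<lambda>i. i) ?p ((!) (qs[i := qs ! i - 1])) =
      inversion_sum ?n (\<lambda>i. i) ?p (\<lambda>k. qs ! k - ?d k)"
    unfolding inversion_sum_def by (intro sum.cong refl) (auto simp: nth_list_update)
  have row: "(\<Sum>b<?n. if a = i then (if ?I i b then ?q b else 0) else 0) =
      (if a = i then \<Sum>b<?n. if ?I i b then ?q b else 0 else 0)" for a by auto
  \<comment> \<open>No index is reversed with itself, so the change is linear in the other degrees: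
    one row and one column of the double sum.\<close>
  have "inversion_sum ?n (\<lambda>i. i) ?p ?q - inversion_sum ?n (\<lambda>i. i) ?p (\<lambda>k. qs ! k - ?d k) =
      (\<Sum>a<?n. \<Sum>b<?n. (if a = i then (if ?I a b then ?q b else 0) else 0) +
        (if b = i then (if ?I a b then ?q a else 0) else 0))"
    unfolding inversion_sum_def sum_subtractf[symmetric]
    by (intro sum.cong refl) (auto simp: algebra_simps)
  also have "\<dots> = (\<Sum>b<?n. if ?I i b then ?q b else 0) + (\<Sum>a<?n. if ?I a i then ?q a else 0)"
    using assms(2) by (simp add: sum.distrib row sum.delta cong: if_cong)
  finally have diff: "inversion_sum ?n (\<lambda>i. i) ?p ?q - inversion_sum ?n (\<lambda>i. i) ?p (\<lambda>k. qs ! k - ?d k) = \<dots>" .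
  have "even (\<Sum>k<?n. (if ?I i k then ?q k else 0) + (if ?I k i then ?q k else 0) +
      (if k < i then ?q k else 0) + (if ?p k < ?p i then ?q k else 0))"
  proof (rule dvd_sum)
    fix k assume "k \<in> {..<?n}"
    have "k = i \<or> ?p k \<noteq> ?p i"
      using permutes_inj_on_Suc[OF assms(1), of UNIV] by (auto dest!: inj_onD)
    then show "even ((if ?I i k then ?q k else 0) + (if ?I k i then ?q k else 0) +
      (if k < i then ?q k else 0) + (if ?p k < ?p i then ?q k else 0))" by auto
  qed
  then have "even (inversion_sum ?n (\<lambda>i. i) ?p ?q - inversion_sum ?n (\<lambda>i. i) ?p (\<lambda>k. qs ! k - ?d k) +
      sum_list (take i qs) + sum_list (take (?p i - 1) (permuted \<tau> qs)))"
    unfolding diff T1 T2 by (simp add: sum.distrib)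
  then show ?thesis
    by (simp add: koszul_sign_eq upd flip: minus_one_pow_add) (auto intro!: minus_one_pow_cong)
qed

subsection \<open>Signs of sums and block permutations\<close>

text \<open>The entries are pairs of a label and a degree; a list stands for a word to be sorted by labels.\<close>

primrec cross_sum :: "nat \<times> int \<Rightarrow> (nat \<times> int) list \<Rightarrow> int" where
  "cross_sum x [] = 0"
| "cross_sum x (y # ys) = (if fst y < fst x then snd x * snd y else 0) + cross_sum x ys"

primrec word_sum :: "(nat \<times> int) list \<Rightarrow> int" where
  "word_sum [] = 0"
| "word_sum (x # xs) = cross_sum x xs + word_sum xs"

definition word_cross :: "(nat \<times> int) list \<Rightarrow> (nat \<times> int) list \<Rightarrow> int" where
  "word_cross xs ys = (\<Sum>x\<leftarrow>xs. cross_sum x ys)"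

lemma cross_sum_nth:
  "cross_sum x ys = (\<Sum>j<length ys. if fst (ys ! j) < fst x then snd x * snd (ys ! j) else 0)"
  by (induction ys) (simp_all add: sum.lessThan_Suc_shift del: sum.lessThan_Suc cong: if_cong)

lemma word_sum_nth:
  "word_sum xs = inversion_sum (length xs) (\<lambda>i. i) (\<lambda>i. fst (xs ! i)) (\<lambda>i. snd (xs ! i))"
  unfolding inversion_sum_def
proof (induction xs)
  case (Cons x xs)
  show ?case
    by (simp add: Cons sum.lessThan_Suc_shift cross_sum_nth del: sum.lessThan_Suc cong: if_cong)
qed simp

text \<open>The recursive exponent of a word splits along concatenation, which suits block
  permutations, and it can be evaluated, which the tables need.\<close>

lemma koszul_sign_word:
  "koszul_sign \<tau> qs = minus_one_pow (word_sum (zip (oneline (length qs) \<tau>) qs))"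
  unfolding koszul_sign_eq word_sum_nth inversion_sum_def
  by (intro arg_cong[of _ _ minus_one_pow] sum.cong) (auto simp: nth_oneline intro!: sum.cong)

lemma cross_sum_append: "cross_sum x (ys @ zs) = cross_sum x ys + cross_sum x zs"
  by (induction ys) auto

lemma word_sum_append: "word_sum (xs @ ys) = word_sum xs + word_sum ys + word_cross xs ys"
  by (induction xs) (auto simp: cross_sum_append word_cross_def)

lemma cross_sum_0: "(\<And>y. y \<in> set ys \<Longrightarrow> fst x \<le> fst y) \<Longrightarrow> cross_sum x ys = 0"
  by (induction ys) force+

lemma word_cross_0:
  "(\<And>x y. x \<in> set xs \<Longrightarrow> y \<in> set ys \<Longrightarrow> fst x \<le> fst y) \<Longrightarrow> word_cross xs ys = 0"
  unfolding word_cross_def by (induction xs) (auto simp: cross_sum_0)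

lemma cross_sum_full: "(\<And>y. y \<in> set ys \<Longrightarrow> fst y < fst x) \<Longrightarrow> cross_sum x ys = snd x * sum_list (map snd ys)"
  by (induction ys) (auto simp: algebra_simps)

lemma word_cross_full:
  "(\<And>x y. x \<in> set xs \<Longrightarrow> y \<in> set ys \<Longrightarrow> fst y < fst x) \<Longrightarrow>
   word_cross xs ys = sum_list (map snd xs) * sum_list (map snd ys)"
  unfolding word_cross_def by (induction xs) (auto simp: cross_sum_full algebra_simps)

lemma word_sum_sorted: "sorted (map fst xs) \<Longrightarrow> word_sum xs = 0"
  by (induction xs) (auto intro!: cross_sum_0)

lemma word_sum_shift: "word_sum (map (\<lambda>(l, q). (n + l, q)) xs) = word_sum xs"
proof -
  have "cross_sum (n + l, q) (map (\<lambda>(l, q). (n + l, q)) ys) = cross_sum (l, q) ys" for l q ys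
    by (induction ys) auto
  then show ?thesis by (induction xs) auto
qed

lemma word_cross_concat: "word_cross xs (concat yss) = (\<Sum>j<length yss. word_cross xs (yss ! j))"
proof -
  have app: "word_cross xs (ys @ zs) = word_cross xs ys + word_cross xs zs" for ys zs
    by (simp add: word_cross_def cross_sum_append sum_list_addf)
  have nil: "word_cross xs [] = 0" by (simp add: word_cross_def)
  show ?thesis
    by (induction yss) (simp_all add: app nil sum.lessThan_Suc_shift del: sum.lessThan_Suc)
qed

lemma word_sum_concat:
  "word_sum (concat xss) = (\<Sum>i<length xss. word_sum (xss ! i)) +
    (\<Sum>i<length xss. \<Sum>j<length xss. if i < j then word_cross (xss ! i) (xss ! j) else 0)"
  by (induction xss)
    (simp_all add: word_sum_append word_cross_concat sum.lessThan_Suc_shift del: sum.lessThan_Suc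
      cong: if_cong)

lemma oneline_perm_sum:
  "oneline (n + m) (perm_sum n \<sigma> \<tau>) = oneline n \<sigma> @ map ((+) n) (oneline m \<tau>)"
  by (rule nth_equalityI) (auto simp: nth_oneline nth_append perm_sum_def Suc_diff_le not_less)

text \<open>Labels of the first part are at most \<open>length qs\<close> and those of the second
  exceed it, so no inversion crosses the boundary; shifting the second labels preserves their
  order.\<close>

lemma koszul_sign_perm_sum:
  assumes "\<sigma> permutes {1..length qs}" "\<tau> permutes {1..length rs}"
  shows "koszul_sign (perm_sum (length qs) \<sigma> \<tau>) (qs @ rs) = koszul_sign \<sigma> qs * koszul_sign \<tau> rs"
proof -
  have range: "x \<in> {1..n}" if "\<rho> permutes {1..n}" "x \<in> set (oneline n \<rho>)" for x n \<rho>
    using that permutes_range_Suc[OF that(1)] by (auto simp: in_set_conv_nth nth_oneline)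
  let ?R = "map (\<lambda>(l, q). (length qs + l, q)) (zip (oneline (length rs) \<tau>) rs)"
  have "zip (oneline (length (qs @ rs)) (perm_sum (length qs) \<sigma> \<tau>)) (qs @ rs) =
      zip (oneline (length qs) \<sigma>) qs @ ?R"
    by (simp add: oneline_perm_sum zip_append zip_map1)
  moreover have "word_cross (zip (oneline (length qs) \<sigma>) qs) ?R = 0"
    using range[OF assms(1)] by (intro word_cross_0) (force dest!: set_zip_leftD)
  ultimately show ?thesis
    by (simp add: koszul_sign_word word_sum_append word_sum_shift minus_one_pow_add)
qed

lemma koszul_sign_sum_perm:
  assumes "perms_of (map length qss) \<tau>s"
  shows "koszul_sign (sum_perm (map length qss) \<tau>s) (concat qss) = prod_list (map2 koszul_sign \<tau>s qss)"
  using assms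
proof (induction qss arbitrary: \<tau>s)
  case (Cons qs qss)
  then obtain \<tau> \<tau>s' where \<tau>: "\<tau>s = \<tau> # \<tau>s'" "\<tau> permutes {1..length qs}" "perms_of (map length qss) \<tau>s'"
    by (auto simp: list_all2_Cons1)
  have "sum_perm (map length qss) \<tau>s' permutes {1..length (concat qss)}"
    using sum_perm_permutes[OF \<tau>(3)] by (simp add: length_concat)
  from koszul_sign_perm_sum[OF \<tau>(2) this] show ?case
    using \<tau> Cons.IH[OF \<tau>(3)] by (simp add: sum_perm_Cons)
qed (simp add: koszul_sign_eq inversion_sum_def)

definition block_labels :: "perm \<Rightarrow> nat list \<Rightarrow> nat \<Rightarrow> nat list" where
  "block_labels \<tau> ns i = map ((+) (block_start \<tau> ns i)) [1..<ns ! i + 1]"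

lemma oneline_block_perm:
  "oneline (sum_list ns) (block_perm \<tau> ns) = concat (map (block_labels \<tau> ns) [0..<length ns])"
  unfolding oneline_def upt_eq_concat_blocks map_concat map_map
  by (intro arg_cong[of _ _ concat] map_cong) (auto simp: block_labels_def block_perm_block)

text \<open>Within a block labels increase, so there are no inversions. Two blocks are either
  entirely in order or entirely reversed, and a reversed pair contributes the product of the total
  degrees.\<close>

lemma koszul_sign_block_perm:
  assumes \<tau>: "\<tau> permutes {1..length qss}"
  shows "koszul_sign (block_perm \<tau> (map length qss)) (concat qss) = koszul_sign \<tau> (map sum_list qss)"
proof -
  let ?ns = "map length qss" and ?n = "length qss"
  let ?w = "\<lambda>i. zip (block_labels \<tau> ?ns i) (qss ! i)"
  have "zip (concat (map (block_labels \<tau> ?ns) [0..<k])) (concat (take k qss)) = concat (map ?w [0..<k])"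
    if "k \<le> ?n" for k
    using that
  proof (induction k)
    case (Suc k)
    have "length (concat (map (block_labels \<tau> ?ns) [0..<k])) = length (concat (take k qss))"
      using Suc.prems
      by (auto simp: length_concat take_map comp_def block_labels_def intro!: arg_cong[of _ _ sum_list] nth_equalityI)
    then show ?case using Suc by (simp add: take_Suc_conv_app_nth zip_append upt_Suc)
  qed simp
  from this[of ?n] have zip: "zip (oneline (length (concat qss)) (block_perm \<tau> ?ns)) (concat qss) =
      concat (map ?w [0..<?n])"
    using oneline_block_perm[of ?ns \<tau>] by (simp add: length_concat)
  have snd: "map snd (?w i) = qss ! i" if "i < ?n" for i
    using that by (simp add: block_labels_def)
  have sorted: "word_sum (?w i) = 0" if "i < ?n" for i
    using that by (intro word_sum_sorted) (simp add: block_labels_def sorted_map sorted_wrt_upt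
        sorted_wrt_map strict_sorted_imp_sorted)
  \<comment> \<open>The blocks landing before block \<open>j\<close> include block \<open>i\<close>
    and everything before it, so the labels of block \<open>i\<close> end at or below the offset of
    block \<open>j\<close>.\<close>
  have sep: "x < y" if "i < ?n" "j < ?n" "\<tau> (Suc i) < \<tau> (Suc j)"
    "x \<in> set (block_labels \<tau> ?ns i)" "y \<in> set (block_labels \<tau> ?ns j)" for i j x y
  proof -
    let ?B = "\<lambda>i. {k. k < ?n \<and> \<tau> (Suc k) < \<tau> (Suc i)}"
    have "block_start \<tau> ?ns i + ?ns ! i = (\<Sum>k\<in>insert i (?B i). ?ns ! k)"
      by (subst sum.insert) (auto simp: block_start_def)
    also have "\<dots> \<le> (\<Sum>k\<in>?B j. ?ns ! k)"
      using that by (intro sum_mono2) auto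
    finally show ?thesis using that(1,2,4,5) by (auto simp: block_labels_def block_start_def)
  qed
  have cross: "word_cross (?w i) (?w j) =
      (if \<tau> (Suc j) < \<tau> (Suc i) then sum_list (qss ! i) * sum_list (qss ! j) else 0)"
    if "i < j" "j < ?n" for i j
  proof (cases "\<tau> (Suc j) < \<tau> (Suc i)")
    case True
    have "word_cross (?w i) (?w j) = sum_list (map snd (?w i)) * sum_list (map snd (?w j))"
    proof (rule word_cross_full)
      fix x y assume "x \<in> set (?w i)" "y \<in> set (?w j)"
      then have "fst x \<in> set (block_labels \<tau> ?ns i)" "fst y \<in> set (block_labels \<tau> ?ns j)"
        by (metis prod.collapse set_zip_leftD)+
      then show "fst y < fst x" using sep[of j i "fst y" "fst x"] True that by simp
    qed
    with True show ?thesis using that snd[of i] snd[of j] by simp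
  next
    case False
    moreover have "\<tau> (Suc i) \<noteq> \<tau> (Suc j)"
      using permutes_inj_on_Suc[OF \<tau>, of UNIV] that by (auto dest!: inj_onD)
    ultimately have less: "\<tau> (Suc i) < \<tau> (Suc j)" by simp
    have "word_cross (?w i) (?w j) = 0"
    proof (rule word_cross_0)
      fix x y assume "x \<in> set (?w i)" "y \<in> set (?w j)"
      then have "fst x \<in> set (block_labels \<tau> ?ns i)" "fst y \<in> set (block_labels \<tau> ?ns j)"
        by (metis prod.collapse set_zip_leftD)+
      then show "fst x \<le> fst y" using sep[of i j "fst x" "fst y"] less that by simp
    qed
    with False show ?thesis by simp
  qed
  have "word_sum (concat (map ?w [0..<?n])) =
      inversion_sum ?n (\<lambda>i. i) (\<lambda>i. \<tau> (Suc i)) ((!) (map sum_list qss))"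
    unfolding word_sum_concat inversion_sum_def
    by (simp add: sorted cross cong: if_cong) (intro sum.cong refl, simp)
  then show ?thesis
    by (simp add: koszul_sign_word[of "block_perm \<tau> ?ns"] zip) (simp add: koszul_sign_eq)
qed

subsection \<open>The sign of a permutation\<close>

text \<open>The inversions are the pairs \<open>(a, j)\<close> with \<open>a < j \<le> b\<close> and
  \<open>(i, b)\<close> with \<open>a < i < b\<close>, which makes \<open>2 * (b - a) - 1\<close> of
  them, an odd number.\<close>

lemma koszul_sign_transpose:
  assumes "a \<in> {1..n}" "b \<in> {1..n}" "a < b"
  shows "koszul_sign (transpose a b) (replicate n 1) = -1"
proof -
  let ?S = "{(i, j). i \<in> {1..n} \<and> j \<in> {1..n} \<and> i < j \<and> transpose a b i > transpose a b j}"
  have "?S = Pair a ` {a<..b} \<union> (\<lambda>i. (i, b)) ` {a<..<b}"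
    using assms by (auto simp: transpose_def split: if_splits)
  moreover have "card (Pair a ` {a<..b} \<union> (\<lambda>i. (i, b)) ` {a<..<b}) = (b - a) + (b - a - 1)"
    by (subst card_Un_disjoint) (auto simp: card_image inj_on_def)
  ultimately have "odd (card ?S)" using assms by simp
  moreover have "koszul_sign (transpose a b) (replicate n 1) = (\<Prod>x\<in>?S. -1)"
    unfolding koszul_sign_def by (intro prod.cong) (auto simp: minus_one_pow_def)
  ultimately show ?thesis by simp
qed

text \<open>The library sign is built from transpositions, the Koszul sign from inversions. With all
  degrees 1 both are multiplicative and equal -1 on transpositions; the inversion form is the one
  that can be evaluated on the shuffles.\<close>

lemma sign_eq_koszul_sign:
  assumes "\<sigma> permutes {1..n}"
  shows "sign \<sigma> = koszul_sign \<sigma> (replicate n 1)"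
  using assms finite_atLeastAtMost[of 1 n]
proof (induction rule: permutes_induct)
  case id
  show ?case by (simp only: koszul_sign_id sign_id)
next
  case (swap a b p)
  have t: "transpose a b permutes {1..n}" using swap by (intro permutes_swap_id)
  have const: "permuted p (replicate n 1) = replicate n (1::int)"
    using set_permuted[of p "replicate n (1::int)"] swap.hyps(4)
    by (intro replicate_eqI) (auto split: if_splits)
  have "koszul_sign (transpose a b) (replicate n 1) = -1"
    using swap koszul_sign_transpose[of a n b] koszul_sign_transpose[of b n a]
    by (cases "a < b") (auto simp: transpose_commute)
  then have "koszul_sign (transpose a b \<circ> p) (replicate n 1) = - koszul_sign p (replicate n 1)"
    using koszul_sign_comp[of "transpose a b" "replicate n 1" p] t swap.hyps(4) by (simp add: const)
  moreover have "sign (transpose a b \<circ> p) = - sign p"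
    using swap permutes_imp_permutation[OF finite_atLeastAtMost swap.hyps(4)] 
    by (subst sign_compose) (auto simp: permutation_swap_id sign_swap_id)
  ultimately show ?case by (simp only: swap.IH)
qed

section \<open>The composite product by generators and relations\<close>

lemma homog_simps [simp]:
  "arity (n, p, x) = n" "degr (n, p, x) = p" "elt (n, p, x) = x"
  by (simp_all add: arity_def degr_def elt_def)

lemma homogs_iff [simp]: "(n, p, x) \<in> homogs M \<longleftrightarrow> x \<in> carrier (piece M n p)"
  by (simp add: homogs_def)

lemma hact_simp [simp]: "hact M (n, p, x) \<sigma> = (n, p, act M n p x \<sigma>)"
  by (simp add: hact_def)

lemma hdif_simp [simp]: "hdif M (n, p, x) = (n, p - 1, dif M n p x)"
  by (simp add: hdif_def)

lemma hmap_simp [simp]: "hmap f (n, p, x) = (n, p, f n p x)"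
  by (simp add: hmap_def)

lemma arity_hact [simp]: "arity (hact M \<mu> \<sigma>) = arity \<mu>"
  and degr_hact [simp]: "degr (hact M \<mu> \<sigma>) = degr \<mu>"
  and arity_hdif [simp]: "arity (hdif M \<mu>) = arity \<mu>"
  and degr_hdif [simp]: "degr (hdif M \<mu>) = degr \<mu> - 1"
  and arity_hmap [simp]: "arity (hmap f \<mu>) = arity \<mu>"
  and degr_hmap [simp]: "degr (hmap f \<mu>) = degr \<mu>"
  by (cases \<mu>; simp)+

lemma gen_simps [simp]:
  "gen_arity (\<mu>, \<nu>s, \<sigma>) = sum_list (map arity \<nu>s)"
  "gen_degr (\<mu>, \<nu>s, \<sigma>) = degr \<mu> + sum_list (map degr \<nu>s)"
  by (simp_all add: gen_arity_def gen_degr_def)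

lemma gens_iff:
  "(\<mu>, \<nu>s, \<sigma>) \<in> gens M N n p \<longleftrightarrow> \<mu> \<in> homogs M \<and> set \<nu>s \<subseteq> homogs N \<and> arity \<mu> = length \<nu>s \<and>
     sum_list (map arity \<nu>s) = n \<and> degr \<mu> + sum_list (map degr \<nu>s) = p \<and> \<sigma> permutes {1..n}"
  by (simp add: gens_def)

text \<open>The modules and actions underlying a dg symmetric module. Composites are shown to be of
  this kind again, so they can be nested, as the associator demands.\<close>

locale graded_smodule = R?: cring R for R (structure) +
  fixes M :: "('a, 'b) smodule"
  assumes piece_module: "module R (piece M n p)"
    and act_hom: "\<sigma> permutes {1..n} \<Longrightarrow>
          (\<lambda>x. act M n p x \<sigma>) \<in> module_hom R (piece M n p) (piece M n p)"
    and act_id: "x \<in> carrier (piece M n p) \<Longrightarrow> act M n p x id = x"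
    and act_act: "\<sigma> permutes {1..n} \<Longrightarrow> \<tau> permutes {1..n} \<Longrightarrow> x \<in> carrier (piece M n p) \<Longrightarrow>
          act M n p (act M n p x \<sigma>) \<tau> = act M n p x (\<sigma> \<circ> \<tau>)"
begin

lemma piece_rmodule: "rmodule R (piece M n p)"
  by (intro rmodule.intro piece_module)

lemma act_closed:
  "\<sigma> permutes {1..n} \<Longrightarrow> x \<in> carrier (piece M n p) \<Longrightarrow> act M n p x \<sigma> \<in> carrier (piece M n p)"
  using module_hom_closed[OF act_hom] .

lemma hact_closed: "\<mu> \<in> homogs M \<Longrightarrow> \<sigma> permutes {1..arity \<mu>} \<Longrightarrow> hact M \<mu> \<sigma> \<in> homogs M"
  by (cases \<mu>) (simp add: act_closed)

lemma map2_hact_closed: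
  assumes "set \<mu>s \<subseteq> homogs M" "perms_of (map arity \<mu>s) \<sigma>s"
  shows "set (map2 (hact M) \<mu>s \<sigma>s) \<subseteq> homogs M"
    and "map arity (map2 (hact M) \<mu>s \<sigma>s) = map arity \<mu>s"
    and "map degr (map2 (hact M) \<mu>s \<sigma>s) = map degr \<mu>s"
proof -
  have "set (map2 (hact M) \<mu>s \<sigma>s) \<subseteq> homogs M \<and> map arity (map2 (hact M) \<mu>s \<sigma>s) = map arity \<mu>s \<and>
      map degr (map2 (hact M) \<mu>s \<sigma>s) = map degr \<mu>s"
    using assms
  proof (induction \<mu>s arbitrary: \<sigma>s)
    case (Cons \<mu> \<mu>s)
    then obtain \<sigma> \<sigma>s' where \<sigma>: "\<sigma>s = \<sigma> # \<sigma>s'" "\<sigma> permutes {1..arity \<mu>}" "perms_of (map arity \<mu>s) \<sigma>s'"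
      by (auto simp: list_all2_Cons1 simp del: One_nat_def)
    with Cons.IH[OF _ \<sigma>(3)] hact_closed[OF _ \<sigma>(2)] Cons.prems(1) show ?case by simp
  qed simp
  then show "set (map2 (hact M) \<mu>s \<sigma>s) \<subseteq> homogs M"
    "map arity (map2 (hact M) \<mu>s \<sigma>s) = map arity \<mu>s"
    "map degr (map2 (hact M) \<mu>s \<sigma>s) = map degr \<mu>s" by blast+
qed

end

sublocale dg_smodule \<subseteq> graded_smodule R M
  by (rule graded_smodule.intro[OF is_cring], rule graded_smodule_axioms.intro)
    (rule piece_module, rule act_hom, assumption, rule act_id, assumption, rule act_act, assumption+)

context dg_smodule
begin

lemma hdif_closed: "\<mu> \<in> homogs M \<Longrightarrow> hdif M \<mu> \<in> homogs M"
  by (cases \<mu>) (simp add: module_hom_closed[OF dif_hom])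

lemma hdif_hact:
  "\<mu> \<in> homogs M \<Longrightarrow> \<sigma> permutes {1..arity \<mu>} \<Longrightarrow> hdif M (hact M \<mu> \<sigma>) = hact M (hdif M \<mu>) \<sigma>"
  by (cases \<mu>) (simp add: dif_act)

end

text \<open>The conditions on a function of generators that turn each family in \<open>rels\<close>
  into an equation in \<open>A\<close>. In the two linearity clauses the outer \<open>x\<close> only
  ensures that the remaining entries form a generator; the inner \<open>x\<close> ranges over the
  whole module.\<close>

definition compatible ::
    "('r, 'm) ring_scheme \<Rightarrow> ('r, 'a) smodule \<Rightarrow> ('r, 'b) smodule \<Rightarrow> nat \<Rightarrow> int \<Rightarrow>
     ('r, 'c) module \<Rightarrow> (('a, 'b) gen \<Rightarrow> 'c) \<Rightarrow> bool" where
  "compatible R M N n p A \<phi> \<longleftrightarrow>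
     (\<forall>s\<in>gens M N n p. \<phi> s \<in> carrier A) \<and>
     (\<forall>m q x \<nu>s \<sigma>. ((m, q, x), \<nu>s, \<sigma>) \<in> gens M N n p \<longrightarrow>
        (\<lambda>x. \<phi> ((m, q, x), \<nu>s, \<sigma>)) \<in> module_hom R (piece M m q) A) \<and>
     (\<forall>\<mu> \<nu>s k q x \<nu>s' \<sigma>. (\<mu>, \<nu>s @ (k, q, x) # \<nu>s', \<sigma>) \<in> gens M N n p \<longrightarrow>
        (\<lambda>x. \<phi> (\<mu>, \<nu>s @ (k, q, x) # \<nu>s', \<sigma>)) \<in> module_hom R (piece N k q) A) \<and>
     (\<forall>\<mu> \<nu>s \<tau>s \<sigma>. (\<mu>, \<nu>s, \<sigma>) \<in> gens M N n p \<longrightarrow> perms_of (map arity \<nu>s) \<tau>s \<longrightarrow>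
        \<phi> (\<mu>, map2 (hact N) \<nu>s \<tau>s, \<sigma>) = \<phi> (\<mu>, \<nu>s, sum_perm (map arity \<nu>s) \<tau>s \<circ> \<sigma>)) \<and>
     (\<forall>\<mu> \<nu>s \<tau> \<sigma>. (\<mu>, \<nu>s, \<sigma>) \<in> gens M N n p \<longrightarrow> \<tau> permutes {1..arity \<mu>} \<longrightarrow>
        \<phi> (hact M \<mu> \<tau>, \<nu>s, \<sigma>) =
          [koszul_sign \<tau> (map degr \<nu>s)] \<cdot>\<^bsub>A\<^esub> \<phi> (\<mu>, permuted \<tau> \<nu>s, block_perm \<tau> (map arity \<nu>s) \<circ> \<sigma>))"

lemma compatibleI:
  assumes "\<And>\<mu> \<nu>s \<sigma>. (\<mu>, \<nu>s, \<sigma>) \<in> gens M N n p \<Longrightarrow> \<phi> (\<mu>, \<nu>s, \<sigma>) \<in> carrier A"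
    and "\<And>m q x \<nu>s \<sigma>. ((m, q, x), \<nu>s, \<sigma>) \<in> gens M N n p \<Longrightarrow>
        (\<lambda>x. \<phi> ((m, q, x), \<nu>s, \<sigma>)) \<in> module_hom R (piece M m q) A"
    and "\<And>\<mu> \<nu>s k q x \<nu>s' \<sigma>. (\<mu>, \<nu>s @ (k, q, x) # \<nu>s', \<sigma>) \<in> gens M N n p \<Longrightarrow>
        (\<lambda>x. \<phi> (\<mu>, \<nu>s @ (k, q, x) # \<nu>s', \<sigma>)) \<in> module_hom R (piece N k q) A"
    and "\<And>\<mu> \<nu>s \<tau>s \<sigma>. (\<mu>, \<nu>s, \<sigma>) \<in> gens M N n p \<Longrightarrow> perms_of (map arity \<nu>s) \<tau>s \<Longrightarrow>
        \<phi> (\<mu>, map2 (hact N) \<nu>s \<tau>s, \<sigma>) = \<phi> (\<mu>, \<nu>s, sum_perm (map arity \<nu>s) \<tau>s \<circ> \<sigma>)"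
    and "\<And>\<mu> \<nu>s \<tau> \<sigma>. (\<mu>, \<nu>s, \<sigma>) \<in> gens M N n p \<Longrightarrow> \<tau> permutes {1..arity \<mu>} \<Longrightarrow>
        \<phi> (hact M \<mu> \<tau>, \<nu>s, \<sigma>) =
          [koszul_sign \<tau> (map degr \<nu>s)] \<cdot>\<^bsub>A\<^esub> \<phi> (\<mu>, permuted \<tau> \<nu>s, block_perm \<tau> (map arity \<nu>s) \<circ> \<sigma>)"
  shows "compatible R M N n p A \<phi>"
  unfolding compatible_def by (intro conjI ballI allI impI) (use assms in \<open>auto simp del: One_nat_def\<close>)

lemma compatibleD:
  assumes "compatible R M N n p A \<phi>"
  shows "s \<in> gens M N n p \<Longrightarrow> \<phi> s \<in> carrier A"
    and "((m, q, x), \<nu>s, \<sigma>) \<in> gens M N n p \<Longrightarrow>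
        (\<lambda>x. \<phi> ((m, q, x), \<nu>s, \<sigma>)) \<in> module_hom R (piece M m q) A"
    and "(\<mu>, \<nu>s @ (k, q, y) # \<nu>s', \<sigma>) \<in> gens M N n p \<Longrightarrow>
        (\<lambda>x. \<phi> (\<mu>, \<nu>s @ (k, q, x) # \<nu>s', \<sigma>)) \<in> module_hom R (piece N k q) A"
    and "(\<mu>, \<nu>s, \<sigma>) \<in> gens M N n p \<Longrightarrow> perms_of (map arity \<nu>s) \<tau>s \<Longrightarrow>
        \<phi> (\<mu>, map2 (hact N) \<nu>s \<tau>s, \<sigma>) = \<phi> (\<mu>, \<nu>s, sum_perm (map arity \<nu>s) \<tau>s \<circ> \<sigma>)"
    and "(\<mu>, \<nu>s, \<sigma>) \<in> gens M N n p \<Longrightarrow> \<tau> permutes {1..arity \<mu>} \<Longrightarrow>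
        \<phi> (hact M \<mu> \<tau>, \<nu>s, \<sigma>) =
          [koszul_sign \<tau> (map degr \<nu>s)] \<cdot>\<^bsub>A\<^esub> \<phi> (\<mu>, permuted \<tau> \<nu>s, block_perm \<tau> (map arity \<nu>s) \<circ> \<sigma>)"
  using assms[unfolded compatible_def, THEN conjunct1]
    assms[unfolded compatible_def, THEN conjunct2, THEN conjunct1]
    assms[unfolded compatible_def, THEN conjunct2, THEN conjunct2, THEN conjunct1]
    assms[unfolded compatible_def, THEN conjunct2, THEN conjunct2, THEN conjunct2, THEN conjunct1]
    assms[unfolded compatible_def, THEN conjunct2, THEN conjunct2, THEN conjunct2, THEN conjunct2]
  by - metis+

locale composite_product = R?: cring R + M: graded_smodule R M + N: graded_smodule R N
  for R (structure) and M :: "('a, 'b) smodule" and N :: "('a, 'c) smodule"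
begin

abbreviation "G n p \<equiv> gens M N n p"
abbreviation "F n p \<equiv> free_module R (gens M N n p)"
abbreviation "H n p \<equiv> rel_submodule R M N n p"
abbreviation "Q n p \<equiv> composite_piece R M N n p"
abbreviation "el \<equiv> elementary R M N"

lemma gens_change_left:
  "((m, q, x), \<nu>s, \<sigma>) \<in> G n p \<Longrightarrow> y \<in> carrier (piece M m q) \<Longrightarrow> ((m, q, y), \<nu>s, \<sigma>) \<in> G n p"
  by (simp add: gens_iff)

lemma gens_change_slot:
  "(\<mu>, \<nu>s @ (k, q, x) # \<nu>s', \<sigma>) \<in> G n p \<Longrightarrow> y \<in> carrier (piece N k q) \<Longrightarrow>
   (\<mu>, \<nu>s @ (k, q, y) # \<nu>s', \<sigma>) \<in> G n p"
  by (simp add: gens_iff)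

lemma gens_left_closed: "((m, q, x), \<nu>s, \<sigma>) \<in> G n p \<Longrightarrow> x \<in> carrier (piece M m q)"
  by (auto simp: gens_iff)

lemma gens_slot_closed: "(\<mu>, \<nu>s @ (k, q, x) # \<nu>s', \<sigma>) \<in> G n p \<Longrightarrow> x \<in> carrier (piece N k q)"
  by (auto simp: gens_iff)

lemma gens_compose: "(\<mu>, \<nu>s, \<sigma>) \<in> G n p \<Longrightarrow> \<tau> permutes {1..n} \<Longrightarrow> (\<mu>, \<nu>s, \<sigma> \<circ> \<tau>) \<in> G n p"
  and gens_compose_left: "(\<mu>, \<nu>s, \<sigma>) \<in> G n p \<Longrightarrow> \<tau> permutes {1..n} \<Longrightarrow> (\<mu>, \<nu>s, \<tau> \<circ> \<sigma>) \<in> G n p"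
  by (auto simp: gens_iff permutes_compose)

lemma gens_balanced:
  assumes "(\<mu>, \<nu>s, \<sigma>) \<in> G n p" "perms_of (map arity \<nu>s) \<tau>s"
  shows "(\<mu>, map2 (hact N) \<nu>s \<tau>s, \<sigma>) \<in> G n p"
    and "(\<mu>, \<nu>s, sum_perm (map arity \<nu>s) \<tau>s \<circ> \<sigma>) \<in> G n p"
proof -
  have len: "length \<tau>s = length \<nu>s" using list_all2_lengthD[OF assms(2)] by simp
  have "set \<nu>s \<subseteq> homogs N" using assms(1) by (simp add: gens_iff)
  note m = N.map2_hact_closed[OF this assms(2)]
  show "(\<mu>, map2 (hact N) \<nu>s \<tau>s, \<sigma>) \<in> G n p"
    using assms(1) m len unfolding gens_iff by (simp only: m) simp
  show "(\<mu>, \<nu>s, sum_perm (map arity \<nu>s) \<tau>s \<circ> \<sigma>) \<in> G n p"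
    using sum_perm_permutes[OF assms(2)] assms(1)
    by (intro gens_compose_left) (auto simp: gens_iff)
qed

lemma gens_left_act:
  assumes "(\<mu>, \<nu>s, \<sigma>) \<in> G n p" "\<tau> permutes {1..arity \<mu>}"
  shows "(hact M \<mu> \<tau>, \<nu>s, \<sigma>) \<in> G n p"
    and "(\<mu>, permuted \<tau> \<nu>s, block_perm \<tau> (map arity \<nu>s) \<circ> \<sigma>) \<in> G n p"
proof -
  have *: "arity \<mu> = length \<nu>s" "sum_list (map arity \<nu>s) = n" using assms by (auto simp: gens_iff)
  note \<tau> = assms(2)[unfolded *(1)]
  show "(hact M \<mu> \<tau>, \<nu>s, \<sigma>) \<in> G n p"
    using assms by (simp add: gens_iff M.hact_closed)
  have "map f (permuted \<tau> \<nu>s) = permuted \<tau> (map f \<nu>s)" for f :: "_ \<Rightarrow> nat"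
    using \<tau> by (simp add: permuted_map)
  then have 1: "sum_list (map arity (permuted \<tau> \<nu>s)) = sum_list (map arity \<nu>s)"
    using \<tau> by (simp add: sum_list_permuted)
  have "map f (permuted \<tau> \<nu>s) = permuted \<tau> (map f \<nu>s)" for f :: "_ \<Rightarrow> int"
    using \<tau> by (simp add: permuted_map)
  then have 2: "sum_list (map degr (permuted \<tau> \<nu>s)) = sum_list (map degr \<nu>s)"
    using \<tau> by (simp add: sum_list_permuted)
  have "block_perm \<tau> (map arity \<nu>s) permutes {1..n}"
    using block_perm_permutes[of \<tau> "map arity \<nu>s"] \<tau> * by simp
  then show "(\<mu>, permuted \<tau> \<nu>s, block_perm \<tau> (map arity \<nu>s) \<circ> \<sigma>) \<in> G n p"
    using assms(1) set_permuted[OF \<tau>] 1 2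
    by (intro gens_compose_left) (auto simp: gens_iff)
qed

section \<open>The relation submodule and the universal property of the composite product\<close>

lemma F_rmodule: "rmodule R (F n p)"
  by (intro rmodule.intro free_module_is_module)

lemma basis_closed: "s \<in> G n p \<Longrightarrow> basis R s \<in> carrier (F n p)"
  by (rule basis_in_free_module)

lemma rels_closed: "rels R M N n p \<subseteq> carrier (F n p)"
proof -
  interpret F: rmodule R "F n p" by (rule F_rmodule)
  interpret PM: rmodule R "piece M m q" for m q by (rule M.piece_rmodule)
  interpret PN: rmodule R "piece N m q" for m q by (rule N.piece_rmodule)
  show ?thesis
    unfolding rels_def Let_def
  proof (intro Un_least subsetI; elim CollectE exE conjE; hypsubst)
    fix m q x y \<nu>s \<sigma> assume *: "((m, q, x), \<nu>s, \<sigma>) \<in> G n p" "y \<in> carrier (piece M m q)"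
    have "x \<in> carrier (piece M m q)" by (rule gens_left_closed[OF *(1)])
    with *(2) have "x \<oplus>\<^bsub>piece M m q\<^esub> y \<in> carrier (piece M m q)" by simp
    note gs = *(1) gens_change_left[OF *] gens_change_left[OF *(1) this]
    show "basis R ((m, q, x \<oplus>\<^bsub>piece M m q\<^esub> y), \<nu>s, \<sigma>) \<ominus>\<^bsub>F n p\<^esub>
        (basis R ((m, q, x), \<nu>s, \<sigma>) \<oplus>\<^bsub>F n p\<^esub> basis R ((m, q, y), \<nu>s, \<sigma>)) \<in> carrier (F n p)"
      using gs[THEN basis_closed] by simp
  next
    fix m q a x \<nu>s \<sigma> assume *: "((m, q, x), \<nu>s, \<sigma>) \<in> G n p" "a \<in> carrier R"
    have "x \<in> carrier (piece M m q)" by (rule gens_left_closed[OF *(1)])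
    with *(2) have "a \<odot>\<^bsub>piece M m q\<^esub> x \<in> carrier (piece M m q)" by simp
    note gs = *(1) gens_change_left[OF *(1) this]
    show "basis R ((m, q, a \<odot>\<^bsub>piece M m q\<^esub> x), \<nu>s, \<sigma>) \<ominus>\<^bsub>F n p\<^esub>
        (a \<odot>\<^bsub>F n p\<^esub> basis R ((m, q, x), \<nu>s, \<sigma>)) \<in> carrier (F n p)"
      using gs[THEN basis_closed] *(2) by simp
  next
    fix \<mu> \<nu>s k q x y \<nu>s' \<sigma>
    assume *: "(\<mu>, \<nu>s @ (k, q, x) # \<nu>s', \<sigma>) \<in> G n p" "y \<in> carrier (piece N k q)"
    have "x \<in> carrier (piece N k q)" by (rule gens_slot_closed[OF *(1)])
    with *(2) have "x \<oplus>\<^bsub>piece N k q\<^esub> y \<in> carrier (piece N k q)" by simp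
    note gs = *(1) gens_change_slot[OF *] gens_change_slot[OF *(1) this]
    show "basis R (\<mu>, \<nu>s @ (k, q, x \<oplus>\<^bsub>piece N k q\<^esub> y) # \<nu>s', \<sigma>) \<ominus>\<^bsub>F n p\<^esub>
        (basis R (\<mu>, \<nu>s @ (k, q, x) # \<nu>s', \<sigma>) \<oplus>\<^bsub>F n p\<^esub>
          basis R (\<mu>, \<nu>s @ (k, q, y) # \<nu>s', \<sigma>)) \<in> carrier (F n p)"
      using gs[THEN basis_closed] by simp
  next
    fix \<mu> \<nu>s k q a x \<nu>s' \<sigma>
    assume *: "(\<mu>, \<nu>s @ (k, q, x) # \<nu>s', \<sigma>) \<in> G n p" "a \<in> carrier R"
    have "x \<in> carrier (piece N k q)" by (rule gens_slot_closed[OF *(1)])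
    with *(2) have "a \<odot>\<^bsub>piece N k q\<^esub> x \<in> carrier (piece N k q)" by simp
    note gs = *(1) gens_change_slot[OF *(1) this]
    show "basis R (\<mu>, \<nu>s @ (k, q, a \<odot>\<^bsub>piece N k q\<^esub> x) # \<nu>s', \<sigma>) \<ominus>\<^bsub>F n p\<^esub>
        (a \<odot>\<^bsub>F n p\<^esub> basis R (\<mu>, \<nu>s @ (k, q, x) # \<nu>s', \<sigma>)) \<in> carrier (F n p)"
      using gs[THEN basis_closed] *(2) by simp
  next
    fix \<mu> \<nu>s \<tau>s \<sigma>
    assume *: "(\<mu>, \<nu>s, \<sigma>) \<in> G n p" "list_all2 (\<lambda>\<nu> \<tau>. \<tau> permutes {1..arity \<nu>}) \<nu>s \<tau>s"
    then have p: "perms_of (map arity \<nu>s) \<tau>s" by (simp add: list.rel_map)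
    show "basis R (\<mu>, map2 (hact N) \<nu>s \<tau>s, \<sigma>) \<ominus>\<^bsub>F n p\<^esub>
        basis R (\<mu>, \<nu>s, sum_perm (map arity \<nu>s) \<tau>s \<circ> \<sigma>) \<in> carrier (F n p)"
      using gens_balanced[OF *(1) p, THEN basis_closed] by (rule F.M.minus_closed)
  next
    fix \<mu> \<nu>s \<tau> \<sigma> assume *: "(\<mu>, \<nu>s, \<sigma>) \<in> G n p" "\<tau> permutes {1..arity \<mu>}"
    show "basis R (hact M \<mu> \<tau>, \<nu>s, \<sigma>) \<ominus>\<^bsub>F n p\<^esub>
        ([koszul_sign \<tau> (map degr \<nu>s)] \<cdot>\<^bsub>F n p\<^esub>
          basis R (\<mu>, permuted \<tau> \<nu>s, block_perm \<tau> (map arity \<nu>s) \<circ> \<sigma>)) \<in> carrier (F n p)"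
      using gens_left_act[OF *, THEN basis_closed] by (intro F.M.minus_closed F.zsmult_closed)
  qed
qed

lemma H_submodule: "submodule (H n p) R (F n p)"
  and rels_in_H: "rels R M N n p \<subseteq> H n p"
  and H_least: "submodule K R (F n p) \<Longrightarrow> rels R M N n p \<subseteq> K \<Longrightarrow> H n p \<subseteq> K"
proof -
  interpret F: rmodule R "F n p" by (rule F_rmodule)
  let ?S = "{H. submodule H R (F n p) \<and> rels R M N n p \<subseteq> H}"
  \<comment> \<open>The family intersected is not empty: the whole free module contains the
    relations. Hence the intersection lies in the carrier.\<close>
  have ne: "carrier (F n p) \<in> ?S"
    using F.carrier_is_submodule rels_closed by blast
  note E = F.submoduleE
  show "submodule (H n p) R (F n p)"
    unfolding rel_submodule_def
  proof (rule F.submoduleI)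
    show "\<Inter>?S \<subseteq> carrier (F n p)" using ne by blast
    show "\<zero>\<^bsub>F n p\<^esub> \<in> \<Inter>?S"
      using subgroup.one_closed[OF submodule.axioms(1)] by fastforce
  qed (use E(3,4,5) in blast)+
  show "rels R M N n p \<subseteq> H n p" unfolding rel_submodule_def by blast
  show "submodule K R (F n p) \<Longrightarrow> rels R M N n p \<subseteq> K \<Longrightarrow> H n p \<subseteq> K"
    unfolding rel_submodule_def by blast
qed

lemma quotient: "module_quotient R (F n p) (H n p)"
  by (intro module_quotient.intro F_rmodule module_quotient_axioms.intro H_submodule)

lemma Q_module: "module R (Q n p)"
proof -
  interpret Z: module_quotient R "F n p" "H n p" by (rule quotient)
  show ?thesis unfolding composite_piece_def by (rule Z.quotient_is_module)
qed

lemma Q_rmodule: "rmodule R (Q n p)"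
  by (intro rmodule.intro Q_module)

lemma el_coset: "s \<in> G n p \<Longrightarrow> el s = H n p +>\<^bsub>F n p\<^esub> basis R s"
  by (cases s) (auto simp: elementary_def Let_def gens_iff)

lemma coset_Q_hom: "(\<lambda>x. H n p +>\<^bsub>F n p\<^esub> x) \<in> module_hom R (F n p) (Q n p)"
proof -
  interpret Z: module_quotient R "F n p" "H n p" by (rule quotient)
  show ?thesis unfolding composite_piece_def by (rule Z.coset_hom)
qed

lemma el_closed: "s \<in> G n p \<Longrightarrow> el s \<in> carrier (Q n p)"
  using module_hom_closed[OF coset_Q_hom basis_closed] by (simp add: el_coset)

text \<open>The elementary elements generate, being the cosets of the basis elements. Later
  identities between maps out of composites are tested on them.\<close>

lemma Q_hom_eqI:
  assumes "module R A" "f \<in> module_hom R (Q n p) A" "g \<in> module_hom R (Q n p) A"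
    and "\<And>\<mu> \<nu>s \<sigma>. (\<mu>, \<nu>s, \<sigma>) \<in> G n p \<Longrightarrow> f (el (\<mu>, \<nu>s, \<sigma>)) = g (el (\<mu>, \<nu>s, \<sigma>))"
    and "X \<in> carrier (Q n p)"
  shows "f X = g X"
proof -
  interpret Z: module_quotient R "F n p" "H n p" by (rule quotient)
  obtain x where x: "x \<in> carrier (F n p)" "X = H n p +>\<^bsub>F n p\<^esub> x"
    using assms(5) by (auto simp: composite_piece_def Z.carrier_quotient)
  have "f (H n p +>\<^bsub>F n p\<^esub> x) = g (H n p +>\<^bsub>F n p\<^esub> x)"
  proof (rule free_module_hom_eqI[OF assms(1) _ _ _ x(1)])
    show "(\<lambda>x. f (H n p +>\<^bsub>F n p\<^esub> x)) \<in> module_hom R (F n p) A"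
      "(\<lambda>x. g (H n p +>\<^bsub>F n p\<^esub> x)) \<in> module_hom R (F n p) A"
      by (rule module_hom_comp[OF coset_Q_hom], fact)+
    show "f (H n p +>\<^bsub>F n p\<^esub> basis R s) = g (H n p +>\<^bsub>F n p\<^esub> basis R s)" if "s \<in> G n p" for s
      using assms(4) that by (cases s) (auto simp flip: el_coset)
  qed
  with x show ?thesis by simp
qed

lemma H_eqI:
  assumes "x \<in> carrier (F n p)" "y \<in> carrier (F n p)" "x \<ominus>\<^bsub>F n p\<^esub> y \<in> rels R M N n p"
  shows "H n p +>\<^bsub>F n p\<^esub> x = H n p +>\<^bsub>F n p\<^esub> y"
proof -
  interpret Z: module_quotient R "F n p" "H n p" by (rule quotient)
  show ?thesis using Z.coset_eq_iff assms rels_in_H by blast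
qed

text \<open>The universal case: each clause is one of the families of relations, read in the
  quotient.\<close>

lemma el_compatible: "compatible R M N n p (Q n p) el"
proof (rule compatibleI)
  interpret F: rmodule R "F n p" by (rule F_rmodule)
  interpret Q: rmodule R "Q n p" by (rule Q_rmodule)
  interpret PM: rmodule R "piece M m q" for m q by (rule M.piece_rmodule)
  interpret PN: rmodule R "piece N m q" for m q by (rule N.piece_rmodule)
  note hom = module_hom_add[OF coset_Q_hom] module_hom_smult[OF coset_Q_hom]
    F.module_hom_zsmult[OF Q_module coset_Q_hom]
  show "(\<mu>, \<nu>s, \<sigma>) \<in> G n p \<Longrightarrow> el (\<mu>, \<nu>s, \<sigma>) \<in> carrier (Q n p)" for \<mu> \<nu>s \<sigma>
    by (rule el_closed)
  show "(\<lambda>x. el ((m, q, x), \<nu>s, \<sigma>)) \<in> module_hom R (piece M m q) (Q n p)"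
    if *: "((m, q, x0), \<nu>s, \<sigma>) \<in> G n p" for m q x0 \<nu>s \<sigma>
  proof (rule module_homI)
    note g = gens_change_left[OF *]
    show "el ((m, q, x), \<nu>s, \<sigma>) \<in> carrier (Q n p)" if "x \<in> carrier (piece M m q)" for x
      by (rule el_closed[OF g[OF that]])
    show "el ((m, q, x \<oplus>\<^bsub>piece M m q\<^esub> y), \<nu>s, \<sigma>) =
        el ((m, q, x), \<nu>s, \<sigma>) \<oplus>\<^bsub>Q n p\<^esub> el ((m, q, y), \<nu>s, \<sigma>)"
      if "x \<in> carrier (piece M m q)" "y \<in> carrier (piece M m q)" for x y
    proof -
      note gs = g[OF that(1)] g[OF that(2)] g[OF PM.add.m_closed[OF that]]
      show ?thesis
        unfolding gs[THEN el_coset] hom(1)[OF gs(1,2)[THEN basis_closed], symmetric]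
        by (rule H_eqI) (use gs that in \<open>auto intro!: basis_closed F.add.m_closed simp: rels_def Let_def\<close>)
    qed
    show "el ((m, q, a \<odot>\<^bsub>piece M m q\<^esub> x), \<nu>s, \<sigma>) = a \<odot>\<^bsub>Q n p\<^esub> el ((m, q, x), \<nu>s, \<sigma>)"
      if "a \<in> carrier R" "x \<in> carrier (piece M m q)" for a x
    proof -
      note gs = g[OF that(2)] g[OF PM.smult_closed[OF that]]
      show ?thesis
        unfolding gs[THEN el_coset] hom(2)[OF that(1) gs(1)[THEN basis_closed], symmetric]
        by (rule H_eqI) (use gs that in \<open>auto intro!: basis_closed F.smult_closed simp: rels_def Let_def\<close>)
    qed
  qed
  show "(\<lambda>x. el (\<mu>, \<nu>s @ (k, q, x) # \<nu>s', \<sigma>)) \<in> module_hom R (piece N k q) (Q n p)"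
    if *: "(\<mu>, \<nu>s @ (k, q, x0) # \<nu>s', \<sigma>) \<in> G n p" for \<mu> \<nu>s k q x0 \<nu>s' \<sigma>
  proof (rule module_homI)
    note g = gens_change_slot[OF *]
    show "el (\<mu>, \<nu>s @ (k, q, x) # \<nu>s', \<sigma>) \<in> carrier (Q n p)" if "x \<in> carrier (piece N k q)" for x
      by (rule el_closed[OF g[OF that]])
    show "el (\<mu>, \<nu>s @ (k, q, x \<oplus>\<^bsub>piece N k q\<^esub> y) # \<nu>s', \<sigma>) =
        el (\<mu>, \<nu>s @ (k, q, x) # \<nu>s', \<sigma>) \<oplus>\<^bsub>Q n p\<^esub> el (\<mu>, \<nu>s @ (k, q, y) # \<nu>s', \<sigma>)"
      if "x \<in> carrier (piece N k q)" "y \<in> carrier (piece N k q)" for x y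
    proof -
      note gs = g[OF that(1)] g[OF that(2)] g[OF PN.add.m_closed[OF that]]
      show ?thesis
        unfolding gs[THEN el_coset] hom(1)[OF gs(1,2)[THEN basis_closed], symmetric]
      proof (rule H_eqI)
        show "basis R (\<mu>, \<nu>s @ (k, q, x \<oplus>\<^bsub>piece N k q\<^esub> y) # \<nu>s', \<sigma>) \<ominus>\<^bsub>F n p\<^esub>
          (basis R (\<mu>, \<nu>s @ (k, q, x) # \<nu>s', \<sigma>) \<oplus>\<^bsub>F n p\<^esub>
            basis R (\<mu>, \<nu>s @ (k, q, y) # \<nu>s', \<sigma>)) \<in> rels R M N n p"
          unfolding rels_def Let_def
          \<comment> \<open>The chain of rules selects the third of the six families of relations,
            additivity in an inner factor.\<close>
          by (rule UnI1, rule UnI1, rule UnI1, rule UnI2, intro CollectI exI conjI, rule refl) (use gs(1) that in simp_all)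
      qed (use gs in \<open>auto intro!: basis_closed F.add.m_closed\<close>)
    qed
    show "el (\<mu>, \<nu>s @ (k, q, a \<odot>\<^bsub>piece N k q\<^esub> x) # \<nu>s', \<sigma>) =
        a \<odot>\<^bsub>Q n p\<^esub> el (\<mu>, \<nu>s @ (k, q, x) # \<nu>s', \<sigma>)"
      if "a \<in> carrier R" "x \<in> carrier (piece N k q)" for a x
    proof -
      note gs = g[OF that(2)] g[OF PN.smult_closed[OF that]]
      show ?thesis
        unfolding gs[THEN el_coset] hom(2)[OF that(1) gs(1)[THEN basis_closed], symmetric]
      proof (rule H_eqI)
        show "basis R (\<mu>, \<nu>s @ (k, q, a \<odot>\<^bsub>piece N k q\<^esub> x) # \<nu>s', \<sigma>) \<ominus>\<^bsub>F n p\<^esub>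
          (a \<odot>\<^bsub>F n p\<^esub> basis R (\<mu>, \<nu>s @ (k, q, x) # \<nu>s', \<sigma>)) \<in> rels R M N n p"
          unfolding rels_def Let_def
          by (rule UnI1, rule UnI1, rule UnI2, intro CollectI exI conjI, rule refl) (use gs(1) that in simp_all)
      qed (use gs that in \<open>auto intro!: basis_closed F.smult_closed\<close>)
    qed
  qed
  show "el (\<mu>, map2 (hact N) \<nu>s \<tau>s, \<sigma>) = el (\<mu>, \<nu>s, sum_perm (map arity \<nu>s) \<tau>s \<circ> \<sigma>)"
    if *: "(\<mu>, \<nu>s, \<sigma>) \<in> G n p" "perms_of (map arity \<nu>s) \<tau>s" for \<mu> \<nu>s \<tau>s \<sigma>
  proof -
    note gs = gens_balanced[OF *]
    show ?thesis
      unfolding gs[THEN el_coset]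
    proof (rule H_eqI)
      show "basis R (\<mu>, map2 (hact N) \<nu>s \<tau>s, \<sigma>) \<ominus>\<^bsub>F n p\<^esub>
          basis R (\<mu>, \<nu>s, sum_perm (map arity \<nu>s) \<tau>s \<circ> \<sigma>) \<in> rels R M N n p"
        using * unfolding rels_def Let_def list.rel_map
        by - (rule UnI1, rule UnI2, intro CollectI exI conjI, rule refl)
    qed (use gs in \<open>auto intro!: basis_closed\<close>)
  qed
  show "el (hact M \<mu> \<tau>, \<nu>s, \<sigma>) =
      [koszul_sign \<tau> (map degr \<nu>s)] \<cdot>\<^bsub>Q n p\<^esub> el (\<mu>, permuted \<tau> \<nu>s, block_perm \<tau> (map arity \<nu>s) \<circ> \<sigma>)"
    if *: "(\<mu>, \<nu>s, \<sigma>) \<in> G n p" "\<tau> permutes {1..arity \<mu>}" for \<mu> \<nu>s \<tau> \<sigma>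
  proof -
    note gs = gens_left_act[OF *]
    show ?thesis
      unfolding gs[THEN el_coset] hom(3)[OF gs(2)[THEN basis_closed], symmetric]
    proof (rule H_eqI)
      show "basis R (hact M \<mu> \<tau>, \<nu>s, \<sigma>) \<ominus>\<^bsub>F n p\<^esub>
          ([koszul_sign \<tau> (map degr \<nu>s)] \<cdot>\<^bsub>F n p\<^esub>
            basis R (\<mu>, permuted \<tau> \<nu>s, block_perm \<tau> (map arity \<nu>s) \<circ> \<sigma>)) \<in> rels R M N n p"
        using * unfolding rels_def Let_def
        by - (rule UnI2, intro CollectI exI conjI, rule refl)
    qed (use gs in \<open>auto intro!: basis_closed F.zsmult_closed\<close>)
  qed
qed

lemmas el_left_hom = compatibleD(2)[OF el_compatible]
lemmas el_slot_hom = compatibleD(3)[OF el_compatible]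
lemmas el_balanced = compatibleD(4)[OF el_compatible]
lemmas el_left_act = compatibleD(5)[OF el_compatible]

text \<open>Universal property: the linear extension of \<open>\<phi>\<close> kills every relation,
  its kernel is a submodule, and the relation submodule is the smallest one containing the
  relations.\<close>

lemma
  assumes A: "module R A" and \<phi>: "compatible R M N n p A \<phi>"
  shows composite_lift_hom: "quotient_lift R A \<phi> \<in> module_hom R (Q n p) A"
    and composite_lift_el: "s \<in> G n p \<Longrightarrow> quotient_lift R A \<phi> (el s) = \<phi> s"
proof -
  interpret F: rmodule R "F n p" by (rule F_rmodule)
  interpret A: rmodule R A by (intro rmodule.intro A)
  interpret PM: rmodule R "piece M m q" for m q by (rule M.piece_rmodule)
  interpret PN: rmodule R "piece N m q" for m q by (rule N.piece_rmodule)
  note D = compatibleD[OF \<phi>]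
  have hom: "free_lift R A \<phi> \<in> module_hom R (F n p) A"
    by (rule free_lift_hom[OF A D(1)])
  have val: "free_lift R A \<phi> (basis R s) = \<phi> s" if "s \<in> G n p" for s
    by (rule free_lift_basis[OF A D(1) that])
  let ?K = "{x \<in> carrier (F n p). free_lift R A \<phi> x = \<zero>\<^bsub>A\<^esub>}"
  have diff: "x \<ominus>\<^bsub>F n p\<^esub> y \<in> ?K"
    if "x \<in> carrier (F n p)" "y \<in> carrier (F n p)" "free_lift R A \<phi> x = free_lift R A \<phi> y" for x y
    using that module_hom_closed[OF hom that(2)]
    by (simp add: F.module_hom_diff[OF A hom]) (simp add: a_minus_def A.M.r_neg)
  note homs = module_hom_add[OF hom] module_hom_smult[OF hom] F.module_hom_zsmult[OF A hom]
  have "rels R M N n p \<subseteq> ?K"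
    unfolding rels_def Let_def
  proof (intro Un_least subsetI; elim CollectE exE conjE; hypsubst)
    fix m q x y \<nu>s \<sigma> assume *: "((m, q, x), \<nu>s, \<sigma>) \<in> G n p" "y \<in> carrier (piece M m q)"
    have x: "x \<in> carrier (piece M m q)" by (rule gens_left_closed[OF *(1)])
    note gs = *(1) gens_change_left[OF *] gens_change_left[OF *(1) PM.add.m_closed[OF x *(2)]]
    show "basis R ((m, q, x \<oplus>\<^bsub>piece M m q\<^esub> y), \<nu>s, \<sigma>) \<ominus>\<^bsub>F n p\<^esub>
        (basis R ((m, q, x), \<nu>s, \<sigma>) \<oplus>\<^bsub>F n p\<^esub> basis R ((m, q, y), \<nu>s, \<sigma>)) \<in> ?K"
      by (rule diff) (simp_all add: homs gs basis_closed val module_hom_add[OF D(2)[OF *(1)]] x *(2))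
  next
    fix m q a x \<nu>s \<sigma> assume *: "((m, q, x), \<nu>s, \<sigma>) \<in> G n p" "a \<in> carrier R"
    have x: "x \<in> carrier (piece M m q)" by (rule gens_left_closed[OF *(1)])
    note gs = *(1) gens_change_left[OF *(1) PM.smult_closed[OF *(2) x]]
    show "basis R ((m, q, a \<odot>\<^bsub>piece M m q\<^esub> x), \<nu>s, \<sigma>) \<ominus>\<^bsub>F n p\<^esub>
        (a \<odot>\<^bsub>F n p\<^esub> basis R ((m, q, x), \<nu>s, \<sigma>)) \<in> ?K"
      by (rule diff) (simp_all add: homs gs basis_closed val module_hom_smult[OF D(2)[OF *(1)]] x *(2))
  next
    fix \<mu> \<nu>s k q x y \<nu>s' \<sigma>
    assume *: "(\<mu>, \<nu>s @ (k, q, x) # \<nu>s', \<sigma>) \<in> G n p" "y \<in> carrier (piece N k q)"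
    have x: "x \<in> carrier (piece N k q)" by (rule gens_slot_closed[OF *(1)])
    note gs = *(1) gens_change_slot[OF *] gens_change_slot[OF *(1) PN.add.m_closed[OF x *(2)]]
    show "basis R (\<mu>, \<nu>s @ (k, q, x \<oplus>\<^bsub>piece N k q\<^esub> y) # \<nu>s', \<sigma>) \<ominus>\<^bsub>F n p\<^esub>
        (basis R (\<mu>, \<nu>s @ (k, q, x) # \<nu>s', \<sigma>) \<oplus>\<^bsub>F n p\<^esub>
          basis R (\<mu>, \<nu>s @ (k, q, y) # \<nu>s', \<sigma>)) \<in> ?K"
      by (rule diff) (simp_all add: homs gs basis_closed val module_hom_add[OF D(3)[OF *(1)]] x *(2))
  next
    fix \<mu> \<nu>s k q a x \<nu>s' \<sigma>
    assume *: "(\<mu>, \<nu>s @ (k, q, x) # \<nu>s', \<sigma>) \<in> G n p" "a \<in> carrier R"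
    have x: "x \<in> carrier (piece N k q)" by (rule gens_slot_closed[OF *(1)])
    note gs = *(1) gens_change_slot[OF *(1) PN.smult_closed[OF *(2) x]]
    show "basis R (\<mu>, \<nu>s @ (k, q, a \<odot>\<^bsub>piece N k q\<^esub> x) # \<nu>s', \<sigma>) \<ominus>\<^bsub>F n p\<^esub>
        (a \<odot>\<^bsub>F n p\<^esub> basis R (\<mu>, \<nu>s @ (k, q, x) # \<nu>s', \<sigma>)) \<in> ?K"
      by (rule diff) (simp_all add: homs gs basis_closed val module_hom_smult[OF D(3)[OF *(1)]] x *(2))
  next
    fix \<mu> \<nu>s \<tau>s \<sigma>
    assume *: "(\<mu>, \<nu>s, \<sigma>) \<in> G n p" "list_all2 (\<lambda>\<nu> \<tau>. \<tau> permutes {1..arity \<nu>}) \<nu>s \<tau>s"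
    then have p: "perms_of (map arity \<nu>s) \<tau>s" by (simp add: list.rel_map)
    note gs = gens_balanced[OF *(1) p]
    show "basis R (\<mu>, map2 (hact N) \<nu>s \<tau>s, \<sigma>) \<ominus>\<^bsub>F n p\<^esub>
        basis R (\<mu>, \<nu>s, sum_perm (map arity \<nu>s) \<tau>s \<circ> \<sigma>) \<in> ?K"
      using D(4)[OF *(1) p] by (intro diff basis_closed gs) (simp only: val gs)
  next
    fix \<mu> \<nu>s \<tau> \<sigma> assume *: "(\<mu>, \<nu>s, \<sigma>) \<in> G n p" "\<tau> permutes {1..arity \<mu>}"
    note gs = gens_left_act[OF *]
    show "basis R (hact M \<mu> \<tau>, \<nu>s, \<sigma>) \<ominus>\<^bsub>F n p\<^esub>
        ([koszul_sign \<tau> (map degr \<nu>s)] \<cdot>\<^bsub>F n p\<^esub>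
          basis R (\<mu>, permuted \<tau> \<nu>s, block_perm \<tau> (map arity \<nu>s) \<circ> \<sigma>)) \<in> ?K"
      using D(5)[OF *] by (intro diff basis_closed F.zsmult_closed gs) (simp only: homs val gs basis_closed)
  qed
  from H_least[OF F.kernel_submodule[OF A hom] this]
  have vanish: "free_lift R A \<phi> h = \<zero>\<^bsub>A\<^esub>" if "h \<in> H n p" for h using that by blast
  show "quotient_lift R A \<phi> \<in> module_hom R (Q n p) A"
    unfolding composite_piece_def
    by (rule quotient_lift_hom[OF is_cring A H_submodule D(1) vanish])
  show "quotient_lift R A \<phi> (el s) = \<phi> s" if "s \<in> G n p"
    using quotient_lift_coset[OF is_cring A H_submodule D(1) vanish basis_closed[OF that]] val that
    by (simp add: el_coset)
qed

end

section \<open>Action, differential and morphisms of composite products\<close>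

lemma permuted_update:
  assumes "\<tau> permutes {1..length xs}" "i < length xs"
  shows "permuted \<tau> (xs[i := x]) = (permuted \<tau> xs)[\<tau> (Suc i) - 1 := x]"
proof (rule permuted_eqI)
  show "\<tau> permutes {1..length xs}" by fact
  fix j assume j: "j < length xs"
  have r: "\<tau> (Suc j) \<in> {1..length xs}" "\<tau> (Suc i) \<in> {1..length xs}"
    using assms j permutes_range_Suc by blast+
  have "\<tau> (Suc j) - 1 = \<tau> (Suc i) - 1 \<longleftrightarrow> \<tau> (Suc j) = \<tau> (Suc i)" using r by auto
  also have "\<dots> \<longleftrightarrow> j = i" using permutes_inj[OF assms(1)] by (auto dest: injD)
  finally have "\<tau> (Suc j) - 1 = \<tau> (Suc i) - 1 \<longleftrightarrow> j = i" .
  then show "(permuted \<tau> xs)[\<tau> (Suc i) - 1 := x] ! (\<tau> (Suc j) - 1) = xs[i := x] ! j"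
    using nth_permuted[OF assms(1) j] r j by (cases "i = j") auto
qed auto

lemma sum_perm_single: "\<tau> permutes {1..n} \<Longrightarrow> sum_perm [n] [\<tau>] = \<tau>"
proof -
  assume \<tau>: "\<tau> permutes {1..n}"
  show "sum_perm [n] [\<tau>] = \<tau>"
  proof
    fix x
    have "x \<le> n \<or> \<tau> x = x"
      using permutes_not_in[OF \<tau>, of x] by auto
    then show "sum_perm [n] [\<tau>] x = \<tau> x"
      using sum_perm_Cons[of "[]" "[]", OF _ \<tau>] by (cases "x \<le> n") (auto simp: perm_sum_def)
  qed
qed

lemma sum_perm_ids: "set \<tau>s \<subseteq> {id} \<Longrightarrow> length \<tau>s = length ns \<Longrightarrow> sum_perm ns \<tau>s = id"
proof (induction ns arbitrary: \<tau>s)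
  case (Cons n ns)
  then obtain \<tau>s' where \<tau>s: "\<tau>s = id # \<tau>s'" "set \<tau>s' \<subseteq> {id}" "length \<tau>s' = length ns"
    by (cases \<tau>s) (auto simp: id_def)
  have "perms_of ns \<tau>s'"
    unfolding list_all2_iff
  proof (intro conjI ballI)
    fix z assume "z \<in> set (zip ns \<tau>s')"
    then have "snd z = id" using \<tau>s(2) by (metis prod.collapse set_zip_rightD singletonD subsetD)
    then show "case z of (n, \<tau>) \<Rightarrow> \<tau> permutes {1..n}" by (simp only: case_prod_unfold permutes_id)
  qed (use \<tau>s(3) in simp)
  have "perm_sum n id id = id" by (auto simp: perm_sum_def fun_eq_iff)
  with sum_perm_Cons[OF \<open>perms_of ns \<tau>s'\<close> permutes_id, of n] Cons.IH[OF \<tau>s(2,3)] \<tau>s(1) show ?case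
    by (simp only:)
qed simp

lemma block_perm_id: "block_perm id ns = id"
proof (rule permutes_eqI_permuted)
  show "block_perm id ns permutes {1..sum_list ns}" by (rule block_perm_permutes[OF permutes_id])
  show "id permutes {1..sum_list ns}" by (rule permutes_id)
  fix xs :: "nat list" assume "length xs = sum_list ns"
  then obtain xss where "xs = concat xss" "map length xss = ns" by (rule obtain_blocks)
  then show "permuted (block_perm id ns) xs = permuted id xs"
    using permuted_block_perm[OF permutes_id, of xss] by simp
qed

text \<open>Blocks of size one are single letters. This is the situation of the right unitor, where
  the relevant inner factors all have arity one.\<close>

lemma block_perm_ones:
  assumes "\<tau> permutes {1..n}"
  shows "block_perm \<tau> (replicate n 1) = \<tau>"
proof (rule permutes_eqI_permuted)
  show "block_perm \<tau> (replicate n 1) permutes {1..n}"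
    using block_perm_permutes[of \<tau> "replicate n 1"] assms by (simp add: sum_list_replicate)
  fix xs :: "nat list" assume len: "length xs = n"
  let ?xss = "map (\<lambda>x. [x]) xs"
  have 1: "concat ?xss = xs" "concat (map (\<lambda>x. [x]) (permuted \<tau> xs)) = permuted \<tau> xs"
    by (simp_all add: concat_map_singleton)
  have 2: "map length ?xss = replicate n 1"
    using len by (simp add: comp_def map_replicate_const)
  have "permuted (block_perm \<tau> (map length ?xss)) (concat ?xss) = concat (permuted \<tau> ?xss)"
    using assms len by (intro permuted_block_perm) simp
  also have "permuted \<tau> ?xss = map (\<lambda>x. [x]) (permuted \<tau> xs)"
    using assms len by (simp add: permuted_map)
  finally show "permuted (block_perm \<tau> (replicate n 1)) xs = permuted \<tau> xs"
    unfolding 1 2 .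
qed (rule assms)

lemma permutes_singleton: "\<tau> permutes {1..1::nat} \<Longrightarrow> \<tau> = id"
  by (simp add: id_def)

lemma composite_simps [simp]:
  "piece (composite R M N) = composite_piece R M N"
  "act (composite R M N) n p X \<tau> = quotient_lift R (composite_piece R M N n p)
     (\<lambda>(\<mu>, \<nu>s, \<sigma>). elementary R M N (\<mu>, \<nu>s, \<sigma> \<circ> \<tau>)) X"
  "dif (composite R M N) n p X = quotient_lift R (composite_piece R M N n (p - 1)) (elementary_dif R M N) X"
  by (simp_all add: composite_def)

lemma (in rmodule) zero_hom: "(\<lambda>x. \<zero>\<^bsub>M\<^esub>) \<in> module_hom R A M"
  by (rule module_homI) auto

lemma (in rmodule) module_hom_finsum_fun:
  assumes "module R A" "finite I" "\<And>i. i \<in> I \<Longrightarrow> f i \<in> module_hom R A M"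
  shows "(\<lambda>x. \<Oplus>\<^bsub>M\<^esub>i\<in>I. f i x) \<in> module_hom R A M"
  using assms(2,3)
proof (induction I rule: finite_induct)
  case empty
  show ?case by (simp add: zero_hom)
next
  case (insert i I)
  note h = module_hom_closed[OF insert.prems]
  have "(\<lambda>x. f i x \<oplus>\<^bsub>M\<^esub> (\<Oplus>\<^bsub>M\<^esub>i\<in>I. f i x)) \<in> module_hom R A M"
    using insert by (intro module_hom_compose_add[OF assms(1)]) auto
  then show ?case
  proof (rule module_hom_cong)
    show "f i x \<oplus>\<^bsub>M\<^esub> (\<Oplus>\<^bsub>M\<^esub>i\<in>I. f i x) = (\<Oplus>\<^bsub>M\<^esub>i\<in>insert i I. f i x)" if "x \<in> carrier A" for x
      using insert.hyps h that by (subst M.finsum_insert) auto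
  qed (rule assms(1))
qed

context composite_product
begin

text \<open>The balancing relations multiply the permutation from the left, so multiplication from
  the right passes through them.\<close>

lemma act_compatible:
  assumes \<tau>: "\<tau> permutes {1..n}"
  shows "compatible R M N n p (Q n p) (\<lambda>(\<mu>, \<nu>s, \<sigma>). el (\<mu>, \<nu>s, \<sigma> \<circ> \<tau>))"
proof (rule compatibleI, simp_all only: case_prod_conv)
  note g = gens_compose[OF _ \<tau>]
  show "el (\<mu>, \<nu>s, \<sigma> \<circ> \<tau>) \<in> carrier (Q n p)" if "(\<mu>, \<nu>s, \<sigma>) \<in> G n p" for \<mu> \<nu>s \<sigma>
    by (rule el_closed[OF g[OF that]])
  show "(\<lambda>x. el ((m, q, x), \<nu>s, \<sigma> \<circ> \<tau>)) \<in> module_hom R (piece M m q) (Q n p)"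
    if "((m, q, x), \<nu>s, \<sigma>) \<in> G n p" for m q x \<nu>s \<sigma>
    by (rule el_left_hom[OF g[OF that]])
  show "(\<lambda>x. el (\<mu>, \<nu>s @ (k, q, x) # \<nu>s', \<sigma> \<circ> \<tau>)) \<in> module_hom R (piece N k q) (Q n p)"
    if "(\<mu>, \<nu>s @ (k, q, x) # \<nu>s', \<sigma>) \<in> G n p" for \<mu> \<nu>s k q x \<nu>s' \<sigma>
    by (rule el_slot_hom[OF g[OF that]])
  show "el (\<mu>, map2 (hact N) \<nu>s \<tau>s, \<sigma> \<circ> \<tau>) = el (\<mu>, \<nu>s, sum_perm (map arity \<nu>s) \<tau>s \<circ> \<sigma> \<circ> \<tau>)"
    if "(\<mu>, \<nu>s, \<sigma>) \<in> G n p" "perms_of (map arity \<nu>s) \<tau>s" for \<mu> \<nu>s \<sigma> \<tau>s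
    using el_balanced[OF g[OF that(1)] that(2)] by (simp only: comp_assoc)
  show "el (hact M \<mu> \<rho>, \<nu>s, \<sigma> \<circ> \<tau>) = [koszul_sign \<rho> (map degr \<nu>s)] \<cdot>\<^bsub>Q n p\<^esub>
      el (\<mu>, permuted \<rho> \<nu>s, block_perm \<rho> (map arity \<nu>s) \<circ> \<sigma> \<circ> \<tau>)"
    if "(\<mu>, \<nu>s, \<sigma>) \<in> G n p" "\<rho> permutes {1..arity \<mu>}" for \<mu> \<nu>s \<sigma> \<rho>
    using el_left_act[OF g[OF that(1)] that(2)] by (simp only: comp_assoc)
qed

lemma act_el:
  assumes "(\<mu>, \<nu>s, \<sigma>) \<in> G n p" "\<tau> permutes {1..n}"
  shows "act (composite R M N) n p (el (\<mu>, \<nu>s, \<sigma>)) \<tau> = el (\<mu>, \<nu>s, \<sigma> \<circ> \<tau>)"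
  using composite_lift_el[OF Q_module act_compatible[OF assms(2)] assms(1)] by simp

lemma composite_act_hom:
  assumes "\<tau> permutes {1..n}"
  shows "(\<lambda>X. act (composite R M N) n p X \<tau>) \<in> module_hom R (Q n p) (Q n p)"
  using composite_lift_hom[OF Q_module act_compatible[OF assms]] by simp

lemma composite_graded_smodule: "graded_smodule R (composite R M N)"
proof (rule graded_smodule.intro[OF is_cring], rule graded_smodule_axioms.intro)
  fix n p
  show "module R (piece (composite R M N) n p)" by (simp add: Q_module)
  show "(\<lambda>X. act (composite R M N) n p X \<tau>) \<in>
      module_hom R (piece (composite R M N) n p) (piece (composite R M N) n p)"
    if "\<tau> permutes {1..n}" for \<tau>
    using composite_act_hom[OF that] by simp
  show "act (composite R M N) n p X id = X" if "X \<in> carrier (piece (composite R M N) n p)" for X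
  proof (rule Q_hom_eqI[OF Q_module composite_act_hom[OF permutes_id] module_hom_id])
    show "act (composite R M N) n p (el (\<mu>, \<nu>s, \<sigma>)) id = el (\<mu>, \<nu>s, \<sigma>)"
      if "(\<mu>, \<nu>s, \<sigma>) \<in> G n p" for \<mu> \<nu>s \<sigma>
      using act_el[OF that permutes_id] by (simp only: comp_id)
  qed (use that in simp)
  show "act (composite R M N) n p (act (composite R M N) n p X \<sigma>) \<tau> = act (composite R M N) n p X (\<sigma> \<circ> \<tau>)"
    if "\<sigma> permutes {1..n}" "\<tau> permutes {1..n}" "X \<in> carrier (piece (composite R M N) n p)" for \<sigma> \<tau> X
  proof (rule Q_hom_eqI[OF Q_module
        module_hom_comp[OF composite_act_hom[OF that(1)] composite_act_hom[OF that(2)]]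
        composite_act_hom[OF permutes_compose[OF that(2,1)]]])
    show "act (composite R M N) n p (act (composite R M N) n p (el (\<mu>, \<nu>s, \<rho>)) \<sigma>) \<tau> =
        act (composite R M N) n p (el (\<mu>, \<nu>s, \<rho>)) (\<sigma> \<circ> \<tau>)" if g: "(\<mu>, \<nu>s, \<rho>) \<in> G n p" for \<mu> \<nu>s \<rho>
      unfolding act_el[OF g \<open>\<sigma> permutes {1..n}\<close>]
        act_el[OF gens_compose[OF g \<open>\<sigma> permutes {1..n}\<close>] \<open>\<tau> permutes {1..n}\<close>]
        act_el[OF g permutes_compose[OF \<open>\<tau> permutes {1..n}\<close> \<open>\<sigma> permutes {1..n}\<close>]]
      by (simp only: comp_assoc)
  qed (use that in simp)
qed

end

text \<open>Linear equivariant maps: the properties by which a pair of maps carries the relations of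
  one composite to those of another.\<close>

definition smodule_hom ::
    "('r, 'm) ring_scheme \<Rightarrow> ('r, 'a) smodule \<Rightarrow> ('r, 'b) smodule \<Rightarrow> (nat \<Rightarrow> int \<Rightarrow> 'a \<Rightarrow> 'b) set" where
  "smodule_hom R M N = {f. \<forall>n p. f n p \<in> module_hom R (piece M n p) (piece N n p) \<and>
     (\<forall>x\<in>carrier (piece M n p). \<forall>\<sigma>. \<sigma> permutes {1..n} \<longrightarrow> f n p (act M n p x \<sigma>) = act N n p (f n p x) \<sigma>)}"

lemma
  assumes "f \<in> smodule_hom R M N"
  shows smodule_hom_hom: "f n p \<in> module_hom R (piece M n p) (piece N n p)"
    and smodule_hom_act: "x \<in> carrier (piece M n p) \<Longrightarrow> \<sigma> permutes {1..n} \<Longrightarrow>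
      f n p (act M n p x \<sigma>) = act N n p (f n p x) \<sigma>"
  using assms by (auto simp: smodule_hom_def)

lemma smodule_hom_id: "(\<lambda>_ _ x. x) \<in> smodule_hom R M M"
  by (auto simp: smodule_hom_def module_hom_id)

lemma dg_smodule_hom_subset: "dg_smodule_hom R M N \<subseteq> smodule_hom R M N"
  by (auto simp: smodule_hom_def dg_smodule_hom_def)

lemma hmap_closed: "f \<in> smodule_hom R M N \<Longrightarrow> \<mu> \<in> homogs M \<Longrightarrow> hmap f \<mu> \<in> homogs N"
  by (cases \<mu>) (simp add: module_hom_closed[OF smodule_hom_hom])

lemma hmap_hact:
  "f \<in> smodule_hom R M N \<Longrightarrow> \<mu> \<in> homogs M \<Longrightarrow> \<sigma> permutes {1..arity \<mu>} \<Longrightarrow>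
   hmap f (hact M \<mu> \<sigma>) = hact N (hmap f \<mu>) \<sigma>"
  by (cases \<mu>) (simp add: smodule_hom_act del: One_nat_def)

lemma map2_hmap_hact:
  assumes "f \<in> smodule_hom R M N" "set \<mu>s \<subseteq> homogs M" "perms_of (map arity \<mu>s) \<sigma>s"
  shows "map (hmap f) (map2 (hact M) \<mu>s \<sigma>s) = map2 (hact N) (map (hmap f) \<mu>s) \<sigma>s"
  using assms(2,3)
proof (induction \<mu>s arbitrary: \<sigma>s)
  case (Cons \<mu> \<mu>s)
  then obtain \<sigma> \<sigma>s' where \<sigma>: "\<sigma>s = \<sigma> # \<sigma>s'" "\<sigma> permutes {1..arity \<mu>}" "perms_of (map arity \<mu>s) \<sigma>s'"
    by (auto simp: list_all2_Cons1 simp del: One_nat_def)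
  with Cons.IH[OF _ \<sigma>(3)] Cons.prems(1) hmap_hact[OF assms(1) _ \<sigma>(2)] show ?case by simp
qed simp

lemma map_arity_hmap [simp]: "map arity (map (hmap f) \<mu>s) = map arity \<mu>s"
  and map_degr_hmap [simp]: "map degr (map (hmap f) \<mu>s) = map degr \<mu>s"
  by simp_all

locale composite_morphism =
  composite_product R M N + T: composite_product R M' N'
  for R (structure) and M :: "('a, 'b) smodule" and N :: "('a, 'c) smodule"
    and M' :: "('a, 'd) smodule" and N' :: "('a, 'e) smodule" +
  fixes f g
  assumes f: "f \<in> smodule_hom R M M'" and g: "g \<in> smodule_hom R N N'"
begin

lemma gens_map: "(\<mu>, \<nu>s, \<sigma>) \<in> G n p \<Longrightarrow> (hmap f \<mu>, map (hmap g) \<nu>s, \<sigma>) \<in> gens M' N' n p"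
  unfolding gens_iff map_arity_hmap map_degr_hmap
  using hmap_closed[OF f] hmap_closed[OF g] by auto

text \<open>The maps preserve arities and degrees, so the signs and block permutations in the
  relations are the same before and after; equivariance carries the two balancing relations
  over.\<close>

lemma map_compatible:
  "compatible R M N n p (T.Q n p) (\<lambda>(\<mu>, \<nu>s, \<sigma>). T.el (hmap f \<mu>, map (hmap g) \<nu>s, \<sigma>))"
proof (rule compatibleI, simp_all only: case_prod_conv)
  show "T.el (hmap f \<mu>, map (hmap g) \<nu>s, \<sigma>) \<in> carrier (T.Q n p)"
    if "(\<mu>, \<nu>s, \<sigma>) \<in> G n p" for \<mu> \<nu>s \<sigma>
    by (rule T.el_closed[OF gens_map[OF that]])
  show "(\<lambda>x. T.el (hmap f (m, q, x), map (hmap g) \<nu>s, \<sigma>)) \<in> module_hom R (piece M m q) (T.Q n p)"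
    if "((m, q, x), \<nu>s, \<sigma>) \<in> G n p" for m q x \<nu>s \<sigma>
    using module_hom_comp[OF smodule_hom_hom[OF f] T.el_left_hom[OF gens_map[OF that, unfolded hmap_simp]]]
    by simp
  show "(\<lambda>x. T.el (hmap f \<mu>, map (hmap g) (\<nu>s @ (k, q, x) # \<nu>s'), \<sigma>)) \<in> module_hom R (piece N k q) (T.Q n p)"
    if "(\<mu>, \<nu>s @ (k, q, x) # \<nu>s', \<sigma>) \<in> G n p" for \<mu> \<nu>s k q x \<nu>s' \<sigma>
    using module_hom_comp[OF smodule_hom_hom[OF g]
        T.el_slot_hom[OF gens_map[OF that, unfolded map_append list.map hmap_simp]]]
    by simp
  show "T.el (hmap f \<mu>, map (hmap g) (map2 (hact N) \<nu>s \<tau>s), \<sigma>) =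
      T.el (hmap f \<mu>, map (hmap g) \<nu>s, sum_perm (map arity \<nu>s) \<tau>s \<circ> \<sigma>)"
    if *: "(\<mu>, \<nu>s, \<sigma>) \<in> G n p" "perms_of (map arity \<nu>s) \<tau>s" for \<mu> \<nu>s \<sigma> \<tau>s
  proof -
    have "set \<nu>s \<subseteq> homogs N" using * by (simp add: gens_iff)
    from map2_hmap_hact[OF g this *(2)] show ?thesis
      using T.el_balanced[OF gens_map[OF *(1)], of \<tau>s] *(2) by (simp only: map_arity_hmap)
  qed
  show "T.el (hmap f (hact M \<mu> \<rho>), map (hmap g) \<nu>s, \<sigma>) = [koszul_sign \<rho> (map degr \<nu>s)] \<cdot>\<^bsub>T.Q n p\<^esub>
      T.el (hmap f \<mu>, map (hmap g) (permuted \<rho> \<nu>s), block_perm \<rho> (map arity \<nu>s) \<circ> \<sigma>)"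
    if *: "(\<mu>, \<nu>s, \<sigma>) \<in> G n p" "\<rho> permutes {1..arity \<mu>}" for \<mu> \<nu>s \<sigma> \<rho>
  proof -
    have "\<mu> \<in> homogs M" "\<rho> permutes {1..length \<nu>s}" using * by (auto simp: gens_iff)
    then show ?thesis
      using T.el_left_act[OF gens_map[OF *(1)], of \<rho>] *(2)
      by (simp only: map_arity_hmap map_degr_hmap hmap_hact[OF f] permuted_map arity_hmap)
  qed
qed

lemma composite_map_hom: "composite_map R M' N' f g n p \<in> module_hom R (Q n p) (T.Q n p)"
  unfolding composite_map_def by (rule composite_lift_hom[OF T.Q_module map_compatible])

lemma composite_map_el:
  "(\<mu>, \<nu>s, \<sigma>) \<in> G n p \<Longrightarrow>
   composite_map R M' N' f g n p (el (\<mu>, \<nu>s, \<sigma>)) = T.el (hmap f \<mu>, map (hmap g) \<nu>s, \<sigma>)"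
  unfolding composite_map_def by (simp add: composite_lift_el[OF T.Q_module map_compatible])

end

subsection \<open>The differential\<close>

locale dg_composite_product = R?: cring R + M: dg_smodule R M + N: dg_smodule R N
  for R (structure) and M :: "('a, 'b) smodule" and N :: "('a, 'c) smodule"
begin

sublocale composite_product R M N ..

lemma gens_dif_left: "(\<mu>, \<nu>s, \<sigma>) \<in> G n p \<Longrightarrow> (hdif M \<mu>, \<nu>s, \<sigma>) \<in> G n (p - 1)"
  using M.hdif_closed by (auto simp: gens_iff)

lemma gens_dif_slot:
  assumes "(\<mu>, \<nu>s, \<sigma>) \<in> G n p" "i < length \<nu>s"
  shows "(\<mu>, \<nu>s[i := hdif N (\<nu>s ! i)], \<sigma>) \<in> G n (p - 1)"
proof -
  obtain \<nu>1 \<nu> \<nu>2 where "\<nu>s = \<nu>1 @ \<nu> # \<nu>2" "length \<nu>1 = i"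
    using id_take_nth_drop[OF assms(2)] assms(2) by (metis length_take min.absorb4)
  then show ?thesis
    using assms(1) N.hdif_closed[of \<nu>] by (clarsimp simp: gens_iff)
qed

lemma map_arity_update: "map arity (\<nu>s[i := hdif N (\<nu>s ! i)]) = map arity \<nu>s"
  by (metis arity_hdif list_update_id map_update)

abbreviation dif_sign :: "'b homog \<Rightarrow> 'c homog list \<Rightarrow> nat \<Rightarrow> int" where
  "dif_sign \<mu> \<nu>s i \<equiv> minus_one_pow (degr \<mu> + sum_list (map degr (take i \<nu>s)))"

lemma elementary_dif_eq:
  assumes "(\<mu>, \<nu>s, \<sigma>) \<in> G n p"
  shows "elementary_dif R M N (\<mu>, \<nu>s, \<sigma>) = el (hdif M \<mu>, \<nu>s, \<sigma>) \<oplus>\<^bsub>Q n (p - 1)\<^esub>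
     (\<Oplus>\<^bsub>Q n (p - 1)\<^esub>i\<in>{..<length \<nu>s}. [dif_sign \<mu> \<nu>s i] \<cdot>\<^bsub>Q n (p - 1)\<^esub>
        el (\<mu>, \<nu>s[i := hdif N (\<nu>s ! i)], \<sigma>))"
  using assms by (simp add: elementary_dif_def gens_iff Let_def)

text \<open>Except in the last clause each summand satisfies the relation separately, with unchanged
  sign, because the differentials are linear, equivariant and preserve arities. In the last clause
  the summands are permuted as well, and their signs change.\<close>

lemma dif_compatible: "compatible R M N n p (Q n (p - 1)) (elementary_dif R M N)"
proof (rule compatibleI)
  interpret Q: rmodule R "Q n (p - 1)" by (rule Q_rmodule)
  let ?Q = "Q n (p - 1)"
  have term_closed: "[(c::int)] \<cdot>\<^bsub>?Q\<^esub> el (\<mu>, \<nu>s[i := hdif N (\<nu>s ! i)], \<sigma>) \<in> carrier ?Q"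
    if "(\<mu>, \<nu>s, \<sigma>) \<in> G n p" "i < length \<nu>s" for \<mu> \<nu>s \<sigma> i c
    by (intro Q.zsmult_closed el_closed gens_dif_slot that)
  show "elementary_dif R M N (\<mu>, \<nu>s, \<sigma>) \<in> carrier ?Q" if *: "(\<mu>, \<nu>s, \<sigma>) \<in> G n p" for \<mu> \<nu>s \<sigma>
    unfolding elementary_dif_eq[OF *]
    by (intro Q.M.add.m_closed el_closed[OF gens_dif_left[OF *]] Q.M.finsum_closed) (auto intro: term_closed *)
  show "(\<lambda>x. elementary_dif R M N ((m, q, x), \<nu>s, \<sigma>)) \<in> module_hom R (piece M m q) ?Q"
    if *: "((m, q, x0), \<nu>s, \<sigma>) \<in> G n p" for m q x0 \<nu>s \<sigma>
  proof -
    have "(\<lambda>x. el ((m, q - 1, dif M m q x), \<nu>s, \<sigma>) \<oplus>\<^bsub>?Q\<^esub>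
        (\<Oplus>\<^bsub>?Q\<^esub>i\<in>{..<length \<nu>s}. [minus_one_pow (q + sum_list (map degr (take i \<nu>s)))] \<cdot>\<^bsub>?Q\<^esub>
          el ((m, q, x), \<nu>s[i := hdif N (\<nu>s ! i)], \<sigma>))) \<in> module_hom R (piece M m q) ?Q"
    proof (intro Q.module_hom_compose_add Q.module_hom_finsum_fun Q.module_hom_zsmult_fun M.piece_module)
      show "(\<lambda>x. el ((m, q - 1, dif M m q x), \<nu>s, \<sigma>)) \<in> module_hom R (piece M m q) ?Q"
        using module_hom_comp[OF M.dif_hom el_left_hom[OF gens_dif_left[OF *, unfolded hdif_simp]]] by simp
      show "(\<lambda>x. el ((m, q, x), \<nu>s[i := hdif N (\<nu>s ! i)], \<sigma>)) \<in> module_hom R (piece M m q) ?Q"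
        if "i \<in> {..<length \<nu>s}" for i
        using el_left_hom[OF gens_dif_slot[OF *]] that by simp
    qed simp
    then show ?thesis
      by (rule module_hom_cong)
        (simp_all add: elementary_dif_eq[OF gens_change_left[OF *]] M.piece_module)
  qed
  show "(\<lambda>x. elementary_dif R M N (\<mu>, \<nu>s @ (k, q, x) # \<nu>s', \<sigma>)) \<in> module_hom R (piece N k q) ?Q"
    if *: "(\<mu>, \<nu>s @ (k, q, x0) # \<nu>s', \<sigma>) \<in> G n p" for \<mu> \<nu>s k q x0 \<nu>s' \<sigma>
  proof -
    let ?l = "\<lambda>x. \<nu>s @ (k, q, x) # \<nu>s'"
    have "(\<lambda>x. el (hdif M \<mu>, ?l x, \<sigma>) \<oplus>\<^bsub>?Q\<^esub>
        (\<Oplus>\<^bsub>?Q\<^esub>i\<in>{..<length (?l x0)}.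
          [minus_one_pow (degr \<mu> + sum_list (take i (map degr \<nu>s @ q # map degr \<nu>s')))] \<cdot>\<^bsub>?Q\<^esub>
          el (\<mu>, (?l x)[i := hdif N (?l x ! i)], \<sigma>))) \<in> module_hom R (piece N k q) ?Q"
    proof (intro Q.module_hom_compose_add Q.module_hom_finsum_fun Q.module_hom_zsmult_fun N.piece_module)
      show "(\<lambda>x. el (hdif M \<mu>, ?l x, \<sigma>)) \<in> module_hom R (piece N k q) ?Q"
        by (rule el_slot_hom[OF gens_dif_left[OF *]])
      show "(\<lambda>x. el (\<mu>, (?l x)[i := hdif N (?l x ! i)], \<sigma>)) \<in> module_hom R (piece N k q) ?Q"
        if "i \<in> {..<length (?l x0)}" for i
      proof -
        note g = gens_dif_slot[OF *, of i]
        \<comment> \<open>The differentiated factor lies before, at or after the varying slot; only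
          in the second case is the differential applied to the varying element.\<close>
        consider "i < length \<nu>s" | "i = length \<nu>s" | j where "i = length \<nu>s + Suc j"
          by (metis less_imp_Suc_add linorder_neqE_nat add_Suc_right)
        then show ?thesis
        proof cases
          case 1
          with g that el_slot_hom[of \<mu> "\<nu>s[i := hdif N (\<nu>s ! i)]" k q x0 \<nu>s' \<sigma>] show ?thesis
            by (simp add: list_update_append nth_append)
        next
          case 2
          with g that el_slot_hom[of \<mu> \<nu>s k "q - 1" "dif N k q x0" \<nu>s' \<sigma>, THEN module_hom_comp[OF N.dif_hom]]
          show ?thesis by (simp add: list_update_append nth_append)
        next
          case 3
          with g that el_slot_hom[of \<mu> \<nu>s k q x0 "\<nu>s'[j := hdif N (\<nu>s' ! j)]" \<sigma>] show ?thesis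
            by (simp add: list_update_append nth_append)
        qed
      qed
    qed simp
    then show ?thesis
      by (rule module_hom_cong)
        (simp_all add: elementary_dif_eq[OF gens_change_slot[OF *]] N.piece_module take_map[symmetric])
  qed
  show "elementary_dif R M N (\<mu>, map2 (hact N) \<nu>s \<tau>s, \<sigma>) =
      elementary_dif R M N (\<mu>, \<nu>s, sum_perm (map arity \<nu>s) \<tau>s \<circ> \<sigma>)"
    if *: "(\<mu>, \<nu>s, \<sigma>) \<in> G n p" "perms_of (map arity \<nu>s) \<tau>s" for \<mu> \<nu>s \<tau>s \<sigma>
  proof -
    note gs = gens_balanced[OF *]
    have sub: "set \<nu>s \<subseteq> homogs N" using * by (simp add: gens_iff)
    note m = N.map2_hact_closed[OF sub *(2)]
    have len: "length \<tau>s = length \<nu>s" using list_all2_lengthD[OF *(2)] by simp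
    have e1: "el (hdif M \<mu>, map2 (hact N) \<nu>s \<tau>s, \<sigma>) = el (hdif M \<mu>, \<nu>s, sum_perm (map arity \<nu>s) \<tau>s \<circ> \<sigma>)"
      by (rule el_balanced[OF gens_dif_left[OF *(1)] *(2)])
    have e2: "el (\<mu>, (map2 (hact N) \<nu>s \<tau>s)[i := hdif N (map2 (hact N) \<nu>s \<tau>s ! i)], \<sigma>) =
        el (\<mu>, \<nu>s[i := hdif N (\<nu>s ! i)], sum_perm (map arity \<nu>s) \<tau>s \<circ> \<sigma>)" if i: "i < length \<nu>s" for i
    proof -
      have "\<nu>s ! i \<in> homogs N" "\<tau>s ! i permutes {1..arity (\<nu>s ! i)}"
        using i sub *(2) by (auto simp: list_all2_conv_all_nth simp del: One_nat_def)
      then have "hdif N (map2 (hact N) \<nu>s \<tau>s ! i) = hact N (hdif N (\<nu>s ! i)) (\<tau>s ! i)"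
        using i len by (simp add: N.hdif_hact del: One_nat_def)
      then have "(map2 (hact N) \<nu>s \<tau>s)[i := hdif N (map2 (hact N) \<nu>s \<tau>s ! i)] =
          map2 (hact N) (\<nu>s[i := hdif N (\<nu>s ! i)]) \<tau>s"
        using i len by (intro nth_equalityI) (auto simp: nth_list_update)
      then show ?thesis
        using el_balanced[OF gens_dif_slot[OF *(1) i], of \<tau>s] *(2) by (simp only: map_arity_update)
    qed
    have e3: "dif_sign \<mu> (map2 (hact N) \<nu>s \<tau>s) i = dif_sign \<mu> \<nu>s i" for i
      using m(3) by (simp only: take_map[symmetric])
    have e4: "length (map2 (hact N) \<nu>s \<tau>s) = length \<nu>s" using len by simp
    show ?thesis
      unfolding elementary_dif_eq[OF gs(1)] elementary_dif_eq[OF gs(2)] e1 e3 e4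
    proof (rule arg_cong[of _ _ "add ?Q _"], rule Q.M.finsum_cong'[OF refl])
      show "[dif_sign \<mu> \<nu>s i] \<cdot>\<^bsub>?Q\<^esub> el (\<mu>, (map2 (hact N) \<nu>s \<tau>s)[i := hdif N (map2 (hact N) \<nu>s \<tau>s ! i)], \<sigma>) =
          [dif_sign \<mu> \<nu>s i] \<cdot>\<^bsub>?Q\<^esub> el (\<mu>, \<nu>s[i := hdif N (\<nu>s ! i)], sum_perm (map arity \<nu>s) \<tau>s \<circ> \<sigma>)"
        if "i \<in> {..<length \<nu>s}" for i
        using that by (simp only: e2 lessThan_iff)
    qed (use term_closed[OF gs(2)] in auto)
  qed
  show "elementary_dif R M N (hact M \<mu> \<tau>, \<nu>s, \<sigma>) = [koszul_sign \<tau> (map degr \<nu>s)] \<cdot>\<^bsub>?Q\<^esub>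
      elementary_dif R M N (\<mu>, permuted \<tau> \<nu>s, block_perm \<tau> (map arity \<nu>s) \<circ> \<sigma>)"
    if *: "(\<mu>, \<nu>s, \<sigma>) \<in> G n p" "\<tau> permutes {1..arity \<mu>}" for \<mu> \<nu>s \<tau> \<sigma>
  proof -
    note gs = gens_left_act[OF *]
    let ?K = "koszul_sign \<tau> (map degr \<nu>s)" and ?\<sigma> = "block_perm \<tau> (map arity \<nu>s) \<circ> \<sigma>"
    let ?t = "\<lambda>i. \<tau> (Suc i) - 1" and ?\<nu> = "permuted \<tau> \<nu>s"
    have \<mu>: "\<mu> \<in> homogs M" "arity \<mu> = length \<nu>s" using * by (auto simp: gens_iff)
    note \<tau> = *(2)[unfolded \<mu>(2)]
    \<comment> \<open>The summand for place \<open>k\<close> after the rearrangement.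
      Differentiating factor \<open>i\<close> before it corresponds to place
      \<open>\<tau> (Suc i) - 1\<close> after it, and \<open>koszul_sign_update\<close> matches the
      signs.\<close>
    define T where "T k = [dif_sign \<mu> ?\<nu> k] \<cdot>\<^bsub>?Q\<^esub> el (\<mu>, ?\<nu>[k := hdif N (?\<nu> ! k)], ?\<sigma>)" for k
    have T: "T k \<in> carrier ?Q" if "k < length \<nu>s" for k
      unfolding T_def using that by (intro term_closed[OF gs(2)]) simp
    have tr: "\<tau> (Suc i) - Suc 0 < length \<nu>s" if "i < length \<nu>s" for i
      using permutes_range_Suc[OF \<tau> that] by auto
    have left: "el (hdif M (hact M \<mu> \<tau>), \<nu>s, \<sigma>) = [?K] \<cdot>\<^bsub>?Q\<^esub> el (hdif M \<mu>, ?\<nu>, ?\<sigma>)"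
      using el_left_act[OF gens_dif_left[OF *(1)], of \<tau>] * \<mu> by (simp add: M.hdif_hact del: One_nat_def)
    have "[dif_sign (hact M \<mu> \<tau>) \<nu>s i] \<cdot>\<^bsub>?Q\<^esub> el (hact M \<mu> \<tau>, \<nu>s[i := hdif N (\<nu>s ! i)], \<sigma>) =
        [?K] \<cdot>\<^bsub>?Q\<^esub> T (?t i)" if i: "i < length \<nu>s" for i
    proof -
      let ?qs = "map degr \<nu>s"
      have ti: "?t i < length \<nu>s" using permutes_range_Suc[OF \<tau> i] by auto
      note g = gens_dif_slot[OF *(1) i]
      have d: "map degr (\<nu>s[i := hdif N (\<nu>s ! i)]) = ?qs[i := ?qs ! i - 1]"
        using i by (simp add: map_update)
      have p: "permuted \<tau> (\<nu>s[i := hdif N (\<nu>s ! i)]) = ?\<nu>[?t i := hdif N (?\<nu> ! ?t i)]"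
        using permuted_update[OF \<tau> i] nth_permuted[OF \<tau> i] by simp
      have "el (hact M \<mu> \<tau>, \<nu>s[i := hdif N (\<nu>s ! i)], \<sigma>) =
          [koszul_sign \<tau> (?qs[i := ?qs ! i - 1])] \<cdot>\<^bsub>?Q\<^esub> el (\<mu>, ?\<nu>[?t i := hdif N (?\<nu> ! ?t i)], ?\<sigma>)"
        using el_left_act[OF g *(2)] by (simp only: d p map_arity_update)
      moreover have "dif_sign (hact M \<mu> \<tau>) \<nu>s i * koszul_sign \<tau> (?qs[i := ?qs ! i - 1]) =
          ?K * dif_sign \<mu> ?\<nu> (?t i)"
        using koszul_sign_update[of \<tau> ?qs i] \<tau> i permuted_map[OF \<tau>, of degr]
        by (simp add: minus_one_pow_add take_map algebra_simps)
      ultimately show ?thesis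
        unfolding T_def using gens_dif_slot[OF gs(2), of "?t i"] ti
        by (simp add: Q.zsmult_zsmult el_closed)
    qed
    then have "(\<Oplus>\<^bsub>?Q\<^esub>i\<in>{..<length \<nu>s}. [dif_sign (hact M \<mu> \<tau>) \<nu>s i] \<cdot>\<^bsub>?Q\<^esub>
          el (hact M \<mu> \<tau>, \<nu>s[i := hdif N (\<nu>s ! i)], \<sigma>)) = (\<Oplus>\<^bsub>?Q\<^esub>i\<in>{..<length \<nu>s}. [?K] \<cdot>\<^bsub>?Q\<^esub> T (?t i))"
      using T tr by (intro Q.M.finsum_cong') auto
    also have "\<dots> = (\<Oplus>\<^bsub>?Q\<^esub>k\<in>?t ` {..<length \<nu>s}. [?K] \<cdot>\<^bsub>?Q\<^esub> T k)"
      using T permutes_index_bij[OF \<tau>] by (intro Q.M.finsum_reindex[symmetric]) (auto simp: bij_betw_def)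
    also have "?t ` {..<length \<nu>s} = {..<length \<nu>s}"
      using permutes_index_bij[OF \<tau>] by (simp add: bij_betw_def)
    also have "(\<Oplus>\<^bsub>?Q\<^esub>k\<in>{..<length \<nu>s}. [?K] \<cdot>\<^bsub>?Q\<^esub> T k) = [?K] \<cdot>\<^bsub>?Q\<^esub> (\<Oplus>\<^bsub>?Q\<^esub>k\<in>{..<length \<nu>s}. T k)"
      by (rule Q.module_hom_finsum[OF Q_module Q.module_hom_zsmult_fun[OF module_hom_id], symmetric])
        (use T in auto)
    finally have right: "(\<Oplus>\<^bsub>?Q\<^esub>i\<in>{..<length \<nu>s}. [dif_sign (hact M \<mu> \<tau>) \<nu>s i] \<cdot>\<^bsub>?Q\<^esub>
          el (hact M \<mu> \<tau>, \<nu>s[i := hdif N (\<nu>s ! i)], \<sigma>)) = [?K] \<cdot>\<^bsub>?Q\<^esub> (\<Oplus>\<^bsub>?Q\<^esub>k\<in>{..<length \<nu>s}. T k)" .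
    have "el (hdif M \<mu>, ?\<nu>, ?\<sigma>) \<in> carrier ?Q" by (rule el_closed[OF gens_dif_left[OF gs(2)]])
    moreover have "(\<Oplus>\<^bsub>?Q\<^esub>k\<in>{..<length \<nu>s}. T k) \<in> carrier ?Q"
      using T by (intro Q.M.finsum_closed) auto
    ultimately show ?thesis
      unfolding elementary_dif_eq[OF gs(1)] elementary_dif_eq[OF gs(2)] left right
      by (simp add: Q.zsmult_add_right T_def[abs_def])
  qed
qed

lemma composite_dif_hom: "dif (composite R M N) n p \<in> module_hom R (Q n p) (Q n (p - 1))"
  using composite_lift_hom[OF Q_module dif_compatible] by (simp add: composite_def)

lemma composite_dif_el:
  "(\<mu>, \<nu>s, \<sigma>) \<in> G n p \<Longrightarrow> dif (composite R M N) n p (el (\<mu>, \<nu>s, \<sigma>)) = elementary_dif R M N (\<mu>, \<nu>s, \<sigma>)"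
  using composite_lift_el[OF Q_module dif_compatible] by simp

end

section \<open>The associator\<close>

text \<open>The order of quantifiers matters: the surrounding lists are chosen independently of
  \<open>z\<close>, so an expression stays linear in the entry after rearrangement.\<close>

lemma permuted_slot:
  assumes "\<tau> permutes {1..length \<alpha> + 1 + length \<beta>}"
  shows "\<exists>\<alpha>' \<beta>'. \<forall>z. permuted \<tau> (\<alpha> @ z # \<beta>) = \<alpha>' @ z # \<beta>'"
proof -
  \<comment> \<open>A placeholder fills the slot; its neighbours after rearrangement are the lists
    sought, whatever entry replaces it.\<close>
  let ?l = "\<alpha> @ undefined # \<beta>" and ?t = "\<tau> (Suc (length \<alpha>)) - 1"
  have \<tau>: "\<tau> permutes {1..length ?l}" using assms by simp
  have t: "?t < length (permuted \<tau> ?l)"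
    using permutes_range_Suc[OF \<tau>, of "length \<alpha>"] by auto
  have "permuted \<tau> (\<alpha> @ z # \<beta>) = take ?t (permuted \<tau> ?l) @ z # drop (Suc ?t) (permuted \<tau> ?l)" for z
    using permuted_update[OF \<tau>, of "length \<alpha>" z] upd_conv_take_nth_drop[OF t, of z] by simp
  then show ?thesis by blast
qed

text \<open>The same uniformity for cutting into blocks: which block receives the slot depends on
  positions only.\<close>

lemma chunks_slot:
  "length \<alpha> + 1 + length \<beta> = sum_list ns \<Longrightarrow>
   \<exists>css1 c1 c2 css2. \<forall>z. chunks ns (\<alpha> @ z # \<beta>) = css1 @ (c1 @ z # c2) # css2"
proof (induction ns arbitrary: \<alpha> \<beta>)
  case (Cons n ns)
  show ?case
  proof (cases "length \<alpha> < n")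
    case True
    then obtain k where "n = Suc (length \<alpha> + k)" using less_imp_Suc_add by blast
    then have "\<forall>z. chunks (n # ns) (\<alpha> @ z # \<beta>) = [] @ (\<alpha> @ z # take k \<beta>) # chunks ns (drop k \<beta>)"
      by (simp add: Suc_diff_le)
    then show ?thesis by (intro exI)
  next
    case False
    then have "length (drop n \<alpha>) + 1 + length \<beta> = sum_list ns" using Cons.prems by simp
    from Cons.IH[OF this] obtain css1 c1 c2 css2 where
      *: "\<forall>z. chunks ns (drop n \<alpha> @ z # \<beta>) = css1 @ (c1 @ z # c2) # css2" by (elim exE)
    have "\<forall>z. chunks (n # ns) (\<alpha> @ z # \<beta>) = (take n \<alpha> # css1) @ (c1 @ z # c2) # css2"
      using False * by simp
    then show ?thesis by (intro exI)
  qed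
qed simp

lemma chunks_map2:
  "length xs = length ys \<Longrightarrow> chunks ns (map2 f xs ys) = map2 (map2 f) (chunks ns xs) (chunks ns ys)"
  by (induction ns arbitrary: xs ys) (auto simp: take_map drop_map take_zip drop_zip)

lemma distrib_sign_cong:
  "map sum_list rss = map sum_list rss' \<Longrightarrow> distrib_sign qs rss = distrib_sign qs rss'"
  by (simp add: distrib_sign_def flip: take_map)

definition hscale :: "('r, 'a) smodule \<Rightarrow> int \<Rightarrow> 'a homog \<Rightarrow> 'a homog" where
  "hscale M c = (\<lambda>(n, p, x). (n, p, [c] \<cdot>\<^bsub>piece M n p\<^esub> x))"

lemma hscale_simp [simp]: "hscale M c (n, p, x) = (n, p, [c] \<cdot>\<^bsub>piece M n p\<^esub> x)"
  by (simp add: hscale_def)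

text \<open>Pulls out the Koszul signs that arise inside several inner factors at once. The prefix
  \<open>\<alpha>\<close> holds the slots already treated in the induction.\<close>

lemma (in composite_product) el_hscale:
  assumes "(\<mu>, \<alpha> @ \<nu>s, \<sigma>) \<in> G n p" "length cs = length \<nu>s"
  shows "el (\<mu>, \<alpha> @ map2 (hscale N) cs \<nu>s, \<sigma>) = [prod_list cs] \<cdot>\<^bsub>Q n p\<^esub> el (\<mu>, \<alpha> @ \<nu>s, \<sigma>)"
  using assms
proof (induction \<nu>s arbitrary: \<alpha> cs)
  case Nil
  interpret Q: rmodule R "Q n p" by (rule Q_rmodule)
  show ?case using Nil el_closed by simp
next
  case (Cons \<nu> \<nu>s)
  interpret Q: rmodule R "Q n p" by (rule Q_rmodule)
  obtain c cs' where cs: "cs = c # cs'" "length cs' = length \<nu>s" using Cons.prems(2) by (cases cs) auto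
  obtain k q x where \<nu>: "\<nu> = (k, q, x)" by (cases \<nu>)
  interpret PN: rmodule R "piece N k q" by (rule N.piece_rmodule)
  have x: "x \<in> carrier (piece N k q)"
    using Cons.prems(1) gens_slot_closed unfolding \<nu> by blast
  have hom: "(\<lambda>x. el (\<mu>, \<alpha> @ (k, q, x) # \<nu>s, \<sigma>)) \<in> module_hom R (piece N k q) (Q n p)"
    using Cons.prems(1) unfolding \<nu> by (rule el_slot_hom)
  have g: "(\<mu>, (\<alpha> @ [hscale N c \<nu>]) @ \<nu>s, \<sigma>) \<in> G n p"
    using gens_change_slot[OF Cons.prems(1)[unfolded \<nu>] PN.zsmult_closed[OF x]] by (simp add: \<nu>)
  have "el (\<mu>, \<alpha> @ map2 (hscale N) cs (\<nu> # \<nu>s), \<sigma>) = [prod_list cs'] \<cdot>\<^bsub>Q n p\<^esub> el (\<mu>, \<alpha> @ hscale N c \<nu> # \<nu>s, \<sigma>)"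
    using Cons.IH[OF g cs(2)] by (simp add: cs(1))
  also have "el (\<mu>, \<alpha> @ hscale N c \<nu> # \<nu>s, \<sigma>) = [c] \<cdot>\<^bsub>Q n p\<^esub> el (\<mu>, \<alpha> @ \<nu> # \<nu>s, \<sigma>)"
    using PN.module_hom_zsmult[OF Q_module hom x] by (simp add: \<nu>)
  finally show ?case
    using el_closed[OF Cons.prems(1)] by (simp add: cs(1) Q.zsmult_zsmult mult.commute)
qed

lemma (in rmodule) module_hom_smult_fun:
  assumes "f \<in> module_hom R A M" "a \<in> carrier R"
  shows "(\<lambda>x. a \<odot>\<^bsub>M\<^esub> f x) \<in> module_hom R A M"
  using assms module_hom_closed[OF assms(1)]
  by (intro module_homI)
    (simp_all add: module_hom_add[OF assms(1)] module_hom_smult[OF assms(1)] smult_r_distr R.m_comm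
      flip: smult_assoc1)

section \<open>The associator respects the relations of both nested composites\<close>

locale composite_triple =
  R?: cring R + M: graded_smodule R M + N: graded_smodule R N + P: graded_smodule R P
  for R (structure) and M :: "('a, 'b) smodule" and N :: "('a, 'c) smodule" and P :: "('a, 'd) smodule"
begin

sublocale MN: composite_product R M N ..
sublocale NP: composite_product R N P ..
sublocale MN: graded_smodule R "composite R M N" by (rule MN.composite_graded_smodule)
sublocale NP: graded_smodule R "composite R N P" by (rule NP.composite_graded_smodule)
sublocale L: composite_product R "composite R M N" P ..
sublocale T: composite_product R M "composite R N P" ..

definition inner :: "'c homog \<Rightarrow> 'd homog list \<Rightarrow> (('c, 'd) gen \<Rightarrow> 'a) set homog" where
  "inner \<nu> \<pi>s = (sum_list (map arity \<pi>s), degr \<nu> + sum_list (map degr \<pi>s), NP.el (\<nu>, \<pi>s, id))"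

lemma inner_simps [simp]:
  "arity (inner \<nu> \<pi>s) = sum_list (map arity \<pi>s)"
  "degr (inner \<nu> \<pi>s) = degr \<nu> + sum_list (map degr \<pi>s)"
  by (simp_all add: inner_def)

lemma inner_gens:
  "\<nu> \<in> homogs N \<Longrightarrow> set \<pi>s \<subseteq> homogs P \<Longrightarrow> arity \<nu> = length \<pi>s \<Longrightarrow>
   (\<nu>, \<pi>s, id) \<in> NP.G (sum_list (map arity \<pi>s)) (degr \<nu> + sum_list (map degr \<pi>s))"
  unfolding gens_iff by (simp only: permutes_id)

lemma inner_closed:
  "\<nu> \<in> homogs N \<Longrightarrow> set \<pi>s \<subseteq> homogs P \<Longrightarrow> arity \<nu> = length \<pi>s \<Longrightarrow> inner \<nu> \<pi>s \<in> homogs (composite R N P)"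
  unfolding inner_def using NP.el_closed[OF inner_gens] by simp

lemma map2_inner:
  assumes "map arity \<nu>s = map length \<pi>ss" "set \<nu>s \<subseteq> homogs N" "set (concat \<pi>ss) \<subseteq> homogs P"
  shows "set (map2 inner \<nu>s \<pi>ss) \<subseteq> homogs (composite R N P)"
    and "map arity (map2 inner \<nu>s \<pi>ss) = map sum_list (map (map arity) \<pi>ss)"
    and "map degr (map2 inner \<nu>s \<pi>ss) = map2 (+) (map degr \<nu>s) (map sum_list (map (map degr) \<pi>ss))"
proof -
  have "set (map2 inner \<nu>s \<pi>ss) \<subseteq> homogs (composite R N P) \<and>
    map arity (map2 inner \<nu>s \<pi>ss) = map sum_list (map (map arity) \<pi>ss) \<and>
    map degr (map2 inner \<nu>s \<pi>ss) = map2 (+) (map degr \<nu>s) (map sum_list (map (map degr) \<pi>ss))"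
    using assms
  proof (induction \<nu>s arbitrary: \<pi>ss)
    case (Cons \<nu> \<nu>s)
    then obtain \<pi>s \<pi>ss' where \<pi>: "\<pi>ss = \<pi>s # \<pi>ss'" by (cases \<pi>ss) auto
    with Cons inner_closed[of \<nu> \<pi>s] show ?case by simp
  qed simp
  then show "set (map2 inner \<nu>s \<pi>ss) \<subseteq> homogs (composite R N P)"
    "map arity (map2 inner \<nu>s \<pi>ss) = map sum_list (map (map arity) \<pi>ss)"
    "map degr (map2 inner \<nu>s \<pi>ss) = map2 (+) (map degr \<nu>s) (map sum_list (map (map degr) \<pi>ss))"
    by blast+
qed

abbreviation "asc n p \<equiv> associator_gen R M N P n p"

text \<open>The admissible arguments of \<open>asc n p\<close>, with \<open>\<pi>ss\<close> the factors distributed over \<open>\<nu>s\<close>.\<close>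

definition admissible where
  "admissible n p \<mu> \<nu>s \<tau> \<pi>s \<sigma> \<pi>ss \<longleftrightarrow>
     (\<mu>, \<nu>s, \<tau>) \<in> MN.G (length \<pi>s) (p - sum_list (map degr \<pi>s)) \<and> set \<pi>s \<subseteq> homogs P \<and>
     sum_list (map arity \<pi>s) = n \<and> \<sigma> permutes {1..n} \<and>
     permuted \<tau> \<pi>s = concat \<pi>ss \<and> map length \<pi>ss = map arity \<nu>s"

lemma admissibleI:
  assumes "(\<mu>, \<nu>s, \<tau>) \<in> MN.G (length \<pi>s) (p - sum_list (map degr \<pi>s))" "set \<pi>s \<subseteq> homogs P"
    "sum_list (map arity \<pi>s) = n" "\<sigma> permutes {1..n}"
  obtains \<pi>ss where "admissible n p \<mu> \<nu>s \<tau> \<pi>s \<sigma> \<pi>ss"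
proof -
  have "length (permuted \<tau> \<pi>s) = sum_list (map arity \<nu>s)" using assms(1) by (simp add: gens_iff)
  then obtain \<pi>ss where "permuted \<tau> \<pi>s = concat \<pi>ss" "map length \<pi>ss = map arity \<nu>s"
    by (rule obtain_blocks)
  with assms that show ?thesis unfolding admissible_def by blast
qed

lemma admissibleD:
  assumes "admissible n p \<mu> \<nu>s \<tau> \<pi>s \<sigma> \<pi>ss"
  shows "(\<mu>, \<nu>s, \<tau>) \<in> MN.G (length \<pi>s) (p - sum_list (map degr \<pi>s))"
    and "set \<pi>s \<subseteq> homogs P" "sum_list (map arity \<pi>s) = n" "\<sigma> permutes {1..n}"
    and "permuted \<tau> \<pi>s = concat \<pi>ss" "map length \<pi>ss = map arity \<nu>s"
    and "\<mu> \<in> homogs M" "set \<nu>s \<subseteq> homogs N" "arity \<mu> = length \<nu>s" "\<tau> permutes {1..length \<pi>s}"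
    and "degr \<mu> + sum_list (map degr \<nu>s) + sum_list (map degr \<pi>s) = p"
    and "chunks (map arity \<nu>s) (permuted \<tau> \<pi>s) = \<pi>ss" "length \<pi>ss = length \<nu>s"
    and "permuted \<tau> (map arity \<pi>s) = concat (map (map arity) \<pi>ss)"
    and "permuted \<tau> (map degr \<pi>s) = concat (map (map degr) \<pi>ss)"
    and "set (concat \<pi>ss) \<subseteq> homogs P"
    and "block_perm \<tau> (map arity \<pi>s) permutes {1..n}"
proof -
  note a = assms[unfolded admissible_def]
  show b: "(\<mu>, \<nu>s, \<tau>) \<in> MN.G (length \<pi>s) (p - sum_list (map degr \<pi>s))"
    "set \<pi>s \<subseteq> homogs P" "sum_list (map arity \<pi>s) = n" "\<sigma> permutes {1..n}"
    "permuted \<tau> \<pi>s = concat \<pi>ss" "map length \<pi>ss = map arity \<nu>s"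
    using a by blast+
  show c: "\<mu> \<in> homogs M" "set \<nu>s \<subseteq> homogs N" "arity \<mu> = length \<nu>s" "\<tau> permutes {1..length \<pi>s}"
    "degr \<mu> + sum_list (map degr \<nu>s) + sum_list (map degr \<pi>s) = p"
    using b(1) by (simp_all add: gens_iff)
  show "chunks (map arity \<nu>s) (permuted \<tau> \<pi>s) = \<pi>ss"
    using b(5,6) by (simp add: chunks_concat)
  show "length \<pi>ss = length \<nu>s" using arg_cong[OF b(6), of length] by simp
  show "permuted \<tau> (map arity \<pi>s) = concat (map (map arity) \<pi>ss)"
    "permuted \<tau> (map degr \<pi>s) = concat (map (map degr) \<pi>ss)"
    using b(5) permuted_map[OF c(4)] by (simp_all add: map_concat)
  show "set (concat \<pi>ss) \<subseteq> homogs P" using set_permuted[OF c(4)] b(2,5) by simp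
  show "block_perm \<tau> (map arity \<pi>s) permutes {1..n}"
    using block_perm_permutes[of \<tau> "map arity \<pi>s"] c(4) b(3) by simp
qed

lemma asc_eq:
  assumes "admissible n p \<mu> \<nu>s \<tau> \<pi>s \<sigma> \<pi>ss"
  shows "asc n p (\<mu>, \<nu>s, \<tau>) \<pi>s \<sigma> =
    [(koszul_sign \<tau> (map degr \<pi>s) * distrib_sign (map degr \<nu>s) (map (map degr) \<pi>ss))] \<cdot>\<^bsub>T.Q n p\<^esub>
      T.el (\<mu>, map2 inner \<nu>s \<pi>ss, block_perm \<tau> (map arity \<pi>s) \<circ> \<sigma>)"
  unfolding associator_gen_def Let_def case_prod_conv gen_simps admissibleD(12)[OF assms] inner_def[abs_def]
  by (rule refl)

lemma asc_gens:
  assumes "admissible n p \<mu> \<nu>s \<tau> \<pi>s \<sigma> \<pi>ss"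
  shows "(\<mu>, map2 inner \<nu>s \<pi>ss, block_perm \<tau> (map arity \<pi>s) \<circ> \<sigma>) \<in> T.G n p"
proof -
  note a = admissibleD[OF assms]
  note m = map2_inner[OF a(6)[symmetric] a(8,16)]
  have ss: "sum_list (map sum_list xss) = sum_list (concat xss)" for xss :: "'z::comm_monoid_add list list"
    by (induction xss) auto
  have "sum_list (map arity (map2 inner \<nu>s \<pi>ss)) = sum_list (permuted \<tau> (map arity \<pi>s))"
    unfolding m(2) a(14) by (rule ss)
  also have "\<dots> = n" using a(3,10) by (simp add: sum_list_permuted)
  finally have n: "sum_list (map arity (map2 inner \<nu>s \<pi>ss)) = n" .
  have s2: "sum_list (map2 (+) xs ys) = sum_list xs + sum_list ys" if "length xs = length ys"
    for xs ys :: "int list" using that by (induction xs ys rule: list_induct2) auto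
  have "sum_list (map degr (map2 inner \<nu>s \<pi>ss)) = sum_list (map degr \<nu>s) + sum_list (permuted \<tau> (map degr \<pi>s))"
    unfolding m(3) a(15) ss[symmetric] by (rule s2) (use a(13) in simp)
  also have "sum_list (permuted \<tau> (map degr \<pi>s)) = sum_list (map degr \<pi>s)"
    using a(10) by (simp add: sum_list_permuted)
  finally have d: "degr \<mu> + sum_list (map degr (map2 inner \<nu>s \<pi>ss)) = p" using a(11) by simp
  show ?thesis
    unfolding gens_iff using n d m(1) a(7,9,13) permutes_compose[OF a(4,17)] by simp
qed

lemma asc_closed:
  assumes "admissible n p \<mu> \<nu>s \<tau> \<pi>s \<sigma> \<pi>ss"
  shows "asc n p (\<mu>, \<nu>s, \<tau>) \<pi>s \<sigma> \<in> carrier (T.Q n p)"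
proof -
  interpret Q: rmodule R "T.Q n p" by (rule T.Q_rmodule)
  show ?thesis unfolding asc_eq[OF assms] by (intro Q.zsmult_closed T.el_closed asc_gens[OF assms])
qed

lemma asc_left_hom:
  assumes adm: "admissible n p (m, q, x) \<nu>s \<tau> \<pi>s \<sigma> \<pi>ss"
  shows "(\<lambda>x. asc n p ((m, q, x), \<nu>s, \<tau>) \<pi>s \<sigma>) \<in> module_hom R (piece M m q) (T.Q n p)"
proof -
  interpret Q: rmodule R "T.Q n p" by (rule T.Q_rmodule)
  show ?thesis
  proof (rule module_hom_cong[OF Q.module_hom_zsmult_fun[OF T.el_left_hom[OF asc_gens[OF adm]]] _ M.piece_module])
    fix y assume "y \<in> carrier (piece M m q)"
    then have "admissible n p (m, q, y) \<nu>s \<tau> \<pi>s \<sigma> \<pi>ss"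
      using adm unfolding admissible_def gens_iff by simp
    from asc_eq[OF this, symmetric]
    show "[(koszul_sign \<tau> (map degr \<pi>s) * distrib_sign (map degr \<nu>s) (map (map degr) \<pi>ss))] \<cdot>\<^bsub>T.Q n p\<^esub>
        T.el ((m, q, y), map2 inner \<nu>s \<pi>ss, block_perm \<tau> (map arity \<pi>s) \<circ> \<sigma>) = asc n p ((m, q, y), \<nu>s, \<tau>) \<pi>s \<sigma>" .
  qed
qed

text \<open>The factor is the outer element of one inner composite, which fills one slot of the
  whole; two linear maps compose, and the sign in front depends only on degrees.\<close>

lemma asc_middle_hom:
  assumes adm: "admissible n p \<mu> (\<nu>s @ (k, r, x) # \<nu>s') \<tau> \<pi>s \<sigma> \<pi>ss"
  shows "(\<lambda>x. asc n p (\<mu>, \<nu>s @ (k, r, x) # \<nu>s', \<tau>) \<pi>s \<sigma>) \<in> module_hom R (piece N k r) (T.Q n p)"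
proof -
  interpret Q: rmodule R "T.Q n p" by (rule T.Q_rmodule)
  note a = admissibleD[OF adm]
  define \<pi>1 where "\<pi>1 = take (length \<nu>s) \<pi>ss"
  define c where "c = \<pi>ss ! length \<nu>s"
  define \<pi>2 where "\<pi>2 = drop (Suc (length \<nu>s)) \<pi>ss"
  have split: "\<pi>ss = \<pi>1 @ c # \<pi>2" "length \<pi>1 = length \<nu>s"
    using a(13) id_take_nth_drop[of "length \<nu>s" \<pi>ss] by (auto simp: \<pi>1_def \<pi>2_def c_def)
  have "map length \<pi>1 @ length c # map length \<pi>2 = map arity \<nu>s @ k # map arity \<nu>s'"
    using a(6) split(1) by simp
  then have c: "length c = k" using split(2) by (simp add: append_eq_append_conv)
  have z: "map2 inner (\<nu>s @ (k, r, y) # \<nu>s') \<pi>ss =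
      map2 inner \<nu>s \<pi>1 @ (sum_list (map arity c), r + sum_list (map degr c), NP.el ((k, r, y), c, id)) # map2 inner \<nu>s' \<pi>2" for y
    using split(2) by (simp only: split(1) zip_append list.simps zip_Cons_Cons map_append case_prod_conv inner_def homog_simps)
  have "x \<in> carrier (piece N k r)" "set c \<subseteq> homogs P" using a(8,16) split(1) by auto
  then have g: "((k, r, x), c, id) \<in> NP.G (sum_list (map arity c)) (r + sum_list (map degr c))"
    using inner_gens[of "(k, r, x)" c] c by simp
  have hom: "(\<lambda>y. T.el (\<mu>, map2 inner (\<nu>s @ (k, r, y) # \<nu>s') \<pi>ss, block_perm \<tau> (map arity \<pi>s) \<circ> \<sigma>))
      \<in> module_hom R (piece N k r) (T.Q n p)"
    unfolding z
    using module_hom_comp[OF NP.el_left_hom[OF g]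
        T.el_slot_hom[OF asc_gens[OF adm, unfolded z], unfolded composite_simps]] .
  show ?thesis
  proof (rule module_hom_cong[OF Q.module_hom_zsmult_fun[OF hom] _ N.piece_module])
    fix y assume "y \<in> carrier (piece N k r)"
    then have "admissible n p \<mu> (\<nu>s @ (k, r, y) # \<nu>s') \<tau> \<pi>s \<sigma> \<pi>ss"
      using adm unfolding admissible_def gens_iff by simp
    from asc_eq[OF this, symmetric]
    show "[(koszul_sign \<tau> (map degr \<pi>s) * distrib_sign (map degr (\<nu>s @ (k, r, x) # \<nu>s')) (map (map degr) \<pi>ss))]
        \<cdot>\<^bsub>T.Q n p\<^esub> T.el (\<mu>, map2 inner (\<nu>s @ (k, r, y) # \<nu>s') \<pi>ss, block_perm \<tau> (map arity \<pi>s) \<circ> \<sigma>) =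
        asc n p (\<mu>, \<nu>s @ (k, r, y) # \<nu>s', \<tau>) \<pi>s \<sigma>" by simp
  qed
qed

text \<open>The varying factor is followed through the rearrangement by \<open>\<tau>\<close> and
  the cutting into blocks to a fixed slot of a fixed inner composite; there two linear maps compose
  again.\<close>

lemma asc_right_hom:
  assumes adm: "admissible n p \<mu> \<nu>s \<tau> (\<pi>s @ (k, r, x) # \<pi>s') \<sigma> \<pi>ss"
  shows "(\<lambda>x. asc n p (\<mu>, \<nu>s, \<tau>) (\<pi>s @ (k, r, x) # \<pi>s') \<sigma>) \<in> module_hom R (piece P k r) (T.Q n p)"
proof -
  interpret Q: rmodule R "T.Q n p" by (rule T.Q_rmodule)
  note a = admissibleD[OF adm]
  have "\<tau> permutes {1..length \<pi>s + 1 + length \<pi>s'}" using a(10) by simp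
  then obtain \<alpha> \<beta> where p: "permuted \<tau> (\<pi>s @ z # \<pi>s') = \<alpha> @ z # \<beta>" for z
    using permuted_slot by blast
  have "length \<alpha> + 1 + length \<beta> = length (permuted \<tau> (\<pi>s @ (k, r, x) # \<pi>s'))" unfolding p by simp
  also have "\<dots> = sum_list (map arity \<nu>s)" using a(1) by (simp add: gens_iff)
  finally have "\<exists>css1 c1 c2 css2. \<forall>z. chunks (map arity \<nu>s) (\<alpha> @ z # \<beta>) = css1 @ (c1 @ z # c2) # css2"
    by (rule chunks_slot)
  then obtain css1 c1 c2 css2 where ch: "chunks (map arity \<nu>s) (\<alpha> @ z # \<beta>) = css1 @ (c1 @ z # c2) # css2" for z
    by (elim exE) simp
  have adm': "admissible n p \<mu> \<nu>s \<tau> (\<pi>s @ (k, r, y) # \<pi>s') \<sigma> (css1 @ (c1 @ (k, r, y) # c2) # css2)"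
    if y: "y \<in> carrier (piece P k r)" for y
  proof -
    have "(\<mu>, \<nu>s, \<tau>) \<in> MN.G (length (\<pi>s @ (k, r, y) # \<pi>s')) (p - sum_list (map degr (\<pi>s @ (k, r, y) # \<pi>s')))"
      "set (\<pi>s @ (k, r, y) # \<pi>s') \<subseteq> homogs P" "sum_list (map arity (\<pi>s @ (k, r, y) # \<pi>s')) = n"
      using a(1-3) y by simp_all
    from admissibleI[OF this a(4)] obtain yss where
      "admissible n p \<mu> \<nu>s \<tau> (\<pi>s @ (k, r, y) # \<pi>s') \<sigma> yss" by blast
    with admissibleD(12)[OF this] show ?thesis by (simp add: p ch)
  qed
  have x: "x \<in> carrier (piece P k r)" using a(2) by simp
  note b = admissibleD[OF adm'[OF x]]
  define \<nu>1 where "\<nu>1 = take (length css1) \<nu>s"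
  define \<nu> where "\<nu> = \<nu>s ! length css1"
  define \<nu>2 where "\<nu>2 = drop (Suc (length css1)) \<nu>s"
  have split: "\<nu>s = \<nu>1 @ \<nu> # \<nu>2" "length \<nu>1 = length css1"
    using b(13) id_take_nth_drop[of "length css1" \<nu>s] by (auto simp: \<nu>1_def \<nu>2_def \<nu>_def)
  have "map length css1 @ length (c1 @ (k, r, x) # c2) # map length css2 = map arity \<nu>1 @ arity \<nu> # map arity \<nu>2"
    using b(6) split(1) by simp
  then have \<nu>: "arity \<nu> = length (c1 @ (k, r, x) # c2)" using split(2) by (simp add: append_eq_append_conv)
  let ?a = "sum_list (map arity c1) + (k + sum_list (map arity c2))"
  let ?d = "degr \<nu> + (sum_list (map degr c1) + (r + sum_list (map degr c2)))"
  have z: "map2 inner \<nu>s (css1 @ (c1 @ (k, r, y) # c2) # css2) =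
      map2 inner \<nu>1 css1 @ (?a, ?d, NP.el (\<nu>, c1 @ (k, r, y) # c2, id)) # map2 inner \<nu>2 css2" for y
    using split(2)
    by (simp only: split(1) zip_append list.simps zip_Cons_Cons map_append case_prod_conv inner_def sum_list_append sum_list.Cons homog_simps)
  have "\<nu> \<in> homogs N" "set (c1 @ (k, r, x) # c2) \<subseteq> homogs P" using b(8,16) split(1) by auto
  then have g: "(\<nu>, c1 @ (k, r, x) # c2, id) \<in> NP.G ?a ?d"
    using inner_gens[of \<nu> "c1 @ (k, r, x) # c2"] \<nu> by simp
  let ?ar = "map arity \<pi>s @ k # map arity \<pi>s'" and ?dg = "map degr \<pi>s @ r # map degr \<pi>s'"
  have hom: "(\<lambda>y. T.el (\<mu>, map2 inner \<nu>s (css1 @ (c1 @ (k, r, y) # c2) # css2), block_perm \<tau> ?ar \<circ> \<sigma>))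
      \<in> module_hom R (piece P k r) (T.Q n p)"
    unfolding z
    using module_hom_comp[OF NP.el_slot_hom[OF g]
        T.el_slot_hom[OF asc_gens[OF adm'[OF x], unfolded z], unfolded composite_simps]] by simp
  show ?thesis
  proof (rule module_hom_cong[OF Q.module_hom_zsmult_fun[OF hom] _ P.piece_module])
    fix y assume "y \<in> carrier (piece P k r)"
    from asc_eq[OF adm'[OF this], symmetric]
    show "[(koszul_sign \<tau> ?dg * distrib_sign (map degr \<nu>s)
          (map (map degr) css1 @ (map degr c1 @ r # map degr c2) # map (map degr) css2))] \<cdot>\<^bsub>T.Q n p\<^esub>
        T.el (\<mu>, map2 inner \<nu>s (css1 @ (c1 @ (k, r, y) # c2) # css2), block_perm \<tau> ?ar \<circ> \<sigma>) =
        asc n p (\<mu>, \<nu>s, \<tau>) (\<pi>s @ (k, r, y) # \<pi>s') \<sigma>" by simp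
  qed
qed

text \<open>The relation for the action on the outer element, applied inside the inner composite, is
  recast as a sign and an action on the whole inner element. In this form the balancing relation of
  the outer composite can absorb it.\<close>

lemma inner_hact_left:
  assumes "\<nu> \<in> homogs N" "set \<pi>s \<subseteq> homogs P" "arity \<nu> = length \<pi>s" "\<tau> permutes {1..length \<pi>s}"
  shows "inner (hact N \<nu> \<tau>) \<pi>s = hscale (composite R N P) (koszul_sign \<tau> (map degr \<pi>s))
    (hact (composite R N P) (inner \<nu> (permuted \<tau> \<pi>s)) (block_perm \<tau> (map arity \<pi>s)))"
proof -
  note g = inner_gens[OF assms(1-3)]
  have s: "sum_list (map arity (permuted \<tau> \<pi>s)) = sum_list (map arity \<pi>s)"
    "sum_list (map degr (permuted \<tau> \<pi>s)) = sum_list (map degr \<pi>s)"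
    using assms(4) by (simp_all add: permuted_map[symmetric] sum_list_permuted)
  have g': "(\<nu>, permuted \<tau> \<pi>s, id) \<in> NP.G (sum_list (map arity \<pi>s)) (degr \<nu> + sum_list (map degr \<pi>s))"
    using inner_gens[of \<nu> "permuted \<tau> \<pi>s"] assms set_permuted[OF assms(4)] by (simp add: s)
  have b: "block_perm \<tau> (map arity \<pi>s) permutes {1..sum_list (map arity \<pi>s)}"
    using block_perm_permutes[of \<tau> "map arity \<pi>s"] assms(4) by simp
  show ?thesis
    using NP.el_left_act[OF g, of \<tau>] NP.act_el[OF g' b] assms(3,4)
    by (simp only: inner_def hact_simp hscale_simp degr_hact s composite_simps(1) comp_id id_comp)
qed

lemma inner_hact_right:
  assumes "\<nu> \<in> homogs N" "set \<pi>s \<subseteq> homogs P" "arity \<nu> = length \<pi>s" "perms_of (map arity \<pi>s) \<tau>s"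
  shows "inner \<nu> (map2 (hact P) \<pi>s \<tau>s) =
    hact (composite R N P) (inner \<nu> \<pi>s) (sum_perm (map arity \<pi>s) \<tau>s)"
proof -
  note g = inner_gens[OF assms(1-3)]
  show ?thesis
    using NP.el_balanced[OF g assms(4)] NP.act_el[OF g sum_perm_permutes[OF assms(4)]]
    by (simp only: inner_def hact_simp P.map2_hact_closed[OF assms(2,4)] comp_id id_comp)
qed

text \<open>On one side each twist of a middle factor becomes a sign and an action on its inner
  element; on the other it enters the permutation next to \<open>\<tau>\<close>. Signs agree since
  the Koszul sign of a block sum is the product over the blocks, and permutations agree by
  \<open>block_perm_sum_perm\<close>. The distribution sign sees only block totals.\<close>

lemma asc_balanced:
  assumes adm: "admissible n p \<mu> \<nu>s \<tau> \<pi>s \<sigma> \<pi>ss" and \<tau>s: "perms_of (map arity \<nu>s) \<tau>s"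
  shows "asc n p (\<mu>, map2 (hact N) \<nu>s \<tau>s, \<tau>) \<pi>s \<sigma> = asc n p (\<mu>, \<nu>s, sum_perm (map arity \<nu>s) \<tau>s \<circ> \<tau>) \<pi>s \<sigma>"
proof -
  interpret Q: rmodule R "T.Q n p" by (rule T.Q_rmodule)
  note a = admissibleD[OF adm]
  note m = N.map2_hact_closed[OF a(8) \<tau>s]
  note gb = MN.gens_balanced[OF a(1) \<tau>s]
  have len: "length \<tau>s = length \<nu>s" using list_all2_lengthD[OF \<tau>s] by simp
  note \<tau>s' = \<tau>s[folded a(6)]
  let ?\<pi>ss = "map2 permuted \<tau>s \<pi>ss"
  let ?nss = "map (map arity) \<pi>ss" and ?qss = "map (map degr) \<pi>ss"
  let ?s = "sum_perm (map arity \<nu>s) \<tau>s"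
  have s: "?s permutes {1..length \<pi>s}"
    using sum_perm_permutes[OF \<tau>s] a(1) by (simp add: gens_iff)
  have perm: "permuted (?s \<circ> \<tau>) \<pi>s = concat ?\<pi>ss"
    using permuted_sum_perm[OF \<tau>s'] a(5,6) by (simp add: permuted_comp[OF s a(10)])
  have len\<pi>: "map length ?\<pi>ss = map arity \<nu>s"
    using len a(6,13) by (auto simp: list_eq_iff_nth_eq)
  have adm1: "admissible n p \<mu> (map2 (hact N) \<nu>s \<tau>s) \<tau> \<pi>s \<sigma> \<pi>ss"
    unfolding admissible_def using gb(1) a(2-6) m(2) by simp
  have adm2: "admissible n p \<mu> \<nu>s (?s \<circ> \<tau>) \<pi>s \<sigma> ?\<pi>ss"
    unfolding admissible_def using gb(2) a(2-4) perm len\<pi> by simp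
  have p1: "perms_of (map length (map (map f) \<pi>ss)) \<tau>s" for f :: "_ \<Rightarrow> 'z"
    using \<tau>s' by (simp add: comp_def)
  have nth: "\<tau>s ! i permutes {1..length (\<pi>ss ! i)}" "arity (\<nu>s ! i) = length (\<pi>ss ! i)"
    if "i < length \<nu>s" for i
    using \<tau>s' that a(6,13) len by (auto simp: list_all2_conv_all_nth list_eq_iff_nth_eq)
  have sums: "map sum_list (map (map f) ?\<pi>ss) = map sum_list (map (map f) \<pi>ss)"
    for f :: "_ \<Rightarrow> 'z :: comm_monoid_add"
    using len a(13) nth by (intro nth_equalityI) (simp_all add: permuted_map[symmetric] sum_list_permuted)
  have koszul: "koszul_sign (?s \<circ> \<tau>) (map degr \<pi>s) =
      koszul_sign \<tau> (map degr \<pi>s) * prod_list (map2 koszul_sign \<tau>s ?qss)"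
    using koszul_sign_comp[of ?s "map degr \<pi>s" \<tau>] s a(10) koszul_sign_sum_perm[OF p1, of degr]
    by (simp add: a(15) a(6) comp_def)
  have block: "block_perm (?s \<circ> \<tau>) (map arity \<pi>s) =
      sum_perm (map sum_list ?nss) (map2 block_perm \<tau>s ?nss) \<circ> block_perm \<tau> (map arity \<pi>s)"
    using block_perm_comp[of ?s "map arity \<pi>s" \<tau>] s a(10) block_perm_sum_perm[OF p1, of arity]
    by (simp add: a(14) a(6) comp_def)
  let ?X = "map2 inner \<nu>s ?\<pi>ss" and ?K = "map2 koszul_sign \<tau>s ?qss" and ?B = "map2 block_perm \<tau>s ?nss"
  note b = admissibleD[OF adm2]
  note mi = map2_inner[OF b(6)[symmetric] b(8,16)]
  have pX: "perms_of (map arity ?X) ?B"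
    unfolding mi(2) sums by (rule perms_of_block_perm[OF p1])
  have X: "map2 inner (map2 (hact N) \<nu>s \<tau>s) \<pi>ss =
      map2 (hscale (composite R N P)) ?K (map2 (hact (composite R N P)) ?X ?B)"
  proof (rule nth_equalityI)
    fix i assume "i < length (map2 inner (map2 (hact N) \<nu>s \<tau>s) \<pi>ss)"
    then have i: "i < length \<nu>s" by simp
    have "\<nu>s ! i \<in> homogs N" "set (\<pi>ss ! i) \<subseteq> homogs P"
      using a(8,13,16) i nth_mem[of i \<nu>s] nth_mem[of i \<pi>ss] by (simp_all add: UN_subset_iff subsetD)
    from inner_hact_left[OF this nth(2)[OF i] nth(1)[OF i]]
    show "map2 inner (map2 (hact N) \<nu>s \<tau>s) \<pi>ss ! i =
        map2 (hscale (composite R N P)) ?K (map2 (hact (composite R N P)) ?X ?B) ! i"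
      using i len a(13) by simp
  qed (use len a(13) in simp)
  have g2: "(\<mu>, ?X, block_perm \<tau> (map arity \<pi>s) \<circ> \<sigma>) \<in> T.G n p"
    using asc_gens[OF adm2] permutes_compose[OF a(4,17)] unfolding gens_iff by simp
  have "T.el (\<mu>, map2 inner (map2 (hact N) \<nu>s \<tau>s) \<pi>ss, block_perm \<tau> (map arity \<pi>s) \<circ> \<sigma>) =
      [prod_list ?K] \<cdot>\<^bsub>T.Q n p\<^esub> T.el (\<mu>, map2 (hact (composite R N P)) ?X ?B, block_perm \<tau> (map arity \<pi>s) \<circ> \<sigma>)"
    unfolding X using T.el_hscale[of \<mu> "[]", OF _ , of _ _ _ _ ?K] T.gens_balanced(1)[OF g2 pX] len a(13)
    by simp
  also have "T.el (\<mu>, map2 (hact (composite R N P)) ?X ?B, block_perm \<tau> (map arity \<pi>s) \<circ> \<sigma>) =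
      T.el (\<mu>, ?X, block_perm (?s \<circ> \<tau>) (map arity \<pi>s) \<circ> \<sigma>)"
    using T.el_balanced[OF g2 pX] unfolding mi(2) sums block by (simp only: comp_assoc)
  finally have "T.el (\<mu>, map2 inner (map2 (hact N) \<nu>s \<tau>s) \<pi>ss, block_perm \<tau> (map arity \<pi>s) \<circ> \<sigma>) =
      [prod_list ?K] \<cdot>\<^bsub>T.Q n p\<^esub> T.el (\<mu>, ?X, block_perm (?s \<circ> \<tau>) (map arity \<pi>s) \<circ> \<sigma>)" .
  then show ?thesis
    unfolding asc_eq[OF adm1] asc_eq[OF adm2] koszul m(3) distrib_sign_cong[OF sums]
    using T.el_closed[OF asc_gens[OF adm2]] by (simp add: Q.zsmult_zsmult algebra_simps)
qed

text \<open>Whole middle factors move together with their groups of innermost ones, so the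
  distribution sign changes along with the Koszul signs; \<open>distrib_sign_permuted\<close>
  balances all of them.\<close>

lemma asc_left_act:
  assumes adm: "admissible n p \<mu> \<nu>s \<tau> \<pi>s \<sigma> \<pi>ss" and \<rho>: "\<rho> permutes {1..arity \<mu>}"
  shows "asc n p (hact M \<mu> \<rho>, \<nu>s, \<tau>) \<pi>s \<sigma> =
    [koszul_sign \<rho> (map degr \<nu>s)] \<cdot>\<^bsub>T.Q n p\<^esub>
      asc n p (\<mu>, permuted \<rho> \<nu>s, block_perm \<rho> (map arity \<nu>s) \<circ> \<tau>) \<pi>s \<sigma>"
proof -
  interpret Q: rmodule R "T.Q n p" by (rule T.Q_rmodule)
  note a = admissibleD[OF adm]
  note gb = MN.gens_left_act[OF a(1) \<rho>]
  note \<rho>\<nu> = \<rho>[unfolded a(9)]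
  note \<rho>\<pi> = \<rho>\<nu>[folded a(13)]
  let ?nss = "map (map arity) \<pi>ss" and ?qss = "map (map degr) \<pi>ss"
  let ?b = "block_perm \<rho> (map arity \<nu>s)"
  have b: "?b permutes {1..length \<pi>s}"
    using block_perm_permutes[of \<rho> "map arity \<nu>s"] \<rho>\<nu> a(1) by (simp add: gens_iff)
  have perm: "permuted (?b \<circ> \<tau>) \<pi>s = concat (permuted \<rho> \<pi>ss)"
    using permuted_block_perm[OF \<rho>\<pi>] a(5,6) by (simp add: permuted_comp[OF b a(10)])
  have len\<pi>: "map length (permuted \<rho> \<pi>ss) = map arity (permuted \<rho> \<nu>s)"
    using a(6) permuted_map[OF \<rho>\<pi>, of length] permuted_map[OF \<rho>\<nu>, of arity] by simp
  have adm1: "admissible n p (hact M \<mu> \<rho>) \<nu>s \<tau> \<pi>s \<sigma> \<pi>ss"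
    unfolding admissible_def using gb(1) a(2-6) by simp
  have adm2: "admissible n p \<mu> (permuted \<rho> \<nu>s) (?b \<circ> \<tau>) \<pi>s \<sigma> (permuted \<rho> \<pi>ss)"
    unfolding admissible_def using gb(2) a(2-4) perm len\<pi> by simp
  have lens: "map length ?qss = map arity \<nu>s" "map length ?nss = map arity \<nu>s"
    using a(6) by (simp_all add: comp_def)
  have koszul: "koszul_sign (?b \<circ> \<tau>) (map degr \<pi>s) =
      koszul_sign \<tau> (map degr \<pi>s) * koszul_sign \<rho> (map sum_list ?qss)"
    using koszul_sign_comp[of ?b "map degr \<pi>s" \<tau>] b a(10) koszul_sign_block_perm[of \<rho> ?qss] \<rho>\<pi>
    unfolding lens by (simp add: a(15))
  have block: "block_perm (?b \<circ> \<tau>) (map arity \<pi>s) =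
      block_perm \<rho> (map sum_list ?nss) \<circ> block_perm \<tau> (map arity \<pi>s)"
    using block_perm_comp[of ?b "map arity \<pi>s" \<tau>] b a(10) block_perm_block_perm[of \<rho> ?nss] \<rho>\<pi>
    unfolding lens by (simp add: a(14))
  note mi = map2_inner[OF a(6)[symmetric] a(8,16)]
  let ?X = "map2 inner \<nu>s \<pi>ss" and ?q = "map degr \<nu>s"
  have pX: "permuted \<rho> ?X = map2 inner (permuted \<rho> \<nu>s) (permuted \<rho> \<pi>ss)"
    by (rule permuted_map2[OF \<rho>\<nu> a(13)])
  have el: "T.el (hact M \<mu> \<rho>, ?X, block_perm \<tau> (map arity \<pi>s) \<circ> \<sigma>) =
      [koszul_sign \<rho> (map2 (+) ?q (map sum_list ?qss))] \<cdot>\<^bsub>T.Q n p\<^esub>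
      T.el (\<mu>, map2 inner (permuted \<rho> \<nu>s) (permuted \<rho> \<pi>ss), block_perm (?b \<circ> \<tau>) (map arity \<pi>s) \<circ> \<sigma>)"
    using T.el_left_act[OF asc_gens[OF adm] \<rho>] unfolding mi(2,3) pX block by (simp only: comp_assoc)
  have sign: "koszul_sign \<tau> (map degr \<pi>s) * distrib_sign ?q ?qss * koszul_sign \<rho> (map2 (+) ?q (map sum_list ?qss)) =
      koszul_sign \<rho> ?q * (koszul_sign (?b \<circ> \<tau>) (map degr \<pi>s) *
        distrib_sign (map degr (permuted \<rho> \<nu>s)) (map (map degr) (permuted \<rho> \<pi>ss)))"
    using distrib_sign_permuted[of \<rho> ?q ?qss] \<rho>\<nu> a(13)
      permuted_map[OF \<rho>\<nu>, of degr] permuted_map[OF \<rho>\<pi>, of "map degr"]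
    unfolding koszul by (simp add: algebra_simps)
  show ?thesis
    unfolding asc_eq[OF adm1] asc_eq[OF adm2] el
    using T.el_closed[OF asc_gens[OF adm2]] sign by (simp add: Q.zsmult_zsmult)
qed

text \<open>Collects the clauses concerning \<open>\<mu>\<close> and the middle factors, with the
  innermost factors held fixed.\<close>

lemma asc_compatible:
  assumes "set \<pi>s \<subseteq> homogs P" "sum_list (map arity \<pi>s) = n" "q + sum_list (map degr \<pi>s) = p"
    "\<sigma> permutes {1..n}"
  shows "compatible R M N (length \<pi>s) q (T.Q n p) (\<lambda>s. asc n p s \<pi>s \<sigma>)"
proof -
  have q: "q = p - sum_list (map degr \<pi>s)" using assms(3) by simp
  have adm: "\<exists>\<pi>ss. admissible n p \<mu> \<nu>s \<tau> \<pi>s \<sigma> \<pi>ss" if "(\<mu>, \<nu>s, \<tau>) \<in> MN.G (length \<pi>s) q" for \<mu> \<nu>s \<tau>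
    using admissibleI[OF that[unfolded q] assms(1,2,4)] by blast
  show ?thesis
    by (rule compatibleI; drule adm; elim exE;
      (rule asc_closed asc_left_hom asc_middle_hom asc_balanced asc_left_act; assumption))
qed

text \<open>No sign arises: permutations acting on the innermost factors leave degrees unchanged and
  travel with the factors through \<open>\<tau>\<close>.\<close>

lemma asc_right_balanced:
  assumes adm: "admissible n p \<mu> \<nu>s \<tau> \<pi>s \<sigma> \<pi>ss" and \<tau>s: "perms_of (map arity \<pi>s) \<tau>s"
  shows "asc n p (\<mu>, \<nu>s, \<tau>) (map2 (hact P) \<pi>s \<tau>s) \<sigma> = asc n p (\<mu>, \<nu>s, \<tau>) \<pi>s (sum_perm (map arity \<pi>s) \<tau>s \<circ> \<sigma>)"
proof -
  note a = admissibleD[OF adm]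
  note m = P.map2_hact_closed[OF a(2) \<tau>s]
  have len: "length \<tau>s = length \<pi>s" using list_all2_lengthD[OF \<tau>s] by simp
  let ?nss = "map (map arity) \<pi>ss"
  \<comment> \<open>The permutations are rearranged and cut exactly like the factors on which they
    act.\<close>
  define \<tau>ss where "\<tau>ss = chunks (map arity \<nu>s) (permuted \<tau> \<tau>s)"
  have \<tau>len: "length (permuted \<tau> \<tau>s) = sum_list (map arity \<nu>s)"
    using len a(1) by (simp add: gens_iff)
  have \<tau>ss: "concat \<tau>ss = permuted \<tau> \<tau>s" "map length \<tau>ss = map arity \<nu>s" "length \<tau>ss = length \<nu>s"
    unfolding \<tau>ss_def using \<tau>len by (simp_all add: concat_chunks map_length_chunks)
  have pc: "perms_of (concat ?nss) (concat \<tau>ss)"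
    using perms_of_permuted[of \<tau> "map arity \<pi>s" \<tau>s] \<tau>s a(10) by (simp add: \<tau>ss(1) a(14))
  have nth: "length (\<tau>ss ! i) = length (\<pi>ss ! i)" "arity (\<nu>s ! i) = length (\<pi>ss ! i)" if "i < length \<nu>s" for i
    using that \<tau>ss(2,3) a(6,13) by (auto simp: list_eq_iff_nth_eq)
  have pss: "list_all2 perms_of ?nss \<tau>ss"
    using pc a(13) \<tau>ss(3) nth
  proof (induction \<pi>ss arbitrary: \<tau>ss \<nu>s)
    case (Cons c \<pi>ss)
    then obtain \<tau>c \<tau>ss' \<nu> \<nu>s' where e: "\<tau>ss = \<tau>c # \<tau>ss'" "\<nu>s = \<nu> # \<nu>s'"
      by (metis Suc_length_conv)
    have "length \<tau>c = length c" using Cons.prems(4)[of 0] e by simp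
    then have "perms_of (map arity c) \<tau>c" "perms_of (concat (map (map arity) \<pi>ss)) (concat \<tau>ss')"
      using Cons.prems(1) e by (auto simp: list_all2_append)
    moreover have "length (\<tau>ss' ! i) = length (\<pi>ss ! i)" "arity (\<nu>s' ! i) = length (\<pi>ss ! i)"
      if "i < length \<nu>s'" for i
      using Cons.prems(4)[of "Suc i"] Cons.prems(5)[of "Suc i"] that e by simp_all
    ultimately show ?case using Cons.IH[of \<tau>ss' \<nu>s'] Cons.prems(2,3) e by simp
  qed simp
  have ch: "chunks (map arity \<nu>s) (permuted \<tau> (map2 (hact P) \<pi>s \<tau>s)) = map2 (map2 (hact P)) \<pi>ss \<tau>ss"
    using a(10) len a(12) by (simp add: permuted_map2 chunks_map2 \<tau>ss_def)
  have adm1: "admissible n p \<mu> \<nu>s \<tau> (map2 (hact P) \<pi>s \<tau>s) \<sigma> (map2 (map2 (hact P)) \<pi>ss \<tau>ss)"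
  proof -
    have "(\<mu>, \<nu>s, \<tau>) \<in> MN.G (length (map2 (hact P) \<pi>s \<tau>s)) (p - sum_list (map degr (map2 (hact P) \<pi>s \<tau>s)))"
      using a(1) len unfolding m(3) by simp
    from admissibleI[OF this m(1) _ a(4)] obtain yss where
      "admissible n p \<mu> \<nu>s \<tau> (map2 (hact P) \<pi>s \<tau>s) \<sigma> yss" using a(3) unfolding m(2) by blast
    with admissibleD(12)[OF this] ch show ?thesis by simp
  qed
  have s: "sum_perm (map arity \<pi>s) \<tau>s permutes {1..n}" using sum_perm_permutes[OF \<tau>s] a(3) by simp
  have adm2: "admissible n p \<mu> \<nu>s \<tau> \<pi>s (sum_perm (map arity \<pi>s) \<tau>s \<circ> \<sigma>) \<pi>ss"
    unfolding admissible_def using a(1-6) permutes_compose[OF a(4) s] by simp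
  note mi = map2_inner[OF a(6)[symmetric] a(8,16)]
  let ?X = "map2 inner \<nu>s \<pi>ss" and ?S = "map2 sum_perm ?nss \<tau>ss"
  have pX: "perms_of (map arity ?X) ?S" unfolding mi(2) by (rule perms_of_sum_perm[OF pss])
  have sub: "\<nu>s ! i \<in> homogs N" "set (\<pi>ss ! i) \<subseteq> homogs P" if "i < length \<nu>s" for i
    using a(8,13,16) that nth_mem[of i \<nu>s] nth_mem[of i \<pi>ss] by (simp_all add: UN_subset_iff subsetD)
  have pi: "perms_of (map arity (\<pi>ss ! i)) (\<tau>ss ! i)" if "i < length \<nu>s" for i
    using pss that a(13) by (auto simp: list_all2_conv_all_nth)
  have X: "map2 inner \<nu>s (map2 (map2 (hact P)) \<pi>ss \<tau>ss) = map2 (hact (composite R N P)) ?X ?S"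
    using inner_hact_right[OF sub nth(2) pi] \<tau>ss(3) a(13) by (intro nth_equalityI) simp_all
  have D: "map (map degr) (map2 (map2 (hact P)) \<pi>ss \<tau>ss) = map (map degr) \<pi>ss"
    using P.map2_hact_closed(3)[OF sub(2) pi] \<tau>ss(3) a(13) by (intro nth_equalityI) simp_all
  have "T.el (\<mu>, map2 (hact (composite R N P)) ?X ?S, block_perm \<tau> (map arity \<pi>s) \<circ> \<sigma>) =
      T.el (\<mu>, ?X, sum_perm (map sum_list ?nss) ?S \<circ> (block_perm \<tau> (map arity \<pi>s) \<circ> \<sigma>))"
    using T.el_balanced[OF asc_gens[OF adm] pX] unfolding mi(2) .
  also have "sum_perm (map sum_list ?nss) ?S \<circ> (block_perm \<tau> (map arity \<pi>s) \<circ> \<sigma>) =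
      sum_perm (concat ?nss) (concat \<tau>ss) \<circ> block_perm \<tau> (map arity \<pi>s) \<circ> \<sigma>"
    unfolding sum_perm_sum_perm[OF pss] by (simp only: comp_assoc)
  also have "sum_perm (concat ?nss) (concat \<tau>ss) \<circ> block_perm \<tau> (map arity \<pi>s) =
      block_perm \<tau> (map arity \<pi>s) \<circ> sum_perm (map arity \<pi>s) \<tau>s"
    using sum_perm_block_perm[of \<tau> "map arity \<pi>s" \<tau>s] \<tau>s a(10) by (simp add: \<tau>ss(1) a(14))
  finally show ?thesis
    unfolding asc_eq[OF adm1] asc_eq[OF adm2] X D m(2,3) by (simp only: comp_assoc)
qed

text \<open>Bringing the factors into order in one stage or in two gives the same list; signs and
  block permutations agree by their composition rules.\<close>

lemma asc_right_act:
  assumes adm: "admissible n p \<mu> \<nu>s (\<tau> \<circ> \<rho>) \<pi>s \<sigma> \<pi>ss" and \<rho>: "\<rho> permutes {1..length \<pi>s}"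
    and \<tau>: "\<tau> permutes {1..length \<pi>s}"
  shows "asc n p (\<mu>, \<nu>s, \<tau> \<circ> \<rho>) \<pi>s \<sigma> =
    [koszul_sign \<rho> (map degr \<pi>s)] \<cdot>\<^bsub>T.Q n p\<^esub>
      asc n p (\<mu>, \<nu>s, \<tau>) (permuted \<rho> \<pi>s) (block_perm \<rho> (map arity \<pi>s) \<circ> \<sigma>)"
proof -
  interpret Q: rmodule R "T.Q n p" by (rule T.Q_rmodule)
  note a = admissibleD[OF adm]
  have b: "block_perm \<rho> (map arity \<pi>s) permutes {1..n}"
    using block_perm_permutes[of \<rho> "map arity \<pi>s"] \<rho> a(3) by simp
  have pm: "map arity (permuted \<rho> \<pi>s) = permuted \<rho> (map arity \<pi>s)"
    "map degr (permuted \<rho> \<pi>s) = permuted \<rho> (map degr \<pi>s)"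
    using \<rho> by (simp_all add: permuted_map)
  have g: "(\<mu>, \<nu>s, \<tau>) \<in> MN.G (length \<pi>s) (p - sum_list (map degr \<pi>s))"
    using a(1) \<tau> by (simp add: gens_iff)
  have adm2: "admissible n p \<mu> \<nu>s \<tau> (permuted \<rho> \<pi>s) (block_perm \<rho> (map arity \<pi>s) \<circ> \<sigma>) \<pi>ss"
    unfolding admissible_def pm
    using g a(2,3,5,6) \<rho> \<tau> permutes_compose[OF a(4) b]
    by (simp add: sum_list_permuted set_permuted permuted_comp)
  have "koszul_sign (\<tau> \<circ> \<rho>) (map degr \<pi>s) =
      koszul_sign \<rho> (map degr \<pi>s) * koszul_sign \<tau> (permuted \<rho> (map degr \<pi>s))"
    using koszul_sign_comp[of \<tau> "map degr \<pi>s" \<rho>] \<rho> \<tau> by simp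
  moreover have "block_perm (\<tau> \<circ> \<rho>) (map arity \<pi>s) =
      block_perm \<tau> (permuted \<rho> (map arity \<pi>s)) \<circ> block_perm \<rho> (map arity \<pi>s)"
    using block_perm_comp[of \<tau> "map arity \<pi>s" \<rho>] \<rho> \<tau> by simp
  ultimately show ?thesis
    unfolding asc_eq[OF adm] asc_eq[OF adm2] pm
    using T.el_closed[OF asc_gens[OF adm2]] by (simp add: Q.zsmult_zsmult pm comp_assoc mult.assoc)
qed

text \<open>The inner of the two nested lifts in \<open>associator\<close>: the innermost factors
  and the last permutation are fixed, and only the composite element varies.\<close>

abbreviation outer where
  "outer n p X \<pi>s \<sigma> \<equiv> quotient_lift R (T.Q n p) (\<lambda>s. asc n p s \<pi>s \<sigma>) X"

lemma
  assumes "set \<pi>s \<subseteq> homogs P" "sum_list (map arity \<pi>s) = n" "q + sum_list (map degr \<pi>s) = p"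
    "\<sigma> permutes {1..n}" "m = length \<pi>s"
  shows outer_hom: "(\<lambda>X. outer n p X \<pi>s \<sigma>) \<in> module_hom R (MN.Q m q) (T.Q n p)"
    and outer_el: "s \<in> MN.G m q \<Longrightarrow> outer n p (MN.el s) \<pi>s \<sigma> = asc n p s \<pi>s \<sigma>"
  using MN.composite_lift_hom[OF T.Q_module asc_compatible[OF assms(1-4)]]
    MN.composite_lift_el[OF T.Q_module asc_compatible[OF assms(1-4)]] assms(5) by simp_all

text \<open>For fixed remaining data each relation is an equation between two linear maps in
  \<open>X\<close>, so it may be tested on elementary \<open>X\<close>, where it is one of the
  lemmas on \<open>asc\<close>.\<close>

lemma outer_compatible:
  "compatible R (composite R M N) P n p (T.Q n p) (\<lambda>(X, \<pi>s, \<sigma>). outer n p (elt X) \<pi>s \<sigma>)"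
proof (rule compatibleI, simp_all only: case_prod_conv homog_simps)
  interpret Q: rmodule R "T.Q n p" by (rule T.Q_rmodule)
  interpret PP: rmodule R "piece P k r" for k r by (rule P.piece_rmodule)
  have D: "set \<pi>s \<subseteq> homogs P" "sum_list (map arity \<pi>s) = n" "q + sum_list (map degr \<pi>s) = p"
    "\<sigma> permutes {1..n}" "m = length \<pi>s" "X \<in> carrier (MN.Q m q)"
    if "((m, q, X), \<pi>s, \<sigma>) \<in> L.G n p" for m q X \<pi>s \<sigma>
    using that unfolding gens_iff homogs_iff homog_simps composite_simps by blast+
  have H: "(\<lambda>X. outer n p X \<pi>s \<sigma>) \<in> module_hom R (MN.Q m q) (T.Q n p)"
    and E: "\<And>s. s \<in> MN.G m q \<Longrightarrow> outer n p (MN.el s) \<pi>s \<sigma> = asc n p s \<pi>s \<sigma>"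
    if "((m, q, X), \<pi>s, \<sigma>) \<in> L.G n p" for m q X \<pi>s \<sigma>
    by (rule outer_hom[OF D(1-5)[OF that]]) (rule outer_el[OF D(1-5)[OF that]])
  have adm: "\<exists>\<pi>ss. admissible n p \<mu> \<nu>s \<tau> \<pi>s \<sigma> \<pi>ss"
    if "((m, q, X), \<pi>s, \<sigma>) \<in> L.G n p" "(\<mu>, \<nu>s, \<tau>) \<in> MN.G m q" for m q X \<pi>s \<sigma> \<mu> \<nu>s \<tau>
  proof -
    note d = D[OF that(1)]
    have "(\<mu>, \<nu>s, \<tau>) \<in> MN.G (length \<pi>s) (p - sum_list (map degr \<pi>s))" using that(2) d(3,5) by auto
    from admissibleI[OF this d(1,2,4)] show ?thesis by blast
  qed
  show "outer n p (elt X) \<pi>s \<sigma> \<in> carrier (T.Q n p)" if "(X, \<pi>s, \<sigma>) \<in> L.G n p" for X \<pi>s \<sigma>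
    using that module_hom_closed[OF H D(6)] by (cases X) simp
  show "(\<lambda>X. outer n p X \<pi>s \<sigma>) \<in> module_hom R (piece (composite R M N) m q) (T.Q n p)"
    if "((m, q, X), \<pi>s, \<sigma>) \<in> L.G n p" for m q X \<pi>s \<sigma>
    using H[OF that] by simp
  show "(\<lambda>x. outer n p (elt X) (\<pi>s @ (k, r, x) # \<pi>s') \<sigma>) \<in> module_hom R (piece P k r) (T.Q n p)"
    if *: "(X, \<pi>s @ (k, r, x0) # \<pi>s', \<sigma>) \<in> L.G n p" for X \<pi>s k r x0 \<pi>s' \<sigma>
  proof -
    obtain m q X' where X: "X = (m, q, X')" by (cases X)
    note g = L.gens_change_slot[OF *[unfolded X]]
    note X' = D(6)[OF *[unfolded X]]
    have hom: "(\<lambda>x. asc n p (\<mu>, \<nu>s, \<tau>) (\<pi>s @ (k, r, x) # \<pi>s') \<sigma>) \<in> module_hom R (piece P k r) (T.Q n p)"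
      if "(\<mu>, \<nu>s, \<tau>) \<in> MN.G m q" for \<mu> \<nu>s \<tau>
      using adm[OF *[unfolded X] that] asc_right_hom by blast
    show ?thesis
      unfolding X homog_simps
    proof (rule module_homI)
      show "outer n p X' (\<pi>s @ (k, r, x) # \<pi>s') \<sigma> \<in> carrier (T.Q n p)" if "x \<in> carrier (piece P k r)" for x
        by (rule module_hom_closed[OF H[OF g[OF that]] X'])
      fix x assume x: "x \<in> carrier (piece P k r)"
      show "outer n p X' (\<pi>s @ (k, r, x \<oplus>\<^bsub>piece P k r\<^esub> y) # \<pi>s') \<sigma> =
          outer n p X' (\<pi>s @ (k, r, x) # \<pi>s') \<sigma> \<oplus>\<^bsub>T.Q n p\<^esub> outer n p X' (\<pi>s @ (k, r, y) # \<pi>s') \<sigma>"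
        if y: "y \<in> carrier (piece P k r)" for y
      proof (rule MN.Q_hom_eqI[OF T.Q_module H[OF g[OF PP.add.m_closed[OF x y]]]
            Q.module_hom_compose_add[OF MN.Q_module H[OF g[OF x]] H[OF g[OF y]]] _ X'])
        fix \<mu> \<nu>s \<tau> assume s: "(\<mu>, \<nu>s, \<tau>) \<in> MN.G m q"
        show "outer n p (MN.el (\<mu>, \<nu>s, \<tau>)) (\<pi>s @ (k, r, x \<oplus>\<^bsub>piece P k r\<^esub> y) # \<pi>s') \<sigma> =
          outer n p (MN.el (\<mu>, \<nu>s, \<tau>)) (\<pi>s @ (k, r, x) # \<pi>s') \<sigma> \<oplus>\<^bsub>T.Q n p\<^esub>
          outer n p (MN.el (\<mu>, \<nu>s, \<tau>)) (\<pi>s @ (k, r, y) # \<pi>s') \<sigma>"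
          unfolding E[OF g[OF x] s] E[OF g[OF y] s] E[OF g[OF PP.add.m_closed[OF x y]] s]
          by (rule module_hom_add[OF hom[OF s] x y])
      qed
      show "outer n p X' (\<pi>s @ (k, r, c \<odot>\<^bsub>piece P k r\<^esub> x) # \<pi>s') \<sigma> =
          c \<odot>\<^bsub>T.Q n p\<^esub> outer n p X' (\<pi>s @ (k, r, x) # \<pi>s') \<sigma>" if c: "c \<in> carrier R" for c
      proof (rule MN.Q_hom_eqI[OF T.Q_module H[OF g[OF PP.smult_closed[OF c x]]]
            Q.module_hom_smult_fun[OF H[OF g[OF x]] c] _ X'])
        fix \<mu> \<nu>s \<tau> assume s: "(\<mu>, \<nu>s, \<tau>) \<in> MN.G m q"
        show "outer n p (MN.el (\<mu>, \<nu>s, \<tau>)) (\<pi>s @ (k, r, c \<odot>\<^bsub>piece P k r\<^esub> x) # \<pi>s') \<sigma> =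
          c \<odot>\<^bsub>T.Q n p\<^esub> outer n p (MN.el (\<mu>, \<nu>s, \<tau>)) (\<pi>s @ (k, r, x) # \<pi>s') \<sigma>"
          unfolding E[OF g[OF x] s] E[OF g[OF PP.smult_closed[OF c x]] s]
          by (rule module_hom_smult[OF hom[OF s] c x])
      qed
    qed
  qed
  show "outer n p (elt X) (map2 (hact P) \<pi>s \<tau>s) \<sigma> = outer n p (elt X) \<pi>s (sum_perm (map arity \<pi>s) \<tau>s \<circ> \<sigma>)"
    if *: "(X, \<pi>s, \<sigma>) \<in> L.G n p" "perms_of (map arity \<pi>s) \<tau>s" for X \<pi>s \<tau>s \<sigma>
  proof -
    obtain m q X' where X: "X = (m, q, X')" by (cases X)
    note gs = L.gens_balanced[OF *[unfolded X]]
    show ?thesis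
      unfolding X homog_simps
    proof (rule MN.Q_hom_eqI[OF T.Q_module H[OF gs(1)] H[OF gs(2)] _ D(6)[OF gs(1)]])
      fix \<mu> \<nu>s \<tau> assume s: "(\<mu>, \<nu>s, \<tau>) \<in> MN.G m q"
      show "outer n p (MN.el (\<mu>, \<nu>s, \<tau>)) (map2 (hact P) \<pi>s \<tau>s) \<sigma> =
          outer n p (MN.el (\<mu>, \<nu>s, \<tau>)) \<pi>s (sum_perm (map arity \<pi>s) \<tau>s \<circ> \<sigma>)"
        unfolding E[OF gs(1) s] E[OF gs(2) s]
        using adm[OF *(1)[unfolded X] s] asc_right_balanced[OF _ *(2)] by blast
    qed
  qed
  show "outer n p (elt (hact (composite R M N) X \<rho>)) \<pi>s \<sigma> = [koszul_sign \<rho> (map degr \<pi>s)] \<cdot>\<^bsub>T.Q n p\<^esub>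
      outer n p (elt X) (permuted \<rho> \<pi>s) (block_perm \<rho> (map arity \<pi>s) \<circ> \<sigma>)"
    if *: "(X, \<pi>s, \<sigma>) \<in> L.G n p" "\<rho> permutes {1..arity X}" for X \<pi>s \<rho> \<sigma>
  proof -
    obtain m q X' where X: "X = (m, q, X')" by (cases X)
    note gs = L.gens_left_act[OF *[unfolded X]]
    note g = *(1)[unfolded X]
    have \<rho>: "\<rho> permutes {1..m}" "\<rho> permutes {1..length \<pi>s}" using *(2) D(5)[OF g] unfolding X by simp_all
    show ?thesis
      unfolding X hact_simp homog_simps
    proof (rule MN.Q_hom_eqI[OF T.Q_module module_hom_comp[OF MN.composite_act_hom[OF \<rho>(1)] H[OF g]]
          Q.module_hom_zsmult_fun[OF H[OF gs(2)]] _ D(6)[OF g]])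
      fix \<mu> \<nu>s \<tau> assume s: "(\<mu>, \<nu>s, \<tau>) \<in> MN.G m q"
      have \<tau>: "\<tau> permutes {1..length \<pi>s}" using s D(5)[OF g] by (simp add: gens_iff)
      note s' = MN.gens_compose[OF s \<rho>(1)]
      show "outer n p (act (composite R M N) m q (MN.el (\<mu>, \<nu>s, \<tau>)) \<rho>) \<pi>s \<sigma> =
          [koszul_sign \<rho> (map degr \<pi>s)] \<cdot>\<^bsub>T.Q n p\<^esub>
          outer n p (MN.el (\<mu>, \<nu>s, \<tau>)) (permuted \<rho> \<pi>s) (block_perm \<rho> (map arity \<pi>s) \<circ> \<sigma>)"
        unfolding MN.act_el[OF s \<rho>(1)] E[OF gs(2) s] E[OF g s']
        using adm[OF g s'] asc_right_act[OF _ \<rho>(2) \<tau>] by blast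
    qed
  qed
qed

lemma associator_hom: "associator R M N P n p \<in> module_hom R (L.Q n p) (T.Q n p)"
  unfolding associator_def Let_def by (rule L.composite_lift_hom[OF T.Q_module outer_compatible])

lemma associator_el:
  assumes "((m, q, X), \<pi>s, \<sigma>) \<in> L.G n p"
  shows "associator R M N P n p (L.el ((m, q, X), \<pi>s, \<sigma>)) = outer n p X \<pi>s \<sigma>"
  unfolding associator_def Let_def
  using L.composite_lift_el[OF T.Q_module outer_compatible assms] by simp

end

section \<open>The unitors\<close>

context cring
begin

lemma unit_simps [simp]:
  "act (unit_smodule R) n p x \<sigma> = x" "dif (unit_smodule R) n p x = \<zero>"
  "carrier (piece (unit_smodule R) n p) = (if n = 1 \<and> p = 0 then carrier R else {\<zero>})"
  "zero (piece (unit_smodule R) n p) = \<zero>" "add (piece (unit_smodule R) n p) = add R"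
  "smult (piece (unit_smodule R) n p) = mult R"
  by (simp_all add: unit_smodule_def)

lemma unit_graded_smodule: "graded_smodule R (unit_smodule R)"
proof (rule graded_smodule.intro[OF is_cring], rule graded_smodule_axioms.intro)
  show "module R (piece (unit_smodule R) n p)" for n p
  proof (rule moduleI)
    show "abelian_group (piece (unit_smodule R) n p)"
    proof (rule abelian_groupI)
      fix x assume "x \<in> carrier (piece (unit_smodule R) n p)"
      then show "\<exists>y\<in>carrier (piece (unit_smodule R) n p).
          y \<oplus>\<^bsub>piece (unit_smodule R) n p\<^esub> x = \<zero>\<^bsub>piece (unit_smodule R) n p\<^esub>"
        by (intro bexI[of _ "\<ominus> x"]) (auto simp: l_neg split: if_splits)
    qed (auto simp: a_ac split: if_splits)
  qed (auto simp: is_cring l_distr r_distr m_assoc split: if_splits)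
qed (auto simp: module_hom_def split: if_splits)

end

locale unitors = graded_smodule R M for R (structure) and M :: "('a, 'b) smodule"
begin

sublocale I: graded_smodule R "unit_smodule R" by (rule unit_graded_smodule)
sublocale IM: composite_product R "unit_smodule R" M ..
sublocale MI: composite_product R M "unit_smodule R" ..

abbreviation left_fun where
  "left_fun n p \<equiv> (\<lambda>((m, q, a), \<nu>s, \<sigma>). if m = 1 \<and> q = 0
        then a \<odot>\<^bsub>piece M n p\<^esub> act M n p (elt (hd \<nu>s)) \<sigma> else \<zero>\<^bsub>piece M n p\<^esub>)"

text \<open>An outer element of arity one and degree zero forces a single inner factor, which then
  carries the full arity and degree.\<close>

lemma left_gens:
  assumes "((m, q, a), \<nu>s, \<sigma>) \<in> IM.G n p" "m = 1 \<and> q = 0"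
  obtains y where "\<nu>s = [(n, p, y)]" "y \<in> carrier (piece M n p)" "\<sigma> permutes {1..n}" "a \<in> carrier R"
proof -
  have "length \<nu>s = Suc 0" using assms by (simp add: gens_iff)
  then obtain \<nu> where "\<nu>s = [\<nu>]" by (auto simp: length_Suc_conv)
  moreover obtain k r y where "\<nu> = (k, r, y)" by (cases \<nu>)
  ultimately show ?thesis using assms that[of y] by (auto simp: gens_iff)
qed

text \<open>In arity one the symmetric group is trivial, so the relation for the outer action holds
  at once, and the balancing for the single inner factor is the composition law of its
  action.\<close>

lemma left_compatible: "compatible R (unit_smodule R) M n p (piece M n p) (left_fun n p)"
proof (rule compatibleI)
  interpret PM: rmodule R "piece M n p" by (rule piece_rmodule)
  show "left_fun n p (\<mu>, \<nu>s, \<sigma>) \<in> carrier (piece M n p)" if g: "(\<mu>, \<nu>s, \<sigma>) \<in> IM.G n p" for \<mu> \<nu>s \<sigma>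
  proof (cases \<mu>)
    case (fields m q a)
    show ?thesis
    proof (cases "m = 1 \<and> q = 0")
      case True
      obtain y where y: "\<nu>s = [(n, p, y)]" "y \<in> carrier (piece M n p)" "\<sigma> permutes {1..n}" "a \<in> carrier R"
        using left_gens[OF g[unfolded fields] True] by blast
      then show ?thesis using True act_closed[OF y(3,2)] by (simp add: fields)
    qed (auto simp: fields)
  qed
  show "(\<lambda>x. left_fun n p ((m, q, x), \<nu>s, \<sigma>)) \<in> module_hom R (piece (unit_smodule R) m q) (piece M n p)"
    if *: "((m, q, a), \<nu>s, \<sigma>) \<in> IM.G n p" for m q a \<nu>s \<sigma>
  proof (cases "m = 1 \<and> q = 0")
    case True
    then obtain y where "\<nu>s = [(n, p, y)]" "y \<in> carrier (piece M n p)" "\<sigma> permutes {1..n}"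
      using left_gens[OF * True] by blast
    then show ?thesis
      using True act_closed[of \<sigma> n y p]
      by (intro module_homI) (auto simp: PM.smult_l_distr PM.smult_assoc1 simp del: One_nat_def)
  qed (auto intro: PM.zero_hom)
  show "(\<lambda>x. left_fun n p (\<mu>, \<nu>s @ (k, r, x) # \<nu>s', \<sigma>)) \<in> module_hom R (piece M k r) (piece M n p)"
    if *: "(\<mu>, \<nu>s @ (k, r, x0) # \<nu>s', \<sigma>) \<in> IM.G n p" for \<mu> \<nu>s k r x0 \<nu>s' \<sigma>
  proof -
    obtain m q a where \<mu>: "\<mu> = (m, q, a)" by (cases \<mu>)
    show ?thesis
    proof (cases "m = 1 \<and> q = 0")
      case True
      then obtain y where y: "\<nu>s @ (k, r, x0) # \<nu>s' = [(n, p, y)]" "\<sigma> permutes {1..n}" "a \<in> carrier R"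
        using left_gens[OF *(1)[unfolded \<mu>] True] by blast
      then have "\<nu>s = []" "k = n" "r = p" by (auto simp: append_eq_Cons_conv)
      then show ?thesis
        using True \<mu> PM.module_hom_smult_fun[OF act_hom[OF y(2)] y(3)] by simp
    qed (auto simp: \<mu> intro: PM.zero_hom)
  qed
  show "left_fun n p (\<mu>, map2 (hact M) \<nu>s \<tau>s, \<sigma>) = left_fun n p (\<mu>, \<nu>s, sum_perm (map arity \<nu>s) \<tau>s \<circ> \<sigma>)"
    if *: "(\<mu>, \<nu>s, \<sigma>) \<in> IM.G n p" "perms_of (map arity \<nu>s) \<tau>s" for \<mu> \<nu>s \<tau>s \<sigma>
  proof -
    obtain m q a where \<mu>: "\<mu> = (m, q, a)" by (cases \<mu>)
    show ?thesis
    proof (cases "m = 1 \<and> q = 0")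
      case True
      then obtain y where y: "\<nu>s = [(n, p, y)]" "y \<in> carrier (piece M n p)" "\<sigma> permutes {1..n}"
        using left_gens[OF *(1)[unfolded \<mu>] True] by blast
      moreover obtain \<tau> where \<tau>: "\<tau>s = [\<tau>]" "\<tau> permutes {1..n}"
        using *(2) y(1) by (auto simp: list_all2_Cons1 simp del: One_nat_def)
      ultimately show ?thesis
        using True by (simp add: \<mu> sum_perm_single act_act del: One_nat_def)
    qed (auto simp: \<mu>)
  qed
  show "left_fun n p (hact (unit_smodule R) \<mu> \<tau>, \<nu>s, \<sigma>) = [koszul_sign \<tau> (map degr \<nu>s)] \<cdot>\<^bsub>piece M n p\<^esub>
      left_fun n p (\<mu>, permuted \<tau> \<nu>s, block_perm \<tau> (map arity \<nu>s) \<circ> \<sigma>)"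
    if *: "(\<mu>, \<nu>s, \<sigma>) \<in> IM.G n p" "\<tau> permutes {1..arity \<mu>}" for \<mu> \<nu>s \<tau> \<sigma>
  proof -
    obtain m q a where \<mu>: "\<mu> = (m, q, a)" by (cases \<mu>)
    show ?thesis
    proof (cases "m = 1 \<and> q = 0")
      case True
      then have \<tau>: "\<tau> = id" using *(2) \<mu> permutes_singleton by simp
      obtain y where "\<nu>s = [(n, p, y)]" "y \<in> carrier (piece M n p)" "\<sigma> permutes {1..n}" "a \<in> carrier R"
        using left_gens[OF *(1)[unfolded \<mu>] True] by blast
      then show ?thesis
        unfolding \<tau> block_perm_id permuted_id koszul_sign_id id_comp
        using True by (simp add: \<mu> act_closed del: One_nat_def)
    qed (auto simp: \<mu>)
  qed
qed

lemma left_unitor_hom: "left_unitor R M n p \<in> module_hom R (IM.Q n p) (piece M n p)"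
  unfolding left_unitor_def by (rule IM.composite_lift_hom[OF piece_module left_compatible])

lemma left_unitor_el:
  "((m, q, a), \<nu>s, \<sigma>) \<in> IM.G n p \<Longrightarrow> left_unitor R M n p (IM.el ((m, q, a), \<nu>s, \<sigma>)) =
    (if m = 1 \<and> q = 0 then a \<odot>\<^bsub>piece M n p\<^esub> act M n p (elt (hd \<nu>s)) \<sigma> else \<zero>\<^bsub>piece M n p\<^esub>)"
  unfolding left_unitor_def by (simp only: IM.composite_lift_el[OF piece_module left_compatible] case_prod_conv)

abbreviation scalars :: "'a homog list \<Rightarrow> bool" where
  "scalars as \<equiv> list_all (\<lambda>a. arity a = 1 \<and> degr a = 0) as"

abbreviation scalar_prod :: "'a homog list \<Rightarrow> 'a" where
  "scalar_prod as \<equiv> foldr (\<lambda>a b. a \<otimes> b) (map elt as) \<one>"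

abbreviation right_fun where
  "right_fun n p \<equiv> (\<lambda>(\<mu>, as, \<sigma>). if scalars as
        then scalar_prod as \<odot>\<^bsub>piece M n p\<^esub> act M n p (elt \<mu>) \<sigma> else \<zero>\<^bsub>piece M n p\<^esub>)"

lemma scalar_prod_closed: "set as \<subseteq> homogs (unit_smodule R) \<Longrightarrow> scalar_prod as \<in> carrier R"
  by (induction as) (auto simp: homogs_def split: if_splits)

lemma scalar_prod_append:
  "set as \<subseteq> homogs (unit_smodule R) \<Longrightarrow> set bs \<subseteq> homogs (unit_smodule R) \<Longrightarrow>
   scalar_prod (as @ bs) = scalar_prod as \<otimes> scalar_prod bs"
proof (induction as)
  case (Cons a as)
  then have "elt a \<in> carrier R" by (auto simp: homogs_def split: if_splits)
  with Cons scalar_prod_closed[of as] scalar_prod_closed[of bs] show ?case by (simp add: m_assoc)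
qed (simp add: scalar_prod_closed)

text \<open>A product over an index set no longer depends on an order, which gives invariance under
  rearrangement by reindexing.\<close>

lemma scalar_prod_finprod:
  "set as \<subseteq> homogs (unit_smodule R) \<Longrightarrow> scalar_prod as = (\<Otimes>i\<in>{..<length as}. elt (as ! i))"
proof (induction as rule: rev_induct)
  case (snoc a as)
  have el: "elt b \<in> carrier R" if "b \<in> homogs (unit_smodule R)" for b
    using that by (auto simp: homogs_def split: if_splits)
  have *: "elt ((as @ [a]) ! i) \<in> carrier R" if "i < Suc (length as)" for i
    using snoc.prems that nth_mem[of i "as @ [a]"] by (intro el) (auto simp del: nth_mem)
  have "(\<Otimes>i\<in>{..<Suc (length as)}. elt ((as @ [a]) ! i)) =
      elt a \<otimes> (\<Otimes>i\<in>{..<length as}. elt ((as @ [a]) ! i))"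
    unfolding lessThan_Suc using * *[of "length as"] by (subst finprod_insert) auto
  also have "(\<Otimes>i\<in>{..<length as}. elt ((as @ [a]) ! i)) = (\<Otimes>i\<in>{..<length as}. elt (as ! i))"
  proof (rule finprod_cong'[OF refl])
    show "(\<lambda>i. elt (as ! i)) \<in> {..<length as} \<rightarrow> carrier R"
    proof
      fix i assume "i \<in> {..<length as}"
      then show "elt (as ! i) \<in> carrier R" using *[of i] by (simp add: nth_append)
    qed
  qed (simp add: nth_append)
  finally show ?case
    using snoc scalar_prod_append[of as "[a]"] scalar_prod_closed[of as] el[of a] by (simp add: m_comm)
qed simp

lemma scalar_prod_permuted:
  assumes "set as \<subseteq> homogs (unit_smodule R)" "\<tau> permutes {1..length as}"
  shows "scalar_prod (permuted \<tau> as) = scalar_prod as"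
proof -
  let ?t = "\<lambda>i. \<tau> (Suc i) - 1"
  have el: "elt b \<in> carrier R" if "b \<in> homogs (unit_smodule R)" for b
    using that by (auto simp: homogs_def split: if_splits)
  note bij = permutes_index_bij[OF assms(2)]
  have set: "set (permuted \<tau> as) \<subseteq> homogs (unit_smodule R)" using assms set_permuted by metis
  have mem: "elt (permuted \<tau> as ! k) \<in> carrier R" if "k < length as" for k
    using set nth_mem[of k "permuted \<tau> as"] that by (intro el) (auto simp del: nth_mem)
  have "scalar_prod (permuted \<tau> as) = (\<Otimes>k\<in>{..<length as}. elt (permuted \<tau> as ! k))"
    using scalar_prod_finprod[OF set] by simp
  also have "\<dots> = (\<Otimes>k\<in>?t ` {..<length as}. elt (permuted \<tau> as ! k))"
    using bij by (simp add: bij_betw_def)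
  also have "\<dots> = (\<Otimes>i\<in>{..<length as}. elt (permuted \<tau> as ! ?t i))"
    using bij mem by (intro finprod_reindex) (auto simp: bij_betw_def)
  also have "\<dots> = (\<Otimes>i\<in>{..<length as}. elt (as ! i))"
  proof (rule finprod_cong'[OF refl])
    show "(\<lambda>i. elt (as ! i)) \<in> {..<length as} \<rightarrow> carrier R"
    proof
      fix i assume "i \<in> {..<length as}"
      then show "elt (as ! i) \<in> carrier R" using assms(1) nth_mem[of i as] by (intro el) auto
    qed
  qed (use nth_permuted[OF assms(2)] in auto)
  finally show ?thesis using scalar_prod_finprod[OF assms(1)] by simp
qed

lemma right_gens:
  assumes "(\<mu>, as, \<sigma>) \<in> MI.G n p" "scalars as"
  obtains x where "\<mu> = (n, p, x)" "x \<in> carrier (piece M n p)" "\<sigma> permutes {1..n}" "length as = n"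
    "map arity as = replicate n 1" "map degr as = replicate n 0"
proof -
  obtain m q x where \<mu>: "\<mu> = (m, q, x)" by (cases \<mu>)
  have 1: "map arity as = replicate (length as) 1" "map degr as = replicate (length as) 0"
    using assms(2) by (induction as) auto
  then have "sum_list (map arity as) = length as" "sum_list (map degr as) = 0"
    by (simp_all only: sum_list_replicate) simp_all
  then show ?thesis using assms(1) that[of x] 1 by (auto simp: \<mu> gens_iff)
qed

text \<open>When all inner factors have arity one and degree zero, their own permutations are
  trivial, the Koszul signs are 1, and a block permutation is the permutation itself. In all other
  cases both sides are zero.\<close>

lemma right_compatible: "compatible R M (unit_smodule R) n p (piece M n p) (right_fun n p)"
proof (rule compatibleI)
  interpret PM: rmodule R "piece M n p" by (rule piece_rmodule)
  have U: "set as \<subseteq> homogs (unit_smodule R)" if "(\<mu>, as, \<sigma>) \<in> MI.G n p" for \<mu> as \<sigma>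
    using that by (simp add: gens_iff)
  note C = scalar_prod_closed[OF U]
  show "right_fun n p (\<mu>, as, \<sigma>) \<in> carrier (piece M n p)" if *: "(\<mu>, as, \<sigma>) \<in> MI.G n p" for \<mu> as \<sigma>
  proof (cases "scalars as")
    case True
    obtain y where y: "\<mu> = (n, p, y)" "y \<in> carrier (piece M n p)" "\<sigma> permutes {1..n}"
      using right_gens[OF * True] by blast
    then show ?thesis using True C[OF *] act_closed[OF y(3,2)] by simp
  qed simp
  show "(\<lambda>x. right_fun n p ((m, q, x), as, \<sigma>)) \<in> module_hom R (piece M m q) (piece M n p)"
    if *: "((m, q, a), as, \<sigma>) \<in> MI.G n p" for m q a as \<sigma>
  proof (cases "scalars as")
    case True
    from right_gens[OF * this] have "m = n" "q = p" "\<sigma> permutes {1..n}" by auto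
    then show ?thesis using True PM.module_hom_smult_fun[OF act_hom C[OF *]] by simp
  qed (simp add: PM.zero_hom)
  show "(\<lambda>x. right_fun n p (\<mu>, as @ (k, r, x) # bs, \<sigma>)) \<in> module_hom R (piece (unit_smodule R) k r) (piece M n p)"
    if *: "(\<mu>, as @ (k, r, x0) # bs, \<sigma>) \<in> MI.G n p" for \<mu> as k r x0 bs \<sigma>
  proof (cases "scalars (as @ (k, r, x0) # bs)")
    case True
    from right_gens[OF * this] obtain y where y: "\<mu> = (n, p, y)" "y \<in> carrier (piece M n p)" "\<sigma> permutes {1..n}"
      by blast
    have kr: "k = 1" "r = 0" "scalars as" "scalars bs" using True by auto
    have ab: "set as \<subseteq> homogs (unit_smodule R)" "set bs \<subseteq> homogs (unit_smodule R)"
      using U[OF *] by auto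
    note cl = scalar_prod_closed[OF ab(1)] scalar_prod_closed[OF ab(2)] act_closed[OF y(3,2)]
    \<comment> \<open>Commutativity moves the varying scalar to the front, where linearity is
      visible.\<close>
    have "scalar_prod (as @ (k, r, x) # bs) = x \<otimes> (scalar_prod as \<otimes> scalar_prod bs)" if "x \<in> carrier R" for x
      using scalar_prod_append[OF ab(1), of "(k, r, x) # bs"] ab(2) that kr cl by (simp add: m_lcomm)
    then show ?thesis
      using kr y(1) cl
      by (intro module_homI) (simp_all add: PM.smult_l_distr PM.smult_assoc1 l_distr del: foldr_append foldr_Cons foldr.simps map_append)
  next
    case False
    then have "\<not> scalars (as @ (k, r, x) # bs)" for x by auto
    then show ?thesis by (simp only: case_prod_conv if_False PM.zero_hom)
  qed
  show "right_fun n p (\<mu>, map2 (hact (unit_smodule R)) as \<tau>s, \<sigma>) = right_fun n p (\<mu>, as, sum_perm (map arity as) \<tau>s \<circ> \<sigma>)"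
    if *: "(\<mu>, as, \<sigma>) \<in> MI.G n p" "perms_of (map arity as) \<tau>s" for \<mu> as \<tau>s \<sigma>
  proof -
    have len: "length \<tau>s = length as" using list_all2_lengthD[OF *(2)] by simp
    have "hact (unit_smodule R) a \<tau> = a" for a \<tau> by (cases a) simp
    then have m: "map2 (hact (unit_smodule R)) as \<tau>s = as"
      using len by (intro nth_equalityI) simp_all
    show ?thesis
    proof (cases "scalars as")
      case True
      have "\<tau> = id" if mem: "\<tau> \<in> set \<tau>s" for \<tau>
      proof -
        obtain i where i: "i < length as" "\<tau> = \<tau>s ! i" using mem len by (auto simp: in_set_conv_nth)
        then have "\<tau> permutes {1..arity (as ! i)}" "arity (as ! i) = 1"
          using *(2) True by (auto simp: list_all2_conv_all_nth list_all_length simp del: One_nat_def)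
        then have "\<tau> permutes {1..1}" by (simp only:)
        then show ?thesis by (rule permutes_singleton)
      qed
      then have "sum_perm (map arity as) \<tau>s = id" using len by (intro sum_perm_ids) auto
      then show ?thesis by (simp only: m id_comp)
    qed (simp only: m case_prod_conv if_False)
  qed
  show "right_fun n p (hact M \<mu> \<tau>, as, \<sigma>) = [koszul_sign \<tau> (map degr as)] \<cdot>\<^bsub>piece M n p\<^esub>
      right_fun n p (\<mu>, permuted \<tau> as, block_perm \<tau> (map arity as) \<circ> \<sigma>)"
    if *: "(\<mu>, as, \<sigma>) \<in> MI.G n p" "\<tau> permutes {1..arity \<mu>}" for \<mu> as \<tau> \<sigma>
  proof -
    have \<tau>: "\<tau> permutes {1..length as}" using * by (simp add: gens_iff)
    have sc: "scalars (permuted \<tau> as) \<longleftrightarrow> scalars as"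
      unfolding list_all_iff set_permuted[OF \<tau>] ..
    show ?thesis
    proof (cases "scalars as")
      case True
      from right_gens[OF *(1) this] obtain y where y: "\<mu> = (n, p, y)" "y \<in> carrier (piece M n p)"
        "\<sigma> permutes {1..n}" "length as = n" "map arity as = replicate n 1" "map degr as = replicate n 0"
        by blast
      note \<tau>n = \<tau>[unfolded y(4)]
      have K: "koszul_sign \<tau> (replicate n 0) = 1"
        unfolding koszul_sign_def by (intro prod.neutral) auto
      have "act M n p (act M n p y \<tau>) \<sigma> = act M n p y (\<tau> \<circ> \<sigma>)"
        by (rule act_act[OF \<tau>n y(3,2)])
      then show ?thesis
        using True sc scalar_prod_permuted[OF U[OF *(1)] \<tau>] C[OF *(1)]
          act_closed[OF permutes_compose[OF y(3) \<tau>n] y(2)]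
        by (simp add: y(1,5,6) K block_perm_ones[OF \<tau>n] del: One_nat_def)
    next
      case False
      then show ?thesis using sc by simp
    qed
  qed
qed

lemma right_unitor_hom: "right_unitor R M n p \<in> module_hom R (MI.Q n p) (piece M n p)"
  unfolding right_unitor_def by (rule MI.composite_lift_hom[OF piece_module right_compatible])

lemma right_unitor_el:
  "(\<mu>, as, \<sigma>) \<in> MI.G n p \<Longrightarrow> right_unitor R M n p (MI.el (\<mu>, as, \<sigma>)) =
    (if scalars as then scalar_prod as \<odot>\<^bsub>piece M n p\<^esub> act M n p (elt \<mu>) \<sigma> else \<zero>\<^bsub>piece M n p\<^esub>)"
  unfolding right_unitor_def by (simp only: MI.composite_lift_el[OF piece_module right_compatible] case_prod_conv)

end

section \<open>Permutations in one-line notation\<close>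

definition is_perm :: "nat \<Rightarrow> nat list \<Rightarrow> bool" where
  "is_perm n s \<longleftrightarrow> length s = n \<and> distinct s \<and> (\<forall>x\<in>set s. 1 \<le> x \<and> x \<le> n)"

text \<open>The tables hold words rather than functions, since equality of functions on all naturals
  cannot be evaluated.\<close>

definition perm_of :: "nat list \<Rightarrow> perm" where
  "perm_of s x = (if 1 \<le> x \<and> x \<le> length s then s ! (x - 1) else x)"

definition comp_list :: "nat list \<Rightarrow> nat list \<Rightarrow> nat list" where
  "comp_list s t = map (\<lambda>i. s ! (i - 1)) t"

fun sum_list_perm :: "nat list \<Rightarrow> nat list list \<Rightarrow> nat list" where
  "sum_list_perm (n # ns) (t # ts) = t @ map ((+) n) (sum_list_perm ns ts)"
| "sum_list_perm _ _ = []"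

definition block_list :: "nat list \<Rightarrow> nat list \<Rightarrow> nat list" where
  "block_list t ns = concat (map
     (\<lambda>(ti, ni). map ((+) (sum_list (map snd (filter (\<lambda>(tj, nj). tj < ti) (zip t ns))))) [1..<ni + 1])
     (zip t ns))"

text \<open>Pairing each entry with its target place and looking the places up avoids computing the
  inverse permutation.\<close>

definition permuted_list :: "nat list \<Rightarrow> 'x list \<Rightarrow> 'x list" where
  "permuted_list t xs = map (\<lambda>k. the (map_of (zip t xs) k)) [1..<length xs + 1]"

definition koszul_list :: "nat list \<Rightarrow> int list \<Rightarrow> int" where
  "koszul_list t qs = minus_one_pow (word_sum (zip t qs))"

text \<open>The accumulator \<open>a\<close> is the total degree of the inner factors already handed
  out, past which the next middle factor has to move.\<close>

fun distrib_exp :: "int \<Rightarrow> int list \<Rightarrow> int list list \<Rightarrow> int" where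
  "distrib_exp a (q # qs) (r # rs) = q * a + distrib_exp (a + sum_list r) qs rs"
| "distrib_exp _ _ _ = 0"

lemma perm_of_permutes:
  assumes "is_perm n s"
  shows "perm_of s permutes {1..n}"
proof (rule bij_imp_permutes)
  have len: "length s = n" and d: "distinct s" using assms by (auto simp: is_perm_def)
  have "perm_of s ` {1..n} \<subseteq> {1..n}"
    using assms by (auto simp: is_perm_def perm_of_def)
  moreover have "inj_on (perm_of s) {1..n}"
    using d len by (intro inj_onI) (auto simp: perm_of_def nth_eq_iff_index_eq)
  ultimately show "bij_betw (perm_of s) {1..n} {1..n}"
    by (simp add: bij_betw_def endo_inj_surj)
  show "perm_of s x = x" if "x \<notin> {1..n}" for x
    using that len by (auto simp: perm_of_def)
qed

lemma oneline_perm_of: "length s = n \<Longrightarrow> oneline n (perm_of s) = s"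
  by (rule nth_equalityI) (auto simp: nth_oneline perm_of_def)

lemma perm_of_oneline: "\<sigma> permutes {1..n} \<Longrightarrow> perm_of (oneline n \<sigma>) = \<sigma>"
  by (rule ext) (auto simp: perm_of_def nth_oneline permutes_not_in)

lemma is_perm_oneline:
  assumes "\<sigma> permutes {1..n}"
  shows "is_perm n (oneline n \<sigma>)"
proof -
  have "distinct (oneline n \<sigma>)"
    unfolding oneline_def using permutes_inj_on[OF assms] by (simp add: distinct_map)
  moreover have "1 \<le> x \<and> x \<le> n" if x: "x \<in> set (oneline n \<sigma>)" for x
  proof -
    obtain i where "i \<in> {1..n}" "x = \<sigma> i" using x by (force simp: oneline_def)
    then show ?thesis using permutes_range[OF assms, of i] by simp
  qed
  ultimately show ?thesis by (simp add: is_perm_def)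
qed

lemma perm_of_upt: "perm_of [1..<n + 1] = id"
  by (rule ext) (auto simp: perm_of_def)

lemma perm_of_eqI: "\<sigma> permutes {1..n} \<Longrightarrow> oneline n \<sigma> = s \<Longrightarrow> perm_of s = \<sigma>"
  using perm_of_oneline by blast

lemma perm_of_comp:
  assumes "is_perm n s" "is_perm n t"
  shows "perm_of (comp_list s t) = perm_of s \<circ> perm_of t"
proof (rule perm_of_eqI)
  show "perm_of s \<circ> perm_of t permutes {1..n}"
    by (intro permutes_compose perm_of_permutes assms)
  have "length s = n" "length t = n" "\<And>i. i < n \<Longrightarrow> 1 \<le> t ! i \<and> t ! i \<le> n"
    using assms by (auto simp: is_perm_def)
  then show "oneline n (perm_of s \<circ> perm_of t) = comp_list s t"
    by (intro nth_equalityI) (auto simp: nth_oneline perm_of_def comp_list_def)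
qed

lemma perm_of_sum:
  assumes "list_all2 is_perm ns ts"
  shows "perm_of (sum_list_perm ns ts) = sum_perm ns (map perm_of ts)"
proof (rule perm_of_eqI)
  have perms: "perms_of ns (map perm_of ts)" if "list_all2 is_perm ns ts" for ns ts
    using that perm_of_permutes by (induction rule: list_all2_induct) (simp_all del: One_nat_def)
  show "sum_perm ns (map perm_of ts) permutes {1..sum_list ns}"
    by (rule sum_perm_permutes[OF perms[OF assms]])
  show "oneline (sum_list ns) (sum_perm ns (map perm_of ts)) = sum_list_perm ns ts"
    using assms
  proof (induction rule: list_all2_induct)
    case Nil
    then show ?case by (simp add: oneline_def)
  next
    case (Cons n ns t ts)
    have "length t = n" using Cons.hyps(1) by (simp add: is_perm_def)
    then show ?case
      using Cons.IH sum_perm_Cons[OF perms[OF Cons.hyps(2)] perm_of_permutes[OF Cons.hyps(1)]]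
      by (simp add: oneline_perm_sum oneline_perm_of)
  qed
qed

text \<open>By \<open>oneline_block_perm\<close> both words are concatenations over the blocks; the
  offsets agree once the sum over indices is rewritten as a sum over a filtered list.\<close>

lemma perm_of_block:
  assumes t: "is_perm (length ns) t"
  shows "perm_of (block_list t ns) = block_perm (perm_of t) ns"
proof (rule perm_of_eqI[OF block_perm_permutes[OF perm_of_permutes[OF t]]])
  have len: "length t = length ns" using t by (simp add: is_perm_def)
  have start: "block_start (perm_of t) ns i =
      sum_list (map snd (filter (\<lambda>(tj, nj). tj < t ! i) (zip t ns)))" if "i < length ns" for i
  proof -
    have sum: "sum_list (map snd (filter (\<lambda>(tj, nj). tj < b) (zip u ms))) =
        (\<Sum>j<length ms. if u ! j < b then ms ! j else 0)" if "length u = length ms" for u ms :: "nat list" and b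
      using that
      by (induction u ms rule: list_induct2)
        (simp_all add: sum.lessThan_Suc_shift del: sum.lessThan_Suc cong: if_cong)
    have "block_start (perm_of t) ns i = (\<Sum>j\<in>{j \<in> {..<length ns}. t ! j < t ! i}. ns ! j)"
      unfolding block_start_def using len that by (intro sum.cong) (auto simp: perm_of_def)
    also have "\<dots> = (\<Sum>j<length ns. if t ! j < t ! i then ns ! j else 0)"
      by (rule sum.inter_filter) simp
    finally show ?thesis by (simp add: sum[OF len])
  qed
  show "oneline (sum_list ns) (block_perm (perm_of t) ns) = block_list t ns"
    unfolding oneline_block_perm block_list_def
  proof (rule arg_cong[where f = concat], rule nth_equalityI)
    fix i assume "i < length (map (block_labels (perm_of t) ns) [0..<length ns])"
    then show "map (block_labels (perm_of t) ns) [0..<length ns] ! i =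
        map (\<lambda>(ti, ni). map ((+) (sum_list (map snd (filter (\<lambda>(tj, nj). tj < ti) (zip t ns))))) [1..<ni + 1])
          (zip t ns) ! i"
      using len by (simp add: block_labels_def start)
  qed (use len in simp)
qed

lemma permuted_list_eq:
  assumes "is_perm (length xs) t"
  shows "permuted_list t xs = permuted (perm_of t) xs"
proof (rule permuted_eqI[OF perm_of_permutes[OF assms], symmetric])
  have t: "length t = length xs" "distinct t" "\<And>i. i < length xs \<Longrightarrow> 1 \<le> t ! i \<and> t ! i \<le> length xs"
    using assms by (auto simp: is_perm_def)
  fix i assume i: "i < length xs"
  have "perm_of t (Suc i) - 1 = t ! i - 1" using i t by (simp add: perm_of_def)
  moreover have "permuted_list t xs ! (t ! i - 1) = the (map_of (zip t xs) (t ! i))"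
    using t(3)[OF i] by (auto simp: permuted_list_def nth_map_upt)
  moreover have "map_of (zip t xs) (t ! i) = Some (xs ! i)"
    using t i by (intro map_of_is_SomeI) (auto simp: in_set_zip)
  ultimately show "permuted_list t xs ! (perm_of t (Suc i) - 1) = xs ! i" by simp
qed (simp_all add: permuted_list_def)

lemma koszul_list_eq: "length t = length qs \<Longrightarrow> koszul_list t qs = koszul_sign (perm_of t) qs"
  by (simp add: koszul_list_def koszul_sign_word oneline_perm_of)

lemma distrib_sign_exp:
  assumes "length rss = length qs"
  shows "distrib_sign qs rss = minus_one_pow (distrib_exp 0 qs rss)"
proof -
  have "(\<Sum>j<length qs. qs ! j * (a + sum_list (map sum_list (take j rss)))) = distrib_exp a qs rss"
    if "length rss = length qs" for a and qs :: "int list" and rss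
    using that
  proof (induction rss qs arbitrary: a rule: list_induct2)
    case (Cons r rss q qs)
    show ?case
      using Cons.IH[of "a + sum_list r"]
      by (simp add: sum.lessThan_Suc_shift add.assoc del: sum.lessThan_Suc)
  qed simp
  from this[OF assms, of 0] show ?thesis by (simp add: distrib_sign_def)
qed

lemma is_perm_sum: "list_all2 is_perm ns ts \<Longrightarrow> is_perm (sum_list ns) (sum_list_perm ns ts)"
proof (induction rule: list_all2_induct)
  case (Cons n ns t ts)
  then show ?case by (auto simp: is_perm_def distinct_map inj_on_def) force+
qed (simp add: is_perm_def)

lemma is_perm_block:
  assumes "is_perm (length ns) t"
  shows "is_perm (sum_list ns) (block_list t ns)"
proof -
  have p: "block_perm (perm_of t) ns permutes {1..sum_list ns}"
    by (rule block_perm_permutes[OF perm_of_permutes[OF assms]])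
  have "length t = length ns" using assms by (simp add: is_perm_def)
  then have "length (block_list t ns) = sum_list ns"
    by (simp add: block_list_def length_concat comp_def case_prod_unfold)
  then show ?thesis
    using is_perm_oneline[OF p] perm_of_block[OF assms] oneline_perm_of by metis
qed

lemma is_perm_upt: "is_perm n [1..<n + 1]"
  by (auto simp: is_perm_def)

section \<open>Formal sums\<close>

text \<open>Substitution of formal sums for keys, extended linearly.\<close>

definition lbind :: "(int \<times> 'k) list \<Rightarrow> ('k \<Rightarrow> (int \<times> 'l) list) \<Rightarrow> (int \<times> 'l) list" where
  "lbind xs F = concat (map (\<lambda>(c, t). map (\<lambda>(d, u). (c * d, u)) (F t)) xs)"

text \<open>The middle component stores the code of the key, so that it is computed once per term
  and not at each comparison.\<close>

fun lmerge :: "(int \<times> nat list \<times> 'k) list \<Rightarrow> (int \<times> nat list \<times> 'k) list \<Rightarrow> (int \<times> nat list \<times> 'k) list"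
  where
  "lmerge [] ys = ys"
| "lmerge (x # xs) [] = x # xs"
| "lmerge ((c, e, k) # xs) ((d, f, l) # ys) =
     (if k = l then (if c + d = 0 then lmerge xs ys else (c + d, e, k) # lmerge xs ys)
      else if ord.lexordp_eq (<) e f then (c, e, k) # lmerge xs ((d, f, l) # ys)
      else (d, f, l) # lmerge ((c, e, k) # xs) ys)"

fun lmerge_pairs where
  "lmerge_pairs (xs # ys # zss) = lmerge xs ys # lmerge_pairs zss"
| "lmerge_pairs xss = xss"

lemma length_lmerge_pairs: "length (lmerge_pairs xss) \<le> length xss"
  by (induction xss rule: lmerge_pairs.induct) auto

function lmerge_all where
  "lmerge_all [] = []"
| "lmerge_all [xs] = xs"
| "lmerge_all (xs # ys # zss) = lmerge_all (lmerge_pairs (xs # ys # zss))"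
  by pat_completeness auto
termination
  by (relation "measure length") (auto simp: less_Suc_eq_le le_SucI length_lmerge_pairs)

text \<open>Equal terms meet during the merge sort by the code \<open>enc\<close>, and their coefficients are added.\<close>

definition lnormal :: "('k \<Rightarrow> nat list) \<Rightarrow> (int \<times> 'k) list \<Rightarrow> (int \<times> 'k) list" where
  "lnormal enc xs = map (\<lambda>(c, e, k). (c, k)) (lmerge_all (map (\<lambda>(c, k). [(c, enc k, k)]) xs))"

definition keys3 :: "(int \<times> nat list \<times> 'k) list \<Rightarrow> 'k set" where
  "keys3 xs = snd ` snd ` set xs"

lemma keys3_simps [simp]:
  "keys3 [] = {}" "keys3 (x # xs) = insert (snd (snd x)) (keys3 xs)"
  "keys3 (xs @ ys) = keys3 xs \<union> keys3 ys"
  by (auto simp: keys3_def image_Un)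

lemma keys3_lmerge: "keys3 (lmerge xs ys) \<subseteq> keys3 xs \<union> keys3 ys"
  by (induction xs ys rule: lmerge.induct) (simp_all, blast+)

section \<open>Evaluation of formal sums and its invariance under normalisation\<close>

context rmodule
begin

lemma lsum_map: "lsum M ev (map (\<lambda>(c, t). (c, f t)) xs) = lsum M (\<lambda>t. ev (f t)) xs"
  by (simp add: lsum_def comp_def case_prod_unfold)

lemma lsum_cong: "(\<And>t. t \<in> snd ` set xs \<Longrightarrow> ev t = ev' t) \<Longrightarrow> lsum M ev xs = lsum M ev' xs"
  unfolding lsum_def by (intro arg_cong[of _ _ "list_sum M"] map_cong) force+

lemma lsum_lbind:
  assumes "\<And>t. t \<in> snd ` set xs \<Longrightarrow> ev t = lsum M ev' (F t)"
    and "\<And>t. t \<in> snd ` set xs \<Longrightarrow> ev' ` snd ` set (F t) \<subseteq> carrier M"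
  shows "lsum M ev xs = lsum M ev' (lbind xs F)"
  using assms
proof (induction xs)
  case (Cons x xs)
  obtain c t where x: "x = (c, t)" by (cases x)
  have F: "ev' ` snd ` set (F u) \<subseteq> carrier M" if "u \<in> snd ` set (x # xs)" for u
    using Cons.prems(2) that by blast
  have "lsum M ev' (lbind (x # xs) F) = lsum M ev' (map (\<lambda>(d, u). (c * d, u)) (F t) @ lbind xs F)"
    by (simp add: lbind_def x)
  also have "\<dots> = lsum M ev' (map (\<lambda>(d, u). (c * d, u)) (F t)) \<oplus>\<^bsub>M\<^esub> lsum M ev' (lbind xs F)"
  proof (rule lsum_append)
    show "ev' ` snd ` set (map (\<lambda>(d, u). (c * d, u)) (F t)) \<subseteq> carrier M"
      using F[of t] by (auto simp: x image_subset_iff)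
    show "ev' ` snd ` set (lbind xs F) \<subseteq> carrier M"
    proof
      fix y assume "y \<in> ev' ` snd ` set (lbind xs F)"
      then obtain b u d v where "(b, u) \<in> set xs" "(d, v) \<in> set (F u)" "y = ev' v"
        by (auto simp: lbind_def)
      then show "y \<in> carrier M" using F[of u] by (force simp: image_subset_iff)
    qed
  qed
  also have "\<dots> = [c] \<cdot>\<^bsub>M\<^esub> ev t \<oplus>\<^bsub>M\<^esub> lsum M ev xs"
    using Cons F[of t] by (simp add: x zsmult_lsum)
  finally show ?case by (simp add: x)
qed (simp add: lbind_def)

abbreviation lsum3 :: "('k \<Rightarrow> 'c) \<Rightarrow> (int \<times> nat list \<times> 'k) list \<Rightarrow> 'c" where
  "lsum3 ev xs \<equiv> lsum M (\<lambda>(e, k). ev k) xs"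

text \<open>Coefficients are combined only for equal keys, so the sum is preserved for lists in any
  order; the order by codes decides how many equal keys meet.\<close>

lemma lsum3_lmerge:
  assumes "\<And>k. k \<in> keys3 xs \<union> keys3 ys \<Longrightarrow> ev k \<in> carrier M"
  shows "lsum3 ev (lmerge xs ys) = lsum3 ev xs \<oplus>\<^bsub>M\<^esub> lsum3 ev ys"
proof -
  have cl: "lsum3 ev zs \<in> carrier M" if "\<And>k. k \<in> keys3 zs \<Longrightarrow> ev k \<in> carrier M" for zs
    using that by (intro lsum_closed) (force simp: keys3_def)
  show "lsum3 ev (lmerge xs ys) = lsum3 ev xs \<oplus>\<^bsub>M\<^esub> lsum3 ev ys"
    using assms
  proof (induction xs ys rule: lmerge.induct)
    case (1 ys)
    then show ?case using cl[of ys] by simp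
  next
    case (2 x xs)
    then show ?case using cl[of "x # xs"] by simp
  next
    case (3 c e k xs d f l ys)
    have k: "ev k \<in> carrier M" "ev l \<in> carrier M" using 3(5)[of k] 3(5)[of l] by auto
    have xs: "lsum3 ev xs \<in> carrier M" by (rule cl, rule 3(5)) auto
    have ys: "lsum3 ev ys \<in> carrier M" by (rule cl, rule 3(5)) auto
    consider (same) "k = l" | (le) "k \<noteq> l" "ord.lexordp_eq (<) e f" | (gt) "k \<noteq> l" "\<not> ord.lexordp_eq (<) e f"
      by blast
    then show ?case
    proof cases
      case same
      have IH: "lsum3 ev (lmerge xs ys) = lsum3 ev xs \<oplus>\<^bsub>M\<^esub> lsum3 ev ys"
      proof (cases "c + d = 0")
        case True
        show ?thesis by (rule 3(1)[OF same True]) (rule 3(5), auto)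
      next
        case False
        show ?thesis by (rule 3(2)[OF same False]) (rule 3(5), auto)
      qed
      have "[c] \<cdot>\<^bsub>M\<^esub> ev k \<oplus>\<^bsub>M\<^esub> lsum3 ev xs \<oplus>\<^bsub>M\<^esub> ([d] \<cdot>\<^bsub>M\<^esub> ev k \<oplus>\<^bsub>M\<^esub> lsum3 ev ys) =
          [(c + d)] \<cdot>\<^bsub>M\<^esub> ev k \<oplus>\<^bsub>M\<^esub> (lsum3 ev xs \<oplus>\<^bsub>M\<^esub> lsum3 ev ys)"
        using k xs ys by (simp add: zsmult_add_left M.a_ac)
      then show ?thesis using same IH xs ys k by (cases "c + d = 0") (simp_all del: zsmult_smult)
    next
      case le
      have "lsum3 ev (lmerge xs ((d, f, l) # ys)) = lsum3 ev xs \<oplus>\<^bsub>M\<^esub> lsum3 ev ((d, f, l) # ys)"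
        by (rule 3(3)[OF le]) (rule 3(5), auto)
      then show ?thesis using le k xs ys by (simp add: M.a_assoc)
    next
      case gt
      have "lsum3 ev (lmerge ((c, e, k) # xs) ys) = lsum3 ev ((c, e, k) # xs) \<oplus>\<^bsub>M\<^esub> lsum3 ev ys"
        by (rule 3(4)[OF gt]) (rule 3(5), auto)
      then show ?thesis using gt k xs ys by (simp add: M.a_ac)
    qed
  qed
qed

lemma lsum3_lmerge_all:
  assumes "\<And>k. k \<in> keys3 (concat xss) \<Longrightarrow> ev k \<in> carrier M"
  shows "lsum3 ev (lmerge_all xss) = list_sum M (map (lsum3 ev) xss)"
proof -
  have cl: "lsum3 ev zs \<in> carrier M" if "\<And>k. k \<in> keys3 zs \<Longrightarrow> ev k \<in> carrier M" for zs
    using that by (intro lsum_closed) (force simp: keys3_def)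
  have pairs: "list_sum M (map (lsum3 ev) (lmerge_pairs xss)) = list_sum M (map (lsum3 ev) xss) \<and>
      keys3 (concat (lmerge_pairs xss)) \<subseteq> keys3 (concat xss)"
    if "\<And>k. k \<in> keys3 (concat xss) \<Longrightarrow> ev k \<in> carrier M" for xss
    using that
  proof (induction xss rule: lmerge_pairs.induct)
    case (1 xs ys zss)
    have z: "ev k \<in> carrier M" if "k \<in> keys3 (concat zss)" for k
      using 1(2) that by simp
    note IH = 1(1)[OF z]
    have m: "lsum3 ev (lmerge xs ys) = lsum3 ev xs \<oplus>\<^bsub>M\<^esub> lsum3 ev ys"
      using 1(2) by (intro lsum3_lmerge) auto
    have "lsum3 ev xs \<in> carrier M" "lsum3 ev ys \<in> carrier M"
      using 1(2) by (auto intro!: cl)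
    moreover have "list_sum M (map (lsum3 ev) zss) \<in> carrier M"
    proof (rule list_sum_closed)
      show "set (map (lsum3 ev) zss) \<subseteq> carrier M"
        using z by (force intro!: cl simp: keys3_def)
    qed
    moreover have "keys3 (concat (lmerge xs ys # lmerge_pairs zss)) \<subseteq> keys3 (concat (xs # ys # zss))"
      using keys3_lmerge[of xs ys] IH unfolding concat.simps keys3_simps by blast
    ultimately show ?case using IH m by (simp add: M.a_assoc)
  qed auto
  show ?thesis
    using assms
  proof (induction xss rule: lmerge_all.induct)
    case (2 xs)
    then show ?case using cl[of xs] by simp
  next
    case (3 xs ys zss)
    have p: "list_sum M (map (lsum3 ev) (lmerge_pairs (xs # ys # zss))) = list_sum M (map (lsum3 ev) (xs # ys # zss))"
      "keys3 (concat (lmerge_pairs (xs # ys # zss))) \<subseteq> keys3 (concat (xs # ys # zss))"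
      using pairs[of "xs # ys # zss"] 3(2) by blast+
    have "lsum3 ev (lmerge_all (lmerge_pairs (xs # ys # zss))) =
        list_sum M (map (lsum3 ev) (lmerge_pairs (xs # ys # zss)))"
      by (rule 3(1), rule 3(2)) (use p in blast)
    then show ?case using p by simp
  qed simp
qed

lemma lsum_lnormal:
  assumes "ev ` snd ` set xs \<subseteq> carrier M"
  shows "lsum M ev (lnormal enc xs) = lsum M ev xs"
proof -
  let ?xss = "map (\<lambda>(c, k). [(c, enc k, k)]) xs"
  have "lsum M ev (lnormal enc xs) = lsum3 ev (lmerge_all ?xss)"
    by (simp add: lnormal_def lsum_def comp_def case_prod_unfold)
  also have "\<dots> = list_sum M (map (lsum3 ev) ?xss)"
    using assms by (intro lsum3_lmerge_all) (force simp: image_subset_iff keys3_def)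
  also have "map (lsum3 ev) ?xss = map (\<lambda>(c, k). [c] \<cdot>\<^bsub>M\<^esub> ev k) xs"
    using assms by (auto simp: image_subset_iff)
  finally show ?thesis by (simp add: lsum_def)
qed

text \<open>The bridge from computation to algebra: equal normal forms, for whatever code, give
  equal values in any module in which all terms evaluate.\<close>

lemma lsum_eqI:
  assumes "lnormal enc xs = lnormal enc ys"
    and "ev ` snd ` set xs \<subseteq> carrier M" "ev ` snd ` set ys \<subseteq> carrier M"
  shows "lsum M ev xs = lsum M ev ys"
  using lsum_lnormal[OF assms(2), of enc] lsum_lnormal[OF assms(3), of enc] assms(1) by simp

end

section \<open>Tables for the generators of \<open>Lie\<^sub>3\<close>\<close>

fun comps :: "nat \<Rightarrow> nat list list" where
  "comps 0 = [[]]"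
| "comps (Suc n) = concat (map (\<lambda>k. map ((#) (Suc k)) (comps (n - k))) [0..<Suc n])"

definition reduced_list :: "nat list \<Rightarrow> nat list \<Rightarrow> bool" where
  "reduced_list ks t \<longleftrightarrow>
     (\<forall>i\<in>set [0..<length ks].
        sorted_wrt (<) (map (\<lambda>j. t ! (j - 1)) [block_end ks i + 1..<block_end ks (Suc i) + 1])) \<and>
     sorted_wrt (<) (map (\<lambda>i. t ! (block_end ks i - 1)) [1..<length ks + 1])"

text \<open>Rearranging the identity word by \<open>t\<close> puts \<open>i\<close> at the place
  that is the \<open>i\<close>-th entry of \<open>t\<close>; the result is the one-line word of the
  inverse.\<close>

definition inverse_list :: "nat list \<Rightarrow> nat list" where
  "inverse_list t = permuted_list t [1..<length t + 1]"

type_synonym lterm = "lgen \<times> lgen list \<times> nat list"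

text \<open>The sign of \<open>s\<close> is taken as a Koszul sign with all degrees 1, a form that
  can be evaluated on words.\<close>

definition decomp_list :: "nat \<Rightarrow> (int \<times> lterm) list" where
  "decomp_list n = concat (map (\<lambda>ks. map (\<lambda>s.
     ((-1) ^ ((length ks - 1) * (n - length ks)) *
      (-1) ^ sum_list (map (\<lambda>i. (i - 1) * (ks ! (i - 1) - 1)) [1..<length ks + 1]) *
      koszul_list s (replicate n 1), lgen_l (length ks), map lgen_l ks, s))
     (map inverse_list (filter (reduced_list ks) (permutations_of_set_list [1..<n + 1])))) (comps n))"

definition lterms :: "lgen \<Rightarrow> (int \<times> lterm) list" where
  "lterms g = (let n = lgen_arity g in
     if g = L1 then [(1, L1, [L1], [1])]
     else if g \<in> {L2, L3, L4, L5} then decomp_list n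
     else (1, L1, [g], [1..<n + 1]) #
       map (\<lambda>(c, h, gs, \<sigma>). (c, h, gs, oneline n \<sigma>)) (lgen_reduced_decomp g) @
       [(1, g, replicate n L1, [1..<n + 1])])"

definition dterms :: "lgen \<Rightarrow> (int \<times> lgen \<times> nat list) list" where
  "dterms g = map (\<lambda>(c, h, \<tau>). (c, h, oneline (lgen_arity g) \<tau>)) (lgen_dif g)"

text \<open>Differentiating a generator yields twisted generators. A twist of the outer one
  rearranges the inner factors, with a Koszul sign and a block permutation; a twist of factor
  \<open>i\<close> becomes a block sum with identities elsewhere. The result again has untwisted
  generators and one permutation.\<close>

definition dif_terms :: "lterm \<Rightarrow> (int \<times> lterm) list" where
  "dif_terms = (\<lambda>(h, gs, s). let ns = map lgen_arity gs; qs = map lgen_degr gs in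
     map (\<lambda>(c, k, t). (c * koszul_list t qs, k, permuted_list t gs, comp_list (block_list t ns) s)) (dterms h) @
     concat (map (\<lambda>i. map (\<lambda>(c, k, t).
        (c * minus_one_pow (lgen_degr h + sum_list (take i qs)), h, gs[i := k],
         comp_list (sum_list_perm ns ((map (\<lambda>n. [1..<n + 1]) ns)[i := t])) s)) (dterms (gs ! i)))
       [0..<length gs]))"

text \<open>Two-level terms after all twists have been collected into the last permutation.\<close>

type_synonym lterm2 = "lgen \<times> (lgen \<times> lgen list) list \<times> nat list"

text \<open>Decomposition of the outer generator followed by the associator, whose Koszul and
  distribution signs supply the new factor of the coefficient.\<close>

definition left_terms :: "lterm \<Rightarrow> (int \<times> lterm2) list" where
  "left_terms = (\<lambda>(h, gs, s). map (\<lambda>(c, k, ks, t).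
     let css = chunks (map lgen_arity ks) (permuted_list t gs) in
     (c * (koszul_list t (map lgen_degr gs) *
        minus_one_pow (distrib_exp 0 (map lgen_degr ks) (map (map lgen_degr) css))),
      k, zip ks css, comp_list (block_list t (map lgen_arity gs)) s)) (lterms h))"

fun prods :: "(int \<times> 'k) list list \<Rightarrow> (int \<times> 'k list) list" where
  "prods [] = [(1, [])]"
| "prods (xs # xss) = lbind xs (\<lambda>t. map (\<lambda>(c, ts). (c, t # ts)) (prods xss))"

text \<open>The decomposition map has degree 0, so applying it to the inner factors produces no sign
  beyond those of the individual decompositions; their permutations combine to a block sum.\<close>

definition right_terms :: "lterm \<Rightarrow> (int \<times> lterm2) list" where
  "right_terms = (\<lambda>(h, gs, s). map (\<lambda>(c, ts).
     (c, h, map (\<lambda>(k, ks, t). (k, ks)) ts,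
      comp_list (sum_list_perm (map lgen_arity gs) (map (\<lambda>(k, ks, t). t) ts)) s))
     (prods (map lterms gs)))"

text \<open>By equivariance the decomposition of a twisted generator is that of the generator, with
  the twist composed on the right.\<close>

definition dl_terms :: "lgen \<Rightarrow> (int \<times> lterm) list" where
  "dl_terms g = lbind (dterms g) (\<lambda>(h, t). map (\<lambda>(c, k, ks, s). (c, k, ks, comp_list s t)) (lterms h))"

definition dd_terms :: "lgen \<Rightarrow> (int \<times> lgen \<times> nat list) list" where
  "dd_terms g = lbind (dterms g) (\<lambda>(h, t). map (\<lambda>(c, k, s). (c, k, comp_list s t)) (dterms h))"

definition lterm_ok :: "lgen \<Rightarrow> lterm \<Rightarrow> bool" where
  "lterm_ok g = (\<lambda>(h, gs, s). lgen_arity h = length gs \<and> sum_list (map lgen_arity gs) = lgen_arity g \<and>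
     lgen_degr h + sum_list (map lgen_degr gs) = lgen_degr g \<and> is_perm (lgen_arity g) s)"

definition dterm_ok :: "lgen \<Rightarrow> lgen \<times> nat list \<Rightarrow> bool" where
  "dterm_ok g = (\<lambda>(h, s). lgen_arity h = lgen_arity g \<and> lgen_degr h = lgen_degr g - 1 \<and> is_perm (lgen_arity g) s)"

fun lgen_code :: "lgen \<Rightarrow> nat" where
  "lgen_code L1 = 0" | "lgen_code L2 = 1" | "lgen_code L2_1 = 2" | "lgen_code L2_11 = 3"
| "lgen_code L2_111 = 4" | "lgen_code L3 = 5" | "lgen_code L3_1 = 6" | "lgen_code L3_2 = 7"
| "lgen_code L3_11 = 8" | "lgen_code L3_12 = 9" | "lgen_code L3_22 = 10" | "lgen_code L4 = 11"
| "lgen_code L4_1 = 12" | "lgen_code L4_2 = 13" | "lgen_code L4_3 = 14" | "lgen_code L5 = 15"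

definition dterm_code :: "lgen \<times> nat list \<Rightarrow> nat list" where
  "dterm_code = (\<lambda>(h, s). s @ [lgen_code h])"

definition lterm_code :: "lterm \<Rightarrow> nat list" where
  "lterm_code = (\<lambda>(h, gs, s). s @ lgen_code h # map lgen_code gs)"

definition lterm2_code :: "lterm2 \<Rightarrow> nat list" where
  "lterm2_code = (\<lambda>(h, ts, s). s @ lgen_code h # concat (map (\<lambda>(k, ks). lgen_code k # map lgen_code ks) ts))"

definition left_counit_terms :: "lterm \<Rightarrow> (int \<times> lgen \<times> nat list) list" where
  "left_counit_terms = (\<lambda>(h, gs, s). if h = L1 then [(1, hd gs, s)] else [])"

definition right_counit_terms :: "lterm \<Rightarrow> (int \<times> lgen \<times> nat list) list" where
  "right_counit_terms = (\<lambda>(h, gs, s). if list_all (\<lambda>g. g = L1) gs then [(1, h, s)] else [])"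

section \<open>Finite verifications on the tables\<close>

definition lgens :: "lgen list" where
  "lgens = [L1, L2, L2_1, L2_11, L2_111, L3, L3_1, L3_2, L3_11, L3_12, L3_22, L4, L4_1, L4_2, L4_3]"

text \<open>Leaves two goals without variables, as evaluation requires; the generator of arity 5
  forms a goal of its own.\<close>

lemma lgen_cases: "list_all P lgens \<Longrightarrow> P L5 \<Longrightarrow> P g"
  by (cases g) (simp_all add: lgens_def)

lemma dterms_ok: "list_all (\<lambda>(c, t). dterm_ok g t) (dterms g)"
  by (rule lgen_cases; code_simp)

lemma lterms_ok: "list_all (\<lambda>(c, t). lterm_ok g t) (lterms g)"
  by (rule lgen_cases; code_simp)

lemma dif_dif_terms: "lnormal dterm_code (dd_terms g) = []"
  by (rule lgen_cases; code_simp)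

text \<open>The decomposition map commutes with the differentials on each generator: here the signs
  of the reduced decompositions are tested against those of the differential.\<close>

lemma dif_decomp_terms: "lnormal lterm_code (dl_terms g) = lnormal lterm_code (lbind (lterms g) dif_terms)"
  by (rule lgen_cases; code_simp)

text \<open>Coassociativity on the generators, including all signs of the associator. Their
  translates are covered because the evaluation of formal sums carries an arbitrary extra
  permutation.\<close>

lemma coassociative_terms:
  "lnormal lterm2_code (lbind (lterms g) left_terms) = lnormal lterm2_code (lbind (lterms g) right_terms)"
  by (rule lgen_cases; code_simp)

text \<open>Of each decomposition only the summand \<open>1 \<circ> (\<mu>)\<close> survives on the
  left and only \<open>\<mu> \<circ> (1, ..., 1)\<close> on the right.\<close>

lemma counit_terms:
  "lnormal dterm_code (lbind (lterms g) left_counit_terms) = lnormal dterm_code [(1, g, [1..<lgen_arity g + 1])] \<and>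
   lnormal dterm_code (lbind (lterms g) right_counit_terms) = lnormal dterm_code [(1, g, [1..<lgen_arity g + 1])]"
  by (rule lgen_cases; code_simp)

text \<open>Needed to turn the sum over the set of compositions into a sum over the list.\<close>

lemma distinct_comps: "n \<in> {2, 3, 4, 5} \<Longrightarrow> distinct (comps n)"
proof -
  have "list_all (\<lambda>n. distinct (comps n)) [2, 3, 4, 5]" by code_simp
  then show "n \<in> {2, 3, 4, 5} \<Longrightarrow> distinct (comps n)" by auto
qed

lemma cyc_permutes: "set cs \<subseteq> {1..n} \<Longrightarrow> cyc cs permutes {1..n}"
  by (rule permutes_subset[OF cycle_permutes])

lemma lgen_dif_permutes: "list_all (\<lambda>(c, h, \<tau>). \<tau> permutes {1..lgen_arity g}) (lgen_dif g)"
  by (cases g) (simp_all add: permutes_id cyc_permutes del: One_nat_def cycle_of_list.simps)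

lemma lgen_reduced_decomp_permutes:
  "g \<notin> {L1, L2, L3, L4, L5} \<Longrightarrow>
   list_all (\<lambda>(c, h, gs, \<sigma>). \<sigma> permutes {1..lgen_arity g}) (lgen_reduced_decomp g)"
  by (cases g) (simp_all add: permutes_id cyc_permutes del: One_nat_def cycle_of_list.simps)

lemma set_comps: "set (comps n) = compositions n"
proof (induction n rule: less_induct)
  case (less n)
  show ?case
  proof (cases n)
    case 0
    have "ks = []" if "ks \<in> compositions 0" for ks
      using that by (cases ks) (auto simp: compositions_def)
    moreover have "[] \<in> compositions 0" by (simp add: compositions_def)
    ultimately show ?thesis using 0 by auto
  next
    case (Suc m)
    have "ks \<in> compositions (Suc m) \<longleftrightarrow> (\<exists>k\<le>m. \<exists>ks'\<in>compositions (m - k). ks = Suc k # ks')" for ks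
    proof
      assume ks: "ks \<in> compositions (Suc m)"
      then obtain k' ks' where e: "ks = k' # ks'" by (cases ks) (auto simp: compositions_def)
      with ks obtain k where "k' = Suc k" by (cases k') (auto simp: compositions_def)
      with ks e show "\<exists>k\<le>m. \<exists>ks'\<in>compositions (m - k). ks = Suc k # ks'"
        by (auto simp: compositions_def)
    qed (auto simp: compositions_def)
    moreover have "set (comps (m - k)) = compositions (m - k)" for k
      using less.IH[of "m - k"] Suc by simp
    moreover have "ks \<in> set (comps (Suc m)) \<longleftrightarrow> (\<exists>k\<le>m. \<exists>ks'\<in>set (comps (m - k)). ks = Suc k # ks')" for ks
      by (auto simp: less_Suc_eq_le image_iff Bex_def)
    ultimately show ?thesis
      using Suc by auto
  qed
qed

subsection \<open>Inverses of reduced shuffles\<close>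

lemma is_perm_iff: "t \<in> set (permutations_of_set_list [1..<n + 1]) \<longleftrightarrow> is_perm n t"
proof -
  have upt: "set [1..<n + 1] = {1..n}" by auto
  have "t \<in> set (permutations_of_set_list [1..<n + 1]) \<longleftrightarrow> t \<in> permutations_of_set (set [1..<n + 1])"
    by (simp only: permutations_of_list distinct_remdups_id[OF distinct_upt])
  also have "\<dots> \<longleftrightarrow> set t = {1..n} \<and> distinct t"
    by (simp only: permutations_of_set_def upt mem_Collect_eq)
  also have "\<dots> \<longleftrightarrow> is_perm n t"
  proof
    assume "set t = {1..n} \<and> distinct t"
    then show "is_perm n t" using distinct_card[of t] by (simp add: is_perm_def)
  next
    assume t: "is_perm n t"
    then have "set t \<subseteq> {1..n}" "card (set t) = card {1..n}" by (auto simp: is_perm_def distinct_card)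
    then have "set t = {1..n}" by (intro card_subset_eq) simp_all
    then show "set t = {1..n} \<and> distinct t" using t by (simp add: is_perm_def)
  qed
  finally show ?thesis .
qed

lemma oneline_inv:
  assumes "\<tau> permutes {1..n}"
  shows "oneline n (inv_into UNIV \<tau>) = inverse_list (oneline n \<tau>)"
proof -
  have "inverse_list (oneline n \<tau>) = permuted \<tau> [1..<n + 1]"
    using permuted_list_eq[of "[1..<n + 1]" "oneline n \<tau>"] is_perm_oneline[OF assms]
    by (simp add: inverse_list_def perm_of_oneline[OF assms])
  also have "\<dots> = oneline n (inv_into UNIV \<tau>)"
  proof (rule permuted_eqI[OF assms])
    fix i assume "i < n"
    then show "oneline n (inv_into UNIV \<tau>) ! (\<tau> (Suc i) - 1) = [1..<n + 1] ! i"
      using permutes_range_Suc[OF assms, of i] permutes_inverses(2)[OF assms, of "Suc i"]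
      by (auto simp: nth_oneline less_eq_Suc_le)
  qed simp_all
  finally show ?thesis by simp
qed

lemma strict_mono_on_upt: "strict_mono_on {a..<b} f \<longleftrightarrow> sorted_wrt (<) (map f [a..<b])" for f :: "nat \<Rightarrow> nat"
proof
  assume m: "strict_mono_on {a..<b} f"
  have "f (a + i) < f (a + j)" if "i < j" "j < b - a" for i j
    by (rule strict_mono_onD[OF m]) (use that in auto)
  then show "sorted_wrt (<) (map f [a..<b])"
    by (simp add: sorted_wrt_iff_nth_less)
next
  assume s: "sorted_wrt (<) (map f [a..<b])"
  show "strict_mono_on {a..<b} f"
  proof (rule strict_mono_onI)
    fix r s' assume rs: "r \<in> {a..<b}" "s' \<in> {a..<b}" "r < s'"
    then have "r - a < s' - a" "s' - a < b - a" "a + (r - a) = r" "a + (s' - a) = s'" by auto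
    moreover have "f (a + i) < f (a + j)" if "i < j" "j < b - a" for i j
      using s that by (simp add: sorted_wrt_iff_nth_less)
    ultimately show "f r < f s'" by metis
  qed
qed

lemma reduced_shuffles_iff:
  assumes "sum_list ks = n" "\<forall>k\<in>set ks. k \<ge> 1"
  shows "\<tau> \<in> reduced_shuffles ks \<longleftrightarrow> \<tau> permutes {1..n} \<and> reduced_list ks (oneline n \<tau>)"
proof -
  have le: "block_end ks i \<le> n" for i
    unfolding block_end_def assms(1)[symmetric]
    by (metis append_take_drop_id le_add1 sum_list_append)
  \<comment> \<open>Parts are positive, so the end of a nonempty initial run of blocks is a letter,
    and its value is an entry of the word.\<close>
  have ge: "block_end ks i \<ge> 1" if i: "i \<ge> 1" "i \<le> length ks" for i
  proof -
    have "hd ks \<in> set (take i ks)" using i by (cases ks; cases i) auto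
    then have "hd ks \<le> block_end ks i" unfolding block_end_def by (rule member_le_sum_list) simp
    moreover have "hd ks \<ge> 1" using assms(2) i by (cases ks) auto
    ultimately show ?thesis by simp
  qed
  have nth: "oneline n \<tau> ! (j - 1) = \<tau> j" if "1 \<le> j" "j \<le> n" for j
    using that by (simp add: nth_oneline)
  have 1: "map (\<lambda>j. oneline n \<tau> ! (j - 1)) [block_end ks i + 1..<block_end ks (Suc i) + 1] =
      map \<tau> [block_end ks i + 1..<block_end ks (Suc i) + 1]" for i
    using nth le[of "Suc i"] by (intro map_cong refl) auto
  have 2: "map (\<lambda>i. oneline n \<tau> ! (block_end ks i - 1)) [1..<length ks + 1] =
      map (\<lambda>i. \<tau> (block_end ks i)) [1..<length ks + 1]"
    using nth[OF ge le] by (intro map_cong refl) auto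
  have e: "{a<..b} = {a + 1..<b + 1}" "{1..b} = {1..<b + 1}" for a b :: nat by auto
  show ?thesis
    unfolding reduced_shuffles_def shuffles_of_def reduced_list_def assms(1) 1 2 e strict_mono_on_upt
    by (auto simp: less_Suc_eq_le)
qed

text \<open>The list has no repetitions because inversion and the passage to words are injective.
  Together with the description of the set, this replaces the sum over a set of permutations by the
  table.\<close>

lemma inv_reduced_shuffles:
  assumes "ks \<in> compositions n"
  defines "ts \<equiv> map inverse_list (filter (reduced_list ks) (permutations_of_set_list [1..<n + 1]))"
  shows "inv_into UNIV ` reduced_shuffles ks = set (map perm_of ts)" "distinct (map perm_of ts)"
    and "s \<in> set ts \<Longrightarrow> is_perm n s"
proof -
  note iff = reduced_shuffles_iff[of ks n]
  have ks: "sum_list ks = n" "\<forall>k\<in>set ks. k \<ge> 1" using assms(1) by (auto simp: compositions_def)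
  have inv: "perm_of (inverse_list t) = inv_into UNIV (perm_of t)" "is_perm n (inverse_list t)" if t: "is_perm n t" for t
  proof -
    note p = perm_of_permutes[OF t]
    have o: "oneline n (perm_of t) = t" using t by (simp add: is_perm_def oneline_perm_of)
    show "perm_of (inverse_list t) = inv_into UNIV (perm_of t)"
      using perm_of_oneline[OF permutes_inv[OF p]] oneline_inv[OF p] o by simp
    show "is_perm n (inverse_list t)"
      using is_perm_oneline[OF permutes_inv[OF p]] oneline_inv[OF p] o by simp
  qed
  have set: "set ts = inverse_list ` {t. is_perm n t \<and> reduced_list ks t}"
    unfolding ts_def using is_perm_iff by auto
  show "s \<in> set ts \<Longrightarrow> is_perm n s" unfolding set using inv(2) by auto
  show "inv_into UNIV ` reduced_shuffles ks = set (map perm_of ts)"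
  proof (intro equalityI subsetI)
    fix \<sigma> assume "\<sigma> \<in> inv_into UNIV ` reduced_shuffles ks"
    then obtain \<tau> where \<tau>: "\<sigma> = inv_into UNIV \<tau>" "\<tau> permutes {1..n}" "reduced_list ks (oneline n \<tau>)"
      using iff[OF ks] by blast
    have "\<sigma> = perm_of (inverse_list (oneline n \<tau>))"
      using \<tau> perm_of_oneline[OF permutes_inv[OF \<tau>(2)]] by (simp add: oneline_inv)
    then show "\<sigma> \<in> set (map perm_of ts)"
      using \<tau>(3) is_perm_oneline[OF \<tau>(2)] by (auto simp: set)
  next
    fix \<sigma> assume "\<sigma> \<in> set (map perm_of ts)"
    then obtain t where t: "is_perm n t" "reduced_list ks t" "\<sigma> = perm_of (inverse_list t)"
      by (auto simp: set)
    then have "perm_of t \<in> reduced_shuffles ks"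
      using iff[OF ks, of "perm_of t"] perm_of_permutes[OF t(1)]
      by (simp add: oneline_perm_of is_perm_def)
    then show "\<sigma> \<in> inv_into UNIV ` reduced_shuffles ks" using t inv(1) by auto
  qed
  have "inj_on (\<lambda>t. perm_of (inverse_list t)) {t. is_perm n t}"
  proof (rule inj_onI)
    fix t u assume "t \<in> {t. is_perm n t}" "u \<in> {t. is_perm n t}"
      and eq: "perm_of (inverse_list t) = perm_of (inverse_list u)"
    then have t: "is_perm n t" and u: "is_perm n u" by simp_all
    have "inv_into UNIV (perm_of t) = inv_into UNIV (perm_of u)"
      using eq unfolding inv(1)[OF t] inv(1)[OF u] .
    then have "inv_into UNIV (inv_into UNIV (perm_of t)) = inv_into UNIV (inv_into UNIV (perm_of u))"
      by (rule arg_cong)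
    then have "perm_of t = perm_of u"
      unfolding permutes_inv_inv[OF perm_of_permutes[OF t]] permutes_inv_inv[OF perm_of_permutes[OF u]] .
    then have "oneline n (perm_of t) = oneline n (perm_of u)" by (rule arg_cong)
    moreover have "length t = n" "length u = n" using t u by (simp_all add: is_perm_def)
    ultimately show "t = u" by (simp only: oneline_perm_of)
  qed
  moreover have "set (filter (reduced_list ks) (permutations_of_set_list [1..<n + 1])) \<subseteq> {t. is_perm n t}"
    by (simp only: set_filter is_perm_iff) blast
  ultimately have "inj_on (\<lambda>t. perm_of (inverse_list t))
      (set (filter (reduced_list ks) (permutations_of_set_list [1..<n + 1])))"
    by (rule inj_on_subset)
  moreover have "distinct (filter (reduced_list ks) (permutations_of_set_list [1..<n + 1]))"
    by (intro distinct_filter distinct_permutations_of_set_list distinct_upt)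
  ultimately show "distinct (map perm_of ts)"
    unfolding ts_def map_map comp_def distinct_map by blast
qed

section \<open>The dg symmetric module \<open>Lie\<^sub>3\<close>\<close>

lemma lbind_closed:
  assumes "\<And>t. t \<in> snd ` set xs \<Longrightarrow> ev ` snd ` set (F t) \<subseteq> A"
  shows "ev ` snd ` set (lbind xs F) \<subseteq> A"
proof
  fix y assume "y \<in> ev ` snd ` set (lbind xs F)"
  then obtain b u d v where *: "(b, u) \<in> set xs" "(d, v) \<in> set (F u)" "y = ev v"
    by (auto simp: lbind_def)
  then have "u \<in> snd ` set xs" by force
  from assms[OF this] * show "y \<in> A" by (force simp: image_subset_iff)
qed

lemma (in rmodule) lsum_scale:
  assumes "ev ` f ` snd ` set xs \<subseteq> carrier M"
  shows "lsum M (\<lambda>t. [(K t)] \<cdot>\<^bsub>M\<^esub> ev (f t)) xs = lsum M ev (map (\<lambda>(c, t). (c * K t, f t)) xs)"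
  using assms by (induction xs) (auto simp: zsmult_zsmult)

lemma (in rmodule) lsum_single: "ev t \<in> carrier M \<Longrightarrow> lsum M ev [(1, t)] = ev t"
  by simp

text \<open>Multilinear expansion in all inner factors at once; \<open>\<alpha>\<close> collects the
  slots already expanded. That all expanded terms are generators is carried through the same
  induction, since it gives membership of the intermediate sums.\<close>

lemma (in composite_product) el_lsum:
  assumes "(\<mu>, \<alpha> @ map (\<lambda>g. (k g, q g, lsum (piece N (k g) (q g)) ev (X g))) gs, \<sigma>) \<in> G n p"
    and "\<And>g. g \<in> set gs \<Longrightarrow> ev ` snd ` set (X g) \<subseteq> carrier (piece N (k g) (q g))"
  shows "el (\<mu>, \<alpha> @ map (\<lambda>g. (k g, q g, lsum (piece N (k g) (q g)) ev (X g))) gs, \<sigma>) =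
      lsum (Q n p) (\<lambda>ts. el (\<mu>, \<alpha> @ map2 (\<lambda>g t. (k g, q g, ev t)) gs ts, \<sigma>)) (prods (map X gs))"
    and "\<And>ts. ts \<in> snd ` set (prods (map X gs)) \<Longrightarrow> (\<mu>, \<alpha> @ map2 (\<lambda>g t. (k g, q g, ev t)) gs ts, \<sigma>) \<in> G n p"
proof -
  interpret Q: rmodule R "Q n p" by (rule Q_rmodule)
  let ?z = "\<lambda>g. (k g, q g, lsum (piece N (k g) (q g)) ev (X g))" and ?w = "\<lambda>g t. (k g, q g, ev t)"
  have "el (\<mu>, \<alpha> @ map ?z gs, \<sigma>) = lsum (Q n p) (\<lambda>ts. el (\<mu>, \<alpha> @ map2 ?w gs ts, \<sigma>)) (prods (map X gs)) \<and>
    (\<forall>ts\<in>snd ` set (prods (map X gs)). (\<mu>, \<alpha> @ map2 ?w gs ts, \<sigma>) \<in> G n p)"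
    using assms
  proof (induction gs arbitrary: \<alpha>)
    case Nil
    then show ?case using el_closed by simp
  next
    case (Cons g gs)
    interpret PN: rmodule R "piece N (k g) (q g)" by (rule N.piece_rmodule)
    have X: "ev ` snd ` set (X g) \<subseteq> carrier (piece N (k g) (q g))" by (rule Cons.prems(2)) simp
    have G0: "(\<mu>, \<alpha> @ ?z g # map ?z gs, \<sigma>) \<in> G n p" using Cons.prems(1) by simp
    have Gt: "(\<mu>, (\<alpha> @ [?w g t]) @ map ?z gs, \<sigma>) \<in> G n p" if "t \<in> snd ` set (X g)" for t
    proof -
      have "ev t \<in> carrier (piece N (k g) (q g))" using X that by blast
      from gens_change_slot[OF G0 this] show ?thesis by simp
    qed
    have IH: "el (\<mu>, (\<alpha> @ [?w g t]) @ map ?z gs, \<sigma>) =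
        lsum (Q n p) (\<lambda>ts. el (\<mu>, (\<alpha> @ [?w g t]) @ map2 ?w gs ts, \<sigma>)) (prods (map X gs))"
      "\<forall>ts\<in>snd ` set (prods (map X gs)). (\<mu>, (\<alpha> @ [?w g t]) @ map2 ?w gs ts, \<sigma>) \<in> G n p"
      if "t \<in> snd ` set (X g)" for t
      using Cons.IH[OF Gt[OF that]] Cons.prems(2) by simp_all
    let ?ev = "\<lambda>ts. el (\<mu>, \<alpha> @ map2 ?w (g # gs) ts, \<sigma>)"
    let ?F = "\<lambda>t. map (\<lambda>(c, ts). (c, t # ts)) (prods (map X gs))"
    have "el (\<mu>, \<alpha> @ map ?z (g # gs), \<sigma>) = lsum (Q n p) (\<lambda>t. el (\<mu>, \<alpha> @ ?w g t # map ?z gs, \<sigma>)) (X g)"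
      using PN.module_hom_lsum[OF Q_module el_slot_hom[OF G0] X] by simp
    also have "\<dots> = lsum (Q n p) ?ev (lbind (X g) ?F)"
    proof (rule Q.lsum_lbind)
      fix t assume t: "t \<in> snd ` set (X g)"
      show "el (\<mu>, \<alpha> @ ?w g t # map ?z gs, \<sigma>) = lsum (Q n p) ?ev (?F t)"
        using IH(1)[OF t] by (simp add: Q.lsum_map)
      show "?ev ` snd ` set (?F t) \<subseteq> carrier (Q n p)"
        using IH(2)[OF t] by (auto intro!: el_closed)
    qed
    finally have 1: "el (\<mu>, \<alpha> @ map ?z (g # gs), \<sigma>) = lsum (Q n p) ?ev (prods (map X (g # gs)))" by simp
    have "(\<mu>, \<alpha> @ map2 ?w (g # gs) ts, \<sigma>) \<in> G n p" if ts: "ts \<in> snd ` set (prods (map X (g # gs)))" for ts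
    proof -
      obtain t us where *: "ts = t # us" "t \<in> snd ` set (X g)" "us \<in> snd ` set (prods (map X gs))"
        using ts by (force simp: lbind_def)
      from bspec[OF IH(2)[OF *(2)] *(3)] show ?thesis by (simp add: *(1))
    qed
    with 1 show ?case by blast
  qed
  then show "el (\<mu>, \<alpha> @ map ?z gs, \<sigma>) = lsum (Q n p) (\<lambda>ts. el (\<mu>, \<alpha> @ map2 ?w gs ts, \<sigma>)) (prods (map X gs))"
    "\<And>ts. ts \<in> snd ` set (prods (map X gs)) \<Longrightarrow> (\<mu>, \<alpha> @ map2 ?w gs ts, \<sigma>) \<in> G n p"
    by blast+
qed

lemma prods_mem:
  assumes "ts \<in> snd ` set (prods xss)"
  shows "list_all2 (\<lambda>xs t. t \<in> snd ` set xs) xss ts"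
  using assms
proof (induction xss arbitrary: ts)
  case (Cons xs xss)
  then obtain t us where "ts = t # us" "t \<in> snd ` set xs" "us \<in> snd ` set (prods xss)"
    by (force simp: lbind_def)
  with Cons.IH[of us] show ?case by simp
qed simp

lemma Lie3_simps [simp]:
  "piece (Lie3 R) n p = Lie3_piece R n p"
  "act (Lie3 R) n p x \<tau> = free_lift R (Lie3_piece R n p) (\<lambda>(g, \<sigma>). basis R (g, \<sigma> \<circ> \<tau>)) x"
  by (simp_all add: Lie3_def)

lemma dterms_okD: "t \<in> snd ` set (dterms g) \<Longrightarrow> dterm_ok g t"
  using dterms_ok[of g] by (auto simp: list_all_iff)

lemma lterms_okD: "t \<in> snd ` set (lterms g) \<Longrightarrow> lterm_ok g t"
  using lterms_ok[of g] by (auto simp: list_all_iff)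

context cring
begin

abbreviation "ind n p \<equiv> {(g, \<sigma>). lgen_arity g = n \<and> lgen_degr g = p \<and> \<sigma> permutes {1..n}}"

lemma Lie3_module: "module R (Lie3_piece R n p)"
  unfolding Lie3_piece_def by (rule free_module_is_module)

lemma Lie3_basis:
  "lgen_arity g = n \<Longrightarrow> lgen_degr g = p \<Longrightarrow> \<sigma> permutes {1..n} \<Longrightarrow> basis R (g, \<sigma>) \<in> carrier (Lie3_piece R n p)"
  unfolding Lie3_piece_def by (rule basis_in_free_module) (simp only: mem_Collect_eq case_prod_conv)

lemma Lie3_hom_eqI:
  assumes "module R A" "f \<in> module_hom R (Lie3_piece R n p) A" "h \<in> module_hom R (Lie3_piece R n p) A"
    and "\<And>g \<sigma>. lgen_arity g = n \<Longrightarrow> lgen_degr g = p \<Longrightarrow> \<sigma> permutes {1..n} \<Longrightarrow> f (basis R (g, \<sigma>)) = h (basis R (g, \<sigma>))"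
    and "x \<in> carrier (Lie3_piece R n p)"
  shows "f x = h x"
  using free_module_hom_eqI[OF assms(1), of f "ind n p" h x] assms unfolding Lie3_piece_def by blast

lemma
  assumes "module R A"
    and "\<And>g \<sigma>. lgen_arity g = n \<Longrightarrow> lgen_degr g = p \<Longrightarrow> \<sigma> permutes {1..n} \<Longrightarrow> \<phi> (g, \<sigma>) \<in> carrier A"
  shows Lie3_lift_hom: "free_lift R A \<phi> \<in> module_hom R (Lie3_piece R n p) A"
    and Lie3_lift_basis: "lgen_arity g = n \<Longrightarrow> lgen_degr g = p \<Longrightarrow> \<sigma> permutes {1..n} \<Longrightarrow>
      free_lift R A \<phi> (basis R (g, \<sigma>)) = \<phi> (g, \<sigma>)"
proof -
  have \<phi>: "\<phi> s \<in> carrier A" if "s \<in> ind n p" for s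
    using that assms(2) by (cases s) blast
  show "free_lift R A \<phi> \<in> module_hom R (Lie3_piece R n p) A"
    unfolding Lie3_piece_def by (rule free_lift_hom[OF assms(1) \<phi>])
  show "free_lift R A \<phi> (basis R (g, \<sigma>)) = \<phi> (g, \<sigma>)"
    if "lgen_arity g = n" "lgen_degr g = p" "\<sigma> permutes {1..n}"
    by (rule free_lift_basis[OF assms(1) \<phi>, of "ind n p"]) (use that in \<open>simp only: mem_Collect_eq case_prod_conv\<close>)+
qed

lemma Lie3_act_hom:
  assumes "\<tau> permutes {1..n}"
  shows "(\<lambda>x. act (Lie3 R) n p x \<tau>) \<in> module_hom R (Lie3_piece R n p) (Lie3_piece R n p)"
  unfolding Lie3_simps
  by (rule Lie3_lift_hom[OF Lie3_module]) (simp only: case_prod_conv Lie3_basis permutes_compose assms)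

lemma Lie3_act_basis:
  assumes "\<tau> permutes {1..n}" "lgen_arity g = n" "lgen_degr g = p" "\<sigma> permutes {1..n}"
  shows "act (Lie3 R) n p (basis R (g, \<sigma>)) \<tau> = basis R (g, \<sigma> \<circ> \<tau>)"
proof -
  have "free_lift R (Lie3_piece R n p) (\<lambda>(g, \<sigma>). basis R (g, \<sigma> \<circ> \<tau>)) (basis R (g, \<sigma>)) =
      (\<lambda>(g, \<sigma>). basis R (g, \<sigma> \<circ> \<tau>)) (g, \<sigma>)"
    by (rule Lie3_lift_basis[OF Lie3_module _ assms(2-4)])
      (simp only: case_prod_conv Lie3_basis permutes_compose assms(1))
  then show ?thesis by simp
qed

text \<open>Evaluates a table entry of a generator at its translate by \<open>\<sigma>\<close>.
  Carrying \<open>\<sigma>\<close> along means that each formal identity has to be checked for the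
  generators only.\<close>

abbreviation dev where "dev \<sigma> \<equiv> (\<lambda>(h, s). basis R (h, perm_of s \<circ> \<sigma>))"

lemma dev_closed:
  assumes "dterm_ok g t" "lgen_arity g = n" "lgen_degr g = p + 1" "\<sigma> permutes {1..n}"
  shows "dev \<sigma> t \<in> carrier (Lie3_piece R n p)"
  using assms perm_of_permutes
  by (cases t) (auto simp: dterm_ok_def intro!: Lie3_basis permutes_compose simp del: One_nat_def)

lemma dterms_closed:
  assumes "lgen_arity g = n" "lgen_degr g = p" "\<sigma> permutes {1..n}"
  shows "dev \<sigma> ` snd ` set (dterms g) \<subseteq> carrier (Lie3_piece R n (p - 1))"
  using dev_closed[OF dterms_okD, of _ g n "p - 1" \<sigma>] assms by auto

lemma Lie3_dif_eq:
  "dif (Lie3 R) n p x = free_lift R (Lie3_piece R n (p - 1))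
     (\<lambda>(g, \<sigma>). list_sum (Lie3_piece R n (p - 1))
        (map (\<lambda>(c, h, \<tau>). [c] \<cdot>\<^bsub>Lie3_piece R n (p - 1)\<^esub> basis R (h, \<tau> \<circ> \<sigma>)) (lgen_dif g))) x"
  by (simp add: Lie3_def)

lemma lgen_dif_sum:
  "list_sum A (map (\<lambda>(c, h, \<tau>). [c] \<cdot>\<^bsub>A\<^esub> basis R (h, \<tau> \<circ> \<sigma>)) (lgen_dif g)) = lsum A (dev \<sigma>) (dterms g)"
proof -
  have eq: "map (\<lambda>(c, h, \<tau>). [c] \<cdot>\<^bsub>A\<^esub> basis R (h, \<tau> \<circ> \<sigma>)) (lgen_dif g) =
      map (\<lambda>(c, h, \<tau>). [c] \<cdot>\<^bsub>A\<^esub> basis R (h, perm_of (oneline (lgen_arity g) \<tau>) \<circ> \<sigma>)) (lgen_dif g)"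
    using lgen_dif_permutes[of g] by (intro map_cong refl) (auto simp: list_all_iff perm_of_oneline simp del: One_nat_def)
  show ?thesis
    unfolding eq by (simp add: lsum_def dterms_def comp_def case_prod_unfold)
qed

lemma
  shows Lie3_dif_hom: "dif (Lie3 R) n p \<in> module_hom R (Lie3_piece R n p) (Lie3_piece R n (p - 1))"
    and Lie3_dif_basis: "lgen_arity g = n \<Longrightarrow> lgen_degr g = p \<Longrightarrow> \<sigma> permutes {1..n} \<Longrightarrow>
      dif (Lie3 R) n p (basis R (g, \<sigma>)) = lsum (Lie3_piece R n (p - 1)) (dev \<sigma>) (dterms g)"
proof -
  let ?\<phi> = "\<lambda>(g, \<sigma>). lsum (Lie3_piece R n (p - 1)) (dev \<sigma>) (dterms g)"
  interpret A: rmodule R "Lie3_piece R n (p - 1)" by (intro rmodule.intro Lie3_module)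
  have eq: "dif (Lie3 R) n p = free_lift R (Lie3_piece R n (p - 1)) ?\<phi>"
    unfolding Lie3_dif_eq[abs_def] lgen_dif_sum by (rule ext) (rule refl)
  have \<phi>: "?\<phi> (g, \<sigma>) \<in> carrier (Lie3_piece R n (p - 1))"
    if "lgen_arity g = n" "lgen_degr g = p" "\<sigma> permutes {1..n}" for g \<sigma>
    unfolding case_prod_conv by (rule A.lsum_closed[OF dterms_closed[OF that]])
  show "dif (Lie3 R) n p \<in> module_hom R (Lie3_piece R n p) (Lie3_piece R n (p - 1))"
    unfolding eq by (rule Lie3_lift_hom[where \<phi> = ?\<phi>, OF Lie3_module \<phi>])
  show "dif (Lie3 R) n p (basis R (g, \<sigma>)) = lsum (Lie3_piece R n (p - 1)) (dev \<sigma>) (dterms g)"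
    if "lgen_arity g = n" "lgen_degr g = p" "\<sigma> permutes {1..n}"
    unfolding eq using Lie3_lift_basis[where \<phi> = ?\<phi>, OF Lie3_module \<phi> that] by simp
qed

lemma dev_comp:
  assumes "dterm_ok g t" "is_perm (lgen_arity g) s"
  shows "dev (perm_of s \<circ> \<sigma>) t = dev \<sigma> (case t of (h, u) \<Rightarrow> (h, comp_list u s))"
  using assms perm_of_comp by (cases t) (auto simp: dterm_ok_def comp_assoc)

text \<open>The equational axioms compare linear maps and are tested on basis elements. The square
  of the differential rests on the evaluated table; the equivariance axioms come down to
  associativity of composition.\<close>

lemma Lie3_dg_smodule: "dg_smodule R (Lie3 R)"
proof (rule dg_smodule.intro[OF is_cring], rule dg_smodule_axioms.intro; unfold Lie3_simps(1))
  fix n p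
  interpret A: rmodule R "Lie3_piece R n q" for q by (intro rmodule.intro Lie3_module)
  show "module R (Lie3_piece R n p)" by (rule Lie3_module)
  show "dif (Lie3 R) n p \<in> module_hom R (Lie3_piece R n p) (Lie3_piece R n (p - 1))" by (rule Lie3_dif_hom)
  show "dif (Lie3 R) n (p - 1) (dif (Lie3 R) n p x) = \<zero>\<^bsub>Lie3_piece R n (p - 1 - 1)\<^esub>"
    if "x \<in> carrier (Lie3_piece R n p)" for x
  proof (rule Lie3_hom_eqI[OF Lie3_module module_hom_comp[OF Lie3_dif_hom Lie3_dif_hom] A.zero_hom _ that])
    fix g \<sigma> assume g: "lgen_arity g = n" "lgen_degr g = p" "\<sigma> permutes {1..n}"
    \<comment> \<open>The substitution occurring in \<open>dd_terms\<close>: the twist of an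
      intermediate generator is composed into the final permutation.\<close>
    let ?F = "\<lambda>(h, t). map (\<lambda>(c, k, s). (c, k, comp_list s t)) (dterms h)"
    have F: "dif (Lie3 R) n (p - 1) (dev \<sigma> t) = lsum (Lie3_piece R n (p - 1 - 1)) (dev \<sigma>) (?F t)"
      "dev \<sigma> ` snd ` set (?F t) \<subseteq> carrier (Lie3_piece R n (p - 1 - 1))"
      if t: "t \<in> snd ` set (dterms g)" for t
    proof -
      obtain h s where hs: "t = (h, s)" by (cases t)
      have ok: "lgen_arity h = n" "lgen_degr h = p - 1" "is_perm n s"
        using dterms_okD[OF t] g by (auto simp: hs dterm_ok_def)
      note p = permutes_compose[OF g(3) perm_of_permutes[OF ok(3)]]
      have F: "?F t = map (\<lambda>(c, u). (c, case u of (h, u) \<Rightarrow> (h, comp_list u s))) (dterms h)"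
        by (simp add: hs case_prod_unfold)
      have comp: "dev (perm_of s \<circ> \<sigma>) u = dev \<sigma> (case u of (h, u) \<Rightarrow> (h, comp_list u s))"
        if "u \<in> snd ` set (dterms h)" for u
        using dev_comp[OF dterms_okD[OF that]] ok by simp
      have "dif (Lie3 R) n (p - 1) (dev \<sigma> t) = lsum (Lie3_piece R n (p - 1 - 1)) (dev (perm_of s \<circ> \<sigma>)) (dterms h)"
        using Lie3_dif_basis[OF ok(1,2) p] by (simp add: hs)
      also have "\<dots> = lsum (Lie3_piece R n (p - 1 - 1)) (dev \<sigma>) (?F t)"
        unfolding F A.lsum_map by (rule A.lsum_cong) (rule comp)
      finally show "dif (Lie3 R) n (p - 1) (dev \<sigma> t) = \<dots>" .
      have "dev \<sigma> ` snd ` set (?F t) = dev (perm_of s \<circ> \<sigma>) ` snd ` set (dterms h)"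
        unfolding F using comp by (force simp: image_image intro!: image_cong)
      then show "dev \<sigma> ` snd ` set (?F t) \<subseteq> carrier (Lie3_piece R n (p - 1 - 1))"
        using dterms_closed[OF ok(1,2) p] by simp
    qed
    have cl: "dev \<sigma> ` snd ` set (dd_terms g) \<subseteq> carrier (Lie3_piece R n (p - 1 - 1))"
      unfolding dd_terms_def by (rule lbind_closed[OF F(2)])
    have "dif (Lie3 R) n (p - 1) (dif (Lie3 R) n p (basis R (g, \<sigma>))) =
        lsum (Lie3_piece R n (p - 1 - 1)) (\<lambda>t. dif (Lie3 R) n (p - 1) (dev \<sigma> t)) (dterms g)"
      unfolding Lie3_dif_basis[OF g] by (rule A.module_hom_lsum[OF Lie3_module Lie3_dif_hom dterms_closed[OF g]])
    also have "\<dots> = lsum (Lie3_piece R n (p - 1 - 1)) (dev \<sigma>) (dd_terms g)"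
      unfolding dd_terms_def by (rule A.lsum_lbind[OF F])
    also have "\<dots> = \<zero>\<^bsub>Lie3_piece R n (p - 1 - 1)\<^esub>"
      using A.lsum_lnormal[OF cl, of dterm_code] by (simp add: dif_dif_terms)
    finally show "dif (Lie3 R) n (p - 1) (dif (Lie3 R) n p (basis R (g, \<sigma>))) = \<zero>\<^bsub>Lie3_piece R n (p - 1 - 1)\<^esub>" .
  qed
  show "(\<lambda>x. act (Lie3 R) n p x \<sigma>) \<in> module_hom R (Lie3_piece R n p) (Lie3_piece R n p)"
    if "\<sigma> permutes {1..n}" for \<sigma> by (rule Lie3_act_hom[OF that])
  show "act (Lie3 R) n p x id = x" if "x \<in> carrier (Lie3_piece R n p)" for x
    by (rule Lie3_hom_eqI[OF Lie3_module Lie3_act_hom[OF permutes_id] module_hom_id _ that])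
      (simp only: Lie3_act_basis permutes_id comp_id)
  show "act (Lie3 R) n p (act (Lie3 R) n p x \<sigma>) \<tau> = act (Lie3 R) n p x (\<sigma> \<circ> \<tau>)"
    if "\<sigma> permutes {1..n}" "\<tau> permutes {1..n}" "x \<in> carrier (Lie3_piece R n p)" for \<sigma> \<tau> x
    by (rule Lie3_hom_eqI[OF Lie3_module module_hom_comp[OF Lie3_act_hom[OF that(1)] Lie3_act_hom[OF that(2)]]
          Lie3_act_hom[OF permutes_compose[OF that(2,1)]] _ that(3)])
      (simp only: Lie3_act_basis permutes_compose that(1,2) comp_assoc)
  show "dif (Lie3 R) n p (act (Lie3 R) n p x \<sigma>) = act (Lie3 R) n (p - 1) (dif (Lie3 R) n p x) \<sigma>"
    if \<sigma>: "\<sigma> permutes {1..n}" and x: "x \<in> carrier (Lie3_piece R n p)" for \<sigma> x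
  proof (rule Lie3_hom_eqI[OF Lie3_module module_hom_comp[OF Lie3_act_hom[OF \<sigma>] Lie3_dif_hom]
        module_hom_comp[OF Lie3_dif_hom Lie3_act_hom[OF \<sigma>]] _ x])
    fix g \<tau> assume g: "lgen_arity g = n" "lgen_degr g = p" "\<tau> permutes {1..n}"
    have "act (Lie3 R) n (p - 1) (lsum (Lie3_piece R n (p - 1)) (dev \<tau>) (dterms g)) \<sigma> =
        lsum (Lie3_piece R n (p - 1)) (\<lambda>t. act (Lie3 R) n (p - 1) (dev \<tau> t) \<sigma>) (dterms g)"
      by (rule A.module_hom_lsum[OF Lie3_module Lie3_act_hom[OF \<sigma>] dterms_closed[OF g]])
    also have "\<dots> = lsum (Lie3_piece R n (p - 1)) (dev (\<tau> \<circ> \<sigma>)) (dterms g)"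
    proof (rule A.lsum_cong)
      fix t assume t: "t \<in> snd ` set (dterms g)"
      obtain h s where hs: "t = (h, s)" by (cases t)
      have ok: "lgen_arity h = n" "lgen_degr h = p - 1" "is_perm n s"
        using dterms_okD[OF t] g by (auto simp: hs dterm_ok_def)
      show "act (Lie3 R) n (p - 1) (dev \<tau> t) \<sigma> = dev (\<tau> \<circ> \<sigma>) t"
        unfolding hs case_prod_conv
        using Lie3_act_basis[OF \<sigma> ok(1,2) permutes_compose[OF g(3) perm_of_permutes[OF ok(3)]]]
        by (simp only: comp_assoc)
    qed
    finally show "dif (Lie3 R) n p (act (Lie3 R) n p (basis R (g, \<tau>)) \<sigma>) =
        act (Lie3 R) n (p - 1) (dif (Lie3 R) n p (basis R (g, \<tau>))) \<sigma>"
      unfolding Lie3_act_basis[OF \<sigma> g] Lie3_dif_basis[OF g]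
        Lie3_dif_basis[OF g(1,2) permutes_compose[OF \<sigma> g(3)]] ..
  qed
qed

end

section \<open>The decomposition map\<close>

locale lie3 = R?: cring R for R (structure)
begin

sublocale L: dg_smodule R "Lie3 R" by (rule Lie3_dg_smodule)
sublocale LL: dg_composite_product R "Lie3 R" "Lie3 R" ..
sublocale T: composite_triple R "Lie3 R" "Lie3 R" "Lie3 R" ..

abbreviation "C \<equiv> Lie3 R"
abbreviation "CC \<equiv> composite R (Lie3 R) (Lie3 R)"
abbreviation "lh \<equiv> lgen_homog R"
abbreviation "Q2 n p \<equiv> composite_piece R (Lie3 R) (Lie3 R) n p"
abbreviation "el2 \<equiv> elementary R (Lie3 R) (Lie3 R)"
abbreviation "ev2 \<sigma> \<equiv> (\<lambda>(h, gs, s). el2 (lh h, map lh gs, perm_of s \<circ> \<sigma>))"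

lemma lh_simps [simp]: "arity (lh g) = lgen_arity g" "degr (lh g) = lgen_degr g"
  by (simp_all add: lgen_homog_def)

lemma lh_closed: "lh g \<in> homogs C"
  unfolding lgen_homog_def by (simp only: homogs_iff Lie3_simps(1) Lie3_basis permutes_id)

lemma map_lh: "map arity (map lh gs) = map lgen_arity gs" "map degr (map lh gs) = map lgen_degr gs"
  by simp_all

lemma set_lh: "set (map lh gs) \<subseteq> homogs C"
  by (simp add: image_subset_iff lh_closed)

lemma ev2_gens:
  assumes "lterm_ok g (h, gs, s)" "lgen_arity g = n" "lgen_degr g = p" "\<sigma> permutes {1..n}"
  shows "(lh h, map lh gs, perm_of s \<circ> \<sigma>) \<in> gens C C n p"
  unfolding gens_iff map_lh
  using assms set_lh lh_closed permutes_compose[OF assms(4) perm_of_permutes]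
  by (simp add: lterm_ok_def)

lemma Q2_rmodule: "rmodule R (Q2 n p)"
  by (rule LL.Q_rmodule)

lemma lterms_closed:
  assumes "lgen_arity g = n" "lgen_degr g = p" "\<sigma> permutes {1..n}"
  shows "ev2 \<sigma> ` snd ` set (lterms g) \<subseteq> carrier (Q2 n p)"
proof (rule image_subsetI)
  fix t assume t: "t \<in> snd ` set (lterms g)"
  obtain h gs s where e: "t = (h, gs, s)" by (cases t)
  from LL.el_closed[OF ev2_gens[OF lterms_okD[OF t, unfolded e] assms]]
  show "ev2 \<sigma> t \<in> carrier (Q2 n p)" by (simp only: e case_prod_conv)
qed

text \<open>The two nested sums over sets become list sums, since compositions and inverse shuffles
  are listed without repetition, and the library sign is replaced by the Koszul sign.\<close>

lemma decomp_l_eq: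
  assumes n: "n \<in> {2, 3, 4, 5}"
  shows "decomp_l R n = lsum (Q2 n (lgen_degr (lgen_l n))) (ev2 id) (decomp_list n)"
proof -
  let ?Q = "Q2 n (lgen_degr (lgen_l n))"
  interpret Q: rmodule R ?Q by (rule Q2_rmodule)
  have g: "lgen_arity (lgen_l n) = n" "lterms (lgen_l n) = decomp_list n"
    using n by (auto simp: lgen_l_def lterms_def Let_def)
  \<comment> \<open>Membership of all terms is read off the evaluated table instead of being derived
    from the general formula.\<close>
  note cl = lterms_closed[OF g(1) refl permutes_id, unfolded g(2)]
  define ts where "ts ks = map inverse_list (filter (reduced_list ks) (permutations_of_set_list [1..<n + 1]))" for ks
  define c where "c ks = ((-1) ^ ((length ks - 1) * (n - length ks)) *
      (-1) ^ sum_list (map (\<lambda>i. (i - 1) * (ks ! (i - 1) - 1)) [1..<length ks + 1]) :: int)" for ks :: "nat list"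
  let ?k = "\<lambda>s. koszul_list s (replicate n 1)"
  define D where "D ks = map (\<lambda>s. (c ks * ?k s, lgen_l (length ks), map lgen_l ks, s)) (ts ks)" for ks
  have list: "decomp_list n = concat (map D (comps n))"
    unfolding decomp_list_def D_def ts_def c_def by (rule refl)
  have Dcl: "ev2 id ` snd ` set (D ks) \<subseteq> carrier ?Q" if "ks \<in> set (comps n)" for ks
    using cl that unfolding list by (auto simp: image_subset_iff)
  have inner: "[(c ks)] \<cdot>\<^bsub>?Q\<^esub> (\<Oplus>\<^bsub>?Q\<^esub>\<sigma>\<in>inv_into UNIV ` reduced_shuffles ks.
      [sign \<sigma>] \<cdot>\<^bsub>?Q\<^esub> lcomp R (lgen_l (length ks)) (map lgen_l ks) \<sigma>) = lsum ?Q (ev2 id) (D ks)"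
    if ks: "ks \<in> set (comps n)" for ks
  proof -
    have "ks \<in> compositions n" using ks by (simp add: set_comps)
    note inv = inv_reduced_shuffles[OF this, folded ts_def]
    let ?e = "\<lambda>s. el2 (lh (lgen_l (length ks)), map lh (map lgen_l ks), perm_of s)"
    have e: "?e s \<in> carrier ?Q" if "s \<in> set (ts ks)" for s
      using Dcl[OF ks] that by (auto simp: D_def image_subset_iff comp_id)
    have "(\<Oplus>\<^bsub>?Q\<^esub>\<sigma>\<in>inv_into UNIV ` reduced_shuffles ks.
        [sign \<sigma>] \<cdot>\<^bsub>?Q\<^esub> lcomp R (lgen_l (length ks)) (map lgen_l ks) \<sigma>) =
        list_sum ?Q (map (\<lambda>\<sigma>. [sign \<sigma>] \<cdot>\<^bsub>?Q\<^esub> lcomp R (lgen_l (length ks)) (map lgen_l ks) \<sigma>) (map perm_of (ts ks)))"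
      unfolding inv(1) using e by (intro Q.finsum_set_eq_list_sum inv(2)) (auto simp: lcomp_def)
    also have "\<dots> = list_sum ?Q (map (\<lambda>s. [(?k s)] \<cdot>\<^bsub>?Q\<^esub> ?e s) (ts ks))"
    proof -
      have "sign (perm_of s) = ?k s" if "s \<in> set (ts ks)" for s
      proof -
        note s = inv(3)[OF that]
        have "length s = n" using s by (simp add: is_perm_def)
        then show ?thesis
          using sign_eq_koszul_sign[OF perm_of_permutes[OF s]] by (simp add: koszul_list_eq)
      qed
      then show ?thesis
        unfolding map_map comp_def lcomp_def by (intro arg_cong[of _ _ "list_sum ?Q"] map_cong) simp_all
    qed
    also have "\<dots> = lsum ?Q ?e (map (\<lambda>s. (?k s, s)) (ts ks))"
      by (simp add: lsum_def comp_def)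
    finally have "[(c ks)] \<cdot>\<^bsub>?Q\<^esub> (\<Oplus>\<^bsub>?Q\<^esub>\<sigma>\<in>inv_into UNIV ` reduced_shuffles ks.
        [sign \<sigma>] \<cdot>\<^bsub>?Q\<^esub> lcomp R (lgen_l (length ks)) (map lgen_l ks) \<sigma>) =
        lsum ?Q ?e (map (\<lambda>(d, s). (c ks * d, s)) (map (\<lambda>s. (?k s, s)) (ts ks)))"
      using e by (simp only:) (intro Q.zsmult_lsum, auto)
    also have "\<dots> = lsum ?Q (ev2 id) (D ks)"
      by (simp only: lsum_def D_def map_map comp_def case_prod_conv) (simp add: id_def)
    finally show ?thesis .
  qed
  have c_eq: "((-1) ^ ((length ks - 1) * (n - length ks)) *
      (-1) ^ (\<Sum>i=1..length ks. (i - 1) * (ks ! (i - 1) - 1)) :: int) = c ks" for ks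
  proof -
    have "{1..length ks} = set [1..<length ks + 1]" by auto
    then show ?thesis unfolding c_def by (simp only: sum.distinct_set_conv_list distinct_upt)
  qed
  have fs: "f \<in> set xs \<rightarrow> carrier ?Q" if "\<And>x. x \<in> set xs \<Longrightarrow> f x \<in> carrier ?Q" for f and xs :: "nat list list"
    using that by blast
  have "decomp_l R n = (\<Oplus>\<^bsub>?Q\<^esub>ks\<in>set (comps n). [(c ks)] \<cdot>\<^bsub>?Q\<^esub> (\<Oplus>\<^bsub>?Q\<^esub>\<sigma>\<in>inv_into UNIV ` reduced_shuffles ks.
        [sign \<sigma>] \<cdot>\<^bsub>?Q\<^esub> lcomp R (lgen_l (length ks)) (map lgen_l ks) \<sigma>))"
    unfolding decomp_l_def Let_def c_eq set_comps by (rule refl)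
  also have "\<dots> = (\<Oplus>\<^bsub>?Q\<^esub>ks\<in>set (comps n). lsum ?Q (ev2 id) (D ks))"
    using inner Dcl by (intro Q.M.finsum_cong'[OF refl] fs Q.lsum_closed)
  also have "\<dots> = list_sum ?Q (map (\<lambda>ks. lsum ?Q (ev2 id) (D ks)) (comps n))"
    using Dcl by (intro Q.finsum_set_eq_list_sum distinct_comps[OF n] fs Q.lsum_closed)
  also have "\<dots> = lsum ?Q (ev2 id) (concat (map D (comps n)))"
  proof -
    have "lsum ?Q (ev2 id) (concat (map D (comps n))) = list_sum ?Q (map (lsum ?Q (ev2 id)) (map D (comps n)))"
    proof (rule Q.lsum_concat)
      fix xs assume "xs \<in> set (map D (comps n))"
      then obtain ks where "ks \<in> set (comps n)" "xs = D ks" by auto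
      then show "ev2 id ` snd ` set xs \<subseteq> carrier ?Q" using Dcl by (simp only:)
    qed
    then show ?thesis by (simp only: map_map comp_def)
  qed
  finally show ?thesis by (simp add: list)
qed

lemma lgen_decomp_eq: "lgen_decomp R g = lsum (Q2 (lgen_arity g) (lgen_degr g)) (ev2 id) (lterms g)"
proof -
  let ?Q = "Q2 (lgen_arity g) (lgen_degr g)"
  interpret Q: rmodule R ?Q by (rule Q2_rmodule)
  note cl = lterms_closed[OF refl refl permutes_id, of g]
  consider (1) "g = L1" | (l) "g \<in> {L2, L3, L4, L5}" | (o) "g \<notin> {L1, L2, L3, L4, L5}" by blast
  then show ?thesis
  proof cases
    case 1
    have "[1..<1 + 1] = [1::nat]" by (simp add: upt_rec)
    with perm_of_upt[of 1] have "perm_of [1] = id" by (simp only:)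
    then have "lcomp R L1 [L1] id = ev2 id (L1, [L1], [1])"
      by (simp only: lcomp_def list.map case_prod_conv comp_id)
    moreover have "lterms L1 = [(1, L1, [L1], [1])]" by (simp add: lterms_def Let_def)
    moreover have "ev2 id (L1, [L1], [1]) \<in> carrier ?Q" using cl calculation(2) 1 by (simp only:) simp
    ultimately show ?thesis using 1 Q.lsum_single[of "ev2 id"] by (simp only: lgen_decomp_def if_True simp_thms)
  next
    case l
    then have n: "lgen_arity g \<in> {2, 3, 4, 5}" "lgen_l (lgen_arity g) = g" "g \<noteq> L1" by (auto simp: lgen_l_def)
    have "lgen_decomp R g = decomp_l R (lgen_arity g)" using l n(3) by (simp only: lgen_decomp_def if_True if_False)
    moreover have "lterms g = decomp_list (lgen_arity g)" using l n(3) by (simp only: lterms_def Let_def if_True if_False)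
    ultimately show ?thesis using decomp_l_eq[OF n(1)] n(2) by simp
  next
    case o
    let ?n = "lgen_arity g"
    let ?M = "map (\<lambda>(c, h, gs, \<sigma>). (c, h, gs, oneline ?n \<sigma>)) (lgen_reduced_decomp g)"
    have lt: "lterms g = (1, L1, [g], [1..<?n + 1]) # ?M @ [(1, g, replicate ?n L1, [1..<?n + 1])]"
      using o by (simp only: lterms_def Let_def insert_iff de_Morgan_disj if_False empty_iff simp_thms)
    have c1: "el2 (lh L1, map lh [g], id) \<in> carrier ?Q" "ev2 id ` snd ` set ?M \<subseteq> carrier ?Q"
      "el2 (lh g, map lh (replicate ?n L1), id) \<in> carrier ?Q"
      using cl unfolding lt by (simp_all only: list.set set_append image_insert image_Un Un_subset_iff
          insert_subset snd_conv case_prod_conv perm_of_upt comp_id)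
    have "list_sum ?Q (map (\<lambda>(c, h, gs, \<sigma>). [c] \<cdot>\<^bsub>?Q\<^esub> lcomp R h gs \<sigma>) (lgen_reduced_decomp g)) = lsum ?Q (ev2 id) ?M"
    proof -
      have "map (\<lambda>(c, h, gs, \<sigma>). [c] \<cdot>\<^bsub>?Q\<^esub> lcomp R h gs \<sigma>) (lgen_reduced_decomp g) =
          map (\<lambda>(c, t). [c] \<cdot>\<^bsub>?Q\<^esub> ev2 id t) ?M"
        unfolding map_map
      proof (rule map_cong[OF refl])
        fix z assume z: "z \<in> set (lgen_reduced_decomp g)"
        obtain c h gs \<sigma> where e: "z = (c, h, gs, \<sigma>)" by (cases z)
        have "\<sigma> permutes {1..?n}"
          using lgen_reduced_decomp_permutes[OF o] z e unfolding list_all_iff by fastforce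
        then show "(case z of (c, h, gs, \<sigma>) \<Rightarrow> [c] \<cdot>\<^bsub>?Q\<^esub> lcomp R h gs \<sigma>) =
            ((\<lambda>(c, t). [c] \<cdot>\<^bsub>?Q\<^esub> ev2 id t) \<circ> (\<lambda>(c, h, gs, \<sigma>). (c, h, gs, oneline ?n \<sigma>))) z"
          by (simp only: e o_apply case_prod_conv lcomp_def perm_of_oneline comp_id)
      qed
      then show ?thesis by (simp only: lsum_def)
    qed
    moreover have "lgen_decomp R g = lcomp R L1 [g] id \<oplus>\<^bsub>?Q\<^esub>
        list_sum ?Q (map (\<lambda>(c, h, gs, \<sigma>). [c] \<cdot>\<^bsub>?Q\<^esub> lcomp R h gs \<sigma>) (lgen_reduced_decomp g)) \<oplus>\<^bsub>?Q\<^esub>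
        lcomp R g (replicate ?n L1) id"
      using o by (simp only: lgen_decomp_def Let_def insert_iff de_Morgan_disj if_False empty_iff simp_thms)
    moreover have "lsum ?Q (ev2 id) (lterms g) = el2 (lh L1, map lh [g], id) \<oplus>\<^bsub>?Q\<^esub>
        (lsum ?Q (ev2 id) ?M \<oplus>\<^bsub>?Q\<^esub> el2 (lh g, map lh (replicate ?n L1), id))"
    proof -
      have e: "ev2 id (h, gs, [1..<?n + 1]) = el2 (lh h, map lh gs, id)" for h gs
        by (simp only: case_prod_conv perm_of_upt comp_id)
      have "lsum ?Q (ev2 id) (?M @ [(1, g, replicate ?n L1, [1..<?n + 1])]) =
          lsum ?Q (ev2 id) ?M \<oplus>\<^bsub>?Q\<^esub> lsum ?Q (ev2 id) [(1, g, replicate ?n L1, [1..<?n + 1])]"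
        by (rule Q.lsum_append[OF c1(2)])
          (simp only: list.set image_insert image_empty snd_conv e insert_subset c1(3) empty_subsetI simp_thms)
      then show ?thesis
        unfolding lt lsum_simps(2) using c1 by (simp only: e lsum_simps Q.zsmult_1 Q.M.r_zero)
    qed
    ultimately show ?thesis
      using c1 Q.lsum_closed[OF c1(2)] by (simp only: lcomp_def Q.M.a_assoc)
  qed
qed

lemma
  shows decomp_hom: "Lie3_decomp R n p \<in> module_hom R (Lie3_piece R n p) (Q2 n p)"
    and decomp_basis: "lgen_arity g = n \<Longrightarrow> lgen_degr g = p \<Longrightarrow> \<sigma> permutes {1..n} \<Longrightarrow>
      Lie3_decomp R n p (basis R (g, \<sigma>)) = lsum (Q2 n p) (ev2 \<sigma>) (lterms g)"
proof -
  interpret Q: rmodule R "Q2 n p" by (rule Q2_rmodule)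
  let ?\<phi> = "\<lambda>(g, \<sigma>). act CC n p (lgen_decomp R g) \<sigma>"
  have eq: "Lie3_decomp R n p = free_lift R (Q2 n p) ?\<phi>"
    by (rule ext) (simp only: Lie3_decomp_def)
  have val: "?\<phi> (g, \<sigma>) = lsum (Q2 n p) (ev2 \<sigma>) (lterms g)"
    if g: "lgen_arity g = n" "lgen_degr g = p" "\<sigma> permutes {1..n}" for g \<sigma>
  proof -
    have "act CC n p (lsum (Q2 n p) (ev2 id) (lterms g)) \<sigma> =
        lsum (Q2 n p) (\<lambda>t. act CC n p (ev2 id t) \<sigma>) (lterms g)"
      by (rule Q.module_hom_lsum[OF LL.Q_module LL.composite_act_hom[OF g(3)] lterms_closed[OF g(1,2) permutes_id]])
    also have "\<dots> = lsum (Q2 n p) (ev2 \<sigma>) (lterms g)"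
    proof (rule Q.lsum_cong)
      fix t assume t: "t \<in> snd ` set (lterms g)"
      obtain h gs s where e: "t = (h, gs, s)" by (cases t)
      from LL.act_el[OF ev2_gens[OF lterms_okD[OF t, unfolded e] g(1,2) permutes_id] g(3)]
      show "act CC n p (ev2 id t) \<sigma> = ev2 \<sigma> t" by (simp only: e case_prod_conv comp_id)
    qed
    finally show ?thesis using lgen_decomp_eq[of g] g by (simp only: case_prod_conv)
  qed
  have cl: "?\<phi> (g, \<sigma>) \<in> carrier (Q2 n p)"
    if g: "lgen_arity g = n" "lgen_degr g = p" "\<sigma> permutes {1..n}" for g \<sigma>
    unfolding val[OF g] by (rule Q.lsum_closed[OF lterms_closed[OF g]])
  show "Lie3_decomp R n p \<in> module_hom R (Lie3_piece R n p) (Q2 n p)"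
    unfolding eq by (rule Lie3_lift_hom[where \<phi> = ?\<phi>, OF LL.Q_module cl])
  show "Lie3_decomp R n p (basis R (g, \<sigma>)) = lsum (Q2 n p) (ev2 \<sigma>) (lterms g)"
    if g: "lgen_arity g = n" "lgen_degr g = p" "\<sigma> permutes {1..n}"
    unfolding eq by (rule trans[OF Lie3_lift_basis[where \<phi> = ?\<phi>, OF LL.Q_module cl g] val[OF g]])
qed

text \<open>Presents a term of the differential as an action on an untwisted generator, the form to
  which the balancing relations apply.\<close>

lemma hact_lh:
  assumes "dterm_ok g (k, t)"
  shows "hact C (lh k) (perm_of t) = (lgen_arity g, lgen_degr g - 1, dev id (k, t))"
proof -
  have ok: "lgen_arity k = lgen_arity g" "lgen_degr k = lgen_degr g - 1" "is_perm (lgen_arity g) t"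
    using assms by (auto simp: dterm_ok_def)
  show ?thesis
    unfolding lgen_homog_def hact_simp case_prod_conv
    using Lie3_act_basis[OF perm_of_permutes[OF ok(3)] ok(1,2) permutes_id]
    by (simp only: ok(1,2) comp_id id_comp)
qed

lemma hact_lh_id: "hact C (lh g) id = lh g"
  unfolding lgen_homog_def hact_simp
  using L.act_id[of "basis R (g, id)" "lgen_arity g" "lgen_degr g"] Lie3_basis[OF refl refl permutes_id]
  by (simp only: Lie3_simps(1))

lemma hdif_lh:
  "hdif C (lh g) = (lgen_arity g, lgen_degr g - 1,
     lsum (Lie3_piece R (lgen_arity g) (lgen_degr g - 1)) (dev id) (dterms g))"
  unfolding lgen_homog_def hdif_simp by (simp only: Lie3_dif_basis permutes_id)

text \<open>Both parts of the differential are expanded linearly into twisted generators, and each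
  twist is removed by the matching balancing relation.\<close>

lemma dif_ev2:
  assumes ok: "lterm_ok g (h, gs, s)" and g: "lgen_arity g = n" "lgen_degr g = p" "\<sigma> permutes {1..n}"
  shows "dif CC n p (ev2 \<sigma> (h, gs, s)) = lsum (Q2 n (p - 1)) (ev2 \<sigma>) (dif_terms (h, gs, s))"
    and "ev2 \<sigma> ` snd ` set (dif_terms (h, gs, s)) \<subseteq> carrier (Q2 n (p - 1))"
proof -
  let ?Q = "Q2 n (p - 1)"
  interpret Q: rmodule R ?Q by (rule Q2_rmodule)
  interpret P: rmodule R "Lie3_piece R m q" for m q by (intro rmodule.intro Lie3_module)
  let ?\<rho> = "perm_of s \<circ> \<sigma>" and ?ns = "map lgen_arity gs" and ?qs = "map lgen_degr gs"
  have t: "lgen_arity h = length gs" "sum_list ?ns = n" "is_perm n s"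
    using ok g by (auto simp: lterm_ok_def)
  note G0 = ev2_gens[OF ok g]
  note left = LL.gens_dif_left[OF G0]
  \<comment> \<open>The terms in which the outer generator is differentiated, with \<open>K1\<close>
    the Koszul sign of moving the twist onto the inner factors.\<close>
  define f1 where "f1 = (\<lambda>(k, t). (k :: lgen, permuted_list t gs, comp_list (block_list t ?ns) s))"
  define K1 where "K1 = (\<lambda>(k :: lgen, t). koszul_list t ?qs)"
  define D1 where "D1 = map (\<lambda>(c, u). (c * K1 u, f1 u)) (dterms h)"
  have u1: "el2 ((lgen_arity h, lgen_degr h - 1, dev id u), map lh gs, ?\<rho>) = [(K1 u)] \<cdot>\<^bsub>?Q\<^esub> ev2 \<sigma> (f1 u) \<and>
      ev2 \<sigma> (f1 u) \<in> carrier ?Q" if u: "u \<in> snd ` set (dterms h)" for u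
  proof -
    obtain k t where e: "u = (k, t)" by (cases u)
    note dok = dterms_okD[OF u, unfolded e]
    have k: "lgen_arity k = lgen_arity h" "lgen_degr k = lgen_degr h - 1" "is_perm (length gs) t"
      using dok t(1) by (auto simp: dterm_ok_def)
    have gk: "(lh k, map lh gs, ?\<rho>) \<in> gens C C n (p - 1)"
      using left k lh_closed unfolding gens_iff by simp
    have pt: "perm_of t permutes {1..length gs}" by (rule perm_of_permutes[OF k(3)])
    have len: "length t = length ?qs" using k(3) by (simp add: is_perm_def)
    have b: "perm_of (comp_list (block_list t ?ns) s) = block_perm (perm_of t) ?ns \<circ> perm_of s"
      using perm_of_comp[of n "block_list t ?ns" s] is_perm_block[of ?ns t] perm_of_block[of ?ns t] k(3) t(2,3)
      by simp
    have pl: "permuted (perm_of t) (map lh gs) = map lh (permuted_list t gs)"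
      using pt by (simp add: permuted_map permuted_list_eq[OF k(3)])
    have "el2 (hact C (lh k) (perm_of t), map lh gs, ?\<rho>) = [(koszul_list t ?qs)] \<cdot>\<^bsub>?Q\<^esub> ev2 \<sigma> (f1 (k, t))"
      using LL.el_left_act[OF gk, of "perm_of t"] pt k(1) t(1)
      unfolding f1_def case_prod_conv b map_lh pl koszul_list_eq[OF len] by (simp only: lh_simps comp_assoc)
    moreover have "ev2 \<sigma> (f1 (k, t)) \<in> carrier ?Q"
      using LL.el_closed[OF LL.gens_left_act(2)[OF gk, of "perm_of t"]] pt k(1) t(1)
      unfolding f1_def case_prod_conv b map_lh pl by (simp only: lh_simps comp_assoc)
    ultimately show ?thesis unfolding e K1_def case_prod_conv hact_lh[OF dok] by blast
  qed
  have cl1: "ev2 \<sigma> ` f1 ` snd ` set (dterms h) \<subseteq> carrier ?Q" using u1 by blast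
  have "el2 (hdif C (lh h), map lh gs, ?\<rho>) =
      lsum ?Q (\<lambda>u. el2 ((lgen_arity h, lgen_degr h - 1, dev id u), map lh gs, ?\<rho>)) (dterms h)"
    unfolding hdif_lh
    by (rule P.module_hom_lsum[OF LL.Q_module LL.el_left_hom[OF left[unfolded hdif_lh], unfolded Lie3_simps(1)]
          dterms_closed[OF refl refl permutes_id]])
  also have "\<dots> = lsum ?Q (\<lambda>u. [(K1 u)] \<cdot>\<^bsub>?Q\<^esub> ev2 \<sigma> (f1 u)) (dterms h)"
    using u1 by (intro Q.lsum_cong) blast
  also have "\<dots> = lsum ?Q (ev2 \<sigma>) D1" unfolding D1_def by (rule Q.lsum_scale[OF cl1])
  finally have L: "el2 (hdif C (lh h), map lh gs, ?\<rho>) = lsum ?Q (ev2 \<sigma>) D1" .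
  have D1cl: "ev2 \<sigma> ` snd ` set D1 \<subseteq> carrier ?Q"
    using cl1 by (auto simp: D1_def image_subset_iff)
  \<comment> \<open>The terms in which factor \<open>i\<close> is differentiated; its twist enters a
    block sum whose other parts are identity words.\<close>
  define f2 where "f2 i = (\<lambda>(k, t). (h, gs[i := k],
    comp_list (sum_list_perm ?ns ((map (\<lambda>n. [1..<n + 1]) ?ns)[i := t])) s))" for i
  define sg where "sg i = minus_one_pow (lgen_degr h + sum_list (take i ?qs))" for i
  define D2 where "D2 i = map (\<lambda>(c, u). (c * sg i, f2 i u)) (dterms (gs ! i))" for i
  have S: "[(sg i)] \<cdot>\<^bsub>?Q\<^esub> el2 (lh h, (map lh gs)[i := hdif C (map lh gs ! i)], ?\<rho>) = lsum ?Q (ev2 \<sigma>) (D2 i) \<and>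
      ev2 \<sigma> ` snd ` set (D2 i) \<subseteq> carrier ?Q" if i: "i < length gs" for i
  proof -
    let ?gi = "gs ! i"
    let ?\<alpha> = "map lh (take i gs)" and ?\<beta> = "map lh (drop (Suc i) gs)"
    have upd: "(map lh gs)[i := x] = ?\<alpha> @ x # ?\<beta>" for x
      using i by (simp add: upd_conv_take_nth_drop take_map drop_map)
    have nth: "map lh gs ! i = lh ?gi" using i by simp
    have slot: "(lh h, (map lh gs)[i := hdif C (lh ?gi)], ?\<rho>) \<in> gens C C n (p - 1)"
      using LL.gens_dif_slot[OF G0, of i] i by simp
    have u2: "el2 (lh h, ?\<alpha> @ (lgen_arity ?gi, lgen_degr ?gi - 1, dev id u) # ?\<beta>, ?\<rho>) = ev2 \<sigma> (f2 i u) \<and>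
        ev2 \<sigma> (f2 i u) \<in> carrier ?Q" if u: "u \<in> snd ` set (dterms ?gi)" for u
    proof -
      obtain k t' where e: "u = (k, t')" by (cases u)
      note dok = dterms_okD[OF u, unfolded e]
      have k: "lgen_arity k = lgen_arity ?gi" "lgen_degr k = lgen_degr ?gi - 1" "is_perm (lgen_arity ?gi) t'"
        using dok by (auto simp: dterm_ok_def)
      have ar: "map lgen_arity (gs[i := k]) = ?ns" "map lgen_degr (gs[i := k]) = ?qs[i := ?qs ! i - 1]"
        using k(1,2) i by (simp_all add: map_update list_update_same_conv)
      have "map arity ((map lh gs)[i := hdif C (lh ?gi)]) = ?ns"
        "map degr ((map lh gs)[i := hdif C (lh ?gi)]) = ?qs[i := ?qs ! i - 1]"
        unfolding map_update map_lh arity_hdif degr_hdif using i by (simp_all add: list_update_same_conv)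
      then have gk: "(lh h, map lh (gs[i := k]), ?\<rho>) \<in> gens C C n (p - 1)"
        using slot set_lh[of "gs[i := k]"] unfolding gens_iff map_lh ar by simp
      let ?us = "(map (\<lambda>n. [1..<n + 1]) ?ns)[i := t']"
      let ?\<pi>s = "(map (\<lambda>_. id) gs)[i := perm_of t']"
      have us: "list_all2 is_perm ?ns ?us"
        using k(3) i by (auto simp: list_all2_conv_all_nth nth_list_update is_perm_upt[simplified])
      have \<pi>: "map perm_of ?us = ?\<pi>s"
        using i by (intro nth_equalityI) (auto simp: nth_list_update perm_of_upt[simplified])
      have perms: "perms_of ?ns ?\<pi>s"
        unfolding \<pi>[symmetric] list_all2_conv_all_nth
        using us perm_of_permutes unfolding list_all2_conv_all_nth by (simp del: One_nat_def)
      have hid: "hact C (lh g') (\<lambda>a. a) = lh g'" for g' using hact_lh_id[of g'] by (simp add: id_def)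
      have m: "map2 (hact C) (map lh (gs[i := k])) ?\<pi>s = (map lh gs)[i := hact C (lh k) (perm_of t')]"
        using i hact_lh_id hid by (intro nth_equalityI) (auto simp: nth_list_update)
      have b: "perm_of (comp_list (sum_list_perm ?ns ?us) s) = sum_perm ?ns ?\<pi>s \<circ> perm_of s"
        using perm_of_comp[of n "sum_list_perm ?ns ?us" s] is_perm_sum[OF us] perm_of_sum[OF us] t(2,3)
        unfolding \<pi> by simp
      have "el2 (lh h, ?\<alpha> @ hact C (lh k) (perm_of t') # ?\<beta>, ?\<rho>) = ev2 \<sigma> (f2 i (k, t'))"
        using LL.el_balanced[OF gk, of ?\<pi>s] perms
        unfolding f2_def case_prod_conv b map_lh ar m upd by (simp only: comp_assoc)
      moreover have "ev2 \<sigma> (f2 i (k, t')) \<in> carrier ?Q"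
        using LL.el_closed[OF LL.gens_balanced(2)[OF gk, of ?\<pi>s]] perms
        unfolding f2_def case_prod_conv b map_lh ar by (simp only: comp_assoc)
      ultimately show ?thesis unfolding e hact_lh[OF dok] by blast
    qed
    have "el2 (lh h, (map lh gs)[i := hdif C (lh ?gi)], ?\<rho>) =
        lsum ?Q (\<lambda>u. el2 (lh h, ?\<alpha> @ (lgen_arity ?gi, lgen_degr ?gi - 1, dev id u) # ?\<beta>, ?\<rho>)) (dterms ?gi)"
      unfolding hdif_lh upd
      by (rule P.module_hom_lsum[OF LL.Q_module LL.el_slot_hom[OF slot[unfolded hdif_lh upd], unfolded Lie3_simps(1)]
            dterms_closed[OF refl refl permutes_id]])
    also have "\<dots> = lsum ?Q (\<lambda>u. ev2 \<sigma> (f2 i u)) (dterms ?gi)"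
      by (rule Q.lsum_cong) (rule conjunct1[OF u2])
    finally have e: "el2 (lh h, (map lh gs)[i := hdif C (lh ?gi)], ?\<rho>) =
        lsum ?Q (\<lambda>u. ev2 \<sigma> (f2 i u)) (dterms ?gi)" .
    have "[(sg i)] \<cdot>\<^bsub>?Q\<^esub> el2 (lh h, (map lh gs)[i := hdif C (map lh gs ! i)], ?\<rho>) =
        lsum ?Q (\<lambda>u. ev2 \<sigma> (f2 i u)) (map (\<lambda>(c, u). (sg i * c, u)) (dterms ?gi))"
      unfolding nth e by (rule Q.zsmult_lsum) (rule image_subsetI, rule conjunct2[OF u2])
    also have "\<dots> = lsum ?Q (ev2 \<sigma>) (D2 i)"
      unfolding D2_def lsum_def map_map comp_def by (simp only: case_prod_unfold fst_conv snd_conv mult.commute)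
    finally have "[(sg i)] \<cdot>\<^bsub>?Q\<^esub> el2 (lh h, (map lh gs)[i := hdif C (map lh gs ! i)], ?\<rho>) =
        lsum ?Q (ev2 \<sigma>) (D2 i)" .
    moreover have "ev2 \<sigma> ` snd ` set (D2 i) \<subseteq> carrier ?Q"
    proof (rule image_subsetI)
      fix y assume "y \<in> snd ` set (D2 i)"
      then obtain u where "u \<in> snd ` set (dterms ?gi)" "y = f2 i u" unfolding D2_def by force
      then show "ev2 \<sigma> y \<in> carrier ?Q" using conjunct2[OF u2, of u] by (simp only:)
    qed
    ultimately show ?thesis by blast
  qed
  have terms: "dif_terms (h, gs, s) = D1 @ concat (map D2 [0..<length gs])"
    unfolding dif_terms_def D1_def D2_def f1_def f2_def K1_def sg_def Let_def case_prod_conv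
    by (simp add: case_prod_unfold)
  have concat: "lsum ?Q (ev2 \<sigma>) (concat (map D2 [0..<length gs])) =
      list_sum ?Q (map (\<lambda>i. lsum ?Q (ev2 \<sigma>) (D2 i)) [0..<length gs])"
  proof -
    have "lsum ?Q (ev2 \<sigma>) (concat (map D2 [0..<length gs])) =
        list_sum ?Q (map (lsum ?Q (ev2 \<sigma>)) (map D2 [0..<length gs]))"
    proof (rule Q.lsum_concat)
      fix xs assume "xs \<in> set (map D2 [0..<length gs])"
      then obtain i where "i < length gs" "xs = D2 i" by auto
      then show "ev2 \<sigma> ` snd ` set xs \<subseteq> carrier ?Q" using conjunct2[OF S, of i] by (simp only:)
    qed
    then show ?thesis by (simp only: map_map comp_def)
  qed
  have ccl: "ev2 \<sigma> ` snd ` set (concat (map D2 [0..<length gs])) \<subseteq> carrier ?Q"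
  proof (rule image_subsetI)
    fix y assume "y \<in> snd ` set (concat (map D2 [0..<length gs]))"
    then obtain z i where "z \<in> set (D2 i)" and i: "i \<in> {0..<length gs}" and "y = snd z"
      unfolding set_concat set_map set_upt by blast
    then have "y \<in> snd ` set (D2 i)" by blast
    moreover have "i < length gs" using i by simp
    ultimately show "ev2 \<sigma> y \<in> carrier ?Q" by (rule subsetD[OF conjunct2[OF S] imageI, rotated])
  qed
  have sgn: "minus_one_pow (degr (lh h) + sum_list (map degr (take i (map lh gs)))) = sg i" for i
    unfolding sg_def by (simp add: take_map comp_def)
  have tm: "[(sg i)] \<cdot>\<^bsub>?Q\<^esub> el2 (lh h, (map lh gs)[i := hdif C (map lh gs ! i)], ?\<rho>) \<in> carrier ?Q"
    if "i < length gs" for i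
    unfolding conjunct1[OF S[OF that]] by (rule Q.lsum_closed[OF conjunct2[OF S[OF that]]])
  have upt: "{..<length (map lh gs)} = set [0..<length gs]" by (simp add: atLeast0LessThan)
  have "(\<Oplus>\<^bsub>?Q\<^esub>i\<in>{..<length (map lh gs)}. [(sg i)] \<cdot>\<^bsub>?Q\<^esub>
        el2 (lh h, (map lh gs)[i := hdif C (map lh gs ! i)], ?\<rho>)) =
      list_sum ?Q (map (\<lambda>i. [(sg i)] \<cdot>\<^bsub>?Q\<^esub> el2 (lh h, (map lh gs)[i := hdif C (map lh gs ! i)], ?\<rho>)) [0..<length gs])"
    unfolding upt by (intro Q.finsum_set_eq_list_sum distinct_upt funcsetI tm) simp
  also have "map (\<lambda>i. [(sg i)] \<cdot>\<^bsub>?Q\<^esub> el2 (lh h, (map lh gs)[i := hdif C (map lh gs ! i)], ?\<rho>)) [0..<length gs] =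
      map (\<lambda>i. lsum ?Q (ev2 \<sigma>) (D2 i)) [0..<length gs]"
    by (intro map_cong refl conjunct1[OF S]) simp
  finally have sum: "(\<Oplus>\<^bsub>?Q\<^esub>i\<in>{..<length (map lh gs)}. [(sg i)] \<cdot>\<^bsub>?Q\<^esub>
        el2 (lh h, (map lh gs)[i := hdif C (map lh gs ! i)], ?\<rho>)) = lsum ?Q (ev2 \<sigma>) (concat (map D2 [0..<length gs]))"
    unfolding concat .
  show "dif CC n p (ev2 \<sigma> (h, gs, s)) = lsum ?Q (ev2 \<sigma>) (dif_terms (h, gs, s))"
    unfolding case_prod_conv LL.composite_dif_el[OF G0] LL.elementary_dif_eq[OF G0] sgn sum L terms
    by (rule Q.lsum_append[OF D1cl ccl, symmetric])
  show "ev2 \<sigma> ` snd ` set (dif_terms (h, gs, s)) \<subseteq> carrier ?Q"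
    unfolding terms set_append image_Un using D1cl ccl by simp
qed

lemma decomp_dg_hom: "Lie3_decomp R \<in> dg_smodule_hom R C CC"
  unfolding dg_smodule_hom_def mem_Collect_eq composite_simps(1) Lie3_simps(1)
proof (intro allI conjI ballI impI)
  fix n p
  show "Lie3_decomp R n p \<in> module_hom R (Lie3_piece R n p) (Q2 n p)" by (rule decomp_hom)
  interpret Q: rmodule R "Q2 n q" for q by (rule Q2_rmodule)
  interpret P: rmodule R "Lie3_piece R n q" for q by (intro rmodule.intro Lie3_module)
  fix x assume x: "x \<in> carrier (Lie3_piece R n p)"
  show "Lie3_decomp R n (p - 1) (dif C n p x) = dif CC n p (Lie3_decomp R n p x)"
  proof (rule Lie3_hom_eqI[OF LL.Q_module module_hom_comp[OF Lie3_dif_hom decomp_hom]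
        module_hom_comp[OF decomp_hom LL.composite_dif_hom] _ x])
    fix g \<sigma> assume g: "lgen_arity g = n" "lgen_degr g = p" "\<sigma> permutes {1..n}"
    let ?F = "\<lambda>(h, t). map (\<lambda>(c, k, ks, s). (c, k, ks, comp_list s t)) (lterms h)"
    have F: "Lie3_decomp R n (p - 1) (dev \<sigma> t) = lsum (Q2 n (p - 1)) (ev2 \<sigma>) (?F t)"
      "ev2 \<sigma> ` snd ` set (?F t) \<subseteq> carrier (Q2 n (p - 1))" if t: "t \<in> snd ` set (dterms g)" for t
    proof -
      obtain h s where hs: "t = (h, s)" by (cases t)
      have ok: "lgen_arity h = n" "lgen_degr h = p - 1" "is_perm n s"
        using dterms_okD[OF t] g by (auto simp: hs dterm_ok_def)
      note pm = permutes_compose[OF g(3) perm_of_permutes[OF ok(3)]]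
      let ?f = "\<lambda>(k, ks, u). (k, ks, comp_list u s)"
      have F: "?F t = map (\<lambda>(c, u). (c, ?f u)) (lterms h)"
        by (simp add: hs case_prod_unfold)
      have comp: "ev2 (perm_of s \<circ> \<sigma>) u = ev2 \<sigma> (?f u)" if u: "u \<in> snd ` set (lterms h)" for u
      proof -
        obtain k ks v where e: "u = (k, ks, v)" by (cases u)
        have "is_perm n v" using lterms_okD[OF u] ok(1) by (simp add: e lterm_ok_def)
        from perm_of_comp[OF this ok(3)] show ?thesis by (simp only: e case_prod_conv comp_assoc)
      qed
      have "Lie3_decomp R n (p - 1) (dev \<sigma> t) = lsum (Q2 n (p - 1)) (ev2 (perm_of s \<circ> \<sigma>)) (lterms h)"
        using decomp_basis[OF ok(1,2) pm] by (simp only: hs case_prod_conv)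
      also have "\<dots> = lsum (Q2 n (p - 1)) (ev2 \<sigma>) (?F t)"
        unfolding F Q.lsum_map by (rule Q.lsum_cong) (rule comp)
      finally show "Lie3_decomp R n (p - 1) (dev \<sigma> t) = \<dots>" .
      have "ev2 \<sigma> ` snd ` set (?F t) = (\<lambda>u. ev2 \<sigma> (?f u)) ` snd ` set (lterms h)"
        unfolding F by (force simp: image_image)
      also have "\<dots> = ev2 (perm_of s \<circ> \<sigma>) ` snd ` set (lterms h)"
        using comp by (intro image_cong) auto
      finally show "ev2 \<sigma> ` snd ` set (?F t) \<subseteq> carrier (Q2 n (p - 1))"
        using lterms_closed[OF ok(1,2) pm] by simp
    qed
    have "Lie3_decomp R n (p - 1) (dif C n p (basis R (g, \<sigma>))) =
        lsum (Q2 n (p - 1)) (\<lambda>t. Lie3_decomp R n (p - 1) (dev \<sigma> t)) (dterms g)"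
      unfolding Lie3_dif_basis[OF g] by (rule P.module_hom_lsum[OF LL.Q_module decomp_hom dterms_closed[OF g]])
    also have "\<dots> = lsum (Q2 n (p - 1)) (ev2 \<sigma>) (dl_terms g)"
      unfolding dl_terms_def by (rule Q.lsum_lbind[OF F])
    \<comment> \<open>The step with content: the evaluated identity between the two formal sums. The
      steps around it only expand both sides linearly.\<close>
    also have "\<dots> = lsum (Q2 n (p - 1)) (ev2 \<sigma>) (lbind (lterms g) dif_terms)"
    proof (rule Q.lsum_eqI[OF dif_decomp_terms])
      show "ev2 \<sigma> ` snd ` set (dl_terms g) \<subseteq> carrier (Q2 n (p - 1))"
        unfolding dl_terms_def by (rule lbind_closed[OF F(2)])
      show "ev2 \<sigma> ` snd ` set (lbind (lterms g) dif_terms) \<subseteq> carrier (Q2 n (p - 1))"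
      proof (rule lbind_closed)
        fix t assume t: "t \<in> snd ` set (lterms g)"
        obtain h gs s where e: "t = (h, gs, s)" by (cases t)
        show "ev2 \<sigma> ` snd ` set (dif_terms t) \<subseteq> carrier (Q2 n (p - 1))"
          using dif_ev2(2)[OF lterms_okD[OF t, unfolded e] g] by (simp only: e)
      qed
    qed
    also have "\<dots> = lsum (Q2 n (p - 1)) (\<lambda>t. dif CC n p (ev2 \<sigma> t)) (lterms g)"
    proof (rule Q.lsum_lbind[symmetric])
      fix t assume t: "t \<in> snd ` set (lterms g)"
      obtain h gs s where e: "t = (h, gs, s)" by (cases t)
      show "dif CC n p (ev2 \<sigma> t) = lsum (Q2 n (p - 1)) (ev2 \<sigma>) (dif_terms t)"
        "ev2 \<sigma> ` snd ` set (dif_terms t) \<subseteq> carrier (Q2 n (p - 1))"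
        using dif_ev2[OF lterms_okD[OF t, unfolded e] g] by (simp_all only: e)
    qed
    also have "\<dots> = dif CC n p (Lie3_decomp R n p (basis R (g, \<sigma>)))"
      unfolding decomp_basis[OF g]
      by (rule Q.module_hom_lsum[OF LL.Q_module LL.composite_dif_hom lterms_closed[OF g], symmetric])
    finally show "Lie3_decomp R n (p - 1) (dif C n p (basis R (g, \<sigma>))) =
        dif CC n p (Lie3_decomp R n p (basis R (g, \<sigma>)))" .
  qed
  fix \<sigma> assume \<sigma>: "\<sigma> permutes {1..n}"
  show "Lie3_decomp R n p (act C n p x \<sigma>) = act CC n p (Lie3_decomp R n p x) \<sigma>"
  proof (rule Lie3_hom_eqI[OF LL.Q_module module_hom_comp[OF Lie3_act_hom[OF \<sigma>] decomp_hom]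
        module_hom_comp[OF decomp_hom LL.composite_act_hom[OF \<sigma>]] _ x])
    fix g \<tau> assume g: "lgen_arity g = n" "lgen_degr g = p" "\<tau> permutes {1..n}"
    have "act CC n p (lsum (Q2 n p) (ev2 \<tau>) (lterms g)) \<sigma> =
        lsum (Q2 n p) (\<lambda>t. act CC n p (ev2 \<tau> t) \<sigma>) (lterms g)"
      by (rule Q.module_hom_lsum[OF LL.Q_module LL.composite_act_hom[OF \<sigma>] lterms_closed[OF g]])
    also have "\<dots> = lsum (Q2 n p) (ev2 (\<tau> \<circ> \<sigma>)) (lterms g)"
    proof (rule Q.lsum_cong)
      fix t assume t: "t \<in> snd ` set (lterms g)"
      obtain h gs s where e: "t = (h, gs, s)" by (cases t)
      from LL.act_el[OF ev2_gens[OF lterms_okD[OF t, unfolded e] g] \<sigma>]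
      show "act CC n p (ev2 \<tau> t) \<sigma> = ev2 (\<tau> \<circ> \<sigma>) t" by (simp only: e case_prod_conv comp_assoc)
    qed
    finally show "Lie3_decomp R n p (act C n p (basis R (g, \<tau>)) \<sigma>) =
        act CC n p (Lie3_decomp R n p (basis R (g, \<tau>))) \<sigma>"
      unfolding Lie3_act_basis[OF \<sigma> g] decomp_basis[OF g]
        decomp_basis[OF g(1,2) permutes_compose[OF \<sigma> g(3)]] ..
  qed
qed

end

section \<open>Coassociativity\<close>

lemma perms_of_perm_of:
  assumes "list_all2 is_perm ns ts"
  shows "perms_of ns (map perm_of ts)"
  using assms perm_of_permutes by (induction rule: list_all2_induct) (simp_all del: One_nat_def)

context lie3
begin

abbreviation "Q3 n p \<equiv> composite_piece R C CC n p"
abbreviation "ev3 \<sigma> \<equiv> (\<lambda>(h, ts, s).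
  elementary R C CC (lh h, map (\<lambda>(k, ks). T.inner (lh k) (map lh ks)) ts, perm_of s \<circ> \<sigma>))"

lemma decomp_smodule_hom: "Lie3_decomp R \<in> smodule_hom R C CC"
  using decomp_dg_hom dg_smodule_hom_subset by blast

lemma hmap_id [simp]: "hmap (\<lambda>_ _ y. y) \<mu> = \<mu>" "map (hmap (\<lambda>_ _ y. y)) \<mu>s = \<mu>s"
  unfolding hmap_def by (simp_all add: case_prod_unfold)

lemma hmap_decomp_lh:
  "hmap (Lie3_decomp R) (lh g) =
     (lgen_arity g, lgen_degr g, lsum (Q2 (lgen_arity g) (lgen_degr g)) (ev2 id) (lterms g))"
  unfolding lgen_homog_def[of R g] hmap_simp by (simp only: decomp_basis permutes_id)

text \<open>Common scheme for coassociativity and both counit laws: a linear map after the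
  decomposition is expanded term by term, and its value becomes the evaluation of one substituted
  formal sum.\<close>

lemma decomp_lsum:
  assumes "module R A" "f \<in> module_hom R (Q2 n p) A"
    and g: "lgen_arity g = n" "lgen_degr g = p" "\<sigma> permutes {1..n}"
    and f: "\<And>h gs s. lterm_ok g (h, gs, s) \<Longrightarrow> f (ev2 \<sigma> (h, gs, s)) = lsum A ev (F (h, gs, s))"
    and cl: "\<And>h gs s. lterm_ok g (h, gs, s) \<Longrightarrow> ev ` snd ` set (F (h, gs, s)) \<subseteq> carrier A"
  shows "f (Lie3_decomp R n p (basis R (g, \<sigma>))) = lsum A ev (lbind (lterms g) F)"
    and "ev ` snd ` set (lbind (lterms g) F) \<subseteq> carrier A"
proof -
  interpret Q: rmodule R "Q2 n p" by (rule Q2_rmodule)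
  interpret A: rmodule R A by (intro rmodule.intro assms(1))
  have f': "f (ev2 \<sigma> t) = lsum A ev (F t)" and cl': "ev ` snd ` set (F t) \<subseteq> carrier A"
    if t: "t \<in> snd ` set (lterms g)" for t
  proof -
    obtain h gs s where e: "t = (h, gs, s)" by (cases t)
    note ok = lterms_okD[OF t, unfolded e]
    show "f (ev2 \<sigma> t) = lsum A ev (F t)" using f[OF ok] by (simp only: e)
    show "ev ` snd ` set (F t) \<subseteq> carrier A" using cl[OF ok] by (simp only: e)
  qed
  have "f (Lie3_decomp R n p (basis R (g, \<sigma>))) = lsum A (\<lambda>t. f (ev2 \<sigma> t)) (lterms g)"
    unfolding decomp_basis[OF g] by (rule Q.module_hom_lsum[OF assms(1,2) lterms_closed[OF g]])
  also have "\<dots> = lsum A ev (lbind (lterms g) F)" by (rule A.lsum_lbind[OF f' cl'])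
  finally show "f (Lie3_decomp R n p (basis R (g, \<sigma>))) = lsum A ev (lbind (lterms g) F)" .
  show "ev ` snd ` set (lbind (lterms g) F) \<subseteq> carrier A" by (rule lbind_closed[OF cl'])
qed

text \<open>Decomposing the outer generator gives an element of the inner composite; linearity of
  \<open>outer\<close> in that element reduces the associator to its values
  \<open>asc\<close>.\<close>

lemma left_ev:
  assumes ok: "lterm_ok g (h, gs, s)" and g: "lgen_arity g = n" "lgen_degr g = p" "\<sigma> permutes {1..n}"
  shows "associator R C C C n p (composite_map R CC C (Lie3_decomp R) (\<lambda>_ _ y. y) n p (ev2 \<sigma> (h, gs, s))) =
      lsum (Q3 n p) (ev3 \<sigma>) (left_terms (h, gs, s))"
    and "ev3 \<sigma> ` snd ` set (left_terms (h, gs, s)) \<subseteq> carrier (Q3 n p)"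
proof -
  let ?Q = "Q3 n p"
  interpret Q: rmodule R ?Q by (rule T.T.Q_rmodule)
  interpret P: rmodule R "Q2 m q" for m q by (rule Q2_rmodule)
  interpret D: composite_morphism R C C CC C "Lie3_decomp R" "\<lambda>_ _ y. y"
    by unfold_locales (rule decomp_smodule_hom smodule_hom_id)+
  let ?\<rho> = "perm_of s \<circ> \<sigma>" and ?ns = "map lgen_arity gs" and ?qs = "map lgen_degr gs"
  have t: "lgen_arity h = length gs" "sum_list ?ns = n" "lgen_degr h + sum_list ?qs = p" "is_perm n s"
    using ok g by (auto simp: lterm_ok_def)
  note G0 = ev2_gens[OF ok g]
  note GX = D.gens_map[OF G0, unfolded hmap_decomp_lh hmap_id]
  have out: "set (map lh gs) \<subseteq> homogs C" "sum_list (map arity (map lh gs)) = n"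
    "lgen_degr h + sum_list (map degr (map lh gs)) = p" "?\<rho> permutes {1..n}"
    "lgen_arity h = length (map lh gs)"
    unfolding map_lh using t set_lh permutes_compose[OF g(3) perm_of_permutes] by simp_all
  let ?css = "\<lambda>ks v. chunks (map lgen_arity ks) (permuted_list v gs)"
  define f where "f = (\<lambda>(k :: lgen, ks, v). (k, zip ks (?css ks v), comp_list (block_list v ?ns) s))"
  define K where "K = (\<lambda>(k :: lgen, ks, v). koszul_list v ?qs *
    minus_one_pow (distrib_exp 0 (map lgen_degr ks) (map (map lgen_degr) (?css ks v))))"
  have terms: "left_terms (h, gs, s) = map (\<lambda>(c, u). (c * K u, f u)) (lterms h)"
    unfolding left_terms_def f_def K_def Let_def case_prod_conv by (simp add: case_prod_unfold)
  have u: "T.outer n p (ev2 id u) (map lh gs) ?\<rho> = [(K u)] \<cdot>\<^bsub>?Q\<^esub> ev3 \<sigma> (f u) \<and> ev3 \<sigma> (f u) \<in> carrier ?Q"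
    if u: "u \<in> snd ` set (lterms h)" for u
  proof -
    obtain k ks v where e: "u = (k, ks, v)" by (cases u)
    note lok = lterms_okD[OF u, unfolded e]
    have v: "is_perm (length gs) v" "length v = length ?qs"
      using lok t(1) by (auto simp: lterm_ok_def is_perm_def)
    note gk = ev2_gens[OF lok refl refl permutes_id]
    have e2: "length (map lh gs) = lgen_arity h" "p - sum_list (map degr (map lh gs)) = lgen_degr h"
      using out by simp_all
    have g2: "(lh k, map lh ks, perm_of v) \<in> gens C C (length (map lh gs)) (p - sum_list (map degr (map lh gs)))"
      unfolding e2 using gk by (simp only: comp_id)
    obtain \<pi>ss where adm: "T.admissible n p (lh k) (map lh ks) (perm_of v) (map lh gs) ?\<rho> \<pi>ss"
      by (rule T.admissibleI[OF g2 out(1,2,4)])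
    have "perm_of v permutes {1..length gs}" by (rule perm_of_permutes[OF v(1)])
    then have \<pi>ss: "\<pi>ss = map (map lh) (?css ks v)"
      using T.admissibleD(12)[OF adm] unfolding map_lh
      by (simp only: permuted_map permuted_list_eq[OF v(1), symmetric] chunks_map)
    have len: "length (?css ks v) = length ks"
      using T.admissibleD(13)[OF adm] unfolding \<pi>ss by simp
    have zip: "map2 T.inner (map lh ks) \<pi>ss = map (\<lambda>(k, ks). T.inner (lh k) (map lh ks)) (zip ks (?css ks v))"
      unfolding \<pi>ss by (simp add: zip_map_map comp_def case_prod_unfold)
    have b: "perm_of (comp_list (block_list v ?ns) s) = block_perm (perm_of v) ?ns \<circ> perm_of s"
      using perm_of_comp[of n "block_list v ?ns" s] is_perm_block[of ?ns v] perm_of_block[of ?ns v] v(1) t(2,4)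
      by simp
    have ds: "map (map degr) \<pi>ss = map (map lgen_degr) (?css ks v)"
      unfolding \<pi>ss by simp
    have "distrib_sign (map lgen_degr ks) (map (map lgen_degr) (?css ks v)) =
        minus_one_pow (distrib_exp 0 (map lgen_degr ks) (map (map lgen_degr) (?css ks v)))"
      by (rule distrib_sign_exp) (simp add: len)
    then have sgn: "koszul_sign (perm_of v) (map degr (map lh gs)) *
        distrib_sign (map degr (map lh ks)) (map (map degr) \<pi>ss) = K u"
      unfolding e K_def case_prod_conv map_lh ds koszul_list_eq[OF v(2)] by simp
    have f: "ev3 \<sigma> (f u) = T.T.el (lh k, map2 T.inner (map lh ks) \<pi>ss,
        block_perm (perm_of v) (map arity (map lh gs)) \<circ> ?\<rho>)"
      unfolding e f_def case_prod_conv zip b map_lh by (simp only: comp_assoc)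
    have "T.outer n p (ev2 id u) (map lh gs) ?\<rho> = T.asc n p (lh k, map lh ks, perm_of v) (map lh gs) ?\<rho>"
      using T.outer_el[OF out gk] unfolding e by (simp only: case_prod_conv comp_id)
    also have "\<dots> = [(K u)] \<cdot>\<^bsub>?Q\<^esub> ev3 \<sigma> (f u)"
      unfolding T.asc_eq[OF adm] sgn f ..
    finally show ?thesis
      using T.T.el_closed[OF T.asc_gens[OF adm]] unfolding f by blast
  qed
  have cl: "ev3 \<sigma> ` f ` snd ` set (lterms h) \<subseteq> carrier ?Q" using u by blast
  have "associator R C C C n p (composite_map R CC C (Lie3_decomp R) (\<lambda>_ _ y. y) n p (ev2 \<sigma> (h, gs, s))) =
      T.outer n p (lsum (Q2 (lgen_arity h) (lgen_degr h)) (ev2 id) (lterms h)) (map lh gs) ?\<rho>"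
    unfolding case_prod_conv D.composite_map_el[OF G0] hmap_decomp_lh hmap_id by (rule T.associator_el[OF GX])
  also have "\<dots> = lsum ?Q (\<lambda>u. T.outer n p (ev2 id u) (map lh gs) ?\<rho>) (lterms h)"
    by (rule P.module_hom_lsum[OF T.T.Q_module T.outer_hom[OF out] lterms_closed[OF refl refl permutes_id]])
  also have "\<dots> = lsum ?Q (\<lambda>u. [(K u)] \<cdot>\<^bsub>?Q\<^esub> ev3 \<sigma> (f u)) (lterms h)"
    using u by (intro Q.lsum_cong) blast
  also have "\<dots> = lsum ?Q (ev3 \<sigma>) (left_terms (h, gs, s))"
    unfolding terms by (rule Q.lsum_scale[OF cl])
  finally show "associator R C C C n p
      (composite_map R CC C (Lie3_decomp R) (\<lambda>_ _ y. y) n p (ev2 \<sigma> (h, gs, s))) =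
      lsum ?Q (ev3 \<sigma>) (left_terms (h, gs, s))" .
  show "ev3 \<sigma> ` snd ` set (left_terms (h, gs, s)) \<subseteq> carrier ?Q"
  proof (rule image_subsetI)
    fix y assume "y \<in> snd ` set (left_terms (h, gs, s))"
    then obtain z where "z \<in> snd ` set (lterms h)" "y = f z" unfolding terms by force
    with u show "ev3 \<sigma> y \<in> carrier ?Q" by blast
  qed
qed

text \<open>Rewrites a term of the decomposition of an inner factor as an action on an untwisted
  inner element, so that the outer balancing relation can collect the permutation.\<close>

lemma ev2_hact_inner:
  assumes "lterm_ok g (k, ks, v)"
  shows "(lgen_arity g, lgen_degr g, ev2 id (k, ks, v)) = hact CC (T.inner (lh k) (map lh ks)) (perm_of v)"
    and "T.inner (lh k) (map lh ks) \<in> homogs CC"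
    and "arity (T.inner (lh k) (map lh ks)) = lgen_arity g"
    and "degr (T.inner (lh k) (map lh ks)) = lgen_degr g"
    and "is_perm (lgen_arity g) v"
proof -
  have t: "lgen_arity k = length ks" "sum_list (map lgen_arity ks) = lgen_arity g"
    "lgen_degr k + sum_list (map lgen_degr ks) = lgen_degr g" and v: "is_perm (lgen_arity g) v"
    using assms by (auto simp: lterm_ok_def)
  show "is_perm (lgen_arity g) v" by (rule v)
  have G: "(lh k, map lh ks, id) \<in> gens C C (lgen_arity g) (lgen_degr g)"
    unfolding gens_iff map_lh using t set_lh lh_closed permutes_id by (simp only: lh_simps length_map simp_thms)
  show ad: "arity (T.inner (lh k) (map lh ks)) = lgen_arity g" "degr (T.inner (lh k) (map lh ks)) = lgen_degr g"
    unfolding T.inner_simps map_lh using t by simp_all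
  then have inner: "T.inner (lh k) (map lh ks) = (lgen_arity g, lgen_degr g, el2 (lh k, map lh ks, id))"
    unfolding T.inner_def by simp
  show "T.inner (lh k) (map lh ks) \<in> homogs CC"
    unfolding inner homogs_iff composite_simps(1) by (rule LL.el_closed[OF G])
  show "(lgen_arity g, lgen_degr g, ev2 id (k, ks, v)) = hact CC (T.inner (lh k) (map lh ks)) (perm_of v)"
    unfolding inner hact_simp case_prod_conv LL.act_el[OF G perm_of_permutes[OF v]] comp_id id_comp ..
qed

text \<open>Multilinear expansion produces the combinations listed by \<open>prods\<close>; one use
  of balancing per combination then merges all inner permutations into a block sum.\<close>

lemma right_ev:
  assumes ok: "lterm_ok g (h, gs, s)" and g: "lgen_arity g = n" "lgen_degr g = p" "\<sigma> permutes {1..n}"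
  shows "composite_map R C CC (\<lambda>_ _ y. y) (Lie3_decomp R) n p (ev2 \<sigma> (h, gs, s)) =
      lsum (Q3 n p) (ev3 \<sigma>) (right_terms (h, gs, s))"
    and "ev3 \<sigma> ` snd ` set (right_terms (h, gs, s)) \<subseteq> carrier (Q3 n p)"
proof -
  let ?Q = "Q3 n p"
  interpret Q: rmodule R ?Q by (rule T.T.Q_rmodule)
  interpret D: composite_morphism R C C C CC "\<lambda>_ _ y. y" "Lie3_decomp R"
    by unfold_locales (rule decomp_smodule_hom smodule_hom_id)+
  let ?\<rho> = "perm_of s \<circ> \<sigma>" and ?ns = "map lgen_arity gs" and ?qs = "map lgen_degr gs"
  have t: "lgen_arity h = length gs" "sum_list ?ns = n" "lgen_degr h + sum_list ?qs = p" "is_perm n s"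
    using ok g by (auto simp: lterm_ok_def)
  note G0 = ev2_gens[OF ok g]
  let ?z = "\<lambda>g. (lgen_arity g, lgen_degr g, lsum (piece CC (lgen_arity g) (lgen_degr g)) (ev2 id) (lterms g))"
  have hds: "map (hmap (Lie3_decomp R)) (map lh gs) = map ?z gs"
    by (simp only: map_map comp_def hmap_decomp_lh composite_simps(1))
  have GX: "(lh h, [] @ map ?z gs, ?\<rho>) \<in> gens C CC n p"
    using D.gens_map[OF G0] unfolding hds hmap_id append_Nil .
  have cl: "ev2 id ` snd ` set (lterms g') \<subseteq> carrier (piece CC (lgen_arity g') (lgen_degr g'))" for g'
    unfolding composite_simps(1) by (rule lterms_closed[OF refl refl permutes_id])
  note E = T.T.el_lsum(1)[where k = lgen_arity and q = lgen_degr and ev = "ev2 id" and X = lterms, OF GX cl]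
  define f where "f ts = (h, map (\<lambda>(k, ks, v). (k, ks)) ts,
    comp_list (sum_list_perm ?ns (map (\<lambda>(k, ks, v). v) ts)) s)" for ts :: "lterm list"
  have terms: "right_terms (h, gs, s) = map (\<lambda>(c, ts). (c, f ts)) (prods (map lterms gs))"
    unfolding right_terms_def f_def case_prod_conv ..
  have u: "T.T.el (lh h, [] @ map2 (\<lambda>g t. (lgen_arity g, lgen_degr g, ev2 id t)) gs ts, ?\<rho>) = ev3 \<sigma> (f ts) \<and>
      ev3 \<sigma> (f ts) \<in> carrier ?Q" if ts: "ts \<in> snd ` set (prods (map lterms gs))" for ts
  proof -
    let ?in = "\<lambda>(k, ks, v). T.inner (lh k) (map lh ks)" and ?v = "\<lambda>(k :: lgen, ks :: lgen list, v). v"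
    let ?inn = "map ?in ts" and ?us = "map ?v ts"
    let ?\<pi>s = "map perm_of ?us"
    note all2 = prods_mem[OF ts]
    have len: "length ts = length gs" using list_all2_lengthD[OF all2] by simp
    have slot: "(lgen_arity (gs ! i), lgen_degr (gs ! i), ev2 id (ts ! i)) = hact CC (?in (ts ! i)) (perm_of (?v (ts ! i)))"
      "?in (ts ! i) \<in> homogs CC" "arity (?in (ts ! i)) = lgen_arity (gs ! i)"
      "degr (?in (ts ! i)) = lgen_degr (gs ! i)" "is_perm (lgen_arity (gs ! i)) (?v (ts ! i))"
      if i: "i < length gs" for i
    proof -
      have m: "ts ! i \<in> snd ` set (lterms (gs ! i))"
        using list_all2_nthD[OF all2, of i] i by simp
      obtain k ks v where e: "ts ! i = (k, ks, v)" by (cases "ts ! i")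
      note E = ev2_hact_inner[OF lterms_okD[OF m, unfolded e]]
      show "(lgen_arity (gs ! i), lgen_degr (gs ! i), ev2 id (ts ! i)) = hact CC (?in (ts ! i)) (perm_of (?v (ts ! i)))"
        unfolding e using E(1) by (simp only: case_prod_conv)
      show "?in (ts ! i) \<in> homogs CC" "arity (?in (ts ! i)) = lgen_arity (gs ! i)"
        "degr (?in (ts ! i)) = lgen_degr (gs ! i)" "is_perm (lgen_arity (gs ! i)) (?v (ts ! i))"
        unfolding e using E(2-5) by (simp_all only: case_prod_conv)
    qed
    have m2: "map2 (\<lambda>g t. (lgen_arity g, lgen_degr g, ev2 id t)) gs ts = map2 (hact CC) ?inn ?\<pi>s"
    proof (rule nth_equalityI)
      fix i assume "i < length (map2 (\<lambda>g t. (lgen_arity g, lgen_degr g, ev2 id t)) gs ts)"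
      then have i: "i < length gs" "i < length ts" by simp_all
      show "map2 (\<lambda>g t. (lgen_arity g, lgen_degr g, ev2 id t)) gs ts ! i = map2 (hact CC) ?inn ?\<pi>s ! i"
        using slot(1)[OF i(1)] i by (simp only: nth_map nth_zip length_map length_zip min_less_iff_conj case_prod_conv)
    qed (simp add: len)
    have ar: "map arity ?inn = ?ns" "map degr ?inn = ?qs"
      using slot(3,4) len by (auto intro!: nth_equalityI)
    have set: "set ?inn \<subseteq> homogs CC"
    proof (rule subsetI)
      fix x assume "x \<in> set ?inn"
      then obtain t where "t \<in> set ts" "x = ?in t" unfolding set_map by blast
      moreover from this(1) obtain i where "i < length ts" "t = ts ! i" by (metis in_set_conv_nth)
      ultimately show "x \<in> homogs CC" using slot(2)[of i] len by (simp only:)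
    qed
    have us: "list_all2 is_perm ?ns ?us"
      using slot(5) len by (auto simp: list_all2_conv_all_nth)
    have perms: "perms_of (map arity ?inn) ?\<pi>s"
      unfolding ar by (rule perms_of_perm_of[OF us])
    have GI: "(lh h, ?inn, ?\<rho>) \<in> gens C CC n p"
      unfolding gens_iff ar using set lh_closed t len permutes_compose[OF g(3) perm_of_permutes[OF t(4)]]
      by (simp only: lh_simps length_map simp_thms)
    have b: "perm_of (comp_list (sum_list_perm ?ns ?us) s) = sum_perm ?ns ?\<pi>s \<circ> perm_of s"
      using perm_of_comp[of n "sum_list_perm ?ns ?us" s] is_perm_sum[OF us] perm_of_sum[OF us] t(2,4) by simp
    have inn: "map (\<lambda>(k, ks). T.inner (lh k) (map lh ks)) (map (\<lambda>(k, ks, v). (k, ks)) ts) = ?inn"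
      by (simp add: comp_def case_prod_unfold)
    have f: "ev3 \<sigma> (f ts) = T.T.el (lh h, ?inn, sum_perm (map arity ?inn) ?\<pi>s \<circ> ?\<rho>)"
      unfolding f_def case_prod_conv inn b ar by (simp only: comp_assoc)
    show ?thesis
      unfolding m2 f append_Nil T.T.el_balanced[OF GI perms]
      using T.T.el_closed[OF T.T.gens_balanced(2)[OF GI perms]] by blast
  qed
  have "composite_map R C CC (\<lambda>_ _ y. y) (Lie3_decomp R) n p (ev2 \<sigma> (h, gs, s)) =
      T.T.el (lh h, [] @ map ?z gs, ?\<rho>)"
    unfolding case_prod_conv D.composite_map_el[OF G0] hds hmap_id append_Nil ..
  also have "\<dots> = lsum ?Q (\<lambda>ts. ev3 \<sigma> (f ts)) (prods (map lterms gs))"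
    unfolding E by (rule Q.lsum_cong) (rule conjunct1[OF u])
  also have "\<dots> = lsum ?Q (ev3 \<sigma>) (right_terms (h, gs, s))"
    unfolding terms Q.lsum_map ..
  finally show "composite_map R C CC (\<lambda>_ _ y. y) (Lie3_decomp R) n p (ev2 \<sigma> (h, gs, s)) =
      lsum ?Q (ev3 \<sigma>) (right_terms (h, gs, s))" .
  show "ev3 \<sigma> ` snd ` set (right_terms (h, gs, s)) \<subseteq> carrier ?Q"
  proof (rule image_subsetI)
    fix y assume "y \<in> snd ` set (right_terms (h, gs, s))"
    then obtain z where "z \<in> snd ` set (prods (map lterms gs))" "y = f z" unfolding terms by force
    then show "ev3 \<sigma> y \<in> carrier ?Q" using conjunct2[OF u, of z] by (simp only:)
  qed
qed

lemma decomp_coassociative: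
  assumes "x \<in> carrier (Lie3_piece R n p)"
  shows "associator R C C C n p (composite_map R CC C (Lie3_decomp R) (\<lambda>_ _ y. y) n p (Lie3_decomp R n p x)) =
    composite_map R C CC (\<lambda>_ _ y. y) (Lie3_decomp R) n p (Lie3_decomp R n p x)"
proof -
  interpret Q: rmodule R "Q3 n p" by (rule T.T.Q_rmodule)
  interpret DL: composite_morphism R C C CC C "Lie3_decomp R" "\<lambda>_ _ y. y"
    by unfold_locales (rule decomp_smodule_hom smodule_hom_id)+
  interpret DR: composite_morphism R C C C CC "\<lambda>_ _ y. y" "Lie3_decomp R"
    by unfold_locales (rule decomp_smodule_hom smodule_hom_id)+
  note homL = module_hom_comp[OF DL.composite_map_hom T.associator_hom]
  note homR = DR.composite_map_hom
  show ?thesis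
  proof (rule Lie3_hom_eqI[OF T.T.Q_module module_hom_comp[OF decomp_hom homL]
        module_hom_comp[OF decomp_hom homR] _ assms])
    fix g \<sigma> assume g: "lgen_arity g = n" "lgen_degr g = p" "\<sigma> permutes {1..n}"
    have L: "associator R C C C n p (composite_map R CC C (Lie3_decomp R) (\<lambda>_ _ y. y) n p
          (Lie3_decomp R n p (basis R (g, \<sigma>)))) = lsum (Q3 n p) (ev3 \<sigma>) (lbind (lterms g) left_terms)"
      "ev3 \<sigma> ` snd ` set (lbind (lterms g) left_terms) \<subseteq> carrier (Q3 n p)"
      by (rule decomp_lsum[OF T.T.Q_module homL g]; (rule left_ev[OF _ g], assumption))+
    have R: "composite_map R C CC (\<lambda>_ _ y. y) (Lie3_decomp R) n p (Lie3_decomp R n p (basis R (g, \<sigma>))) =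
        lsum (Q3 n p) (ev3 \<sigma>) (lbind (lterms g) right_terms)"
      "ev3 \<sigma> ` snd ` set (lbind (lterms g) right_terms) \<subseteq> carrier (Q3 n p)"
      by (rule decomp_lsum[OF T.T.Q_module homR g]; (rule right_ev[OF _ g], assumption))+
    show "associator R C C C n p (composite_map R CC C (Lie3_decomp R) (\<lambda>_ _ y. y) n p
          (Lie3_decomp R n p (basis R (g, \<sigma>)))) =
        composite_map R C CC (\<lambda>_ _ y. y) (Lie3_decomp R) n p (Lie3_decomp R n p (basis R (g, \<sigma>)))"
      unfolding L(1) R(1) by (rule Q.lsum_eqI[OF coassociative_terms L(2) R(2)])
  qed
qed

section \<open>The counit\<close>

lemma counit_dg_hom: "Lie3_counit R \<in> dg_smodule_hom R C (unit_smodule R)"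
  unfolding dg_smodule_hom_def mem_Collect_eq Lie3_simps(1)
proof (intro allI conjI ballI impI)
  interpret I: graded_smodule R "unit_smodule R" by (rule unit_graded_smodule)
  interpret IP: rmodule R "piece (unit_smodule R) n p" for n p by (rule I.piece_rmodule)
  fix n p
  show hom: "Lie3_counit R n p \<in> module_hom R (Lie3_piece R n p) (piece (unit_smodule R) n p)" for n p
    by (auto simp: module_hom_def Lie3_counit_def Lie3_piece_def free_module_def)
  fix x assume x: "x \<in> carrier (Lie3_piece R n p)"
  show "Lie3_counit R n (p - 1) (dif C n p x) = dif (unit_smodule R) n p (Lie3_counit R n p x)"
    unfolding unit_simps(2)
  proof (rule Lie3_hom_eqI[OF I.piece_module module_hom_comp[OF Lie3_dif_hom hom]
        IP.zero_hom[unfolded unit_simps] _ x])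
    fix g \<sigma> assume "lgen_arity g = n" "lgen_degr g = p"
    \<comment> \<open>No generator of arity 1 has degree 1, so no basis element has its differential
      in the component on which the counit is nonzero.\<close>
    then have "\<not> (n = 1 \<and> p - 1 = 0)" by (cases g) auto
    then show "Lie3_counit R n (p - 1) (dif C n p (basis R (g, \<sigma>))) = \<zero>"
      unfolding Lie3_counit_def by (rule if_not_P)
  qed
  fix \<sigma> assume \<sigma>: "\<sigma> permutes {1..n}"
  show "Lie3_counit R n p (act C n p x \<sigma>) = act (unit_smodule R) n p (Lie3_counit R n p x) \<sigma>"
  proof (cases "n = 1")
    case True
    then have "\<sigma> = id" using permutes_singleton \<sigma> by blast
    then show ?thesis using L.act_id[of x n p] x by (simp only: Lie3_simps(1) unit_simps(1))
  qed (simp add: Lie3_counit_def del: One_nat_def)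
qed

lemma counit_smodule_hom: "Lie3_counit R \<in> smodule_hom R C (unit_smodule R)"
  using counit_dg_hom dg_smodule_hom_subset by blast

lemma hmap_counit_lh: "hmap (Lie3_counit R) (lh g) = (lgen_arity g, lgen_degr g, if g = L1 then \<one> else \<zero>)"
  unfolding lgen_homog_def hmap_simp Lie3_counit_def basis_def by (cases g) simp_all

text \<open>Both counit laws in one: \<open>f\<close> stands for either composite of counit and
  unitor, and \<open>F\<close> for the terms that survive it.\<close>

lemma Lie3_counital:
  assumes f: "f \<in> module_hom R (Q2 n p) (Lie3_piece R n p)"
    and val: "\<And>g h gs s \<sigma>. lterm_ok g (h, gs, s) \<Longrightarrow> lgen_arity g = n \<Longrightarrow> lgen_degr g = p \<Longrightarrow>
      \<sigma> permutes {1..n} \<Longrightarrow> f (ev2 \<sigma> (h, gs, s)) = lsum (Lie3_piece R n p) (dev \<sigma>) (F (h, gs, s))"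
    and cl: "\<And>g h gs s \<sigma>. lterm_ok g (h, gs, s) \<Longrightarrow> lgen_arity g = n \<Longrightarrow> lgen_degr g = p \<Longrightarrow>
      \<sigma> permutes {1..n} \<Longrightarrow> dev \<sigma> ` snd ` set (F (h, gs, s)) \<subseteq> carrier (Lie3_piece R n p)"
    and F: "\<And>g. lnormal dterm_code (lbind (lterms g) F) = lnormal dterm_code [(1, g, [1..<lgen_arity g + 1])]"
    and x: "x \<in> carrier (Lie3_piece R n p)"
  shows "f (Lie3_decomp R n p x) = x"
proof (rule Lie3_hom_eqI[OF Lie3_module module_hom_comp[OF decomp_hom f] module_hom_id _ x])
  interpret P: rmodule R "Lie3_piece R n p" by (intro rmodule.intro Lie3_module)
  fix g \<sigma> assume g: "lgen_arity g = n" "lgen_degr g = p" "\<sigma> permutes {1..n}"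
  have L: "f (Lie3_decomp R n p (basis R (g, \<sigma>))) = lsum (Lie3_piece R n p) (dev \<sigma>) (lbind (lterms g) F)"
    "dev \<sigma> ` snd ` set (lbind (lterms g) F) \<subseteq> carrier (Lie3_piece R n p)"
    by (rule decomp_lsum[OF Lie3_module f g]; (rule val[OF _ g] cl[OF _ g], assumption))+
  have e: "dev \<sigma> (g, [1..<lgen_arity g + 1]) = basis R (g, \<sigma>)"
    by (simp only: case_prod_conv perm_of_upt id_comp)
  have c: "basis R (g, \<sigma>) \<in> carrier (Lie3_piece R n p)" by (rule Lie3_basis[OF g])
  have "f (Lie3_decomp R n p (basis R (g, \<sigma>))) =
      lsum (Lie3_piece R n p) (dev \<sigma>) [(1, g, [1..<lgen_arity g + 1])]"
    unfolding L(1)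
    by (rule P.lsum_eqI[OF F L(2)])
      (simp only: list.set image_insert image_empty snd_conv e insert_subset c empty_subsetI simp_thms)
  also have "\<dots> = basis R (g, \<sigma>)"
    using P.lsum_single[of "dev \<sigma>" "(g, [1..<lgen_arity g + 1])"] c unfolding e .
  finally show "f (Lie3_decomp R n p (basis R (g, \<sigma>))) = basis R (g, \<sigma>)" .
qed

lemma act_lh:
  assumes "lgen_arity g = n" "lgen_degr g = p" "\<sigma> permutes {1..n}"
  shows "\<one> \<odot>\<^bsub>Lie3_piece R n p\<^esub> act C n p (elt (lh g)) \<sigma> = basis R (g, \<sigma>)"
proof -
  interpret P: rmodule R "Lie3_piece R n p" by (intro rmodule.intro Lie3_module)
  have "act C n p (elt (lh g)) \<sigma> = basis R (g, \<sigma>)"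
    unfolding lgen_homog_def homog_simps
    using Lie3_act_basis[OF assms(3,1,2) permutes_id] by (simp only: id_comp)
  then show ?thesis using P.smult_one[OF Lie3_basis[OF assms]] by (simp only:)
qed

lemma lgen_L1: "lgen_arity g = 1 \<longleftrightarrow> g = L1"
  by (cases g) simp_all

text \<open>The counit is 1 on \<open>L1\<close> and 0 on the other generators, so a term survives
  only with outer generator \<open>L1\<close>, and then reduces to its single inner factor.\<close>

lemma decomp_left_counital:
  assumes "x \<in> carrier (Lie3_piece R n p)"
  shows "left_unitor R C n p (composite_map R (unit_smodule R) C (Lie3_counit R) (\<lambda>_ _ y. y) n p
    (Lie3_decomp R n p x)) = x"
proof -
  interpret U: unitors R C ..
  interpret D: composite_morphism R C C "unit_smodule R" C "Lie3_counit R" "\<lambda>_ _ y. y"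
    by unfold_locales (rule counit_smodule_hom smodule_hom_id)+
  interpret P: rmodule R "Lie3_piece R n p" by (intro rmodule.intro Lie3_module)
  let ?f = "\<lambda>y. left_unitor R C n p (composite_map R (unit_smodule R) C (Lie3_counit R) (\<lambda>_ _ y. y) n p y)"
  have "?f (ev2 \<sigma> (h, gs, s)) = lsum (Lie3_piece R n p) (dev \<sigma>) (left_counit_terms (h, gs, s)) \<and>
      dev \<sigma> ` snd ` set (left_counit_terms (h, gs, s)) \<subseteq> carrier (Lie3_piece R n p)"
    if ok: "lterm_ok g (h, gs, s)" and g: "lgen_arity g = n" "lgen_degr g = p" "\<sigma> permutes {1..n}" for g h gs s \<sigma>
  proof -
    note G0 = ev2_gens[OF ok g]
    let ?\<rho> = "perm_of s \<circ> \<sigma>"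
    note GX = D.gens_map[OF G0, unfolded hmap_counit_lh hmap_id]
    have v: "?f (ev2 \<sigma> (h, gs, s)) = (if lgen_arity h = 1 \<and> lgen_degr h = 0
        then (if h = L1 then \<one> else \<zero>) \<odot>\<^bsub>Lie3_piece R n p\<^esub> act C n p (elt (hd (map lh gs))) ?\<rho>
        else \<zero>\<^bsub>Lie3_piece R n p\<^esub>)"
      unfolding case_prod_conv D.composite_map_el[OF G0] hmap_counit_lh hmap_id
      using U.left_unitor_el[OF GX] by (simp only: Lie3_simps(1))
    show ?thesis
    proof (cases "h = L1")
      case True
      have *: "length gs = 1" "sum_list (map lgen_arity gs) = n" "sum_list (map lgen_degr gs) = p" "is_perm n s"
        using ok g True by (auto simp: lterm_ok_def)
      then obtain k where k: "gs = [k]" by (auto simp: length_Suc_conv)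
      have k': "lgen_arity k = n" "lgen_degr k = p" "?\<rho> permutes {1..n}"
        using * k permutes_compose[OF g(3) perm_of_permutes] by simp_all
      note c = Lie3_basis[OF k']
      have t: "left_counit_terms (h, gs, s) = [(1, k, s)]" by (simp add: left_counit_terms_def True k)
      have d: "dev \<sigma> (k, s) = basis R (k, ?\<rho>)" by (simp only: case_prod_conv)
      have "?f (ev2 \<sigma> (h, gs, s)) = basis R (k, ?\<rho>)"
        unfolding v using act_lh[OF k'] True k by (simp only: lgen_arity.simps lgen_degr.simps list.map list.sel simp_thms if_True)
      then show ?thesis
        unfolding t using P.lsum_single[of "dev \<sigma>" "(k, s)"] c
        by (simp only: d list.set image_insert image_empty snd_conv insert_subset empty_subsetI simp_thms)
    next
      case False
      then have "left_counit_terms (h, gs, s) = []" by (simp add: left_counit_terms_def)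
      moreover have "?f (ev2 \<sigma> (h, gs, s)) = \<zero>\<^bsub>Lie3_piece R n p\<^esub>"
        unfolding v lgen_L1 using False by (simp only: simp_thms if_False)
      ultimately show ?thesis by (simp only: lsum_simps list.set image_empty empty_subsetI simp_thms)
    qed
  qed
  note val = conjunct1[OF this] and cl = conjunct2[OF this]
  show ?thesis
    by (rule Lie3_counital[OF module_hom_comp[OF D.composite_map_hom U.left_unitor_hom[unfolded Lie3_simps(1)]]
          val cl conjunct1[OF counit_terms] assms])
qed

text \<open>A term survives only if all inner generators are \<open>L1\<close>; the product of
  scalars is then 1, and arity and degree are those of the outer generator. Any other inner
  generator falls outside arity 1 and degree 0, where the right unitor is zero.\<close>

lemma decomp_right_counital:
  assumes "x \<in> carrier (Lie3_piece R n p)"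
  shows "right_unitor R C n p (composite_map R C (unit_smodule R) (\<lambda>_ _ y. y) (Lie3_counit R) n p
    (Lie3_decomp R n p x)) = x"
proof -
  interpret U: unitors R C ..
  interpret D: composite_morphism R C C C "unit_smodule R" "\<lambda>_ _ y. y" "Lie3_counit R"
    by unfold_locales (rule counit_smodule_hom smodule_hom_id)+
  interpret P: rmodule R "Lie3_piece R n p" by (intro rmodule.intro Lie3_module)
  let ?f = "\<lambda>y. right_unitor R C n p (composite_map R C (unit_smodule R) (\<lambda>_ _ y. y) (Lie3_counit R) n p y)"
  have "?f (ev2 \<sigma> (h, gs, s)) = lsum (Lie3_piece R n p) (dev \<sigma>) (right_counit_terms (h, gs, s)) \<and>
      dev \<sigma> ` snd ` set (right_counit_terms (h, gs, s)) \<subseteq> carrier (Lie3_piece R n p)"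
    if ok: "lterm_ok g (h, gs, s)" and g: "lgen_arity g = n" "lgen_degr g = p" "\<sigma> permutes {1..n}" for g h gs s \<sigma>
  proof -
    note G0 = ev2_gens[OF ok g]
    let ?\<rho> = "perm_of s \<circ> \<sigma>"
    let ?as = "map (\<lambda>g. (lgen_arity g, lgen_degr g, if g = L1 then \<one> else \<zero>)) gs"
    have as: "map (hmap (Lie3_counit R)) (map lh gs) = ?as"
      by (simp only: map_map comp_def hmap_counit_lh)
    note GX = D.gens_map[OF G0, unfolded as hmap_id]
    have sc: "U.scalars ?as \<longleftrightarrow> list_all (\<lambda>g. g = L1) gs"
    proof -
      have "lgen_arity g = 1 \<and> lgen_degr g = 0 \<longleftrightarrow> g = L1" for g by (cases g) simp_all
      then show ?thesis by (simp only: list.pred_map comp_def homog_simps)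
    qed
    have v: "?f (ev2 \<sigma> (h, gs, s)) = (if list_all (\<lambda>g. g = L1) gs
        then U.scalar_prod ?as \<odot>\<^bsub>Lie3_piece R n p\<^esub> act C n p (elt (lh h)) ?\<rho> else \<zero>\<^bsub>Lie3_piece R n p\<^esub>)"
      unfolding case_prod_conv D.composite_map_el[OF G0] as hmap_id
      using U.right_unitor_el[OF GX] unfolding sc by (simp only: Lie3_simps(1))
    show ?thesis
    proof (cases "list_all (\<lambda>g. g = L1) gs")
      case True
      have *: "lgen_arity h = length gs" "sum_list (map lgen_arity gs) = n"
        "lgen_degr h + sum_list (map lgen_degr gs) = p" "is_perm n s"
        using ok g by (auto simp: lterm_ok_def)
      have "U.scalar_prod ?as = \<one> \<and> sum_list (map lgen_arity gs) = length gs \<and> sum_list (map lgen_degr gs) = 0"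
        using True by (induction gs) simp_all
      with * have sp: "U.scalar_prod ?as = \<one>" and h: "lgen_arity h = n" "lgen_degr h = p" by simp_all
      have \<rho>: "?\<rho> permutes {1..n}" by (rule permutes_compose[OF g(3) perm_of_permutes[OF *(4)]])
      note c = Lie3_basis[OF h \<rho>]
      have t: "right_counit_terms (h, gs, s) = [(1, h, s)]" using True by (simp add: right_counit_terms_def)
      have d: "dev \<sigma> (h, s) = basis R (h, ?\<rho>)" by (simp only: case_prod_conv)
      have "?f (ev2 \<sigma> (h, gs, s)) = basis R (h, ?\<rho>)"
        unfolding v sp act_lh[OF h \<rho>] using True by (simp only: if_True)
      then show ?thesis
        unfolding t using P.lsum_single[of "dev \<sigma>" "(h, s)"] c
        by (simp only: d list.set image_insert image_empty snd_conv insert_subset empty_subsetI simp_thms)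
    next
      case False
      then have "right_counit_terms (h, gs, s) = []" by (simp add: right_counit_terms_def)
      moreover have "?f (ev2 \<sigma> (h, gs, s)) = \<zero>\<^bsub>Lie3_piece R n p\<^esub>"
        unfolding v using False by (simp only: if_False)
      ultimately show ?thesis by (simp only: lsum_simps list.set image_empty empty_subsetI simp_thms)
    qed
  qed
  note val = conjunct1[OF this] and cl = conjunct2[OF this]
  show ?thesis
    by (rule Lie3_counital[OF module_hom_comp[OF D.composite_map_hom U.right_unitor_hom[unfolded Lie3_simps(1)]]
          val cl conjunct2[OF counit_terms] assms])
qed

end

theorem lemma2p2:
  fixes R :: "('r, 'm) ring_scheme"
  assumes "cring R"
  shows "dg_cooperad R (Lie3 R) (Lie3_decomp R) (Lie3_counit R)"
proof -
  interpret lie3 R by (rule lie3.intro) fact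
  show ?thesis
    by (intro dg_cooperad.intro dg_cooperad_axioms.intro Lie3_dg_smodule decomp_dg_hom counit_dg_hom;
        unfold Lie3_simps(1); rule decomp_coassociative decomp_left_counital decomp_right_counital)
qed

end
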